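(* Let $c\in\mathbb C$ and let $W$ be an (irreducible) restricted $\mathrm{H}(C)$-module of level $c$. There exists a unique structure of (irreducible) $\mathcal V_{\mathrm{H}}(c)$-module on $W$ given by $$Y_W(\mathrm{diag}\, x^+_{[n]}(u_1,\ldots ,u_n),z)=y_{[n]}(z+u_1,\ldots ,z+u_n)\quad\text{with}\quad n\geqslant 0.$$ (The word "irreducible" is to be read either in both places or in neither; for $n=0$ the formula means $Y_W(\mathbf 1,z)=1_W$.)
   Context: **Conventions.** $N\geqslant 2$ is an integer, $h$ a formal parameter, $c\in\mathbb C$. A $\mathbb C[[h]]$-module is topologically free if it is torsion-free, separated and $h$-adically complete (equivalently $\cong V_0[[h]]$ for a complex space $V_0$). Tensor products of $\mathbb C[[h]]$-modules are $h$-adically completed; $\mathrm{Hom}$ means $\mathbb C[[h]]$-module maps. For a $\mathbb C[[h]]$-module $V$, $V((u))_h$ is the module of series $\sum_{r\in\mathbb Z}a_ru^{-r-1}\in V[[u^{\pm1}]]$ with $a_r\to0$ $h$-adically as $r\to\infty$, and $V[u^{-1}]_h$ is the submodule of those lying in $V[[u^{-1}]]$; similarly in several variables (for $V=V_0[[h]]$, $V((u_1,\dots,u_n))_h=V_0((u_1,\dots,u_n))[[h]]$ with $V_0((u_1,\dots,u_n))=V_0[[u_1,\dots,u_n]][u_1^{-1},\dots,u_n^{-1}]$). Expressions $(x_1+\dots+x_n)^r$ with $r<0$ are expanded in nonnegative powers of $x_2,\dots,x_n$. Subscripts on operators indicate the tensor factors on which they act. $\mathrm{diag}$ applied to an element of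 $(\mathrm{End}\,\mathbb C^N)^{\otimes n}\otimes A$ keeps only the terms with matrix part $e_{i_1i_1}\otimes\dots\otimes e_{i_ni_n}$. **The series $S$.** Let $R(u)=I-\frac hu P$ on $\mathbb C^N\otimes\mathbb C^N$, $I$ the identity, $P=\sum_{i,j}e_{ij}\otimes e_{ji}$. There is a unique series $G(u,C)=1+\frac{C+N}{N}\frac{h^2}{u^2}-\dots\in\mathbb C[C][[h/u]]$ with $\mathrm{tr}_1(G(u,C)R(u)R(-u-hC)-I)=\mathrm{tr}_2(G(u,C)R(u)R(-u-hC)-I)=0$ ($\mathrm{tr}_i$ is the trace over the $i$-th tensor factor). Put $S(u,C)=h^{-2}(G(u,C)R(u)R(-u-hC)-I)$, $S(u)=S(u,c)$, $T(z)=S(z)-S(-z)$ (expanded in $z^{-1}$), $\overline S(u,c)=\mathrm{diag}\,S(u,c)$, and let $s_{ij}(u,C)\in\mathbb C[C,u^{-1}][[h]]$ be the coefficient of $e_{ii}\otimes e_{jj}$ in $S(u,C)$. **$\mathrm{H}^+_N$ and operators.** $\mathrm{H}^+_N$ is the quotient of $\mathbb C[x_{ij}^{(-r)}: i,j=1,\dots,N,\ r\geqslant1][[h]]$ by the $h$-adically complete ideal generated by $x_{11}^{(-r)}+\dots+x_{NN}^{(-r)}$, $r\geqslant1$; $\mathbf 1$ is its unit. Put $x^+_{ij}(u)=\sum_{r\geqslant1}x_{ij}^{(-r)}u^{r-1}$, $x^+(u)=\sum_{i,j}e_{ij}\otimes x^+_{ij}(u)$, $x^+_{[n]}(u_1,\dots,u_n)=x^+_1(u_1)\cdots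 x^+_n(u_n)$ with coefficients in $(\mathrm{End}\,\mathbb C^N)^{\otimes n}\otimes \mathrm{H}^+_N$ ($x_k^+$ has its matrix part in the $k$-th factor), $x^+_{[0]}=\mathbf 1$. $x^-(u)=\sum_{i,j}e_{ij}\otimes x^-_{ij}(u)$, $x^-_{ij}(u)=\sum_{r\geqslant1}x_{ij}^{(r-1)}u^{-r}$, is the unique element of $\mathrm{End}\,\mathbb C^N\otimes\mathrm{Hom}(\mathrm{H}^+_N,\mathrm{H}^+_N[u^{-1}]_h)$ with $x^-(u)\mathbf 1=0$ and $x^-_0(u_0)x^+_{[n]}(u)=-\sum_{j=1}^nS_{0j}(u_0-u_j)x_1^+(u_1)\cdots x_{j-1}^+(u_{j-1})x_{j+1}^+(u_{j+1})\cdots x_n^+(u_n)$ for all $n\geqslant1$. Put $x(u)=x^+(u)+x^-(u)$ ($x^+$ acting by multiplication). For $0\leqslant k\leqslant\lfloor n/2\rfloor$ let $I^n_k$ be the family of all sets of $k$ ordered pairs $(p,q)\in\{1,\dots,n\}^2$, $p<q$, with all coordinates in the set mutually distinct, and for $i\in I^n_k$ let $i'$ be the set of elements of $\{1,\dots,n\}$ not appearing in $i$. Define $$x_{[n]}(u_1,\dots,u_n)=\sum_{k=0}^{\lfloor n/2\rfloor}\ \sum_{\substack{i=\{(i_1,j_1),\dots,(i_k,j_k)\}\in I^n_k\\ l_1<\dots<l_{n-2k}\in i'}}S_{i_1j_1}\cdots S_{i_kj_k}\,x_{l_1}(u_{l_1})\cdots x_{l_{n-2k}}(u_{l_{n-2k}}),\quad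 S_{ij}=S_{ij}(u_i-u_j),$$ an element of $(\mathrm{End}\,\mathbb C^N)^{\otimes n}\otimes\mathrm{Hom}(\mathrm{H}^+_N,\mathrm{H}^+_N((u_1,\dots,u_n))_h)$, and $x_{[n]}(z+u_1,\dots,z+u_n)$ by substituting $z+u_i$ for the $i$-th variable. **The quantum vertex algebra $\mathcal V_{\mathrm{H}}(c)$.** $\mathrm{H}^+_N$ is a quantum vertex algebra with vacuum $\mathbf 1$, vertex operator map $Y(x^+_{[n]}(u_1,\dots,u_n),z)=x_{[n]}(z+u_1,\dots,z+u_n)$, and braiding $\mathcal S(z):\mathrm{H}^+_N\otimes\mathrm{H}^+_N\to\mathrm{H}^+_N\otimes\mathrm{H}^+_N[z^{-1}]_h$ given by $$\mathcal S(z)\,x^+_{1\,n+m+1}(u_1)\cdots x^+_{n\,n+m+1}(u_n)\,x^+_{n+1\,n+m+2}(v_1)\cdots x^+_{n+m\,n+m+2}(v_m)=\sum_{k=0}^{\min\{m,n\}}\ \sum_{i,\ l_1<\dots<l_{n+m-2k}\in i'}T_{i_1j_1}\cdots T_{i_kj_k}\,x^+_{l_1}\cdots x^+_{l_{n+m-2k}},$$ where $i=\{(i_1,j_1),\dots,(i_k,j_k)\}$ runs over sets of $k$ pairs in $\{1,\dots,n\}\times\{n+1,\dots,n+m\}$ with all coordinates mutually distinct, $i'$ is the complement of these coordinates in $\{1,\dots,n+m\}$, $T_{i_pj_p}=T_{i_pj_p}(z+u_{i_p}-v_{j_p-n})$, $x_l^+=x^+_{l\,n+m+1}(u_l)$ for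 $l\leqslant n$, $x^+_l=x^+_{l\,n+m+2}(v_{l-n})$ for $l>n$. $\mathcal V_{\mathrm{H}}(c)$ is the quantum vertex subalgebra of $\mathrm{H}^+_N$ whose underlying module is the topologically free subalgebra generated by $\mathbf 1$ and all $x_{ii}^{(-r)}$, $i=1,\dots,N$, $r\geqslant1$, with the restrictions of $Y$ and $\mathcal S$. **Modules.** For a quantum vertex algebra $(V,Y,\mathbf 1,\mathcal S)$ a $V$-module is a pair $(W,Y_W)$ with $W$ a topologically free $\mathbb C[[h]]$-module and $Y_W(z):V\otimes W\to W((z))_h$, $v\otimes w\mapsto Y_W(v,z)w=\sum_rv_rw\,z^{-r-1}$ a $\mathbb C[[h]]$-module map with $Y_W(\mathbf 1,z)w=w$ and the $\mathcal S$-Jacobi identity, for all $u,v\in V$, $w\in W$, $$z_0^{-1}\delta\left(\tfrac{z_1-z_2}{z_0}\right)Y_W(z_1)(1\otimes Y_W(z_2))(u\otimes v\otimes w)-z_0^{-1}\delta\left(\tfrac{z_2-z_1}{-z_0}\right)Y_W(z_2)(1\otimes Y_W(z_1))(\mathcal S(-z_0)(v\otimes u)\otimes w)=z_2^{-1}\delta\left(\tfrac{z_1-z_0}{z_2}\right)Y_W(Y(u,z_0)v,z_2)w,$$ $\delta(z)=\sum_{n\in\mathbb Z}z^n$. A $V$-submodule is a topologically free $\mathbb C[[h]]$-submodule $W_1\subseteq W$ with $v_rw\in W_1$ for all $v\in V$, $w\in W_1$, $r\in\mathbb Z$ (with the restricted map). A module is irreducible if its only submodules are $0$ and itself. **The algebra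 $\mathrm{H}(C)$** is the $h$-adically complete associative $\mathbb C[[h]]$-algebra generated by a central element $C$ and $y_i^{(r)}$, $i=1,\dots,N$, $r\in\mathbb Z$, subject to, with $y^i(u)=\sum_{r\in\mathbb Z}y_i^{(r)}u^{-r-1}$, $y^i(u)y^j(v)+s_{ij}(u-v,C)=y^j(v)y^i(u)+s_{ij}(v-u,C)$ for all $i,j$ and $y^1(u)+\dots+y^N(u)=0$. Put $y(u)=\sum_ie_{ii}\otimes y^i(u)$. An $\mathrm{H}(C)$-module $W$ has level $c$ if $C$ acts as the scalar $c$; it is restricted if $W$ is a topologically free $\mathbb C[[h]]$-module and $y^i(z)\in\mathrm{Hom}(W,W((z))_h)$ for all $i$. On a restricted module of level $c$ put $$y_{[n]}(u_1,\dots,u_n)=\sum_{k=0}^{\lfloor n/2\rfloor}\ \sum_{\substack{i=\{(i_1,j_1),\dots,(i_k,j_k)\}\in I^n_k\\ l_1<\dots<l_{n-2k}\in i'}}\overline S_{i_1j_1}\cdots\overline S_{i_kj_k}\,y_{l_1}(u_{l_1})\cdots y_{l_{n-2k}}(u_{l_{n-2k}}),\quad\overline S_{ij}=\overline S_{ij}(u_i-u_j,c),$$ an element of $(\mathrm{End}\,\mathbb C^N)^{\otimes n}\otimes\mathrm{Hom}(W,W((u_1,\dots,u_n))_h)$, and let $y_{[n]}(z+u_1,\dots,z+u_n)\in(\mathrm{End}\,\mathbb C^N)^{\otimes n}\otimes\mathrm{Hom}(W,W((z))_h[[u_1,\dots,u_n]])$ be obtained by substituting $z+u_i$ for the $i$-th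 variable. *)

theory Defs
  imports
    "HOL-Analysis.Analysis"
    "HOL-Computational_Algebra.Formal_Power_Series"
    "HOL-Computational_Algebra.Polynomial"
    "HOL-Library.Poly_Mapping"
begin

text \<open>
  The ring of scalars \<open>\<complex>[[h]]\<close> is \<^typ>\<open>complex fps\<close> and \<open>h\<close> is \<^const>\<open>fps_X\<close>. The metric of
  \<^typ>\<open>'a fps\<close> is the \<open>h\<close>-adic one. The matrix indices \<open>1, \<dots>, N\<close> are the elements of a finite
  type \<open>'n\<close>, so that \<open>N = CARD('n)\<close>. A formal series in \<open>z\<close> with coefficients in a module is the
  function that maps an exponent to a coefficient: \<open>a m\<close> is the coefficient of \<open>z\<^sup>m\<close>
  (so the mode \<open>v\<^sub>r\<close> of \<open>Y(v, z) = \<Sum>\<^sub>r v\<^sub>r z\<^sup>-\<^sup>r\<^sup>-\<^sup>1\<close> has index \<open>-r-1\<close>).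
\<close>

section \<open>Modules over \<open>\<complex>[[h]]\<close>\<close>

class hmodule = ab_group_add +
  fixes hscale :: "complex fps \<Rightarrow> 'a \<Rightarrow> 'a"  (infixr \<open>*\<^sub>h\<close> 75)
  assumes hscale_add_right: "f *\<^sub>h (x + y) = f *\<^sub>h x + f *\<^sub>h y"
    and hscale_add_left: "(f + g) *\<^sub>h x = f *\<^sub>h x + g *\<^sub>h x"
    and hscale_hscale: "f *\<^sub>h (g *\<^sub>h x) = (f * g) *\<^sub>h x"
    and hscale_one: "1 *\<^sub>h x = x"

global_interpretation hmod: module "hscale :: complex fps \<Rightarrow> 'a \<Rightarrow> 'a::hmodule"
  by standard (simp_all add: hscale_add_right hscale_add_left hscale_hscale hscale_one)

abbreviation cscale :: "complex \<Rightarrow> 'a::hmodule \<Rightarrow> 'a"  (infixr \<open>*\<^sub>c\<close> 75)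
  where "a *\<^sub>c x \<equiv> fps_const a *\<^sub>h x"

definition hlinear :: "('a::hmodule \<Rightarrow> 'b::hmodule) \<Rightarrow> bool"
  where "hlinear f \<longleftrightarrow> module_hom hscale hscale f"

definition hbilinear :: "('a::hmodule \<Rightarrow> 'b::hmodule \<Rightarrow> 'd::hmodule) \<Rightarrow> bool"
  where "hbilinear f \<longleftrightarrow> (\<forall>b. hlinear (\<lambda>a. f a b)) \<and> (\<forall>a. hlinear (f a))"

definition hpow :: "nat \<Rightarrow> 'a set \<Rightarrow> 'a::hmodule set"
  where "hpow k A = (\<lambda>x. fps_X ^ k *\<^sub>h x) ` A"

text \<open>
  Torsion-freeness, separatedness and completeness of a submodule refer to the module itself,
  i.e. to the filtration \<open>h\<^sup>k A\<close> and not to the topology induced from the ambient module.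
\<close>

definition torsion_free :: "'a::hmodule set \<Rightarrow> bool"
  where "torsion_free A \<longleftrightarrow> (\<forall>f. \<forall>a\<in>A. f *\<^sub>h a = 0 \<longrightarrow> f = 0 \<or> a = 0)"

definition hseparated :: "'a::hmodule set \<Rightarrow> bool"
  where "hseparated A \<longleftrightarrow> (\<Inter>k. hpow k A) = {0}"

definition hcomplete :: "'a::hmodule set \<Rightarrow> bool"
  where "hcomplete A \<longleftrightarrow>
    (\<forall>s :: nat \<Rightarrow> 'a. (\<forall>n. s n \<in> A) \<and> (\<forall>k. \<exists>M. \<forall>m\<ge>M. \<forall>n\<ge>M. s m - s n \<in> hpow k A) \<longrightarrow>
      (\<exists>l\<in>A. \<forall>k. \<exists>M. \<forall>n\<ge>M. s n - l \<in> hpow k A))"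

definition topologically_free :: "'a::hmodule set \<Rightarrow> bool"
  where "topologically_free A \<longleftrightarrow>
    hmod.subspace A \<and> torsion_free A \<and> hseparated A \<and> hcomplete A"

definition has_hsum :: "('i \<Rightarrow> 'a::hmodule) \<Rightarrow> 'i set \<Rightarrow> 'a \<Rightarrow> bool"
  where "has_hsum f A s \<longleftrightarrow>
    (\<forall>k. \<exists>F. finite F \<and> F \<subseteq> A \<and>
      (\<forall>F'. finite F' \<and> F \<subseteq> F' \<and> F' \<subseteq> A \<longrightarrow> s - sum f F' \<in> hpow k UNIV))"

definition hsum :: "('i \<Rightarrow> 'a::hmodule) \<Rightarrow> 'i set \<Rightarrow> 'a"
  where "hsum f A = (THE s. has_hsum f A s)"

text \<open>The modules \<open>V((z))\<^sub>h\<close> and \<open>V[z\<^sup>-\<^sup>1]\<^sub>h\<close>; in the latter \<open>a r\<close> is the coefficient of \<open>z\<^sup>-\<^sup>r\<close>.\<close>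

definition laurent_h :: "(int \<Rightarrow> 'a::hmodule) \<Rightarrow> bool"
  where "laurent_h a \<longleftrightarrow> (\<forall>k. \<exists>M. \<forall>m\<le>M. a m \<in> hpow k UNIV)"

definition polar_h :: "(nat \<Rightarrow> 'a::hmodule) \<Rightarrow> bool"
  where "polar_h a \<longleftrightarrow> (\<forall>k. \<exists>M. \<forall>r\<ge>M. a r \<in> hpow k UNIV)"


section \<open>The completed tensor product\<close>

text \<open>
  The completed tensor product of \<open>V\<close> and \<open>W\<close> is \<open>lim\<^sub>n F / (R + h\<^sup>n F)\<close>, where \<open>F\<close> is the free
  module with basis \<open>V \<times> W\<close> and \<open>R\<close> is the submodule generated by the bilinearity relations. A
  sequence \<open>t\<close> in \<open>F\<close> represents the convergent sum \<open>\<Sum>\<^sub>k h\<^sup>k t\<^sub>k\<close>.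
\<close>

definition fm_scale :: "complex fps \<Rightarrow> ('b \<Rightarrow>\<^sub>0 complex fps) \<Rightarrow> ('b \<Rightarrow>\<^sub>0 complex fps)"
  where "fm_scale f p = Poly_Mapping.map (\<lambda>x. f * x) p"

lemma lookup_fm_scale: "Poly_Mapping.lookup (fm_scale f p) k = f * Poly_Mapping.lookup p k"
  by (simp add: fm_scale_def Poly_Mapping.map.rep_eq when_def)

global_interpretation fm: module "fm_scale :: complex fps \<Rightarrow> ('b \<Rightarrow>\<^sub>0 complex fps) \<Rightarrow> _"
  by standard
    (auto intro!: poly_mapping_eqI simp: lookup_fm_scale lookup_add algebra_simps)

definition tensor_relations :: "('a::hmodule \<times> 'b::hmodule \<Rightarrow>\<^sub>0 complex fps) set"
  where "tensor_relations =
    {Poly_Mapping.single (a + a', b) 1 - Poly_Mapping.single (a, b) 1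
       - Poly_Mapping.single (a', b) 1 | a a' b. True}
  \<union> {Poly_Mapping.single (a, b + b') 1 - Poly_Mapping.single (a, b) 1
       - Poly_Mapping.single (a, b') 1 | a b b'. True}
  \<union> {Poly_Mapping.single (f *\<^sub>h a, b) 1 - Poly_Mapping.single (a, b) f | f a b. True}
  \<union> {Poly_Mapping.single (a, f *\<^sub>h b) 1 - Poly_Mapping.single (a, b) f | f a b. True}"

definition tensor_null ::
    "nat \<Rightarrow> ('a::hmodule \<times> 'b::hmodule \<Rightarrow>\<^sub>0 complex fps) set"
  where "tensor_null n = {q + fm_scale (fps_X ^ n) p | p q. q \<in> fm.span tensor_relations}"

lemma subspace_tensor_null: "fm.subspace (tensor_null n)"
proof (rule fm.subspaceI)
  show "0 \<in> tensor_null n"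
    unfolding tensor_null_def by (smt (verit) fm.scale_zero_right fm.span_zero add_0 mem_Collect_eq)
next
  fix x y :: "'a \<times> 'b \<Rightarrow>\<^sub>0 complex fps"
  assume "x \<in> tensor_null n" "y \<in> tensor_null n"
  then obtain p q p' q' where "x = q + fm_scale (fps_X ^ n) p" "y = q' + fm_scale (fps_X ^ n) p'"
    and q: "q \<in> fm.span tensor_relations" "q' \<in> fm.span tensor_relations"
    unfolding tensor_null_def by blast
  then have "x + y = (q + q') + fm_scale (fps_X ^ n) (p + p')"
    by (simp add: fm.scale_right_distrib)
  then show "x + y \<in> tensor_null n"
    unfolding tensor_null_def using fm.span_add[OF q] by blast
next
  fix c and x :: "'a \<times> 'b \<Rightarrow>\<^sub>0 complex fps"
  assume "x \<in> tensor_null n"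
  then obtain p q where "x = q + fm_scale (fps_X ^ n) p"
    and q: "q \<in> fm.span tensor_relations"
    unfolding tensor_null_def by blast
  then have "fm_scale c x = fm_scale c q + fm_scale (fps_X ^ n) (fm_scale c p)"
    by (simp add: fm.scale_right_distrib mult.commute)
  then show "fm_scale c x \<in> tensor_null n"
    unfolding tensor_null_def using fm.span_scale[OF q] by blast
qed

definition ctensor_rel ::
    "(nat \<Rightarrow> ('a::hmodule \<times> 'b::hmodule \<Rightarrow>\<^sub>0 complex fps)) \<Rightarrow>
     (nat \<Rightarrow> ('a \<times> 'b \<Rightarrow>\<^sub>0 complex fps)) \<Rightarrow> bool"
  where "ctensor_rel s t \<longleftrightarrow>
    (\<forall>n. (\<Sum>k<n. fm_scale (fps_X ^ k) (s k - t k)) \<in> tensor_null n)"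

lemma ctensor_rel_refl: "ctensor_rel s s"
  by (simp add: ctensor_rel_def fm.subspace_0[OF subspace_tensor_null])

lemma ctensor_rel_add:
  assumes "ctensor_rel s t" "ctensor_rel s' t'"
  shows "ctensor_rel (\<lambda>k. s k + s' k) (\<lambda>k. t k + t' k)"
proof -
  have "(\<Sum>k<n. fm_scale (fps_X ^ k) (s k + s' k - (t k + t' k))) =
      (\<Sum>k<n. fm_scale (fps_X ^ k) (s k - t k)) + (\<Sum>k<n. fm_scale (fps_X ^ k) (s' k - t' k))" for n
    by (simp only: add_diff_add fm.scale_right_distrib sum.distrib)
  then show ?thesis
    using assms by (simp only: ctensor_rel_def fm.subspace_add[OF subspace_tensor_null] simp_thms)
qed

lemma ctensor_rel_scale:
  assumes "ctensor_rel s t"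
  shows "ctensor_rel (\<lambda>k. fm_scale f (s k)) (\<lambda>k. fm_scale f (t k))"
proof -
  have "(\<Sum>k<n. fm_scale (fps_X ^ k) (fm_scale f (s k) - fm_scale f (t k))) =
      fm_scale f (\<Sum>k<n. fm_scale (fps_X ^ k) (s k - t k))" for n
    by (simp only: fm.scale_sum_right fm.scale_right_diff_distrib[symmetric] fm.scale_scale
        mult.commute[of f])
  then show ?thesis
    using assms by (simp only: ctensor_rel_def fm.subspace_scale[OF subspace_tensor_null] simp_thms)
qed

lemma ctensor_rel_uminus:
  assumes "ctensor_rel s t"
  shows "ctensor_rel (\<lambda>k. - s k) (\<lambda>k. - t k)"
  using ctensor_rel_scale[OF assms, of "-1"] by simp

lemma ctensor_rel_sym:
  assumes "ctensor_rel s t"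
  shows "ctensor_rel t s"
  using ctensor_rel_add[OF ctensor_rel_uminus[OF assms] ctensor_rel_refl[of "\<lambda>k. s k + t k"]]
  by (simp add: algebra_simps)

lemma ctensor_rel_trans:
  assumes "ctensor_rel s t" "ctensor_rel t u"
  shows "ctensor_rel s u"
  using ctensor_rel_add[OF ctensor_rel_add[OF assms] ctensor_rel_refl[of "\<lambda>k. - t k"]]
  by (simp add: algebra_simps)

quotient_type (overloaded) ('a, 'b) ctensor =
  "nat \<Rightarrow> ('a::hmodule \<times> 'b::hmodule \<Rightarrow>\<^sub>0 complex fps)" / ctensor_rel
  by (rule equivpI)
    (auto simp: reflp_def symp_def transp_def
      intro: ctensor_rel_refl ctensor_rel_sym ctensor_rel_trans)

instantiation ctensor :: (hmodule, hmodule) hmodule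
begin

lift_definition zero_ctensor :: "('a, 'b) ctensor" is "\<lambda>_. 0" .

lift_definition plus_ctensor :: "('a, 'b) ctensor \<Rightarrow> ('a, 'b) ctensor \<Rightarrow> ('a, 'b) ctensor"
  is "\<lambda>s t k. s k + t k" by (rule ctensor_rel_add)

lift_definition uminus_ctensor :: "('a, 'b) ctensor \<Rightarrow> ('a, 'b) ctensor"
  is "\<lambda>s k. - s k" by (rule ctensor_rel_uminus)

lift_definition minus_ctensor :: "('a, 'b) ctensor \<Rightarrow> ('a, 'b) ctensor \<Rightarrow> ('a, 'b) ctensor"
  is "\<lambda>s t k. s k - t k"
  using ctensor_rel_add[OF _ ctensor_rel_uminus] by fastforce

lift_definition hscale_ctensor :: "complex fps \<Rightarrow> ('a, 'b) ctensor \<Rightarrow> ('a, 'b) ctensor"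
  is "\<lambda>f s k. fm_scale f (s k)" by (rule ctensor_rel_scale)

instance
proof
  fix x y z :: "('a, 'b) ctensor" and f g :: "complex fps"
  show "x + y + z = x + (y + z)"
    by transfer (simp add: add.assoc ctensor_rel_refl)
  show "x + y = y + x"
    by transfer (simp add: add.commute ctensor_rel_refl)
  show "0 + x = x"
    by transfer (simp add: ctensor_rel_refl)
  show "- x + x = 0"
    by transfer (simp add: ctensor_rel_refl)
  show "x - y = x + - y"
    by transfer (simp add: ctensor_rel_refl)
  show "f *\<^sub>h (x + y) = f *\<^sub>h x + f *\<^sub>h y"
    by transfer (simp add: fm.scale_right_distrib ctensor_rel_refl)
  show "(f + g) *\<^sub>h x = f *\<^sub>h x + g *\<^sub>h x"
    by transfer (simp add: fm.scale_left_distrib ctensor_rel_refl)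
  show "f *\<^sub>h g *\<^sub>h x = (f * g) *\<^sub>h x"
    by transfer (simp add: ctensor_rel_refl)
  show "1 *\<^sub>h x = x"
    by transfer (simp add: ctensor_rel_refl)
qed

end

lift_definition tensor :: "'a::hmodule \<Rightarrow> 'b::hmodule \<Rightarrow> ('a, 'b) ctensor"  (infixr \<open>\<otimes>\<^sub>h\<close> 70)
  is "\<lambda>a b k. if k = 0 then Poly_Mapping.single (a, b) 1 else 0" .

text \<open>
  The map on the completed tensor product that is induced by a bilinear map into a separated and
  complete module. Module maps are automatically \<open>h\<close>-adically continuous.
\<close>

definition induced ::
    "('a::hmodule \<Rightarrow> 'b::hmodule \<Rightarrow> 'd::hmodule) \<Rightarrow> ('a, 'b) ctensor \<Rightarrow> 'd"
  where "induced B = (THE f. hlinear f \<and> (\<forall>a b. f (a \<otimes>\<^sub>h b) = B a b))"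

definition tensor_map ::
    "('a::hmodule \<Rightarrow> 'd::hmodule) \<Rightarrow> ('b::hmodule \<Rightarrow> 'e::hmodule) \<Rightarrow>
      ('a, 'b) ctensor \<Rightarrow> ('d, 'e) ctensor"
  where "tensor_map f g = induced (\<lambda>a b. f a \<otimes>\<^sub>h g b)"


section \<open>Quotients by closed ideals\<close>

definition two_sided_ideal :: "'a::ring_1 set \<Rightarrow> bool"
  where "two_sided_ideal I \<longleftrightarrow>
    0 \<in> I \<and> (\<forall>a\<in>I. \<forall>b\<in>I. a + b \<in> I) \<and> (\<forall>a\<in>I. \<forall>r. r * a \<in> I \<and> a * r \<in> I)"

definition closed_ideal :: "'a::ring_1 fps set \<Rightarrow> 'a fps set"
  where "closed_ideal S = \<Inter>{I. two_sided_ideal I \<and> closed I \<and> S \<subseteq> I}"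

lemma two_sided_ideal_closed_ideal: "two_sided_ideal (closed_ideal S)"
  unfolding closed_ideal_def two_sided_ideal_def by blast

context
  fixes S :: "'a::ring_1 fps set"
begin

lemma closed_ideal_0: "0 \<in> closed_ideal S"
  and closed_ideal_add: "a \<in> closed_ideal S \<Longrightarrow> b \<in> closed_ideal S \<Longrightarrow> a + b \<in> closed_ideal S"
  and closed_ideal_mult_left: "a \<in> closed_ideal S \<Longrightarrow> r * a \<in> closed_ideal S"
  and closed_ideal_mult_right: "a \<in> closed_ideal S \<Longrightarrow> a * r \<in> closed_ideal S"
  using two_sided_ideal_closed_ideal[of S] unfolding two_sided_ideal_def by blast+

lemma closed_ideal_uminus: "a \<in> closed_ideal S \<Longrightarrow> - a \<in> closed_ideal S"
  using closed_ideal_mult_left[of a "-1"] by simp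

lemma closed_ideal_equivp: "equivp (\<lambda>f g. f - g \<in> closed_ideal S)"
proof (rule equivpI)
  show "reflp (\<lambda>f g. f - g \<in> closed_ideal S)"
    by (simp add: reflp_def closed_ideal_0)
  show "symp (\<lambda>f g. f - g \<in> closed_ideal S)"
    by (metis (mono_tags, lifting) closed_ideal_uminus minus_diff_eq sympI)
  show "transp (\<lambda>f g. f - g \<in> closed_ideal S)"
    by (rule transpI) (metis closed_ideal_add diff_add_cancel add_diff_eq)
qed

lemma closed_ideal_cong_add:
  assumes "f - f' \<in> closed_ideal S" "g - g' \<in> closed_ideal S"
  shows "f + g - (f' + g') \<in> closed_ideal S"
  using closed_ideal_add[OF assms] by (simp add: algebra_simps)

lemma closed_ideal_cong_uminus:
  assumes "f - f' \<in> closed_ideal S"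
  shows "- f - - f' \<in> closed_ideal S"
  using closed_ideal_uminus[OF assms] by simp

lemma closed_ideal_cong_diff:
  assumes "f - f' \<in> closed_ideal S" "g - g' \<in> closed_ideal S"
  shows "f - g - (f' - g') \<in> closed_ideal S"
  using closed_ideal_add[OF assms(1) closed_ideal_uminus[OF assms(2)]] by (simp add: algebra_simps)

lemma closed_ideal_cong_mult:
  assumes "f - f' \<in> closed_ideal S" "g - g' \<in> closed_ideal S"
  shows "f * g - f' * g' \<in> closed_ideal S"
  using closed_ideal_add[OF closed_ideal_mult_right[OF assms(1), of g]
      closed_ideal_mult_left[OF assms(2), of f']]
  by (simp add: algebra_simps)

end

text \<open>The structure map \<open>\<complex>[[h]] \<rightarrow> \<complex>[M][[h]]\<close>, where \<open>\<complex>[M]\<close> is the monoid algebra of a monoid \<open>M\<close>.\<close>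

definition scalar_series :: "complex fps \<Rightarrow> ('m::monoid_add \<Rightarrow>\<^sub>0 complex) fps"
  where "scalar_series f = Abs_fps (\<lambda>k. Poly_Mapping.single 0 (fps_nth f k))"

lemma single_0_sum:
  "Poly_Mapping.single (0::'m::monoid_add) (\<Sum>i\<in>A. f i) = (\<Sum>i\<in>A. Poly_Mapping.single 0 (f i))"
  by (induction A rule: infinite_finite_induct) (simp_all add: single_add)

lemma scalar_series_add: "scalar_series (f + g) = scalar_series f + scalar_series g"
  by (simp add: scalar_series_def fps_eq_iff single_add)

lemma scalar_series_mult: "scalar_series (f * g) = scalar_series f * scalar_series g"
  by (simp add: scalar_series_def fps_eq_iff fps_mult_nth single_0_sum mult_single)

lemma scalar_series_1: "scalar_series 1 = 1"
  by (simp add: scalar_series_def fps_eq_iff)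


section \<open>The series \<open>S\<close>\<close>

text \<open>
  An element of \<open>End \<complex>\<^sup>N \<otimes> End \<complex>\<^sup>N\<close> is a matrix with rows and columns indexed by pairs: the entry
  in row \<open>(a, b)\<close> and column \<open>(a', b')\<close> is the coefficient of \<open>e\<^sub>a\<^sub>a\<^sub>' \<otimes> e\<^sub>b\<^sub>b\<^sub>'\<close>.
\<close>

type_synonym ('r, 'n) mat2 = "'r^('n \<times> 'n)^('n \<times> 'n)"

definition Pmat :: "('r::semiring_1, 'n::finite) mat2"
  where "Pmat = (\<chi> p q. if fst p = snd q \<and> snd p = fst q then 1 else 0)"

definition tr1 :: "('r::comm_ring_1, 'n::finite) mat2 \<Rightarrow> 'r^'n^'n"
  where "tr1 M = (\<chi> b b'. \<Sum>a\<in>UNIV. vec_nth (vec_nth M (a, b)) (a, b'))"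

definition tr2 :: "('r::comm_ring_1, 'n::finite) mat2 \<Rightarrow> 'r^'n^'n"
  where "tr2 M = (\<chi> a a'. \<Sum>b\<in>UNIV. vec_nth (vec_nth M (a, b)) (a', b))"

text \<open>
  Series in \<open>\<complex>[C][[h/u]]\<close>; the formal variable \<^const>\<open>fps_X\<close> of \<^typ>\<open>complex poly fps\<close> stands for
  \<open>t = h/u\<close> here. \<open>Rmat \<tau>\<close> is \<open>R(v)\<close> with \<open>\<tau> = h/v\<close>, and
  \<open>h/(-u-hC) = -t \<Sum>\<^sub>k (-C)\<^sup>k t\<^sup>k\<close>.
\<close>

definition Rmat :: "complex poly fps \<Rightarrow> (complex poly fps, 'n::finite) mat2"
  where "Rmat \<tau> = mat 1 - mat \<tau> ** Pmat"

definition shifted_arg :: "complex poly fps"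
  where "shifted_arg = - (fps_X * Abs_fps (\<lambda>k. (- [:0, 1:]) ^ k))"

definition GRR :: "complex poly fps \<Rightarrow> (complex poly fps, 'n::finite) mat2"
  where "GRR G = mat G ** Rmat fps_X ** Rmat shifted_arg - mat 1"

text \<open>
  The two trace conditions determine \<open>G\<close>; its leading terms \<open>1 + (C+N)/N h\<^sup>2/u\<^sup>2\<close> are a consequence.
\<close>

definition Gser :: "'n::finite itself \<Rightarrow> complex poly fps"
  where "Gser _ = (THE G. tr1 (GRR G :: (complex poly fps, 'n) mat2) = 0 \<and>
                          tr2 (GRR G :: (complex poly fps, 'n) mat2) = 0)"

text \<open>
  \<open>Sgen p q d\<close> is the coefficient of \<open>u\<^sup>d\<close> in the entry \<open>(p, q)\<close> of
  \<open>S(u, C) = h\<^sup>-\<^sup>2 (G(u, C) R(u) R(-u-hC) - I)\<close>, as a series in \<open>h\<close> (which is now \<^const>\<open>fps_X\<close>)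
  with coefficients in \<open>\<complex>[C]\<close>: the coefficient of \<open>t\<^sup>s\<close> contributes to \<open>h\<^sup>s u\<^sup>-\<^sup>s\<close>,
  and \<^term>\<open>fps_shift 2\<close> divides by \<open>h\<^sup>2\<close>.
\<close>

definition Sgen :: "'n::finite \<times> 'n \<Rightarrow> 'n \<times> 'n \<Rightarrow> int \<Rightarrow> complex poly fps"
  where "Sgen p q d = (if d \<le> 0
    then fps_shift 2
      (fps_const (fps_nth (vec_nth (vec_nth (GRR (Gser TYPE('n))) p) q) (nat (- d)))
        * fps_X ^ nat (- d))
    else 0)"

definition Sc :: "complex \<Rightarrow> 'n::finite \<times> 'n \<Rightarrow> 'n \<times> 'n \<Rightarrow> int \<Rightarrow> complex fps"
  where "Sc c p q d = Abs_fps (\<lambda>k. poly (fps_nth (Sgen p q d) k) c)"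

text \<open>Coefficient of \<open>x\<^sup>e y\<^sup>f\<close> in \<open>(x - y)\<^sup>e\<^sup>+\<^sup>f\<close>, expanded in nonnegative powers of \<open>y\<close>.\<close>

definition diff_coeff :: "int \<Rightarrow> int \<Rightarrow> complex"
  where "diff_coeff e f =
    (if 0 \<le> f then (- 1) ^ nat f * (of_int (e + f) gchoose nat f) else 0)"

text \<open>Coefficient of \<open>x\<^sup>e y\<^sup>f\<close> in the entry \<open>(p, q)\<close> of \<open>S(x - y)\<close>.\<close>

definition Sdiff :: "complex \<Rightarrow> 'n::finite \<times> 'n \<Rightarrow> 'n \<times> 'n \<Rightarrow> int \<Rightarrow> int \<Rightarrow> complex fps"
  where "Sdiff c p q e f = fps_const (diff_coeff e f) * Sc c p q (e + f)"

definition Sdiff_diag :: "complex \<Rightarrow> 'n::finite \<times> 'n \<Rightarrow> 'n \<times> 'n \<Rightarrow> int \<Rightarrow> int \<Rightarrow> complex fps"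
  where "Sdiff_diag c p q e f = (if p = q then Sdiff c p q e f else 0)"

text \<open>
  The entry \<open>(p, q)\<close> of the coefficient of \<open>u\<^sup>a v\<^sup>b\<close> in \<open>T(z + u - v)\<close>, \<open>T(z) = S(z) - S(-z)\<close>,
  as a series in \<open>z\<^sup>-\<^sup>1\<close> (the coefficient with index \<open>r\<close> belongs to \<open>z\<^sup>-\<^sup>r\<close>), using
  \<open>(z+u-v)\<^sup>-\<^sup>s = \<Sum> binom(-s, a+b) binom(a+b, a) (-1)\<^sup>b z\<^sup>-\<^sup>s\<^sup>-\<^sup>a\<^sup>-\<^sup>b u\<^sup>a v\<^sup>b\<close>.
\<close>

definition Tc :: "complex \<Rightarrow> 'n::finite \<times> 'n \<Rightarrow> 'n \<times> 'n \<Rightarrow> nat \<Rightarrow> complex fps"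
  where "Tc c p q s = Sc c p q (- int s) - (- 1) ^ s * Sc c p q (- int s)"

definition Tshift ::
    "complex \<Rightarrow> 'n::finite \<times> 'n \<Rightarrow> 'n \<times> 'n \<Rightarrow> nat \<Rightarrow> nat \<Rightarrow> complex fps fps"
  where "Tshift c p q a b = Abs_fps (\<lambda>r. if a + b \<le> r
    then fps_const ((- of_nat (r - (a + b)) gchoose (a + b)) * of_nat ((a + b) choose a) * (- 1) ^ b)
      * Tc c p q (r - (a + b))
    else 0)"


section \<open>Normally ordered products\<close>

text \<open>
  Elements of \<open>(End \<complex>\<^sup>N)\<^sup>\<otimes>\<^sup>n \<otimes> A\<close> are given by their entries: for \<open>I, J : {1, \<dots>, n} \<rightarrow> {1, \<dots>, N}\<close>
  the entry \<open>(I, J)\<close> is the coefficient of \<open>e\<^bsub>I(1)J(1)\<^esub> \<otimes> \<dots> \<otimes> e\<^bsub>I(n)J(n)\<^esub>\<close>. In the products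
  below the matrix parts of the factors occupy different tensor factors and their variables are
  different. Hence the coefficients of a product are products of coefficients.
\<close>

definition coords :: "(nat \<times> nat) set \<Rightarrow> nat set"
  where "coords i = fst ` i \<union> snd ` i"

definition coords_distinct :: "(nat \<times> nat) set \<Rightarrow> bool"
  where "coords_distinct i \<longleftrightarrow>
    (\<forall>(p, q)\<in>i. p \<noteq> q) \<and>
    (\<forall>x\<in>i. \<forall>y\<in>i. x \<noteq> y \<longrightarrow> {fst x, snd x} \<inter> {fst y, snd y} = {})"

definition pairings :: "nat \<Rightarrow> nat \<Rightarrow> (nat \<times> nat) set set"
  where "pairings n k =
    {i. i \<subseteq> {(p, q). p \<in> {1..n} \<and> q \<in> {1..n} \<and> p < q} \<and> card i = k \<and> coords_distinct i}"

definition cross_pairings :: "nat \<Rightarrow> nat \<Rightarrow> nat \<Rightarrow> (nat \<times> nat) set set"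
  where "cross_pairings n m k =
    {i. i \<subseteq> {1..n} \<times> {n+1..n+m} \<and> card i = k \<and> coords_distinct i}"

text \<open>
  The entry \<open>(I, J)\<close> of the coefficient of \<open>u\<^sub>1\<^bsup>e(1)\<^esup> \<dots> u\<^sub>n\<^bsup>e(n)\<^esup>\<close> in
  \<open>\<Sum> S\<^bsub>i\<^sub>1j\<^sub>1\<^esub> \<dots> S\<^bsub>i\<^sub>kj\<^sub>k\<^esub> X\<^bsub>l\<^sub>1\<^esub>(u\<^bsub>l\<^sub>1\<^esub>) \<dots> X\<^bsub>l\<^sub>n\<^sub>-\<^sub>2\<^sub>k\<^esub>(u\<^bsub>l\<^sub>n\<^sub>-\<^sub>2\<^sub>k\<^esub>)\<close>, applied to \<open>w\<close>. Here \<open>X i j e\<close> is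
  the coefficient of \<open>u\<^sup>e\<close> in the entry \<open>(i, j)\<close> of \<open>X(u)\<close> and \<open>S p q e f\<close> is the coefficient of
  \<open>x\<^sup>e y\<^sup>f\<close> in the entry \<open>(p, q)\<close> of \<open>S(x - y)\<close>.
\<close>

definition ordered_product ::
    "('n \<times> 'n \<Rightarrow> 'n \<times> 'n \<Rightarrow> int \<Rightarrow> int \<Rightarrow> complex fps) \<Rightarrow> ('n \<Rightarrow> 'n \<Rightarrow> int \<Rightarrow> 'w \<Rightarrow> 'w) \<Rightarrow>
      nat \<Rightarrow> (nat \<Rightarrow> 'n) \<Rightarrow> (nat \<Rightarrow> 'n) \<Rightarrow> (nat \<Rightarrow> int) \<Rightarrow> 'w \<Rightarrow> 'w::hmodule"
  where "ordered_product S X n I J e w =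
    (\<Sum>k\<le>n div 2. \<Sum>i\<in>pairings n k.
      (\<Prod>(p, q)\<in>i. S (I p, I q) (J p, J q) (e p) (e q)) *\<^sub>h
        foldr (\<lambda>l. X (I l) (J l) (e l)) (sorted_list_of_set ({1..n} - coords i)) w)"

text \<open>
  The coefficient of \<open>z\<^sup>m u\<^sub>1\<^bsup>a(1)\<^esup> \<dots> u\<^sub>n\<^bsup>a(n)\<^esup>\<close> in \<open>F(z+u\<^sub>1, \<dots>, z+u\<^sub>n)\<close>, if \<open>F e\<close> is the
  coefficient of \<open>x\<^sub>1\<^bsup>e(1)\<^esup> \<dots> x\<^sub>n\<^bsup>e(n)\<^esup>\<close> in \<open>F(x\<^sub>1, \<dots>, x\<^sub>n)\<close>.
\<close>

definition translate ::
    "nat \<Rightarrow> ((nat \<Rightarrow> int) \<Rightarrow> 'w::hmodule) \<Rightarrow> int \<Rightarrow> (nat \<Rightarrow> nat) \<Rightarrow> 'w"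
  where "translate n F m a =
    hsum (\<lambda>e. (\<Prod>l=1..n. of_int (e l) gchoose a l) *\<^sub>c F e)
      {e \<in> {1..n} \<rightarrow>\<^sub>E UNIV. (\<Sum>l=1..n. e l - int (a l)) = m}"


section \<open>The algebra \<open>H\<^sup>+\<^sub>N\<close>\<close>

text \<open>The variable \<open>(i, j, r)\<close> is \<open>x\<^sub>i\<^sub>j\<^bsup>(-r-1)\<^esup>\<close>, the coefficient of \<open>u\<^sup>r\<close> in \<open>x\<^sup>+\<^sub>i\<^sub>j(u)\<close>.\<close>

type_synonym 'n xpoly = "('n \<times> 'n \<times> nat \<Rightarrow>\<^sub>0 nat) \<Rightarrow>\<^sub>0 complex"

definition xvar :: "'n \<Rightarrow> 'n \<Rightarrow> nat \<Rightarrow> 'n xpoly fps"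
  where "xvar i j r = fps_const (Poly_Mapping.single (Poly_Mapping.single (i, j, r) 1) 1)"

definition Hplus_ideal :: "'n::finite xpoly fps set"
  where "Hplus_ideal = closed_ideal (range (\<lambda>r. \<Sum>i\<in>UNIV. xvar i i r))"

quotient_type 'n Hplus = "'n::finite xpoly fps" / "\<lambda>f g. f - g \<in> Hplus_ideal"
  unfolding Hplus_ideal_def by (rule closed_ideal_equivp)

instantiation Hplus :: (finite) "{comm_ring, comm_monoid_mult, hmodule}"
begin

lift_definition zero_Hplus :: "'a Hplus" is 0 .
lift_definition one_Hplus :: "'a Hplus" is 1 .
lift_definition plus_Hplus :: "'a Hplus \<Rightarrow> 'a Hplus \<Rightarrow> 'a Hplus" is plus
  unfolding Hplus_ideal_def by (rule closed_ideal_cong_add)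
lift_definition uminus_Hplus :: "'a Hplus \<Rightarrow> 'a Hplus" is uminus
  unfolding Hplus_ideal_def by (rule closed_ideal_cong_uminus)
lift_definition minus_Hplus :: "'a Hplus \<Rightarrow> 'a Hplus \<Rightarrow> 'a Hplus" is minus
  unfolding Hplus_ideal_def by (rule closed_ideal_cong_diff)
lift_definition times_Hplus :: "'a Hplus \<Rightarrow> 'a Hplus \<Rightarrow> 'a Hplus" is times
  unfolding Hplus_ideal_def by (rule closed_ideal_cong_mult)
lift_definition hscale_Hplus :: "complex fps \<Rightarrow> 'a Hplus \<Rightarrow> 'a Hplus"
  is "\<lambda>f x. scalar_series f * x"
  unfolding Hplus_ideal_def by (simp add: closed_ideal_mult_left flip: right_diff_distrib)

instance
proof
  fix x y z :: "'a Hplus" and f g :: "complex fps"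
  show "x + y + z = x + (y + z)"
    by transfer (simp add: add.assoc Hplus_ideal_def closed_ideal_0)
  show "x + y = y + x"
    by transfer (simp add: add.commute Hplus_ideal_def closed_ideal_0)
  show "0 + x = x"
    by transfer (simp add: Hplus_ideal_def closed_ideal_0)
  show "- x + x = 0"
    by transfer (simp add: Hplus_ideal_def closed_ideal_0)
  show "x - y = x + - y"
    by transfer (simp add: Hplus_ideal_def closed_ideal_0)
  show "x * y * z = x * (y * z)"
    by transfer (simp add: mult.assoc Hplus_ideal_def closed_ideal_0)
  show "x * y = y * x"
    by transfer (simp add: mult.commute Hplus_ideal_def closed_ideal_0)
  show "1 * x = x"
    by transfer (simp add: Hplus_ideal_def closed_ideal_0)
  show "(x + y) * z = x * z + y * z"
    by transfer (simp add: distrib_right Hplus_ideal_def closed_ideal_0)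
  show "f *\<^sub>h (x + y) = f *\<^sub>h x + f *\<^sub>h y"
    by transfer (simp add: distrib_left Hplus_ideal_def closed_ideal_0)
  show "(f + g) *\<^sub>h x = f *\<^sub>h x + g *\<^sub>h x"
    by transfer (simp add: scalar_series_add distrib_right Hplus_ideal_def closed_ideal_0)
  show "f *\<^sub>h g *\<^sub>h x = (f * g) *\<^sub>h x"
    by transfer (simp add: scalar_series_mult mult.assoc Hplus_ideal_def closed_ideal_0)
  show "1 *\<^sub>h x = x"
    by transfer (simp add: scalar_series_1 Hplus_ideal_def closed_ideal_0)
qed

end

lift_definition xp :: "'n::finite \<Rightarrow> 'n \<Rightarrow> nat \<Rightarrow> 'n Hplus" is xvar .

text \<open>
  The entry \<open>(I, J)\<close> of the coefficient of \<open>\<Prod>\<^sub>l u\<^sub>l\<^bsup>a(l)\<^esup>\<close> in \<open>\<Prod>\<^sub>l x\<^sup>+\<^sub>l(u\<^sub>l)\<close>, \<open>l\<close> running over a set \<open>L\<close>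
  of tensor factors; \<open>x\<^sup>+\<^bsub>[n]\<^esub>(u\<^sub>1, \<dots>, u\<^sub>n)\<close> is the case \<open>L = {1..n}\<close>.
\<close>

definition xplus :: "nat set \<Rightarrow> (nat \<Rightarrow> 'n::finite) \<Rightarrow> (nat \<Rightarrow> 'n) \<Rightarrow> (nat \<Rightarrow> nat) \<Rightarrow> 'n Hplus"
  where "xplus L I J a = (\<Prod>l\<in>L. xp (I l) (J l) (a l))"

definition xplus_diag ::
    "nat \<Rightarrow> (nat \<Rightarrow> 'n::finite) \<Rightarrow> (nat \<Rightarrow> 'n) \<Rightarrow> (nat \<Rightarrow> nat) \<Rightarrow> 'n Hplus"
  where "xplus_diag n I J a = (if \<forall>l\<in>{1..n}. I l = J l then xplus {1..n} I J a else 0)"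

text \<open>\<open>X i j r\<close> is the coefficient of \<open>u\<^sup>-\<^sup>r\<close> in \<open>x\<^sup>-\<^sub>i\<^sub>j(u)\<close>.\<close>

definition is_xminus :: "complex \<Rightarrow> ('n::finite \<Rightarrow> 'n \<Rightarrow> nat \<Rightarrow> 'n Hplus \<Rightarrow> 'n Hplus) \<Rightarrow> bool"
  where "is_xminus c X \<longleftrightarrow>
    (\<forall>i j r. hlinear (X i j r)) \<and>
    (\<forall>i j v. polar_h (\<lambda>r. X i j r v)) \<and>
    (\<forall>i j v. X i j 0 v = 0) \<and>
    (\<forall>i j r. X i j r 1 = 0) \<and>
    (\<forall>n\<ge>1. \<forall>I J a r. X (I 0) (J 0) r (xplus {1..n} I J a) =
      - (\<Sum>j=1..n. Sdiff c (I 0, I j) (J 0, J j) (- int r) (int (a j)) *\<^sub>h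
            xplus ({1..n} - {j}) I J a))"

definition xminus :: "complex \<Rightarrow> 'n::finite \<Rightarrow> 'n \<Rightarrow> nat \<Rightarrow> 'n Hplus \<Rightarrow> 'n Hplus"
  where "xminus c = (THE X. is_xminus c X)"

text \<open>\<open>xop c i j e\<close> is the coefficient of \<open>u\<^sup>e\<close> in \<open>x\<^sub>i\<^sub>j(u) = x\<^sup>+\<^sub>i\<^sub>j(u) + x\<^sup>-\<^sub>i\<^sub>j(u)\<close>.\<close>

definition xop :: "complex \<Rightarrow> 'n::finite \<Rightarrow> 'n \<Rightarrow> int \<Rightarrow> 'n Hplus \<Rightarrow> 'n Hplus"
  where "xop c i j e v = (if 0 \<le> e then xp i j (nat e) * v else xminus c i j (nat (- e)) v)"

definition Hplus_Y :: "complex \<Rightarrow> 'n::finite Hplus \<Rightarrow> 'n Hplus \<Rightarrow> int \<Rightarrow> 'n Hplus"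
  where "Hplus_Y c = (THE Y.
    (\<forall>m. hbilinear (\<lambda>a b. Y a b m)) \<and>
    (\<forall>a b. laurent_h (Y a b)) \<and>
    (\<forall>n I J a b m. Y (xplus {1..n} I J a) b m =
        translate n (\<lambda>e. ordered_product (Sdiff c) (xop c) n I J e b) m a))"

definition Hplus_S ::
    "complex \<Rightarrow> ('n::finite Hplus, 'n Hplus) ctensor \<Rightarrow> nat \<Rightarrow> ('n Hplus, 'n Hplus) ctensor"
  where "Hplus_S c = (THE S.
    (\<forall>r. hlinear (\<lambda>t. S t r)) \<and>
    (\<forall>t. polar_h (S t)) \<and>
    (\<forall>n m I J a r. S (xplus {1..n} I J a \<otimes>\<^sub>h xplus {n+1..n+m} I J a) r =
      (\<Sum>k\<le>min m n. \<Sum>i\<in>cross_pairings n m k.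
        fps_nth (\<Prod>(p, q)\<in>i. Tshift c (I p, I q) (J p, J q) (a p) (a q)) r *\<^sub>h
          (xplus ({1..n} - coords i) I J a \<otimes>\<^sub>h xplus ({n+1..n+m} - coords i) I J a))))"


section \<open>Quantum vertex algebras and their modules\<close>

text \<open>
  The structure maps of a quantum vertex algebra with underlying module \<^typ>\<open>'v\<close>. Since
  \<open>V((z))\<^sub>h\<close> is separated and complete, module maps from the completed tensor product of \<open>V\<close> with
  itself to \<open>V((z))\<^sub>h\<close> are the same as bilinear maps, and \<open>Y\<close> is given as such.
  The braiding is \<open>\<S>(z) t = \<Sum>\<^sub>r \<S> t r z\<^sup>-\<^sup>r\<close>.
\<close>

record (overloaded) ('v::hmodule) qva =
  qva_vacuum :: 'v
  qva_Y :: "'v \<Rightarrow> 'v \<Rightarrow> int \<Rightarrow> 'v"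
  qva_S :: "('v, 'v) ctensor \<Rightarrow> nat \<Rightarrow> ('v, 'v) ctensor"

text \<open>
  The coefficients of \<open>z\<^sub>0\<^sup>a z\<^sub>1\<^sup>b z\<^sub>2\<^sup>d\<close> in the three terms of the Jacobi identity. In the first
  two, \<open>\<delta>\<close> contributes the summand with \<open>n = -a-1\<close> resp. \<open>n = -a-1-r\<close>, in the third one \<open>n = b+k\<close>.
\<close>

definition jacobi1 ::
    "('v::hmodule \<Rightarrow> 'w::hmodule \<Rightarrow> int \<Rightarrow> 'w) \<Rightarrow> 'v \<Rightarrow> 'v \<Rightarrow> 'w \<Rightarrow> int \<Rightarrow> int \<Rightarrow> int \<Rightarrow> 'w"
  where "jacobi1 YW u v w a b d =
    hsum (\<lambda>k::nat. let n = - a - 1 in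
        diff_coeff (n - int k) (int k) *\<^sub>c YW u (YW v w (d - int k)) (b - (n - int k))) UNIV"

definition jacobi2 ::
    "'v::hmodule qva \<Rightarrow> ('v \<Rightarrow> 'w::hmodule \<Rightarrow> int \<Rightarrow> 'w) \<Rightarrow>
      'v \<Rightarrow> 'v \<Rightarrow> 'w \<Rightarrow> int \<Rightarrow> int \<Rightarrow> int \<Rightarrow> 'w"
  where "jacobi2 V YW u v w a b d =
    hsum (\<lambda>(r::nat, k::nat). let n = - a - 1 - int r in
        ((- 1) ^ r * (- 1) powi n * diff_coeff (n - int k) (int k)) *\<^sub>c
          induced (\<lambda>v' u'. YW v' (YW u' w (b - int k)) (d - (n - int k)))
            (qva_S V (v \<otimes>\<^sub>h u) r)) UNIV"

definition jacobi3 ::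
    "'v::hmodule qva \<Rightarrow> ('v \<Rightarrow> 'w::hmodule \<Rightarrow> int \<Rightarrow> 'w) \<Rightarrow>
      'v \<Rightarrow> 'v \<Rightarrow> 'w \<Rightarrow> int \<Rightarrow> int \<Rightarrow> int \<Rightarrow> 'w"
  where "jacobi3 V YW u v w a b d =
    hsum (\<lambda>k::nat. let n = b + int k in
        diff_coeff (n - int k) (int k) *\<^sub>c YW (qva_Y V u v (a - int k)) w (d + n + 1)) UNIV"

definition qva_module :: "'v::hmodule qva \<Rightarrow> ('v \<Rightarrow> 'w::hmodule \<Rightarrow> int \<Rightarrow> 'w) \<Rightarrow> bool"
  where "qva_module V YW \<longleftrightarrow>
    topologically_free (UNIV :: 'w set) \<and>
    (\<forall>m. hbilinear (\<lambda>v w. YW v w m)) \<and>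
    (\<forall>v w. laurent_h (YW v w)) \<and>
    (\<forall>w m. YW (qva_vacuum V) w m = (if m = 0 then w else 0)) \<and>
    (\<forall>u v w a b d. jacobi1 YW u v w a b d - jacobi2 V YW u v w a b d = jacobi3 V YW u v w a b d)"

text \<open>
  Submodules are only required to be topologically free themselves. In particular \<open>h W\<close> is one, and
  the zero module is not excluded from the irreducible ones.
\<close>

definition qva_submodule :: "('v::hmodule \<Rightarrow> 'w::hmodule \<Rightarrow> int \<Rightarrow> 'w) \<Rightarrow> 'w set \<Rightarrow> bool"
  where "qva_submodule YW U \<longleftrightarrow> topologically_free U \<and> (\<forall>v m. \<forall>w\<in>U. YW v w m \<in> U)"

definition qva_irreducible :: "('v::hmodule \<Rightarrow> 'w::hmodule \<Rightarrow> int \<Rightarrow> 'w) \<Rightarrow> bool"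
  where "qva_irreducible YW \<longleftrightarrow> (\<forall>U. qva_submodule YW U \<longrightarrow> U = {0} \<or> U = UNIV)"


section \<open>The quantum vertex algebra \<open>\<V>\<^sub>H(c)\<close>\<close>

text \<open>
  The underlying module is the smallest topologically free subalgebra that contains the generators;
  it does not depend on \<open>c\<close>. The structure maps are the restrictions of those of \<open>H\<^sup>+\<^sub>N\<close>; the
  braiding is restricted along the injection of the completed tensor squares.
\<close>

definition VH_carrier :: "'n::finite Hplus set"
  where "VH_carrier = \<Inter>{A. topologically_free A \<and> 1 \<in> A \<and> (\<forall>a\<in>A. \<forall>b\<in>A. a * b \<in> A) \<and>
                            (\<forall>i r. xp i i r \<in> A)}"

lemma subspace_VH_carrier: "hmod.subspace VH_carrier"
  unfolding VH_carrier_def hmod.subspace_def topologically_free_def by blast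

typedef (overloaded) 'n VH = "VH_carrier :: 'n::finite Hplus set"
  using hmod.subspace_0[OF subspace_VH_carrier] by blast

setup_lifting type_definition_VH

instantiation VH :: (finite) hmodule
begin

lift_definition zero_VH :: "'a VH" is 0
  by (rule hmod.subspace_0[OF subspace_VH_carrier])
lift_definition plus_VH :: "'a VH \<Rightarrow> 'a VH \<Rightarrow> 'a VH" is plus
  by (rule hmod.subspace_add[OF subspace_VH_carrier])
lift_definition uminus_VH :: "'a VH \<Rightarrow> 'a VH" is uminus
  by (rule hmod.subspace_neg[OF subspace_VH_carrier])
lift_definition minus_VH :: "'a VH \<Rightarrow> 'a VH \<Rightarrow> 'a VH" is minus
  by (rule hmod.subspace_diff[OF subspace_VH_carrier])
lift_definition hscale_VH :: "complex fps \<Rightarrow> 'a VH \<Rightarrow> 'a VH" is hscale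
  by (rule hmod.subspace_scale[OF subspace_VH_carrier])

instance
  by (standard; transfer) (simp_all add: algebra_simps hscale_hscale hscale_one)

end

definition VH :: "complex \<Rightarrow> 'n::finite VH qva"
  where "VH c = \<lparr>
    qva_vacuum = Abs_VH 1,
    qva_Y = (\<lambda>a b m. Abs_VH (Hplus_Y c (Rep_VH a) (Rep_VH b) m)),
    qva_S = (\<lambda>t r. THE t'. tensor_map Rep_VH Rep_VH t' = Hplus_S c (tensor_map Rep_VH Rep_VH t) r)\<rparr>"


section \<open>The algebra \<open>H(C)\<close> and its modules\<close>

datatype 'g word = Word (letters: "'g list")

instantiation word :: (type) monoid_add
begin

definition "0 = Word []"
definition "a + b = Word (letters a @ letters b)"

instance
  by standard (auto simp: zero_word_def plus_word_def)

end

text \<open>\<open>Gen_y i r\<close> is \<open>y\<^sub>i\<^bsup>(r)\<^esup>\<close>, the coefficient of \<open>u\<^sup>-\<^sup>r\<^sup>-\<^sup>1\<close> in \<open>y\<^sup>i(u)\<close>.\<close>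

datatype 'n HCgen = Gen_C | Gen_y 'n int

type_synonym 'n free_alg = "'n HCgen word \<Rightarrow>\<^sub>0 complex"

definition gen :: "'n HCgen \<Rightarrow> 'n free_alg"
  where "gen g = Poly_Mapping.single (Word [g]) 1"

text \<open>Coefficients of \<open>x\<^sup>e y\<^sup>f\<close> in \<open>s\<^sub>i\<^sub>j(x - y, C)\<close>, with the generator \<open>C\<close> in place of the indeterminate.\<close>

definition sC :: "'n::finite \<Rightarrow> 'n \<Rightarrow> int \<Rightarrow> int \<Rightarrow> 'n free_alg fps"
  where "sC i j e f = scalar_series (fps_const (diff_coeff e f)) *
    Abs_fps (\<lambda>k. let p = fps_nth (Sgen (i, j) (i, j) (e + f)) k in
      \<Sum>l\<le>degree p. Poly_Mapping.single 0 (coeff p l) * gen Gen_C ^ l)"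

definition HC_relations :: "'n::finite free_alg fps set"
  where "HC_relations =
    {fps_const (gen Gen_C * gen g - gen g * gen Gen_C) | g. True}
  \<union> {fps_const (gen (Gen_y i r) * gen (Gen_y j s) - gen (Gen_y j s) * gen (Gen_y i r))
       + sC i j (- r - 1) (- s - 1) - sC i j (- s - 1) (- r - 1) | i j r s. True}
  \<union> {fps_const (\<Sum>i\<in>UNIV. gen (Gen_y i r)) | r. True}"

text \<open>
  The \<open>h\<close>-adic completion of the free \<open>\<complex>[[h]]\<close>-algebra on the generators is \<^typ>\<open>'n free_alg fps\<close>.
\<close>

quotient_type 'n HC = "'n::finite free_alg fps" / "\<lambda>f g. f - g \<in> closed_ideal HC_relations"
  by (rule closed_ideal_equivp)

instantiation HC :: (finite) "{ring, monoid_mult, hmodule}"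
begin

lift_definition zero_HC :: "'a HC" is 0 .
lift_definition one_HC :: "'a HC" is 1 .
lift_definition plus_HC :: "'a HC \<Rightarrow> 'a HC \<Rightarrow> 'a HC" is plus
  by (rule closed_ideal_cong_add)
lift_definition uminus_HC :: "'a HC \<Rightarrow> 'a HC" is uminus
  by (rule closed_ideal_cong_uminus)
lift_definition minus_HC :: "'a HC \<Rightarrow> 'a HC \<Rightarrow> 'a HC" is minus
  by (rule closed_ideal_cong_diff)
lift_definition times_HC :: "'a HC \<Rightarrow> 'a HC \<Rightarrow> 'a HC" is times
  by (rule closed_ideal_cong_mult)
lift_definition hscale_HC :: "complex fps \<Rightarrow> 'a HC \<Rightarrow> 'a HC"
  is "\<lambda>f x. scalar_series f * x"
  by (simp add: closed_ideal_mult_left flip: right_diff_distrib)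

instance
proof
  fix x y z :: "'a HC" and f g :: "complex fps"
  show "x + y + z = x + (y + z)"
    by transfer (simp add: add.assoc closed_ideal_0)
  show "x + y = y + x"
    by transfer (simp add: add.commute closed_ideal_0)
  show "0 + x = x"
    by transfer (simp add: closed_ideal_0)
  show "- x + x = 0"
    by transfer (simp add: closed_ideal_0)
  show "x - y = x + - y"
    by transfer (simp add: closed_ideal_0)
  show "x * y * z = x * (y * z)"
    by transfer (simp add: mult.assoc closed_ideal_0)
  show "1 * x = x" "x * 1 = x"
    by (transfer, simp add: closed_ideal_0)+
  show "x * (y + z) = x * y + x * z"
    by transfer (simp add: distrib_left closed_ideal_0)
  show "(x + y) * z = x * z + y * z"
    by transfer (simp add: distrib_right closed_ideal_0)
  show "f *\<^sub>h (x + y) = f *\<^sub>h x + f *\<^sub>h y"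
    by transfer (simp add: distrib_left closed_ideal_0)
  show "(f + g) *\<^sub>h x = f *\<^sub>h x + g *\<^sub>h x"
    by transfer (simp add: scalar_series_add distrib_right closed_ideal_0)
  show "f *\<^sub>h g *\<^sub>h x = (f * g) *\<^sub>h x"
    by transfer (simp add: scalar_series_mult mult.assoc closed_ideal_0)
  show "1 *\<^sub>h x = x"
    by transfer (simp add: scalar_series_1 closed_ideal_0)
qed

end

lift_definition HC_gen :: "'n::finite HCgen \<Rightarrow> 'n HC" is "\<lambda>g. fps_const (gen g)" .

definition HC_module :: "('n::finite HC \<Rightarrow> 'w::hmodule \<Rightarrow> 'w) \<Rightarrow> bool"
  where "HC_module act \<longleftrightarrow> hbilinear act \<and>
    (\<forall>w. act 1 w = w) \<and> (\<forall>a b w. act (a * b) w = act a (act b w))"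

definition HC_level :: "('n::finite HC \<Rightarrow> 'w::hmodule \<Rightarrow> 'w) \<Rightarrow> complex \<Rightarrow> bool"
  where "HC_level act c \<longleftrightarrow> (\<forall>w. act (HC_gen Gen_C) w = c *\<^sub>c w)"

text \<open>\<open>yop act i e\<close> is the coefficient of \<open>z\<^sup>e\<close> in the action of \<open>y\<^sup>i(z)\<close>.\<close>

definition yop :: "('n::finite HC \<Rightarrow> 'w::hmodule \<Rightarrow> 'w) \<Rightarrow> 'n \<Rightarrow> int \<Rightarrow> 'w \<Rightarrow> 'w"
  where "yop act i e = act (HC_gen (Gen_y i (- e - 1)))"

definition HC_restricted :: "('n::finite HC \<Rightarrow> 'w::hmodule \<Rightarrow> 'w) \<Rightarrow> bool"
  where "HC_restricted act \<longleftrightarrow> topologically_free (UNIV :: 'w set) \<and>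
    (\<forall>i w. laurent_h (\<lambda>e. yop act i e w))"

definition HC_submodule :: "('n::finite HC \<Rightarrow> 'w::hmodule \<Rightarrow> 'w) \<Rightarrow> 'w set \<Rightarrow> bool"
  where "HC_submodule act U \<longleftrightarrow> topologically_free U \<and> (\<forall>a. \<forall>w\<in>U. act a w \<in> U)"

definition HC_irreducible :: "('n::finite HC \<Rightarrow> 'w::hmodule \<Rightarrow> 'w) \<Rightarrow> bool"
  where "HC_irreducible act \<longleftrightarrow> (\<forall>U. HC_submodule act U \<longrightarrow> U = {0} \<or> U = UNIV)"

definition ymat :: "('n::finite HC \<Rightarrow> 'w::hmodule \<Rightarrow> 'w) \<Rightarrow> 'n \<Rightarrow> 'n \<Rightarrow> int \<Rightarrow> 'w \<Rightarrow> 'w"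
  where "ymat act i j e w = (if i = j then yop act i e w else 0)"

definition y_bracket ::
    "complex \<Rightarrow> ('n::finite HC \<Rightarrow> 'w::hmodule \<Rightarrow> 'w) \<Rightarrow>
      nat \<Rightarrow> (nat \<Rightarrow> 'n) \<Rightarrow> (nat \<Rightarrow> 'n) \<Rightarrow> (nat \<Rightarrow> int) \<Rightarrow> 'w \<Rightarrow> 'w"
  where "y_bracket c act = ordered_product (Sdiff_diag c) (ymat act)"

text \<open>\<open>Y\<^sub>W(diag x\<^sup>+\<^bsub>[n]\<^esub>(u\<^sub>1, \<dots>, u\<^sub>n), z) = y\<^bsub>[n]\<^esub>(z+u\<^sub>1, \<dots>, z+u\<^sub>n)\<close> for all \<open>n\<close>, entrywise and coefficientwise.\<close>

definition given_by_y ::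
    "complex \<Rightarrow> ('n::finite HC \<Rightarrow> 'w::hmodule \<Rightarrow> 'w) \<Rightarrow> ('n VH \<Rightarrow> 'w \<Rightarrow> int \<Rightarrow> 'w) \<Rightarrow> bool"
  where "given_by_y c act YW \<longleftrightarrow>
    (\<forall>n I J a w m. YW (Abs_VH (xplus_diag n I J a)) w m =
      translate n (\<lambda>e. y_bracket c act n I J e w) m a)"

end

(*
  The modes of y^i(u) satisfy Heisenberg relations with scalar commutators: those with nonnegative
  powers of u commute with each other, and so do those with negative powers. By Wick's theorem the
  matrix y_[n](u_1, ..., u_n) is therefore the normally ordered product of the series y(u_k). The
  formula for Y_W thus says that multiplication of v by x_ii^(-r-1) turns Y_W(v, z) into the normally
  ordered product of d^r y^i(z)/r! with Y_W(v, z), which defines Y_W on monomials uniquely. The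
  vertex operator map of H^+_N is the same construction applied to the operators x(u).

  For the Jacobi identity, commuting a mode of y^i(z) past Y_W(v, z) yields two sums of operators
  Y_W(D v, z) for derivations D of the polynomial algebra, and S(z) intertwines the two families of
  derivations. Hence each of the three terms of the identity satisfies the same recursion when u is
  multiplied by a generator: a normally ordered product plus the sum of the terms with v replaced
  by D v. The binomial coefficients in the delta functions match by Vandermonde's identity. So the
  identity reduces to the case where u is the vacuum, where it is the expansion of the delta
  functions. A submodule for Y_W is closed under the coefficients of
  y^i(z) = Y_W(x_ii^(-1), z), hence a submodule for H(C), which gives irreducibility.
*)
theory Submission
  imports Defs
begin

section \<open>Convergence in \<open>h\<close>-adic modules\<close>

text \<open>The structure maps in the statement (\<open>Gser\<close>, \<open>induced\<close>,
  \<open>xminus\<close>, \<open>Hplus_Y\<close>, \<open>Hplus_S\<close>, the braiding of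
  \<open>VH\<close>) are definite descriptions, so existence and uniqueness of each come before any
  computation. The obstacle is that \<open>Hplus\<close> is a quotient by a closed ideal.
  \<open>Hplus_extend\<close> deals with it once and for all: a linear map out of
  \<open>Hplus\<close> is given by a function on lists of generators that is symmetric and killed by
  the trace relation. The two trace conditions on S let derivations and braiding pass this test. On
  the vertex algebra side convergence has one source: the coefficient of u^(-s) in S is divisible by
  h^(s-2). The delicate part of the Jacobi identity is the second term, since its own recursion
  leaves the wrong derivations and the braiding adds further ones. With T(z) = S(z) - S(-z) the two
  contributions add up to the right ones, up to the sign of z^(-p) under z -> -z. The identity is
  proved for abstract data (\<open>vertex_setup\<close>); the diagonal subalgebra is handled through
  a linear projection of \<open>Hplus\<close> onto it.\<close>

lemma hlinear_iff:
  "hlinear f \<longleftrightarrow> (\<forall>x y. f (x + y) = f x + f y) \<and> (\<forall>c x. f (c *\<^sub>h x) = c *\<^sub>h f x)"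
  unfolding hlinear_def module_hom_def module_hom_axioms_def
  by (simp add: hmod.module_axioms)

lemma hlinearI:
  "(\<And>x y. f (x + y) = f x + f y) \<Longrightarrow> (\<And>c x. f (c *\<^sub>h x) = c *\<^sub>h f x) \<Longrightarrow> hlinear f"
  by (simp add: hlinear_iff)

lemma hlinear_add: "hlinear f \<Longrightarrow> f (x + y) = f x + f y"
  and hlinear_scale: "hlinear f \<Longrightarrow> f (c *\<^sub>h x) = c *\<^sub>h f x"
  by (simp_all add: hlinear_iff)

lemma hlinear_0: "hlinear f \<Longrightarrow> f 0 = 0"
  using hlinear_scale[of f 0 0] by simp

lemma hlinear_uminus: "hlinear f \<Longrightarrow> f (- x) = - f x"
  using hlinear_scale[of f "-1" x] by simp

lemma hlinear_diff: "hlinear f \<Longrightarrow> f (x - y) = f x - f y"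
  using hlinear_add[of f x "- y"] by (simp add: hlinear_uminus)

lemma hlinear_sum: "hlinear f \<Longrightarrow> f (sum g A) = (\<Sum>x\<in>A. f (g x))"
  by (induction A rule: infinite_finite_induct) (simp_all add: hlinear_0 hlinear_add)

lemma hlinear_ident [intro]: "hlinear (\<lambda>x. x)"
  by (simp add: hlinear_iff)

lemma hlinear_zero [intro]: "hlinear (\<lambda>x. 0)"
  by (simp add: hlinear_iff)

lemma hlinear_compose: "hlinear f \<Longrightarrow> hlinear g \<Longrightarrow> hlinear (\<lambda>x. f (g x))"
  by (simp add: hlinear_iff)

lemma hlinear_fun_add: "hlinear f \<Longrightarrow> hlinear g \<Longrightarrow> hlinear (\<lambda>x. f x + g x)"
  by (simp add: hlinear_iff hscale_add_right add_ac)

lemma hlinear_fun_scale: "hlinear f \<Longrightarrow> hlinear (\<lambda>x. c *\<^sub>h f x)"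
  by (simp add: hlinear_iff hscale_add_right hscale_hscale mult.commute)

lemma hlinear_fun_uminus: "hlinear f \<Longrightarrow> hlinear (\<lambda>x. - f x)"
  by (simp add: hlinear_iff)

lemma hlinear_fun_diff: "hlinear f \<Longrightarrow> hlinear g \<Longrightarrow> hlinear (\<lambda>x. f x - g x)"
  using hlinear_fun_add[of f "\<lambda>x. - g x"] by (simp add: hlinear_fun_uminus)

lemma hlinear_fun_sum: "(\<And>i. i \<in> A \<Longrightarrow> hlinear (f i)) \<Longrightarrow> hlinear (\<lambda>x. \<Sum>i\<in>A. f i x)"
  by (induction A rule: infinite_finite_induct) (auto simp: hlinear_fun_add)

lemmas hlinear_intros =
  hlinear_ident hlinear_zero hlinear_fun_add hlinear_fun_scale hlinear_fun_uminus
  hlinear_fun_diff hlinear_fun_sum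

section \<open>The h-adic filtration\<close>

lemma in_hpow: "x \<in> hpow k A \<longleftrightarrow> (\<exists>y\<in>A. x = fps_X ^ k *\<^sub>h y)"
  by (auto simp: hpow_def)

lemma in_hpowI: "fps_X ^ k *\<^sub>h y \<in> hpow k UNIV"
  by (auto simp: hpow_def)

lemma hpow_UNIV_I: "x \<in> hpow k A \<Longrightarrow> x \<in> hpow k UNIV"
  by (auto simp: hpow_def)

lemma hpow_0 [simp]: "hpow 0 A = A"
  by (auto simp: hpow_def hscale_one)

lemma hpow_subspace:
  assumes "hmod.subspace A"
  shows "hmod.subspace (hpow k A)"
proof (rule hmod.subspaceI)
  show "0 \<in> hpow k A"
    using hmod.subspace_0[OF assms] by (force simp: in_hpow)
next
  fix x y assume "x \<in> hpow k A" "y \<in> hpow k A"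
  then show "x + y \<in> hpow k A"
    using hmod.subspace_add[OF assms] by (auto simp: in_hpow simp flip: hscale_add_right)
next
  fix c x assume "x \<in> hpow k A"
  then obtain y where "y \<in> A" "x = fps_X ^ k *\<^sub>h y"
    by (auto simp: in_hpow)
  then show "c *\<^sub>h x \<in> hpow k A"
    using hmod.subspace_scale[OF assms, of y c]
    by (metis in_hpow hscale_hscale mult.commute)
qed

lemma hpow_zero [simp]: "0 \<in> hpow k UNIV"
  by (rule hmod.subspace_0[OF hpow_subspace[OF hmod.subspace_UNIV]])

lemma hpow_add: "x \<in> hpow k UNIV \<Longrightarrow> y \<in> hpow k UNIV \<Longrightarrow> x + y \<in> hpow k UNIV"
  by (rule hmod.subspace_add[OF hpow_subspace[OF hmod.subspace_UNIV]])

lemma hpow_diff: "x \<in> hpow k UNIV \<Longrightarrow> y \<in> hpow k UNIV \<Longrightarrow> x - y \<in> hpow k UNIV"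
  by (rule hmod.subspace_diff[OF hpow_subspace[OF hmod.subspace_UNIV]])

lemma hpow_uminus: "x \<in> hpow k UNIV \<Longrightarrow> - x \<in> hpow k UNIV"
  by (rule hmod.subspace_neg[OF hpow_subspace[OF hmod.subspace_UNIV]])

lemma hpow_scale: "x \<in> hpow k UNIV \<Longrightarrow> c *\<^sub>h x \<in> hpow k UNIV"
  by (rule hmod.subspace_scale[OF hpow_subspace[OF hmod.subspace_UNIV]])

lemma hpow_sum: "(\<And>i. i \<in> I \<Longrightarrow> f i \<in> hpow k UNIV) \<Longrightarrow> sum f I \<in> hpow k UNIV"
  by (rule hmod.subspace_sum[OF hpow_subspace[OF hmod.subspace_UNIV]])

lemma hpow_dvd: "fps_X ^ k dvd c \<Longrightarrow> c *\<^sub>h x \<in> hpow k UNIV"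
  by (elim dvdE, simp only: hscale_hscale[symmetric] in_hpowI)

lemma hpow_mono: "k \<le> l \<Longrightarrow> x \<in> hpow l UNIV \<Longrightarrow> x \<in> hpow k UNIV"
  unfolding in_hpow[of x l] by (blast intro: hpow_dvd le_imp_power_dvd)

text \<open>Module maps are automatically h-adically continuous: they commute with multiplication by
  h^k.\<close>

lemma hpow_hlinear: "hlinear f \<Longrightarrow> x \<in> hpow k UNIV \<Longrightarrow> f x \<in> hpow k UNIV"
  by (auto simp: in_hpow hlinear_scale)

text \<open>The property shared by W, \<open>Hplus\<close> and completed tensor products that gives
  a convergent family exactly one sum.\<close>

definition hcs :: "'a::hmodule itself \<Rightarrow> bool"
  where "hcs _ \<longleftrightarrow> hseparated (UNIV::'a set) \<and> hcomplete (UNIV::'a set)"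

lemma hcs_eqI:
  fixes x y :: "'a::hmodule"
  assumes "hcs TYPE('a)" "\<And>k. x - y \<in> hpow k UNIV"
  shows "x = y"
proof -
  have "x - y \<in> (\<Inter>k. hpow k UNIV)"
    using assms(2) by blast
  also have "\<dots> = {0}"
    using assms(1) by (simp add: hcs_def hseparated_def)
  finally show ?thesis by simp
qed

text \<open>A rate of convergence is built in: comparing the limit with a late term shows that
  already \<open>s k\<close> is within h^k of it.\<close>

lemma hcs_limit:
  fixes s :: "nat \<Rightarrow> 'a::hmodule"
  assumes hc: "hcs TYPE('a)" and s: "\<And>k m. k \<le> m \<Longrightarrow> s m - s k \<in> hpow k UNIV"
  shows "\<exists>l. \<forall>k. l - s k \<in> hpow k UNIV"
proof -
  have "s m - s n \<in> hpow k UNIV" if "k \<le> m" "k \<le> n" for k m n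
    using hpow_diff[OF s[OF that(1)] s[OF that(2)]] by simp
  then have *: "(\<forall>n. s n \<in> UNIV) \<and> (\<forall>k. \<exists>M. \<forall>m\<ge>M. \<forall>n\<ge>M. s m - s n \<in> hpow k UNIV)"
    by blast
  obtain l where l: "\<And>k. \<exists>M. \<forall>n\<ge>M. s n - l \<in> hpow k UNIV"
    using hc[unfolded hcs_def hcomplete_def, THEN conjunct2, rule_format, OF *] by blast
  have "l - s k \<in> hpow k UNIV" for k
  proof -
    obtain M where M: "\<And>n. n \<ge> M \<Longrightarrow> s n - l \<in> hpow k UNIV"
      using l by blast
    show ?thesis
      using hpow_diff[OF s[of k "max M k"] M[of "max M k"]] by simp
  qed
  then show ?thesis by blast
qed

text \<open>A Cauchy sequence has a subsequence whose k-th increment lies in h^k, that is, a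
  sequence of partial sums of an h-adic expansion. So expansions are the only sequences to
  test.\<close>

lemma hcompleteI:
  assumes "\<And>y :: nat \<Rightarrow> 'a::hmodule. \<exists>l. \<forall>n. l - (\<Sum>k<n. fps_X ^ k *\<^sub>h y k) \<in> hpow n UNIV"
  shows "hcomplete (UNIV :: 'a set)"
  unfolding hcomplete_def
proof (intro allI impI, elim conjE)
  fix s :: "nat \<Rightarrow> 'a"
  assume "\<forall>k. \<exists>M. \<forall>m\<ge>M. \<forall>n\<ge>M. s m - s n \<in> hpow k UNIV"
  then obtain M where M: "\<And>k m n. m \<ge> M k \<Longrightarrow> n \<ge> M k \<Longrightarrow> s m - s n \<in> hpow k UNIV"
    by metis
  \<comment> \<open>Summing the bounds gives one that dominates \<open>M k\<close> and is monotone
    in k.\<close>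
  define N where "N k = (\<Sum>j\<le>k. M j)" for k
  have N: "M k \<le> N k" "N k \<le> N (Suc k)" for k
    by (simp_all add: N_def member_le_sum)
  have "s (N (Suc k)) - s (N k) \<in> hpow k UNIV" for k
    using N by (intro M) (auto intro: order_trans)
  then obtain y where y: "\<And>k. s (N (Suc k)) - s (N k) = fps_X ^ k *\<^sub>h y k"
    unfolding in_hpow by metis
  have sN: "s (N n) = s (N 0) + (\<Sum>k<n. fps_X ^ k *\<^sub>h y k)" for n
  proof (induction n)
    case (Suc n)
    have "s (N (Suc n)) = s (N n) + fps_X ^ n *\<^sub>h y n"
      by (simp only: y[symmetric]) simp
    then show ?case by (simp add: Suc add.assoc)
  qed simp
  obtain l where l: "\<And>n. l - (\<Sum>k<n. fps_X ^ k *\<^sub>h y k) \<in> hpow n UNIV"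
    using assms[of y] by blast
  have "s n - (s (N 0) + l) \<in> hpow k UNIV" if "n \<ge> N k" for n k
  proof -
    have "s n - s (N k) \<in> hpow k UNIV"
      using that N(1)[of k] by (intro M) auto
    from hpow_diff[OF this l[of k]] show ?thesis
      by (simp add: sN[of k] algebra_simps)
  qed
  then show "\<exists>l\<in>UNIV. \<forall>k. \<exists>M. \<forall>n\<ge>M. s n - l \<in> hpow k UNIV"
    by blast
qed

text \<open>One finite set witnesses both that all other terms are small and that its partial sum is
  close to s. This is easier to transport along maps than the quantifier over all larger sets in
  \<open>has_hsum\<close>.\<close>

definition hsums :: "('i \<Rightarrow> 'a::hmodule) \<Rightarrow> 'i set \<Rightarrow> 'a \<Rightarrow> bool"
  where "hsums f A s \<longleftrightarrow> (\<forall>K. \<exists>F. finite F \<and> F \<subseteq> A \<and> (\<forall>x\<in>A - F. f x \<in> hpow K UNIV) \<and>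
    s - sum f F \<in> hpow K UNIV)"

lemma hsumsE:
  assumes "hsums f A s"
  obtains F where "finite F" "F \<subseteq> A" "\<forall>x\<in>A - F. f x \<in> hpow K UNIV" "s - sum f F \<in> hpow K UNIV"
proof -
  have "\<exists>F. finite F \<and> F \<subseteq> A \<and> (\<forall>x\<in>A - F. f x \<in> hpow K UNIV) \<and> s - sum f F \<in> hpow K UNIV"
    using assms by (simp only: hsums_def)
  then show ?thesis by (elim exE conjE) (rule that)
qed

text \<open>In a complete non-archimedean module a family can be summed as soon as its terms tend to
  0, so convergence is a finiteness condition for each power of h.\<close>

definition hsummable :: "('i \<Rightarrow> 'a::hmodule) \<Rightarrow> 'i set \<Rightarrow> bool"
  where "hsummable f A \<longleftrightarrow> (\<forall>K. finite {x\<in>A. f x \<notin> hpow K UNIV})"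

lemma sum_hpow_cong:
  assumes "finite F" "finite G" "\<And>x. x \<in> F - G \<Longrightarrow> f x \<in> hpow K UNIV"
    "\<And>x. x \<in> G - F \<Longrightarrow> f x \<in> hpow K UNIV"
  shows "sum f F - sum f G \<in> hpow K UNIV"
proof -
  have "sum f F = sum f (F \<inter> G) + sum f (F - G)" "sum f G = sum f (F \<inter> G) + sum f (G - F)"
    using assms(1,2) sum.Int_Diff by (metis, metis inf_commute)
  then have "sum f F - sum f G = sum f (F - G) - sum f (G - F)"
    by simp
  then show ?thesis
    using assms(3,4) by (auto intro!: hpow_diff hpow_sum)
qed

lemma hsums_has_hsum: "hsums f A s \<Longrightarrow> has_hsum f A s"
  unfolding has_hsum_def
proof
  fix k assume "hsums f A s"
  then obtain F where F: "finite F" "F \<subseteq> A" "\<forall>x\<in>A - F. f x \<in> hpow k UNIV"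
    "s - sum f F \<in> hpow k UNIV"
    by (rule hsumsE)
  have "s - sum f F' \<in> hpow k UNIV" if "finite F'" "F \<subseteq> F'" "F' \<subseteq> A" for F'
  proof -
    have "sum f F' - sum f F \<in> hpow k UNIV"
      using that F by (intro sum_hpow_cong) auto
    then show ?thesis
      using hpow_diff[OF F(4)] by fastforce
  qed
  then show "\<exists>F. finite F \<and> F \<subseteq> A \<and>
      (\<forall>F'. finite F' \<and> F \<subseteq> F' \<and> F' \<subseteq> A \<longrightarrow> s - sum f F' \<in> hpow k UNIV)"
    using F by blast
qed

lemma has_hsum_unique:
  fixes f :: "'i \<Rightarrow> 'a::hmodule"
  assumes "hcs TYPE('a)" "has_hsum f A s" "has_hsum f A t"
  shows "s = t"
proof (rule hcs_eqI[OF assms(1)])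
  fix k
  obtain F G where
    F: "finite F" "F \<subseteq> A" "\<And>F'. finite F' \<Longrightarrow> F \<subseteq> F' \<Longrightarrow> F' \<subseteq> A \<Longrightarrow> s - sum f F' \<in> hpow k UNIV" and
    G: "finite G" "G \<subseteq> A" "\<And>F'. finite F' \<Longrightarrow> G \<subseteq> F' \<Longrightarrow> F' \<subseteq> A \<Longrightarrow> t - sum f F' \<in> hpow k UNIV"
    using assms(2,3) unfolding has_hsum_def by metis
  show "s - t \<in> hpow k UNIV"
    using hpow_diff[OF F(3)[of "F \<union> G"] G(3)[of "F \<union> G"]] F G by simp
qed

lemma hsum_eqI:
  fixes f :: "'i \<Rightarrow> 'a::hmodule"
  assumes "hcs TYPE('a)" "hsums f A s"
  shows "hsum f A = s"
  unfolding hsum_def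
  using hsums_has_hsum[OF assms(2)] has_hsum_unique[OF assms(1)] by blast

lemma hsums_summable: "hsums f A s \<Longrightarrow> hsummable f A"
  unfolding hsummable_def
proof
  fix K assume "hsums f A s"
  then obtain F where "finite F" "\<forall>x\<in>A - F. f x \<in> hpow K UNIV"
    by (rule hsumsE)
  then show "finite {x \<in> A. f x \<notin> hpow K UNIV}"
    by (auto intro: finite_subset[of _ F])
qed

lemma hsummable_hsums:
  fixes f :: "'i \<Rightarrow> 'a::hmodule"
  assumes hc: "hcs TYPE('a)" and "hsummable f A"
  shows "hsums f A (hsum f A)"
proof -
  \<comment> \<open>The finitely many terms outside h^K. Their sums form a Cauchy sequence, since
    enlarging the exponent adds only terms that lie in h^K.\<close>
  define F where "F K = {x\<in>A. f x \<notin> hpow K UNIV}" for K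
  have F: "finite (F K)" "F K \<subseteq> A" for K
    using assms(2) by (auto simp: F_def hsummable_def)
  have "sum f (F m) - sum f (F k) \<in> hpow k UNIV" if "k \<le> m" for k m
    using that F(1) by (intro sum_hpow_cong) (auto simp: F_def dest: hpow_mono)
  from hcs_limit[OF hc this] obtain l where l: "\<And>k. l - sum f (F k) \<in> hpow k UNIV"
    by blast
  have "hsums f A l"
    unfolding hsums_def
  proof
    fix K show "\<exists>F. finite F \<and> F \<subseteq> A \<and> (\<forall>x\<in>A - F. f x \<in> hpow K UNIV) \<and> l - sum f F \<in> hpow K UNIV"
      using F[of K] l[of K] by (intro exI[of _ "F K"]) (auto simp: F_def)
  qed
  then show ?thesis
    using hsum_eqI[OF hc] by metis
qed

lemma hsummableI:
  assumes "\<And>K. \<exists>F. finite F \<and> (\<forall>x\<in>A - F. f x \<in> hpow K UNIV)"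
  shows "hsummable f A"
  unfolding hsummable_def
proof
  fix K
  obtain F where "finite F" "\<forall>x\<in>A - F. f x \<in> hpow K UNIV" using assms by blast
  then show "finite {x \<in> A. f x \<notin> hpow K UNIV}"
    by (auto intro: finite_subset[of _ F])
qed

lemma hsummable_finite [simp]: "finite A \<Longrightarrow> hsummable f A"
  by (simp add: hsummable_def)

lemma hsummable_subset: "hsummable f A \<Longrightarrow> B \<subseteq> A \<Longrightarrow> hsummable f B"
  unfolding hsummable_def
proof
  fix K assume *: "\<forall>K. finite {x \<in> A. f x \<notin> hpow K UNIV}" and "B \<subseteq> A"
  then show "finite {x \<in> B. f x \<notin> hpow K UNIV}"
    by (intro finite_subset[OF _ *[rule_format, of K]]) auto
qed

lemma hsummable_weaken:
  assumes *: "hsummable f A"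
    and fg: "\<And>x K. x \<in> A \<Longrightarrow> f x \<in> hpow K UNIV \<Longrightarrow> g x \<in> hpow K UNIV"
  shows "hsummable g A"
  unfolding hsummable_def
proof
  fix K show "finite {x \<in> A. g x \<notin> hpow K UNIV}"
    using fg by (intro finite_subset[OF _ *[unfolded hsummable_def, rule_format, of K]]) auto
qed

lemma hsummable_hlinear: "hsummable f A \<Longrightarrow> hlinear g \<Longrightarrow> hsummable (\<lambda>x. g (f x)) A"
  by (erule hsummable_weaken) (rule hpow_hlinear)

lemma hsummable_add:
  assumes "hsummable f A" "hsummable g A"
  shows "hsummable (\<lambda>x. f x + g x) A"
  unfolding hsummable_def
proof
  fix K
  have "{x\<in>A. f x + g x \<notin> hpow K UNIV} \<subseteq> {x\<in>A. f x \<notin> hpow K UNIV} \<union> {x\<in>A. g x \<notin> hpow K UNIV}"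
    by (auto intro: hpow_add)
  then show "finite {x\<in>A. f x + g x \<notin> hpow K UNIV}"
    by (rule finite_subset) (use assms in \<open>simp add: hsummable_def\<close>)
qed

lemma hsummable_reindex:
  assumes "inj_on h A"
  shows "hsummable f (h ` A) \<longleftrightarrow> hsummable (\<lambda>x. f (h x)) A"
proof -
  have "{x \<in> h ` A. f x \<notin> hpow K UNIV} = h ` {x \<in> A. f (h x) \<notin> hpow K UNIV}" for K
    by auto
  moreover have "inj_on h {x \<in> A. f (h x) \<notin> hpow K UNIV}" for K
    using assms by (rule inj_on_subset) auto
  ultimately show ?thesis
    unfolding hsummable_def by (simp add: finite_image_iff)
qed

text \<open>No convergence is assumed: \<open>has_hsum\<close> depends only on finite partial sums,
  so the two definite descriptions coincide even for divergent families.\<close>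

lemma hsum_cong: "(\<And>x. x \<in> A \<Longrightarrow> f x = g x) \<Longrightarrow> hsum f A = hsum g A"
proof -
  assume *: "\<And>x. x \<in> A \<Longrightarrow> f x = g x"
  have eq: "sum f F = sum g F" if "F \<subseteq> A" for F
    using that * by (auto intro: sum.cong)
  have "has_hsum f A s = has_hsum g A s" for s
    unfolding has_hsum_def by (simp add: eq cong: conj_cong imp_cong)
  then show ?thesis by (simp add: hsum_def)
qed

lemma hsums_reindex:
  assumes "inj_on h A"
  shows "hsums f (h ` A) s \<longleftrightarrow> hsums (\<lambda>x. f (h x)) A s"
proof
  assume *: "hsums f (h ` A) s"
  show "hsums (\<lambda>x. f (h x)) A s"
    unfolding hsums_def
  proof
    fix K
    obtain F where F: "finite F" "F \<subseteq> h ` A" "\<forall>x\<in>h ` A - F. f x \<in> hpow K UNIV"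
      "s - sum f F \<in> hpow K UNIV"
      using * by (rule hsumsE)
    obtain G where G: "G \<subseteq> A" "finite G" "F = h ` G"
      using finite_subset_image[OF F(1,2)] by blast
    have "sum f F = sum (\<lambda>x. f (h x)) G"
      using sum.reindex[OF inj_on_subset[OF assms G(1)], of f] G(3) by simp
    moreover have "f (h x) \<in> hpow K UNIV" if "x \<in> A - G" for x
    proof -
      have "h x \<notin> F"
        using that G inj_on_image_mem_iff[OF assms, of x G] by blast
      then show ?thesis using F(3) that by blast
    qed
    ultimately show "\<exists>F. finite F \<and> F \<subseteq> A \<and> (\<forall>x\<in>A - F. f (h x) \<in> hpow K UNIV) \<and>
        s - (\<Sum>x\<in>F. f (h x)) \<in> hpow K UNIV"
      using F(4) G(1,2) by (intro exI[of _ G]) simp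
  qed
next
  assume *: "hsums (\<lambda>x. f (h x)) A s"
  show "hsums f (h ` A) s"
    unfolding hsums_def
  proof
    fix K
    obtain F where F: "finite F" "F \<subseteq> A" "\<forall>x\<in>A - F. f (h x) \<in> hpow K UNIV"
      "s - sum (\<lambda>x. f (h x)) F \<in> hpow K UNIV"
      using * by (rule hsumsE)
    have "sum f (h ` F) = sum (\<lambda>x. f (h x)) F"
      using sum.reindex[OF inj_on_subset[OF assms F(2)], of f] by simp
    then show "\<exists>F. finite F \<and> F \<subseteq> h ` A \<and> (\<forall>x\<in>h ` A - F. f x \<in> hpow K UNIV) \<and>
        s - sum f F \<in> hpow K UNIV"
      using F(3,4) finite_imageI[OF F(1), of h] image_mono[OF F(2), of h]
      by (intro exI[of _ "h ` F"]) (simp add: image_iff, blast)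
  qed
qed

section \<open>Calculus of convergent sums: linearity, reindexing, Fubini\<close>

context
  assumes hc: "hcs TYPE('a::hmodule)"
begin

lemma hsum_approx:
  fixes f :: "'i \<Rightarrow> 'a"
  assumes "hsummable f A" "finite F" "F \<subseteq> A" "\<And>x. x \<in> A - F \<Longrightarrow> f x \<in> hpow K UNIV"
  shows "hsum f A - sum f F \<in> hpow K UNIV"
proof -
  obtain G where G: "finite G" "G \<subseteq> A" "\<forall>x\<in>A - G. f x \<in> hpow K UNIV"
    "hsum f A - sum f G \<in> hpow K UNIV"
    using hsummable_hsums[OF hc assms(1)] by (rule hsumsE)
  have "sum f F - sum f G \<in> hpow K UNIV"
    using assms G by (intro sum_hpow_cong) auto
  then show ?thesis
    using hpow_diff[OF G(4)] by fastforce
qed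

lemma hsum_in_hpow:
  fixes f :: "'i \<Rightarrow> 'a"
  assumes "hsummable f A" "\<And>x. x \<in> A \<Longrightarrow> f x \<in> hpow K UNIV"
  shows "hsum f A \<in> hpow K UNIV"
  using hsum_approx[of f A "{}" K] assms by simp

lemma hsum_finite:
  fixes f :: "'i \<Rightarrow> 'a"
  shows "finite A \<Longrightarrow> hsum f A = sum f A"
  by (intro hsum_eqI[OF hc]) (simp add: hsums_def exI[of _ A])

text \<open>A module map carries h^K into h^K, hence a good finite approximation of the sum to a
  good one.\<close>

lemma hsum_hlinear:
  fixes f :: "'i \<Rightarrow> 'b::hmodule" and g :: "'b \<Rightarrow> 'a"
  assumes hb: "hcs TYPE('b)" and "hsummable f A" "hlinear g"
  shows "g (hsum f A) = hsum (\<lambda>x. g (f x)) A"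
proof -
  have "hsums (\<lambda>x. g (f x)) A (g (hsum f A))"
    unfolding hsums_def
  proof
    fix K
    obtain G where G: "finite G" "G \<subseteq> A" "\<forall>x\<in>A - G. f x \<in> hpow K UNIV"
      "hsum f A - sum f G \<in> hpow K UNIV"
      using hsummable_hsums[OF hb assms(2)] by (rule hsumsE)
    have "g (hsum f A) - (\<Sum>x\<in>G. g (f x)) = g (hsum f A - sum f G)"
      using assms(3) by (simp add: hlinear_diff hlinear_sum)
    then show "\<exists>F. finite F \<and> F \<subseteq> A \<and> (\<forall>x\<in>A - F. g (f x) \<in> hpow K UNIV) \<and>
        g (hsum f A) - (\<Sum>x\<in>F. g (f x)) \<in> hpow K UNIV"
      using G assms(3) by (intro exI[of _ G]) (auto intro: hpow_hlinear)
  qed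
  then show ?thesis
    using hsum_eqI[OF hc] by metis
qed

lemma hsum_add:
  fixes f g :: "'i \<Rightarrow> 'a"
  assumes "hsummable f A" "hsummable g A"
  shows "hsum (\<lambda>x. f x + g x) A = hsum f A + hsum g A"
proof (rule hsum_eqI[OF hc], unfold hsums_def, rule allI)
  fix K
  define F where "F = {x\<in>A. f x \<notin> hpow K UNIV} \<union> {x\<in>A. g x \<notin> hpow K UNIV}"
  have F: "finite F" "F \<subseteq> A"
    using assms by (auto simp: F_def hsummable_def)
  have "hsum f A - sum f F \<in> hpow K UNIV" "hsum g A - sum g F \<in> hpow K UNIV"
    using F assms by (auto intro!: hsum_approx simp: F_def)
  from hpow_add[OF this]
  have "hsum f A + hsum g A - (\<Sum>x\<in>F. f x + g x) \<in> hpow K UNIV"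
    by (simp add: sum.distrib algebra_simps)
  then show "\<exists>F. finite F \<and> F \<subseteq> A \<and> (\<forall>x\<in>A - F. f x + g x \<in> hpow K UNIV) \<and>
      hsum f A + hsum g A - (\<Sum>x\<in>F. f x + g x) \<in> hpow K UNIV"
    using F by (intro exI[of _ F]) (auto simp: F_def intro: hpow_add)
qed

lemma hsum_scale:
  fixes f :: "'i \<Rightarrow> 'a"
  shows "hsummable f A \<Longrightarrow> hsum (\<lambda>x. c *\<^sub>h f x) A = c *\<^sub>h hsum f A"
  using hsum_hlinear[OF hc, of f A "\<lambda>x. c *\<^sub>h x"] by (simp add: hlinear_intros)

lemma hsum_uminus:
  fixes f :: "'i \<Rightarrow> 'a"
  shows "hsummable f A \<Longrightarrow> hsum (\<lambda>x. - f x) A = - hsum f A"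
  using hsum_hlinear[OF hc, of f A "\<lambda>x. - x"] by (simp add: hlinear_intros)

lemma hsum_sum:
  fixes f :: "'j \<Rightarrow> 'i \<Rightarrow> 'a"
  assumes "finite J" "\<And>j. j \<in> J \<Longrightarrow> hsummable (f j) A"
  shows "hsum (\<lambda>x. \<Sum>j\<in>J. f j x) A = (\<Sum>j\<in>J. hsum (f j) A)"
    and "hsummable (\<lambda>x. \<Sum>j\<in>J. f j x) A"
proof -
  have "hsum (\<lambda>x. \<Sum>j\<in>J. f j x) A = (\<Sum>j\<in>J. hsum (f j) A) \<and> hsummable (\<lambda>x. \<Sum>j\<in>J. f j x) A"
    using assms
  proof (induction J)
    case empty
    have "hsums (\<lambda>x. 0 :: 'a) A 0"
      by (simp add: hsums_def exI[of _ "{}"])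
    then show ?case
      by (simp add: hsum_eqI[OF hc] hsummable_def)
  next
    case (insert j J)
    then show ?case
      by (simp add: hsum_add hsummable_add)
  qed
  then show "hsum (\<lambda>x. \<Sum>j\<in>J. f j x) A = (\<Sum>j\<in>J. hsum (f j) A)"
    and "hsummable (\<lambda>x. \<Sum>j\<in>J. f j x) A" by auto
qed

lemma hsum_reindex:
  fixes f :: "'i \<Rightarrow> 'a"
  assumes "inj_on h A" "hsummable f (h ` A)"
  shows "hsum f (h ` A) = hsum (\<lambda>x. f (h x)) A"
  using hsum_eqI[OF hc] hsummable_hsums[OF hc assms(2)] hsums_reindex[OF assms(1)] by metis

lemma hsum_bij:
  fixes f :: "'i \<Rightarrow> 'a"
  assumes "bij_betw h A B" "hsummable (\<lambda>x. f (h x)) A"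
  shows "hsum f B = hsum (\<lambda>x. f (h x)) A"
  using hsum_reindex[of h A f] assms hsummable_reindex[of h A f]
  by (auto simp: bij_betw_def)

lemma hsum_neutral:
  fixes f :: "'i \<Rightarrow> 'a"
  assumes "A \<subseteq> B" "\<And>x. x \<in> B - A \<Longrightarrow> f x = 0" "hsummable f A"
  shows "hsum f B = hsum f A" "hsummable f B"
proof -
  have eq: "{x\<in>B. f x \<notin> hpow K UNIV} = {x\<in>A. f x \<notin> hpow K UNIV}" for K
    using assms(1,2) by (metis (lifting) DiffI Collect_cong hpow_zero subset_iff)
  have "hsums f B (hsum f A)"
    unfolding hsums_def
  proof
    fix K
    obtain G where G: "finite G" "G \<subseteq> A" "\<forall>x\<in>A - G. f x \<in> hpow K UNIV"
      "hsum f A - sum f G \<in> hpow K UNIV"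
      using hsummable_hsums[OF hc assms(3)] by (rule hsumsE)
    moreover have "f x \<in> hpow K UNIV" if "x \<in> B - G" for x
      using that G assms(2) by (metis DiffI Diff_iff hpow_zero)
    ultimately show "\<exists>F. finite F \<and> F \<subseteq> B \<and> (\<forall>x\<in>B - F. f x \<in> hpow K UNIV) \<and>
        hsum f A - sum f F \<in> hpow K UNIV"
      using assms(1) by (intro exI[of _ G]) auto
  qed
  then show "hsum f B = hsum f A" "hsummable f B"
    using hsum_eqI[OF hc] hsums_summable by metis+
qed

lemma hsum_single:
  fixes f :: "'i \<Rightarrow> 'a"
  assumes "x \<in> A" "\<And>y. y \<in> A \<Longrightarrow> y \<noteq> x \<Longrightarrow> f y = 0"
  shows "hsum f A = f x"
  using hsum_neutral(1)[of "{x}" A f] assms hsum_finite[of "{x}" f] by auto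

lemma hsum_0 [simp]: "hsum (\<lambda>x. 0::'a) A = 0"
  using hsum_neutral(1)[of "{}" A "\<lambda>x. 0"] hsum_finite[of "{}"] by simp

text \<open>An inner sum outside h^K must contain a term outside h^K, so the bad rows are first
  components of the finitely many bad pairs.\<close>

lemma hsummable_SigmaD:
  fixes f :: "'i \<times> 'j \<Rightarrow> 'a"
  assumes "hsummable f (Sigma A B)"
  shows "x \<in> A \<Longrightarrow> hsummable (\<lambda>y. f (x, y)) (B x)"
    and "hsummable (\<lambda>x. hsum (\<lambda>y. f (x, y)) (B x)) A"
proof -
  show *: "hsummable (\<lambda>y. f (x, y)) (B x)" if "x \<in> A" for x
    using hsummable_reindex[of "Pair x" "B x" f] hsummable_subset[OF assms, of "Pair x ` B x"] that
    by (auto simp: inj_on_def)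
  show "hsummable (\<lambda>x. hsum (\<lambda>y. f (x, y)) (B x)) A"
    unfolding hsummable_def
  proof
    fix K
    have "{x\<in>A. hsum (\<lambda>y. f (x, y)) (B x) \<notin> hpow K UNIV} \<subseteq> fst ` {p\<in>Sigma A B. f p \<notin> hpow K UNIV}"
    proof clarify
      fix x assume x: "x \<in> A" "hsum (\<lambda>y. f (x, y)) (B x) \<notin> hpow K UNIV"
      then obtain y where "y \<in> B x" "f (x, y) \<notin> hpow K UNIV"
        using hsum_in_hpow[OF *[OF x(1)]] by blast
      then show "x \<in> fst ` {p\<in>Sigma A B. f p \<notin> hpow K UNIV}"
        using x(1) by force
    qed
    then show "finite {x\<in>A. hsum (\<lambda>y. f (x, y)) (B x) \<notin> hpow K UNIV}"
      by (rule finite_subset) (use assms in \<open>simp add: hsummable_def\<close>)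
  qed
qed

text \<open>Fubini. The bad set of the double family is itself a dependent product, of the bad rows
  and of the bad entries in each of them; off it everything lies in h^K.\<close>

lemma hsum_Sigma:
  fixes f :: "'i \<times> 'j \<Rightarrow> 'a"
  assumes "hsummable f (Sigma A B)"
  shows "hsum f (Sigma A B) = hsum (\<lambda>x. hsum (\<lambda>y. f (x, y)) (B x)) A"
proof (rule sym, rule hsum_eqI[OF hc], unfold hsums_def, rule allI)
  fix K
  define F where "F = {p\<in>Sigma A B. f p \<notin> hpow K UNIV}"
  have fin: "finite F"
    using assms by (simp add: F_def hsummable_def)
  define F1 where "F1 = fst ` F"
  define F2 where "F2 x = {y \<in> B x. f (x, y) \<notin> hpow K UNIV}" for x
  have F1: "finite F1" "F1 \<subseteq> A"
    using fin by (auto simp: F1_def F_def)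
  have F2: "finite (F2 x)" "F2 x \<subseteq> B x" if "x \<in> A" for x
    using hsummable_SigmaD(1)[OF assms that] by (auto simp: F2_def hsummable_def)
  have F: "F = Sigma F1 F2"
    by (force simp: F_def F1_def F2_def)
  have "hsum (\<lambda>y. f (x, y)) (B x) - (\<Sum>y\<in>F2 x. f (x, y)) \<in> hpow K UNIV" if "x \<in> F1" for x
    using that F1 F2 hsummable_SigmaD(1)[OF assms, of x]
    by (intro hsum_approx) (auto simp: F2_def)
  then have "(\<Sum>x\<in>F1. hsum (\<lambda>y. f (x, y)) (B x) - (\<Sum>y\<in>F2 x. f (x, y))) \<in> hpow K UNIV"
    by (rule hpow_sum)
  moreover have "(\<Sum>x\<in>F1. \<Sum>y\<in>F2 x. f (x, y)) = sum f F"
    using F1 F2 unfolding F by (subst sum.Sigma) auto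
  ultimately have 1: "(\<Sum>x\<in>F1. hsum (\<lambda>y. f (x, y)) (B x)) - sum f F \<in> hpow K UNIV"
    by (simp add: sum_subtractf)
  have 2: "hsum f (Sigma A B) - sum f F \<in> hpow K UNIV"
    using fin assms by (intro hsum_approx) (auto simp: F_def)
  have "hsum f (Sigma A B) - (\<Sum>x\<in>F1. hsum (\<lambda>y. f (x, y)) (B x)) \<in> hpow K UNIV"
    using hpow_diff[OF 2 1] by simp
  moreover have "hsum (\<lambda>y. f (x, y)) (B x) \<in> hpow K UNIV" if "x \<in> A - F1" for x
    using that hsummable_SigmaD(1)[OF assms, of x]
    by (intro hsum_in_hpow) (force simp: F1_def F_def)+
  ultimately show "\<exists>F. finite F \<and> F \<subseteq> A \<and> (\<forall>x\<in>A - F. hsum (\<lambda>y. f (x, y)) (B x) \<in> hpow K UNIV) \<and>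
      hsum f (Sigma A B) - (\<Sum>x\<in>F. hsum (\<lambda>y. f (x, y)) (B x)) \<in> hpow K UNIV"
    using F1 by (intro exI[of _ F1]) auto
qed

lemma hsummable_swap:
  fixes f :: "'i \<Rightarrow> 'j \<Rightarrow> 'a"
  shows "hsummable (\<lambda>(x, y). f x y) (A \<times> B) \<longleftrightarrow> hsummable (\<lambda>(y, x). f x y) (B \<times> A)"
  using hsummable_reindex[of prod.swap "B \<times> A" "\<lambda>(x, y). f x y"]
  by (simp add: product_swap case_prod_unfold)

lemma hsum_swap:
  fixes f :: "'i \<Rightarrow> 'j \<Rightarrow> 'a"
  assumes "hsummable (\<lambda>(x, y). f x y) (A \<times> B)"
  shows "hsum (\<lambda>x. hsum (\<lambda>y. f x y) B) A = hsum (\<lambda>y. hsum (\<lambda>x. f x y) A) B"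
proof -
  have 1: "hsummable (\<lambda>(y, x). f x y) (B \<times> A)"
    using assms hsummable_swap by metis
  have "hsum (\<lambda>(x, y). f x y) (prod.swap ` (B \<times> A)) = hsum (\<lambda>(y, x). f x y) (B \<times> A)"
    using assms by (subst hsum_reindex) (auto simp: product_swap case_prod_unfold)
  then show ?thesis
    using hsum_Sigma[OF assms] hsum_Sigma[OF 1] by (simp add: product_swap)
qed

end

text \<open>The usual way to joint summability: all but finitely many rows are uniformly small, and
  each single row converges.\<close>

lemma hsummable_SigmaI:
  fixes f :: "'i \<times> 'j \<Rightarrow> 'a::hmodule"
  assumes "\<And>K. \<exists>F. finite F \<and> (\<forall>x\<in>A - F. \<forall>y\<in>B x. f (x, y) \<in> hpow K UNIV)"
    and "\<And>x. x \<in> A \<Longrightarrow> hsummable (\<lambda>y. f (x, y)) (B x)"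
  shows "hsummable f (Sigma A B)"
proof (rule hsummableI)
  fix K
  obtain F where F: "finite F" "\<forall>x\<in>A - F. \<forall>y\<in>B x. f (x, y) \<in> hpow K UNIV"
    using assms(1) by blast
  let ?G = "Sigma (F \<inter> A) (\<lambda>x. {y \<in> B x. f (x, y) \<notin> hpow K UNIV})"
  have "finite ?G"
    using F(1) assms(2) by (auto simp: hsummable_def)
  moreover have "\<forall>p\<in>Sigma A B - ?G. f p \<in> hpow K UNIV"
    using F(2) by auto
  ultimately show "\<exists>F. finite F \<and> (\<forall>p\<in>Sigma A B - F. f p \<in> hpow K UNIV)" by blast
qed

section \<open>Modules topologically generated by a set\<close>

text \<open>Generation modulo h. Iterating the decomposition expands every element as an h-adic
  series over the span of B, so this amounts to topological generation.\<close>

definition hgen :: "'a::hmodule set \<Rightarrow> bool"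
  where "hgen B \<longleftrightarrow> (\<forall>a. \<exists>b\<in>hmod.span B. \<exists>a'. a = b + fps_X *\<^sub>h a')"

lemma hgen_expand:
  assumes "hgen B"
  obtains b where "\<And>k. b k \<in> hmod.span B"
    "\<And>n. a - (\<Sum>k<n. fps_X ^ k *\<^sub>h b k) \<in> hpow n UNIV"
proof -
  obtain p q where pq: "\<And>a. p a \<in> hmod.span B" "\<And>a. a = p a + fps_X *\<^sub>h q a"
    using assms unfolding hgen_def by metis
  have "a = (\<Sum>k<n. fps_X ^ k *\<^sub>h p ((q ^^ k) a)) + fps_X ^ n *\<^sub>h (q ^^ n) a" for n
  proof (induction n)
    case 0
    then show ?case by (simp add: hscale_one)
  next
    case (Suc n)
    have "fps_X ^ n *\<^sub>h (q ^^ n) a =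
        fps_X ^ n *\<^sub>h p ((q ^^ n) a) + fps_X ^ Suc n *\<^sub>h (q ^^ Suc n) a"
      using arg_cong[OF pq(2)[of "(q ^^ n) a"], of "hscale (fps_X ^ n)"]
      by (simp only: funpow.simps(2) o_apply hscale_add_right hscale_hscale power_Suc2)
    then show ?case
      using Suc by (simp add: add.assoc)
  qed
  then have "a - (\<Sum>k<n. fps_X ^ k *\<^sub>h p ((q ^^ k) a)) = fps_X ^ n *\<^sub>h (q ^^ n) a" for n
    by (simp add: diff_eq_eq add.commute)
  then have "a - (\<Sum>k<n. fps_X ^ k *\<^sub>h p ((q ^^ k) a)) \<in> hpow n UNIV" for n
    by (simp only: in_hpowI)
  then show ?thesis
    using that[of "\<lambda>k. p ((q ^^ k) a)"] pq(1) by blast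
qed

lemma hgen_approx:
  assumes "hgen B"
  shows "\<exists>b\<in>hmod.span B. a - b \<in> hpow n UNIV"
proof -
  obtain b where b: "\<And>k. b k \<in> hmod.span B" "\<And>n. a - (\<Sum>k<n. fps_X ^ k *\<^sub>h b k) \<in> hpow n UNIV"
    using hgen_expand[OF assms, of a] by blast
  have "(\<Sum>k<n. fps_X ^ k *\<^sub>h b k) \<in> hmod.span B"
    using b(1) by (intro hmod.span_sum hmod.span_scale)
  then show ?thesis using b(2) by blast
qed

text \<open>A property read modulo h^n passes from B to everything without a limit, since a finite
  combination of elements of B agrees with a modulo h^n.\<close>

lemma hgen_induct_hpow:
  assumes B: "hgen B" and P: "hmod.subspace {x. P x}" "\<And>x. x \<in> B \<Longrightarrow> P x" "\<And>x. x \<in> hpow n UNIV \<Longrightarrow> P x"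
  shows "P a"
proof -
  obtain b where b: "b \<in> hmod.span B" "a - b \<in> hpow n UNIV"
    using hgen_approx[OF B] by blast
  have "P b"
    using hmod.span_minimal[OF _ P(1)] P(2) b(1) by blast
  then show ?thesis
    using hmod.subspace_add[OF P(1), of b "a - b"] P(3)[OF b(2)] by simp
qed

lemma hlinear_eqI:
  fixes f g :: "'a::hmodule \<Rightarrow> 'b::hmodule"
  assumes "hcs TYPE('b)" "hgen B" "hlinear f" "hlinear g" "\<And>x. x \<in> B \<Longrightarrow> f x = g x"
  shows "f = g"
proof
  fix x
  have "f x - g x \<in> hpow k UNIV" for k
  proof (rule hgen_induct_hpow[OF assms(2), of _ k])
    have "hlinear (\<lambda>x. f x - g x)"
      using assms by (intro hlinear_intros)
    then show "hmod.subspace {x. f x - g x \<in> hpow k UNIV}"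
      unfolding hmod.subspace_def
      by (auto simp: hlinear_0 assms(3,4) hlinear_scale hlinear_add add_diff_add
          simp flip: hmod.scale_right_diff_distrib intro: hpow_add hpow_scale)
    show "f x - g x \<in> hpow k UNIV" if "x \<in> B" for x
      using assms(5)[OF that] by simp
    show "f x - g x \<in> hpow k UNIV" if "x \<in> hpow k UNIV" for x
      using that by (intro hpow_diff hpow_hlinear[OF assms(3)] hpow_hlinear[OF assms(4)])
  qed
  then show "f x = g x"
    by (rule hcs_eqI[OF assms(1)])
qed

text \<open>For fixed K the elements with finitely many exceptional indices form a submodule that
  contains h^K, so a test on generators suffices, without uniformity over them.\<close>

lemma hlinear_finite_exceptions:
  fixes f :: "'i \<Rightarrow> 'a::hmodule \<Rightarrow> 'b::hmodule"
  assumes "hgen B" "\<And>i. hlinear (f i)" "\<And>x. x \<in> B \<Longrightarrow> hsummable (\<lambda>i. f i x) A"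
  shows "hsummable (\<lambda>i. f i x) A"
  unfolding hsummable_def
proof
  fix K
  show "finite {i \<in> A. f i x \<notin> hpow K UNIV}"
  proof (rule hgen_induct_hpow[OF assms(1), of _ K])
    show "hmod.subspace {x. finite {i \<in> A. f i x \<notin> hpow K UNIV}}"
    proof (rule hmod.subspaceI; clarsimp simp: assms(2) hlinear_0)
      fix x y assume *: "finite {i \<in> A. f i x \<notin> hpow K UNIV}" "finite {i \<in> A. f i y \<notin> hpow K UNIV}"
      show "finite {i \<in> A. f i (x + y) \<notin> hpow K UNIV}"
        by (rule finite_subset[OF _ finite_UnI[OF *]]) (auto simp: hlinear_add assms(2) intro: hpow_add)
    next
      fix c x assume *: "finite {i \<in> A. f i x \<notin> hpow K UNIV}"
      show "finite {i \<in> A. f i (c *\<^sub>h x) \<notin> hpow K UNIV}"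
        by (rule finite_subset[OF _ *]) (auto simp: hlinear_scale assms(2) intro: hpow_scale)
    qed
    show "finite {i \<in> A. f i x \<notin> hpow K UNIV}" if "x \<in> B" for x
      using assms(3)[OF that] by (simp add: hsummable_def)
    show "finite {i \<in> A. f i x \<notin> hpow K UNIV}" if "x \<in> hpow K UNIV" for x
      using that assms(2) by (simp add: hpow_hlinear)
  qed
qed

text \<open>U is complete for its own filtration h^k U, which may be finer than the induced one. The
  image under f of an expansion of a over the span of B has its k-th increment in h^k U, hence
  converges inside U; separatedness of the ambient module identifies the limit with
  \<open>f a\<close>.\<close>

lemma hlinear_in_closed:
  fixes f :: "'a::hmodule \<Rightarrow> 'b::hmodule"
  assumes hb: "hcs TYPE('b)" and B: "hgen B" and f: "hlinear f"
    and U: "hmod.subspace U" "hcomplete U" and BU: "\<And>x. x \<in> B \<Longrightarrow> f x \<in> U"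
  shows "f a \<in> U"
proof -
  have span: "f b \<in> U" if "b \<in> hmod.span B" for b
  proof -
    have "hmod.subspace {x. f x \<in> U}"
      using U(1) by (intro hmod.subspaceI)
        (auto simp: f hlinear_0 hlinear_add hlinear_scale hmod.subspace_0 hmod.subspace_add hmod.subspace_scale)
    then show ?thesis
      using hmod.span_minimal[of B "{x. f x \<in> U}"] BU that by blast
  qed
  obtain b where b: "\<And>k. b k \<in> hmod.span B" "\<And>n. a - (\<Sum>k<n. fps_X ^ k *\<^sub>h b k) \<in> hpow n UNIV"
    using hgen_expand[OF B, of a] by blast
  define s where "s n = (\<Sum>k<n. fps_X ^ k *\<^sub>h f (b k))" for n
  have sU: "s n \<in> U" for n
    unfolding s_def by (intro hmod.subspace_sum[OF U(1)] hmod.subspace_scale[OF U(1)] span b(1))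
  have inc: "s m - s k \<in> hpow k U" if "k \<le> m" for k m
  proof -
    have "s m = s k + (\<Sum>j\<in>{k..<m}. fps_X ^ j *\<^sub>h f (b j))"
      unfolding s_def using that
      by (subst sum.union_disjoint[symmetric]) (auto intro!: sum.cong)
    then have eq: "s m - s k = (\<Sum>j\<in>{k..<m}. fps_X ^ j *\<^sub>h f (b j))"
      by simp
    have "fps_X ^ j *\<^sub>h f (b j) \<in> hpow k U" if "j \<in> {k..<m}" for j
    proof -
      have "fps_X ^ j *\<^sub>h f (b j) = fps_X ^ k *\<^sub>h (fps_X ^ (j - k) *\<^sub>h f (b j))"
        using that by (simp add: hscale_hscale flip: power_add)
      moreover have "fps_X ^ (j - k) *\<^sub>h f (b j) \<in> U"
        by (intro hmod.subspace_scale[OF U(1)] span b(1))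
      ultimately show ?thesis
        unfolding in_hpow by blast
    qed
    then show ?thesis
      unfolding eq by (rule hmod.subspace_sum[OF hpow_subspace[OF U(1)]])
  qed
  have "s m - s n \<in> hpow k U" if "k \<le> m" "k \<le> n" for k m n
    using hmod.subspace_diff[OF hpow_subspace[OF U(1)] inc[OF that(1)] inc[OF that(2)]] by simp
  then have *: "(\<forall>n. s n \<in> U) \<and> (\<forall>k. \<exists>M. \<forall>m\<ge>M. \<forall>n\<ge>M. s m - s n \<in> hpow k U)"
    using sU by blast
  obtain l where l: "l \<in> U" "\<And>k. \<exists>M. \<forall>n\<ge>M. s n - l \<in> hpow k U"
    using U(2)[unfolded hcomplete_def, rule_format, OF *] by blast
  have "f a = l"
  proof (rule hcs_eqI[OF hb])
    fix k
    obtain M where M: "\<And>n. n \<ge> M \<Longrightarrow> s n - l \<in> hpow k U"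
      using l(2) by blast
    have 1: "s (max M k) - l \<in> hpow k UNIV"
      by (rule hpow_UNIV_I[OF M]) simp
    have "f a - s (max M k) = f (a - (\<Sum>j<max M k. fps_X ^ j *\<^sub>h b j))"
      unfolding s_def using f by (simp add: hlinear_diff hlinear_sum hlinear_scale)
    then have "f a - s (max M k) \<in> hpow (max M k) UNIV"
      by (simp only: hpow_hlinear[OF f b(2)])
    then have "f a - s (max M k) \<in> hpow k UNIV"
      by (rule hpow_mono[rotated]) simp
    from hpow_add[OF this 1] show "f a - l \<in> hpow k UNIV" by simp
  qed
  with l show ?thesis by simp
qed

lemma hlinear_hsum:
  fixes f :: "'i \<Rightarrow> 'a::hmodule \<Rightarrow> 'b::hmodule"
  assumes "hcs TYPE('b)" "\<And>i. i \<in> A \<Longrightarrow> hlinear (f i)" "\<And>x. hsummable (\<lambda>i. f i x) A"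
  shows "hlinear (\<lambda>x. hsum (\<lambda>i. f i x) A)"
proof (rule hlinearI)
  fix x y c
  have "hsum (\<lambda>i. f i (x + y)) A = hsum (\<lambda>i. f i x + f i y) A"
    by (rule hsum_cong) (simp add: hlinear_add assms)
  then show "hsum (\<lambda>i. f i (x + y)) A = hsum (\<lambda>i. f i x) A + hsum (\<lambda>i. f i y) A"
    by (simp add: hsum_add assms)
  have "hsum (\<lambda>i. f i (c *\<^sub>h x)) A = hsum (\<lambda>i. c *\<^sub>h f i x) A"
    by (rule hsum_cong) (simp add: hlinear_scale assms)
  then show "hsum (\<lambda>i. f i (c *\<^sub>h x)) A = c *\<^sub>h hsum (\<lambda>i. f i x) A"
    by (simp add: hsum_scale assms)
qed

section \<open>The completed tensor product\<close>

text \<open>An element of the free module, placed at h^0. Every tensor is an h-adic series in such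
  elements.\<close>

definition ct_pure :: "('a::hmodule \<times> 'b::hmodule \<Rightarrow>\<^sub>0 complex fps) \<Rightarrow> ('a, 'b) ctensor"
  where "ct_pure p = abs_ctensor (\<lambda>k. if k = 0 then p else 0)"

lemma tensor_eq_ct_pure: "a \<otimes>\<^sub>h b = ct_pure (Poly_Mapping.single (a, b) 1)"
  by (simp add: tensor.abs_eq ct_pure_def)

lemma abs_ctensor_add: "abs_ctensor (\<lambda>k. s k + t k) = abs_ctensor s + abs_ctensor t"
  by (simp add: plus_ctensor.abs_eq)

lemma abs_ctensor_scale: "abs_ctensor (\<lambda>k. fm_scale f (s k)) = f *\<^sub>h abs_ctensor s"
  by (simp add: hscale_ctensor.abs_eq)

lemma ctensor_abs:
  obtains s where "x = abs_ctensor s"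
  using Quotient3_abs_rep[OF Quotient3_ctensor, of x] by metis

lemma ct_pure_add: "ct_pure (p + q) = ct_pure p + ct_pure q"
  unfolding ct_pure_def abs_ctensor_add[symmetric]
  by (rule arg_cong[of _ _ abs_ctensor]) auto

lemma ct_pure_scale: "ct_pure (fm_scale f p) = f *\<^sub>h ct_pure p"
  unfolding ct_pure_def abs_ctensor_scale[symmetric]
  by (rule arg_cong[of _ _ abs_ctensor]) auto

lemma ct_pure_0: "ct_pure 0 = 0"
  using ct_pure_scale[of 0 0] by simp

lemma ct_pure_sum: "ct_pure (sum f A) = (\<Sum>x\<in>A. ct_pure (f x))"
  by (induction A rule: infinite_finite_induct) (simp_all add: ct_pure_0 ct_pure_add)

lemma fm_single: "fm_scale c (Poly_Mapping.single x 1) = Poly_Mapping.single x c"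
  by (rule poly_mapping_eqI) (simp add: lookup_fm_scale lookup_single when_def)

lemma fm_expand:
  "finite S \<Longrightarrow> Poly_Mapping.keys p \<subseteq> S \<Longrightarrow>
    p = (\<Sum>x\<in>S. fm_scale (Poly_Mapping.lookup p x) (Poly_Mapping.single x 1))"
  by (rule poly_mapping_eqI)
    (auto simp: fm_single lookup_sum lookup_single when_def in_keys_iff)

lemma ct_pure_eq:
  "ct_pure p = (\<Sum>(a, b)\<in>Poly_Mapping.keys p. Poly_Mapping.lookup p (a, b) *\<^sub>h (a \<otimes>\<^sub>h b))"
proof -
  have "ct_pure p = ct_pure (\<Sum>x\<in>Poly_Mapping.keys p. fm_scale (Poly_Mapping.lookup p x) (Poly_Mapping.single x 1))"
    using fm_expand[of "Poly_Mapping.keys p" p] by simp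
  then show ?thesis
    by (simp add: ct_pure_sum ct_pure_scale tensor_eq_ct_pure case_prod_unfold)
qed

lemma tensor_null_relI: "q \<in> fm.span tensor_relations \<Longrightarrow> q \<in> tensor_null n"
  unfolding tensor_null_def
  by (rule CollectI, rule exI[of _ 0], rule exI[of _ q]) simp

lemma tensor_null_scaleI: "fm_scale (fps_X ^ n) p \<in> tensor_null n"
  unfolding tensor_null_def using fm.span_zero[of tensor_relations]
  by (metis (mono_tags, lifting) add_0 mem_Collect_eq)

lemma tensor_null_0: "p \<in> tensor_null 0"
  using tensor_null_scaleI[of 0 p] by simp

lemma ct_pure_relation:
  assumes "p - q \<in> fm.span tensor_relations"
  shows "ct_pure p = ct_pure q"
proof -
  have "(\<Sum>k<n. fm_scale (fps_X ^ k) ((if k = 0 then p else 0) - (if k = 0 then q else 0))) \<in> tensor_null n" for n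
  proof (cases n)
    case (Suc m)
    then have "(\<Sum>k<n. fm_scale (fps_X ^ k) ((if k = 0 then p else 0) - (if k = 0 then q else 0))) =
        (\<Sum>k\<in>{0}. fm_scale (fps_X ^ k) ((if k = 0 then p else 0) - (if k = 0 then q else 0)))"
      by (intro sum.mono_neutral_right) auto
    then show ?thesis
      using assms by (simp add: tensor_null_relI)
  qed (simp add: tensor_null_0)
  then show ?thesis
    unfolding ct_pure_def ctensor.abs_eq_iff by (simp add: ctensor_rel_def)
qed

lemma tensor_add_left: "(a + a') \<otimes>\<^sub>h b = a \<otimes>\<^sub>h b + a' \<otimes>\<^sub>h b"
proof -
  have "Poly_Mapping.single (a + a', b) 1 - Poly_Mapping.single (a, b) 1
       - Poly_Mapping.single (a', b) 1 \<in> fm.span tensor_relations"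
    unfolding tensor_relations_def by (rule fm.span_base) blast
  then show ?thesis
    unfolding tensor_eq_ct_pure ct_pure_add[symmetric]
    by (intro ct_pure_relation) (simp add: diff_diff_eq)
qed

lemma tensor_add_right: "a \<otimes>\<^sub>h (b + b') = a \<otimes>\<^sub>h b + a \<otimes>\<^sub>h b'"
proof -
  have "Poly_Mapping.single (a, b + b') 1 - Poly_Mapping.single (a, b) 1
       - Poly_Mapping.single (a, b') 1 \<in> fm.span tensor_relations"
    unfolding tensor_relations_def by (rule fm.span_base) blast
  then show ?thesis
    unfolding tensor_eq_ct_pure ct_pure_add[symmetric]
    by (intro ct_pure_relation) (simp add: diff_diff_eq)
qed

lemma tensor_scale_left: "(f *\<^sub>h a) \<otimes>\<^sub>h b = f *\<^sub>h (a \<otimes>\<^sub>h b)"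
  unfolding tensor_eq_ct_pure ct_pure_scale[symmetric] fm_single
  by (rule ct_pure_relation, rule fm.span_base, unfold tensor_relations_def) blast

lemma tensor_scale_right: "a \<otimes>\<^sub>h (f *\<^sub>h b) = f *\<^sub>h (a \<otimes>\<^sub>h b)"
  unfolding tensor_eq_ct_pure ct_pure_scale[symmetric] fm_single
  by (rule ct_pure_relation, rule fm.span_base, unfold tensor_relations_def) blast

lemma hbilinear_tensor: "hbilinear (\<otimes>\<^sub>h)"
  by (simp add: hbilinear_def hlinear_iff tensor_add_left tensor_add_right tensor_scale_left
      tensor_scale_right)

lemma hlinear_tensor_left: "hlinear (\<lambda>a. a \<otimes>\<^sub>h b)"
  and hlinear_tensor_right: "hlinear (\<lambda>b. a \<otimes>\<^sub>h b)"
  using hbilinear_tensor by (auto simp: hbilinear_def)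

text \<open>Splits off the first term of an h-adic series. The difference of the two representing
  sequences telescopes: its partial sum of length n is a single multiple of h^n, hence null.\<close>

lemma abs_ctensor_step: "abs_ctensor s = ct_pure (s 0) + fps_X *\<^sub>h abs_ctensor (\<lambda>k. s (Suc k))"
proof -
  let ?t = "\<lambda>k. (if k = 0 then s 0 else 0) + fm_scale fps_X (s (Suc k))"
  have tel: "(\<Sum>k<Suc n. fm_scale (fps_X ^ k) (s k - ?t k)) = - fm_scale (fps_X ^ Suc n) (s (Suc n))" for n
    by (induction n) (simp_all add: fm.scale_right_distrib fm.scale_right_diff_distrib mult.commute)
  have "(\<Sum>k<n. fm_scale (fps_X ^ k) (s k - ?t k)) \<in> tensor_null n" for n
  proof (cases n)
    case (Suc m)
    then show ?thesis
      using fm.subspace_neg[OF subspace_tensor_null tensor_null_scaleI] by (simp only: tel)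
  qed (simp add: tensor_null_0)
  then have "ctensor_rel s ?t"
    by (simp add: ctensor_rel_def)
  then have "abs_ctensor s = abs_ctensor ?t"
    by (simp add: ctensor.abs_eq_iff)
  also have "\<dots> = ct_pure (s 0) + fps_X *\<^sub>h abs_ctensor (\<lambda>k. s (Suc k))"
    by (simp add: abs_ctensor_add abs_ctensor_scale ct_pure_def)
  finally show ?thesis .
qed

text \<open>Separated: an element divisible by every h^n is represented by a sequence all of whose
  partial sums are null. Complete: a series of series is rearranged along diagonals, which is the
  map \<open>L\<close>.\<close>

lemma hcs_ctensor: "hcs TYPE(('a::hmodule, 'b::hmodule) ctensor)"
  unfolding hcs_def
proof
  have "x = 0" if x: "\<And>n. x \<in> hpow n UNIV" for x :: "('a, 'b) ctensor"
  proof -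
    obtain s where s: "x = abs_ctensor s"
      by (rule ctensor_abs)
    have "(\<Sum>k<n. fm_scale (fps_X ^ k) (s k - 0)) \<in> tensor_null n" for n
    proof -
      obtain t where t: "x = fps_X ^ n *\<^sub>h abs_ctensor t"
        using x[of n] unfolding in_hpow by (metis ctensor_abs)
      then have "ctensor_rel s (\<lambda>k. fm_scale (fps_X ^ n) (t k))"
        using s by (simp add: ctensor.abs_eq_iff[symmetric] abs_ctensor_scale)
      then have 1: "(\<Sum>k<n. fm_scale (fps_X ^ k) (s k - fm_scale (fps_X ^ n) (t k))) \<in> tensor_null n"
        by (simp add: ctensor_rel_def)
      have 2: "fm_scale (fps_X ^ n) (\<Sum>k<n. fm_scale (fps_X ^ k) (t k)) \<in> tensor_null n"
        by (rule tensor_null_scaleI)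
      have "(\<Sum>k<n. fm_scale (fps_X ^ k) (s k - 0)) =
          (\<Sum>k<n. fm_scale (fps_X ^ k) (s k - fm_scale (fps_X ^ n) (t k))) +
          fm_scale (fps_X ^ n) (\<Sum>k<n. fm_scale (fps_X ^ k) (t k))"
        by (simp add: fm.scale_sum_right mult.commute fm.scale_right_diff_distrib flip: sum.distrib)
      then show ?thesis
        using fm.subspace_add[OF subspace_tensor_null 1 2] by simp
    qed
    then have "ctensor_rel s (\<lambda>_. 0)"
      by (simp add: ctensor_rel_def)
    then show ?thesis
      by (simp add: s zero_ctensor.abs_eq ctensor.abs_eq_iff)
  qed
  then show "hseparated (UNIV :: ('a, 'b) ctensor set)"
    by (auto simp: hseparated_def)
  define L where "L t = abs_ctensor (\<lambda>k. \<Sum>i\<le>k. t i (k - i))"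
    for t :: "nat \<Rightarrow> nat \<Rightarrow> 'a \<times> 'b \<Rightarrow>\<^sub>0 complex fps"
  have L_step: "L t = abs_ctensor (t 0) + fps_X *\<^sub>h L (\<lambda>i. t (Suc i))" for t
  proof -
    define a where "a k = (\<Sum>i\<in>{1..k}. t i (k - i))" for k
    have 1: "(\<Sum>i\<le>k. t i (k - i)) = t 0 k + a k" for k
      unfolding a_def by (simp add: atMost_atLeast0 sum.atLeast_Suc_atMost)
    have 2: "a (Suc k) = (\<Sum>i\<le>k. t (Suc i) (k - i))" for k
      unfolding a_def by (rule sum.reindex_bij_witness[of _ Suc "\<lambda>i. i - 1"]) auto
    have "a 0 = 0"
      by (simp add: a_def)
    then have "abs_ctensor a = fps_X *\<^sub>h L (\<lambda>i. t (Suc i))"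
      using abs_ctensor_step[of a] by (simp add: L_def 2 ct_pure_0)
    then show ?thesis
      unfolding L_def 1 abs_ctensor_add by simp
  qed
  have L: "L t - (\<Sum>k<n. fps_X ^ k *\<^sub>h abs_ctensor (t k)) = fps_X ^ n *\<^sub>h L (\<lambda>i. t (n + i))" for t n
  proof (induction n)
    case 0
    then show ?case by (simp add: hscale_one)
  next
    case (Suc n)
    have "fps_X ^ n *\<^sub>h L (\<lambda>i. t (n + i)) =
        fps_X ^ n *\<^sub>h abs_ctensor (t n) + fps_X ^ Suc n *\<^sub>h L (\<lambda>i. t (Suc n + i))"
      by (subst L_step) (simp add: hscale_add_right mult.commute)
    with Suc show ?case
      by (simp add: algebra_simps)
  qed
  show "hcomplete (UNIV :: ('a, 'b) ctensor set)"
  proof (rule hcompleteI)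
    fix y :: "nat \<Rightarrow> ('a, 'b) ctensor"
    define t where "t k = rep_ctensor (y k)" for k
    have "y k = abs_ctensor (t k)" for k
      by (simp add: t_def Quotient3_abs_rep[OF Quotient3_ctensor])
    then show "\<exists>l. \<forall>n. l - (\<Sum>k<n. fps_X ^ k *\<^sub>h y k) \<in> hpow n UNIV"
      using L[of t] by (auto simp: in_hpow)
  qed
qed

text \<open>When both factors of a pure tensor are expanded modulo h, the mixed remainders carry a
  factor h. A general tensor is a finite combination of pure ones plus h times another
  tensor.\<close>

lemma hgen_tensor:
  fixes A :: "'a::hmodule set" and B :: "'b::hmodule set"
  assumes "hgen A" "hgen B"
  shows "hgen {a \<otimes>\<^sub>h b | a b. a \<in> A \<and> b \<in> B}"
  unfolding hgen_def
proof
  fix x :: "('a, 'b) ctensor"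
  let ?T = "{a \<otimes>\<^sub>h b | a b. a \<in> A \<and> b \<in> B}"
  let ?P = "\<lambda>x. \<exists>b\<in>hmod.span ?T. \<exists>a'. x = b + fps_X *\<^sub>h a'"
  have P_add: "?P (x + y)" if "?P x" "?P y" for x y
  proof -
    obtain b b' a a' where "b \<in> hmod.span ?T" "b' \<in> hmod.span ?T" "x = b + fps_X *\<^sub>h a" "y = b' + fps_X *\<^sub>h a'"
      using \<open>?P x\<close> \<open>?P y\<close> by blast
    then show ?thesis
      by (intro bexI[of _ "b + b'"] exI[of _ "a + a'"])
        (simp_all add: hscale_add_right hmod.span_add algebra_simps)
  qed
  have P_scale: "?P (c *\<^sub>h x)" if "?P x" for c x
  proof -
    obtain b a where "b \<in> hmod.span ?T" "x = b + fps_X *\<^sub>h a"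
      using \<open>?P x\<close> by blast
    then show ?thesis
      by (intro bexI[of _ "c *\<^sub>h b"] exI[of _ "c *\<^sub>h a"])
        (simp_all add: hscale_add_right hmod.span_scale mult.commute)
  qed
  have P_X: "?P (fps_X *\<^sub>h x)" for x
    by (intro bexI[of _ 0] exI[of _ x]) (simp_all add: hmod.span_zero)
  have P_span: "hmod.subspace (Collect ?P)"
  proof (rule hmod.subspaceI)
    show "0 \<in> Collect ?P"
      using P_X[of 0] by simp
  qed (use P_add P_scale in blast)+
  have "?P (a \<otimes>\<^sub>h b)" for a b
  proof -
    obtain a0 a' where a: "a0 \<in> hmod.span A" "a = a0 + fps_X *\<^sub>h a'"
      using assms(1) unfolding hgen_def by blast
    obtain b0 b' where b: "b0 \<in> hmod.span B" "b = b0 + fps_X *\<^sub>h b'"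
      using assms(2) unfolding hgen_def by blast
    have base: "?P (x \<otimes>\<^sub>h y)" if "x \<in> A" "y \<in> B" for x y
      by (intro bexI[of _ "x \<otimes>\<^sub>h y"] exI[of _ 0]) (use that in \<open>auto intro: hmod.span_base\<close>)
    have 1: "?P (x \<otimes>\<^sub>h y)" if "x \<in> A" "y \<in> hmod.span B" for x y
    proof -
      have "hmod.span B \<subseteq> {y. ?P (x \<otimes>\<^sub>h y)}"
      proof (rule hmod.span_minimal)
        show "hmod.subspace {y. ?P (x \<otimes>\<^sub>h y)}"
        proof (rule hmod.subspaceI; unfold mem_Collect_eq)
          show "?P (x \<otimes>\<^sub>h 0)"
            using P_X[of 0] by (simp add: hlinear_0[OF hlinear_tensor_right])
        qed (use P_add P_scale in \<open>simp_all only: tensor_add_right tensor_scale_right\<close>)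
      qed (use base that in blast)
      then show ?thesis using that by blast
    qed
    have 2: "?P (x \<otimes>\<^sub>h y)" if "x \<in> hmod.span A" "y \<in> hmod.span B" for x y
    proof -
      have "hmod.span A \<subseteq> {x. ?P (x \<otimes>\<^sub>h y)}"
      proof (rule hmod.span_minimal)
        show "hmod.subspace {x. ?P (x \<otimes>\<^sub>h y)}"
        proof (rule hmod.subspaceI; unfold mem_Collect_eq)
          show "?P (0 \<otimes>\<^sub>h y)"
            using P_X[of 0] by (simp add: hlinear_0[OF hlinear_tensor_left])
        qed (use P_add P_scale in \<open>simp_all only: tensor_add_left tensor_scale_left\<close>)
      qed (use 1 that in blast)
      then show ?thesis using that by blast
    qed
    have "a \<otimes>\<^sub>h b = a0 \<otimes>\<^sub>h b0 + fps_X *\<^sub>h (a' \<otimes>\<^sub>h b0 + a \<otimes>\<^sub>h b')"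
      by (simp add: a(2) b(2) tensor_add_left tensor_add_right tensor_scale_left tensor_scale_right
          hscale_add_right add_ac)
    then show ?thesis
      using P_add[OF 2[OF a(1) b(1)] P_X] by simp
  qed
  then have *: "?P (ct_pure p)" for p
    unfolding ct_pure_eq
    using hmod.subspace_sum[OF P_span, of "Poly_Mapping.keys p"
        "\<lambda>(a, b). Poly_Mapping.lookup p (a, b) *\<^sub>h (a \<otimes>\<^sub>h b)"] P_scale
    by (simp add: case_prod_unfold)
  obtain s where "x = abs_ctensor s"
    by (rule ctensor_abs)
  then show "?P x"
    using P_add[OF *[of "s 0"] P_X] abs_ctensor_step[of s] by simp
qed

lemma hgen_UNIV: "hgen UNIV"
  unfolding hgen_def by (metis UNIV_I hmod.span_base add.right_neutral hmod.scale_zero_right)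

text \<open>The linear extension \<open>F\<close> of B to the free module kills the relations, so it
  sends null elements of level n into h^n. Hence the sum of the h^k \<open>F (s k)\<close> depends
  only on the class of s.\<close>

lemma induced_exists:
  fixes B :: "'a::hmodule \<Rightarrow> 'b::hmodule \<Rightarrow> 'd::hmodule"
  assumes hc: "hcs TYPE('d)" and B: "hbilinear B"
  shows "\<exists>f. hlinear f \<and> (\<forall>a b. f (a \<otimes>\<^sub>h b) = B a b)"
proof -
  have Bl: "hlinear (\<lambda>a. B a b)" and Br: "hlinear (B a)" for a b
    using B by (auto simp: hbilinear_def)
  define F where "F p = (\<Sum>x\<in>Poly_Mapping.keys p. Poly_Mapping.lookup p x *\<^sub>h B (fst x) (snd x))"
    for p :: "'a \<times> 'b \<Rightarrow>\<^sub>0 complex fps"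
  have F: "F p = (\<Sum>x\<in>S. Poly_Mapping.lookup p x *\<^sub>h B (fst x) (snd x))"
    if "finite S" "Poly_Mapping.keys p \<subseteq> S" for S p
    unfolding F_def by (rule sum.mono_neutral_left) (use that in \<open>auto simp: in_keys_iff\<close>)
  have F_add: "F (p + q) = F p + F q" for p q
  proof -
    let ?S = "Poly_Mapping.keys p \<union> Poly_Mapping.keys q"
    have "finite ?S" "Poly_Mapping.keys (p + q) \<subseteq> ?S"
      using Poly_Mapping.keys_add[of p q] by auto
    then show ?thesis
      by (subst (1 2 3) F[of ?S]) (auto simp: lookup_add hscale_add_left sum.distrib)
  qed
  have F_scale: "F (fm_scale c p) = c *\<^sub>h F p" for c p
  proof -
    have "Poly_Mapping.keys (fm_scale c p) \<subseteq> Poly_Mapping.keys p"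
      by (auto simp: in_keys_iff lookup_fm_scale)
    then show ?thesis
      by (subst (1 2) F[of "Poly_Mapping.keys p"]) (auto simp: lookup_fm_scale hmod.scale_sum_right)
  qed
  have F_uminus: "F (- p) = - F p" for p
    using F_scale[of "-1" p] by simp
  have F_diff: "F (p - q) = F p - F q" for p q
    using F_add[of p "- q"] F_uminus by simp
  have F_0: "F 0 = 0"
    by (simp add: F_def)
  have F_single: "F (Poly_Mapping.single x c) = c *\<^sub>h B (fst x) (snd x)" for x c
    by (simp add: F_def)
  have F_sum: "F (sum g A) = (\<Sum>x\<in>A. F (g x))" for g and A :: "nat set"
    by (induction A rule: infinite_finite_induct) (simp_all add: F_0 F_add)
  have F_rel: "F q = 0" if "q \<in> tensor_relations" for q
    using that unfolding tensor_relations_def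
    by (auto simp: F_diff F_single hlinear_add[OF Bl] hlinear_add[OF Br] hlinear_scale[OF Bl]
        hlinear_scale[OF Br] hscale_one)
  have F_span: "F q = 0" if "q \<in> fm.span tensor_relations" for q
    using fm.span_minimal[of tensor_relations "{q. F q = 0}"] F_rel that
    by (auto simp: fm.subspace_def F_0 F_add F_scale)
  have F_null: "F p \<in> hpow n UNIV" if "p \<in> tensor_null n" for p n
    using that unfolding tensor_null_def by (auto simp: F_add F_scale F_span in_hpowI)
  define G where "G s = hsum (\<lambda>k. fps_X ^ k *\<^sub>h F (s k)) UNIV" for s
  have summ: "hsummable (\<lambda>k. fps_X ^ k *\<^sub>h F (s k)) UNIV" for s
  proof (rule hsummableI)
    fix K show "\<exists>A. finite A \<and> (\<forall>x\<in>UNIV - A. fps_X ^ x *\<^sub>h F (s x) \<in> hpow K UNIV)"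
      by (rule exI[of _ "{..<K}"]) (auto intro!: hpow_dvd le_imp_power_dvd)
  qed
  have approx: "G s - F (\<Sum>k<n. fm_scale (fps_X ^ k) (s k)) \<in> hpow n UNIV" for s n
    unfolding G_def F_sum F_scale
    by (rule hsum_approx[OF hc summ]) (auto intro!: hpow_dvd le_imp_power_dvd)
  have G_cong: "G s = G t" if "ctensor_rel s t" for s t
  proof (rule hcs_eqI[OF hc])
    fix n
    have "F (\<Sum>k<n. fm_scale (fps_X ^ k) (s k - t k)) \<in> hpow n UNIV"
      using that F_null by (simp add: ctensor_rel_def)
    then have "F (\<Sum>k<n. fm_scale (fps_X ^ k) (s k)) - F (\<Sum>k<n. fm_scale (fps_X ^ k) (t k)) \<in> hpow n UNIV"
      by (simp add: fm.scale_right_diff_distrib sum_subtractf F_diff)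
    from hpow_add[OF hpow_diff[OF approx[of s n] approx[of t n]] this]
    show "G s - G t \<in> hpow n UNIV" by (simp add: algebra_simps)
  qed
  define f where "f x = G (rep_ctensor x)" for x
  have f_abs: "f (abs_ctensor s) = G s" for s
    unfolding f_def by (rule G_cong[OF Quotient3_rep_abs[OF Quotient3_ctensor ctensor_rel_refl]])
  have "hlinear f"
  proof (rule hlinearI)
    fix x y :: "('a, 'b) ctensor" and c :: "complex fps"
    obtain s t where st: "x = abs_ctensor s" "y = abs_ctensor t"
      by (metis ctensor_abs)
    show "f (x + y) = f x + f y"
      unfolding st abs_ctensor_add[symmetric] f_abs
      unfolding G_def using hsum_add[OF hc summ[of s] summ[of t]]
      by (simp add: F_add hscale_add_right)
    show "f (c *\<^sub>h x) = c *\<^sub>h f x"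
      unfolding st abs_ctensor_scale[symmetric] f_abs
      unfolding G_def using hsum_scale[OF hc summ[of s], of c]
      by (simp add: F_scale mult.commute)
  qed
  moreover have "f (a \<otimes>\<^sub>h b) = B a b" for a b
    unfolding tensor.abs_eq f_abs unfolding G_def
    by (subst hsum_single[OF hc, of 0]) (auto simp: F_0 F_single hscale_one)
  ultimately show ?thesis by blast
qed

lemma hlinear_ctensor_eqI:
  fixes f g :: "('a::hmodule, 'b::hmodule) ctensor \<Rightarrow> 'd::hmodule"
  assumes "hcs TYPE('d)" "hgen A" "hgen B" "hlinear f" "hlinear g"
    "\<And>a b. a \<in> A \<Longrightarrow> b \<in> B \<Longrightarrow> f (a \<otimes>\<^sub>h b) = g (a \<otimes>\<^sub>h b)"
  shows "f = g"
  by (rule hlinear_eqI[OF assms(1) hgen_tensor[OF assms(2,3)] assms(4,5)]) (use assms(6) in auto)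

lemma
  fixes B :: "'a::hmodule \<Rightarrow> 'b::hmodule \<Rightarrow> 'd::hmodule"
  assumes hc: "hcs TYPE('d)" and B: "hbilinear B"
  shows hlinear_induced: "hlinear (induced B)"
    and induced_tensor: "induced B (a \<otimes>\<^sub>h b) = B a b"
proof -
  have "\<exists>!f. hlinear f \<and> (\<forall>a b. f (a \<otimes>\<^sub>h b) = B a b)"
  proof (rule ex_ex1I[OF induced_exists[OF hc B]])
    fix f g assume "hlinear f \<and> (\<forall>a b. f (a \<otimes>\<^sub>h b) = B a b)" "hlinear g \<and> (\<forall>a b. g (a \<otimes>\<^sub>h b) = B a b)"
    then show "f = g"
      by (intro hlinear_ctensor_eqI[OF hc hgen_UNIV hgen_UNIV]) auto
  qed
  from theI'[OF this] show "hlinear (induced B)" "induced B (a \<otimes>\<^sub>h b) = B a b"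
    unfolding induced_def by blast+
qed

lemma hbilinear_tensor_comp:
  assumes "hlinear f" "hlinear g"
  shows "hbilinear (\<lambda>a b. f a \<otimes>\<^sub>h g b)"
  unfolding hbilinear_def
  using hlinear_compose[OF hlinear_tensor_left assms(1)] hlinear_compose[OF hlinear_tensor_right assms(2)]
  by blast

lemma
  assumes "hlinear f" "hlinear g"
  shows hlinear_tensor_map: "hlinear (tensor_map f g)"
    and tensor_map_tensor: "tensor_map f g (a \<otimes>\<^sub>h b) = f a \<otimes>\<^sub>h g b"
  unfolding tensor_map_def
  using hlinear_induced[OF hcs_ctensor hbilinear_tensor_comp[OF assms]]
    induced_tensor[OF hcs_ctensor hbilinear_tensor_comp[OF assms]] by auto

lemma tensor_map_comp:
  assumes "hlinear f" "hlinear g" "hlinear f'" "hlinear g'"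
  shows "tensor_map f g (tensor_map f' g' t) = tensor_map (\<lambda>a. f (f' a)) (\<lambda>b. g (g' b)) t"
proof -
  have "(\<lambda>t. tensor_map f g (tensor_map f' g' t)) = tensor_map (\<lambda>a. f (f' a)) (\<lambda>b. g (g' b))"
    by (rule hlinear_ctensor_eqI[OF hcs_ctensor hgen_UNIV hgen_UNIV])
      (simp_all add: assms hlinear_tensor_map hlinear_compose[of "tensor_map f g"] hlinear_compose
        tensor_map_tensor)
  then show ?thesis by (rule fun_cong)
qed

lemma tensor_map_id: "tensor_map (\<lambda>a. a) (\<lambda>b. b) t = t"
proof -
  have "tensor_map (\<lambda>a. a) (\<lambda>b. b) = (\<lambda>t. t)"
    by (rule hlinear_ctensor_eqI[OF hcs_ctensor hgen_UNIV hgen_UNIV])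
      (simp_all add: hlinear_ident hlinear_tensor_map tensor_map_tensor)
  then show ?thesis by (rule fun_cong)
qed

section \<open>The algebra \<open>H\<^sup>+\<^sub>N\<close>\<close>

lemma scalar_series_const: "scalar_series (fps_const c) = fps_const (Poly_Mapping.single 0 c)"
  by (simp add: scalar_series_def fps_eq_iff)

lemma scalar_series_X: "scalar_series fps_X = fps_X"
  by (simp add: scalar_series_def fps_eq_iff fps_X_def)

lemma scalar_series_X_power: "scalar_series (fps_X ^ n) = fps_X ^ n"
  by (induction n) (simp_all add: scalar_series_mult scalar_series_X scalar_series_1)

lemma closed_ideal_base: "S \<subseteq> closed_ideal S"
  by (auto simp: closed_ideal_def)

lemma closed_closed_ideal: "closed (closed_ideal S)"
  unfolding closed_ideal_def by (intro closed_Inter) auto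

lemma closed_ideal_sum: "(\<And>x. x \<in> A \<Longrightarrow> f x \<in> closed_ideal S) \<Longrightarrow> sum f A \<in> closed_ideal S"
  by (induction A rule: infinite_finite_induct) (auto intro: closed_ideal_0 closed_ideal_add)

lemma closed_ideal_minimal:
  "two_sided_ideal I \<Longrightarrow> closed I \<Longrightarrow> S \<subseteq> I \<Longrightarrow> closed_ideal S \<subseteq> I"
  by (auto simp: closed_ideal_def)

text \<open>Each coefficient of a convergent sequence of power series is eventually constant, so a
  condition imposed on every coefficient separately is closed.\<close>

lemma closed_coefficientwise: "closed {f :: 'a::ring_1 fps. \<forall>k. P (fps_nth f k)}"
  unfolding closed_sequential_limits
proof (intro allI impI, elim conjE)
  fix x :: "nat \<Rightarrow> 'a fps" and l
  assume x: "\<forall>n. x n \<in> {f. \<forall>k. P (fps_nth f k)}" and lim: "x \<longlonglongrightarrow> l"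
  have "P (fps_nth l k)" for k
  proof -
    have "\<forall>\<^sub>F n in sequentially. fps_nth (x n) k = fps_nth l k"
      using lim by (simp add: tendsto_fps_iff)
    then obtain n where "fps_nth (x n) k = fps_nth l k"
      by (auto simp: eventually_sequentially)
    then show ?thesis using x by (metis mem_Collect_eq)
  qed
  then show "l \<in> {f. \<forall>k. P (fps_nth f k)}" by simp
qed

text \<open>An ideal whose generators are free of h is homogeneous in h: the series whose
  coefficients all lie in it form a closed ideal containing the generators. Together with
  \<open>closed_ideal_constI\<close> this presents \<open>Hplus\<close> as power series over a
  commutative quotient ring.\<close>

lemma closed_ideal_constD:
  assumes "S \<subseteq> range fps_const" "f \<in> closed_ideal S"
  shows "fps_const (fps_nth f k) \<in> closed_ideal S"
proof -
  let ?J = "{f. \<forall>k. fps_const (fps_nth f k) \<in> closed_ideal S}"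
  have "two_sided_ideal ?J"
    unfolding two_sided_ideal_def
  proof (intro conjI ballI allI)
    show "0 \<in> ?J"
      by (simp add: closed_ideal_0)
    show "a + b \<in> ?J" if "a \<in> ?J" "b \<in> ?J" for a b
      using that by (auto simp: closed_ideal_add simp flip: fps_const_add)
    have const_sum: "fps_const (sum g A) = (\<Sum>x\<in>A. fps_const (g x))" for g and A :: "nat set"
      by (induction A rule: infinite_finite_induct) (simp_all flip: fps_const_add)
    show "r * a \<in> ?J" "a * r \<in> ?J" if "a \<in> ?J" for a r
      using that
      by (simp_all add: fps_mult_nth const_sum closed_ideal_sum closed_ideal_mult_left
          closed_ideal_mult_right flip: fps_const_mult)
  qed
  moreover have "S \<subseteq> ?J"
  proof
    fix s assume s: "s \<in> S"
    then obtain p where "s = fps_const p" using assms(1) by auto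
    with s show "s \<in> ?J"
      using closed_ideal_base[of S] by (auto simp: closed_ideal_0)
  qed
  ultimately show ?thesis
    using closed_ideal_minimal[OF _ closed_coefficientwise, of "\<lambda>p. fps_const p \<in> closed_ideal S" S]
      assms(2) by blast
qed

text \<open>The partial sums of f lie in the ideal and converge to f, so closedness of the ideal
  finishes.\<close>

lemma closed_ideal_constI:
  assumes "\<And>k. fps_const (fps_nth f k) \<in> closed_ideal S"
  shows "f \<in> closed_ideal S"
proof -
  define s where "s n = (\<Sum>k<n. fps_const (fps_nth f k) * fps_X ^ k)" for n
  have "s n \<in> closed_ideal S" for n
    unfolding s_def by (intro closed_ideal_sum closed_ideal_mult_right assms)
  moreover have "s \<longlonglongrightarrow> f"
  proof (rule tendsto_fpsI)
    fix k
    have "fps_nth (fps_const a * fps_X ^ j) k = (if j = k then a else 0)" for a :: 'a and j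
      by (auto simp: fps_X_power_nth)
    then have "fps_nth (s n) k = (if k < n then fps_nth f k else 0)" for n
      by (simp add: s_def fps_sum_nth)
    then show "\<forall>\<^sub>F n in sequentially. fps_nth (s n) k = fps_nth f k"
      unfolding eventually_sequentially by (intro exI[of _ "Suc k"]) auto
  qed
  ultimately show ?thesis
    using closed_closed_ideal[of S] unfolding closed_sequential_limits by blast
qed

lemma Hplus_gens_const: "range (\<lambda>r. \<Sum>i\<in>UNIV. xvar i i r) \<subseteq> range fps_const"
proof -
  have const_sum: "fps_const (sum g A) = (\<Sum>x\<in>A. fps_const (g x))" for g :: "'n \<Rightarrow> 'n xpoly" and A
    by (induction A rule: infinite_finite_induct) (simp_all flip: fps_const_add)
  show ?thesis
    by (auto simp: xvar_def simp flip: const_sum)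
qed

lemma abs_Hplus_eq_iff: "abs_Hplus f = abs_Hplus g \<longleftrightarrow> f - g \<in> Hplus_ideal"
  by (simp add: Hplus.abs_eq_iff)

lemma abs_Hplus_eq_0: "abs_Hplus f = 0 \<longleftrightarrow> (\<forall>k. fps_const (fps_nth f k) \<in> Hplus_ideal)"
  unfolding zero_Hplus.abs_eq abs_Hplus_eq_iff Hplus_ideal_def
  using closed_ideal_constI[of f] closed_ideal_constD[OF Hplus_gens_const, of f] by auto

lemma abs_Hplus_cases: obtains f where "x = abs_Hplus f"
  using Quotient3_abs_rep[OF Quotient3_Hplus, of x] by metis

lemma abs_Hplus_add: "abs_Hplus (f + g) = abs_Hplus f + abs_Hplus g"
  and abs_Hplus_diff: "abs_Hplus (f - g) = abs_Hplus f - abs_Hplus g"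
  and abs_Hplus_mult: "abs_Hplus (f * g) = abs_Hplus f * abs_Hplus g"
  and abs_Hplus_scale: "abs_Hplus (scalar_series c * f) = c *\<^sub>h abs_Hplus f"
  and abs_Hplus_0: "abs_Hplus 0 = 0"
  and abs_Hplus_1: "abs_Hplus 1 = 1"
  by (simp_all add: plus_Hplus.abs_eq minus_Hplus.abs_eq times_Hplus.abs_eq hscale_Hplus.abs_eq
      zero_Hplus.abs_eq one_Hplus.abs_eq)

lemma abs_Hplus_sum: "abs_Hplus (sum f A) = (\<Sum>x\<in>A. abs_Hplus (f x))"
  by (induction A rule: infinite_finite_induct) (simp_all add: abs_Hplus_0 abs_Hplus_add)

lemma abs_Hplus_X_power: "abs_Hplus (fps_X ^ k * f) = fps_X ^ k *\<^sub>h abs_Hplus f"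
  using abs_Hplus_scale[of "fps_X ^ k" f] by (simp add: scalar_series_X_power)

lemma abs_Hplus_X: "abs_Hplus (fps_X * f) = fps_X *\<^sub>h abs_Hplus f"
  using abs_Hplus_X_power[of 1 f] by simp

lemma Hplus_mult_scale: "a * (c *\<^sub>h b) = c *\<^sub>h (a * b)" for a b :: "'n::finite Hplus"
proof -
  obtain f g where "a = abs_Hplus f" "b = abs_Hplus g"
    by (metis abs_Hplus_cases)
  moreover have "f * (scalar_series c * g) = scalar_series c * (f * g)"
    by (simp add: mult.left_commute)
  ultimately show ?thesis
    by (metis abs_Hplus_mult abs_Hplus_scale)
qed

lemma hlinear_mult_Hplus: "hlinear (\<lambda>b. a * b)" for a :: "'n::finite Hplus"
  by (simp add: hlinear_iff Hplus_mult_scale distrib_left)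

lemma hcs_Hplus: "hcs TYPE('n::finite Hplus)"
  unfolding hcs_def
proof
  have "x = 0" if x: "\<And>n. x \<in> hpow n UNIV" for x :: "'n Hplus"
  proof -
    obtain f where f: "x = abs_Hplus f" by (rule abs_Hplus_cases)
    have "fps_const (fps_nth f k) \<in> Hplus_ideal" for k
    proof -
      obtain g where "x = fps_X ^ Suc k *\<^sub>h abs_Hplus g"
        using x[of "Suc k"] unfolding in_hpow by (metis abs_Hplus_cases)
      then have "abs_Hplus (f - fps_X ^ Suc k * g) = 0"
        by (simp add: f abs_Hplus_diff abs_Hplus_X_power del: power_Suc)
      then have "fps_const (fps_nth (f - fps_X ^ Suc k * g) k) \<in> Hplus_ideal"
        by (simp only: abs_Hplus_eq_0)
      then show ?thesis
        by (simp add: fps_X_power_mult_nth del: power_Suc)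
    qed
    then show ?thesis by (simp add: f abs_Hplus_eq_0)
  qed
  then show "hseparated (UNIV :: 'n Hplus set)"
    by (auto simp: hseparated_def)
  \<comment> \<open>Diagonal rearrangement of a power series in h whose coefficients are again power
    series in h.\<close>
  define L where "L t = Abs_fps (\<lambda>k. \<Sum>i\<le>k. fps_nth (t i) (k - i))" for t :: "nat \<Rightarrow> 'n xpoly fps"
  have L_step: "L t = t 0 + fps_X * L (\<lambda>i. t (Suc i))" for t
  proof (rule fps_ext)
    fix k show "fps_nth (L t) k = fps_nth (t 0 + fps_X * L (\<lambda>i. t (Suc i))) k"
      by (cases k) (simp_all add: L_def sum.atMost_Suc_shift del: sum.atMost_Suc)
  qed
  have L: "abs_Hplus (L t) - (\<Sum>k<n. fps_X ^ k *\<^sub>h abs_Hplus (t k)) = fps_X ^ n *\<^sub>h abs_Hplus (L (\<lambda>i. t (n + i)))" for t n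
  proof (induction n)
    case 0
    then show ?case by (simp add: hscale_one)
  next
    case (Suc n)
    have "fps_X ^ n *\<^sub>h abs_Hplus (L (\<lambda>i. t (n + i))) =
        fps_X ^ n *\<^sub>h abs_Hplus (t n) + fps_X ^ Suc n *\<^sub>h abs_Hplus (L (\<lambda>i. t (Suc n + i)))"
      by (subst L_step) (simp add: hscale_add_right abs_Hplus_add abs_Hplus_X mult.commute[of "fps_X ^ n"])
    with Suc show ?case
      by (simp add: algebra_simps)
  qed
  show "hcomplete (UNIV :: 'n Hplus set)"
  proof (rule hcompleteI)
    fix y :: "nat \<Rightarrow> 'n Hplus"
    define t where "t k = rep_Hplus (y k)" for k
    have "y k = abs_Hplus (t k)" for k
      by (simp add: t_def Quotient3_abs_rep[OF Quotient3_Hplus])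
    then show "\<exists>l. \<forall>n. l - (\<Sum>k<n. fps_X ^ k *\<^sub>h y k) \<in> hpow n UNIV"
      using L[of t] by (auto simp: in_hpow)
  qed
qed

text \<open>A nonzero scalar is a power of h up to a unit, so torsion-freeness only concerns
  multiplication by powers of h.\<close>

lemma fps_scalar_unit_decompose:
  fixes c :: "complex fps"
  assumes "c \<noteq> 0"
  obtains u where "u * c = fps_X ^ subdegree c"
proof
  let ?v = "fps_shift (subdegree c) c"
  have "inverse ?v * ?v = 1"
    using assms by (intro inverse_mult_eq_1) simp
  then show "inverse ?v * c = fps_X ^ subdegree c"
    using subdegree_decompose[of c] by (metis mult.assoc mult.commute mult_1)
qed

lemma topologically_free_Hplus: "topologically_free (UNIV :: 'n::finite Hplus set)"
proof -
  have "a = 0" if ca: "c *\<^sub>h a = 0" "c \<noteq> 0" for c and a :: "'n Hplus"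
  proof -
    obtain u where "u * c = fps_X ^ subdegree c"
      by (rule fps_scalar_unit_decompose[OF ca(2)])
    then have 0: "fps_X ^ subdegree c *\<^sub>h a = 0"
      by (metis hmod.scale_zero_right hscale_hscale ca(1))
    obtain f where f: "a = abs_Hplus f" by (rule abs_Hplus_cases)
    have "abs_Hplus (fps_X ^ subdegree c * f) = 0"
      using 0 by (simp add: f abs_Hplus_X_power)
    then have "fps_const (fps_nth (fps_X ^ subdegree c * f) (k + subdegree c)) \<in> Hplus_ideal" for k
      by (simp only: abs_Hplus_eq_0)
    then show ?thesis
      by (simp add: f abs_Hplus_eq_0 fps_X_power_mult_nth)
  qed
  then show ?thesis
    using hcs_Hplus by (auto simp: topologically_free_def torsion_free_def hcs_def)
qed

definition xgen :: "'n::finite \<times> 'n \<times> nat \<Rightarrow> 'n Hplus"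
  where "xgen g = xp (fst g) (fst (snd g)) (snd (snd g))"

text \<open>Monomials are indexed by lists and not by multisets, so that maps on them can be defined
  by primitive recursion; symmetry is checked afterwards with \<open>perm_invariant\<close>.\<close>

definition xmon :: "('n::finite \<times> 'n \<times> nat) list \<Rightarrow> 'n Hplus"
  where "xmon l = prod_list (map xgen l)"

lemma xmon_simps [simp]: "xmon [] = 1" "xmon (g # l) = xgen g * xmon l"
  by (simp_all add: xmon_def)

lemma xmon_mset: "mset l = mset l' \<Longrightarrow> xmon l = xmon l'"
  unfolding xmon_def by (metis mset_map prod_mset_prod_list)

lemma sum_xp_trace: "(\<Sum>i\<in>UNIV. xp i i r) = (0 :: 'n::finite Hplus)"
proof -
  have "(\<Sum>i\<in>UNIV. xp i i r) = abs_Hplus (\<Sum>i\<in>UNIV. xvar i i r :: 'n xpoly fps)"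
    by (simp add: abs_Hplus_sum xp.abs_eq)
  also have "\<dots> = 0"
    unfolding zero_Hplus.abs_eq abs_Hplus_eq_iff Hplus_ideal_def
    using closed_ideal_base[of "range (\<lambda>r. \<Sum>i\<in>UNIV. xvar i i r :: 'n xpoly fps)"] by auto
  finally show ?thesis .
qed

text \<open>The exponent vector of the monomial that a list represents.\<close>

definition lcount :: "'g list \<Rightarrow> ('g \<Rightarrow>\<^sub>0 nat)"
  where "lcount l = (\<Sum>g\<leftarrow>l. Poly_Mapping.single g 1)"

lemma lcount_simps [simp]: "lcount [] = 0" "lcount (g # l) = Poly_Mapping.single g 1 + lcount l"
  by (simp_all add: lcount_def)

lemma lcount_append: "lcount (l @ l') = lcount l + lcount l'"
  by (simp add: lcount_def)

lemma lookup_lcount: "Poly_Mapping.lookup (lcount l) g = count (mset l) g"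
  by (induction l) (auto simp: lookup_add lookup_single when_def)

lemma lcount_eq_iff: "lcount l = lcount l' \<longleftrightarrow> mset l = mset l'"
  by (simp add: poly_mapping_eq_iff fun_eq_iff lookup_lcount multiset_eq_iff)

lemma pm_expand:
  fixes p :: "'b \<Rightarrow>\<^sub>0 'c::comm_monoid_add"
  shows "p = (\<Sum>m\<in>Poly_Mapping.keys p. Poly_Mapping.single m (Poly_Mapping.lookup p m))"
  by (rule poly_mapping_eqI) (auto simp: lookup_sum lookup_single when_def in_keys_iff)

lemma lcount_surj: "\<exists>l. lcount l = m"
proof -
  have "\<exists>l. lcount l = (\<Sum>k\<in>A. Poly_Mapping.single k (v k))" for A and v :: "'a \<Rightarrow> nat"
  proof (induction A rule: infinite_finite_induct)
    case (insert k A)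
    then obtain l where l: "lcount l = (\<Sum>k\<in>A. Poly_Mapping.single k (v k))" by blast
    have "lcount (replicate n k) = Poly_Mapping.single k n" for n
      by (induction n) (auto simp flip: single_add)
    then have "lcount (replicate (v k) k @ l) = (\<Sum>k\<in>insert k A. Poly_Mapping.single k (v k))"
      using insert by (simp add: lcount_append l)
    then show ?case by blast
  qed (auto intro: exI[of _ "[]"])
  then show ?thesis using pm_expand[of m] by metis
qed

lemma abs_Hplus_lcount: "abs_Hplus (fps_const (Poly_Mapping.single (lcount l) 1)) = xmon l"
proof (induction l)
  case Nil
  then show ?case by (simp add: abs_Hplus_1)
next
  case (Cons g l)
  have "fps_const (Poly_Mapping.single (lcount (g # l)) 1) =
      xvar (fst g) (fst (snd g)) (snd (snd g)) * fps_const (Poly_Mapping.single (lcount l) 1)"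
    by (simp add: xvar_def mult_single)
  then show ?case
    using Cons by (simp add: abs_Hplus_mult xgen_def xp.abs_eq)
qed

lemma fps_const_sum: "fps_const (sum g A) = (\<Sum>x\<in>A. fps_const (g x))"
  by (induction A rule: infinite_finite_induct) (simp_all flip: fps_const_add)

lemma fps_const_shift: "f = fps_const (fps_nth f 0) + fps_X * fps_shift 1 (f :: 'a::ring_1 fps)"
  by (rule fps_ext) (simp add: fps_X_mult_nth)

lemma hgen_Hplus: "hgen (range xmon :: 'n::finite Hplus set)"
  unfolding hgen_def
proof
  fix x :: "'n Hplus"
  obtain f where f: "x = abs_Hplus f" by (rule abs_Hplus_cases)
  have x: "x = abs_Hplus (fps_const (fps_nth f 0)) + fps_X *\<^sub>h abs_Hplus (fps_shift 1 f)"
    using arg_cong[OF fps_const_shift[of f], of abs_Hplus] abs_Hplus_X_power[of 1 "fps_shift 1 f"]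
    by (simp add: f abs_Hplus_add)
  have single: "abs_Hplus (fps_const (Poly_Mapping.single m c)) \<in> hmod.span (range xmon)"
    for m and c :: complex
  proof -
    obtain l where l: "lcount l = m" using lcount_surj by blast
    have "fps_const (Poly_Mapping.single m c) =
        scalar_series (fps_const c) * fps_const (Poly_Mapping.single m 1)"
      by (simp add: scalar_series_const mult_single)
    then have "abs_Hplus (fps_const (Poly_Mapping.single m c)) = c *\<^sub>c xmon l"
      using abs_Hplus_lcount[of l] by (simp add: abs_Hplus_scale l)
    then show ?thesis
      by (auto intro: hmod.span_scale hmod.span_base)
  qed
  have "abs_Hplus (fps_const p) \<in> hmod.span (range xmon)" for p :: "'n xpoly"
    by (subst pm_expand[of p])
      (auto simp: fps_const_sum abs_Hplus_sum intro!: hmod.span_sum single)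
  with x show "\<exists>b\<in>hmod.span (range xmon). \<exists>a'. x = b + fps_X *\<^sub>h a'" by blast
qed

text \<open>Induction on the length. If the two heads x and y differ, each tail can be permuted, by
  the induction hypothesis, so as to begin with the other head; then the two heads are
  swapped.\<close>

lemma perm_invariant:
  assumes swap: "\<And>x y l. F (x # y # l) = F (y # x # l)"
    and cong: "\<And>x l l'. mset l = mset l' \<Longrightarrow> F l = F l' \<Longrightarrow> F (x # l) = F (x # l')"
  shows "mset l = mset l' \<Longrightarrow> F l = F l'"
proof (induction "length l" arbitrary: l l' rule: less_induct)
  case less
  show ?case
  proof (cases l)
    case Nil
    with less.prems show ?thesis by simp
  next
    case (Cons x l1)
    then obtain y l1' where l': "l' = y # l1'"
      using less.prems by (cases l') auto
    show ?thesis
    proof (cases "x = y")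
      case True
      then have m: "mset l1 = mset l1'"
        using less.prems Cons l' by simp
      then have "F l1 = F l1'"
        using Cons by (intro less.hyps) simp_all
      then show ?thesis
        using cong[OF m, of x] Cons l' True by simp
    next
      case False
      then obtain M where M: "mset l1 = add_mset y M" "mset l1' = add_mset x M"
        using less.prems Cons l' by (auto simp: add_eq_conv_ex)
      obtain l2 where l2: "mset l2 = M" using ex_mset by blast
      have "length l1 = length (x # l2)"
        using M l2 by (metis size_mset size_add_mset length_Cons)
      then have len: "length l1 < length l" "length (x # l2) < length l"
        using Cons by simp_all
      have "F (x # l1) = F (x # y # l2)"
        using M l2 by (intro cong less.hyps[OF len(1)]) simp_all
      also have "\<dots> = F (y # x # l2)" by (rule swap)
      also have "\<dots> = F (y # l1')"
        using M l2 by (intro cong less.hyps[OF len(2)]) simp_all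
      finally show ?thesis using Cons l' by simp
    qed
  qed
qed

text \<open>The universal property of \<open>Hplus\<close> as a topological module. Symmetry makes F
  a function of the monomial, the trace condition makes its linear extension vanish on the ideal,
  and completeness of the target extends it along h.\<close>

theorem Hplus_extend:
  fixes F :: "('n::finite \<times> 'n \<times> nat) list \<Rightarrow> 'd::hmodule"
  assumes hc: "hcs TYPE('d)"
    and perm: "\<And>l l'. mset l = mset l' \<Longrightarrow> F l = F l'"
    and trace: "\<And>r l. (\<Sum>i\<in>UNIV. F ((i, i, r) # l)) = 0"
  shows "\<exists>L. hlinear L \<and> (\<forall>l. L (xmon l) = F l)"
proof -
  \<comment> \<open>An arbitrary ordering of each monomial; the symmetry of F makes the choice
    harmless.\<close>
  define lst where "lst m = (SOME l. lcount l = m)" for m :: "'n \<times> 'n \<times> nat \<Rightarrow>\<^sub>0 nat"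
  have lst: "lcount (lst m) = m" for m
    unfolding lst_def using someI_ex[OF lcount_surj] .
  define F' where "F' m = F (lst m)" for m
  have F': "F' (lcount l) = F l" for l
    unfolding F'_def by (rule perm) (simp add: lst flip: lcount_eq_iff)
  define L0 where "L0 p = (\<Sum>m\<in>Poly_Mapping.keys p. Poly_Mapping.lookup p m *\<^sub>c F' m)"
    for p :: "'n xpoly"
  have L0: "L0 p = (\<Sum>m\<in>S. Poly_Mapping.lookup p m *\<^sub>c F' m)"
    if "finite S" "Poly_Mapping.keys p \<subseteq> S" for S p
    unfolding L0_def by (rule sum.mono_neutral_left) (use that in \<open>auto simp: in_keys_iff\<close>)
  have L0_add: "L0 (p + q) = L0 p + L0 q" for p q
  proof -
    let ?S = "Poly_Mapping.keys p \<union> Poly_Mapping.keys q"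
    have "finite ?S" "Poly_Mapping.keys (p + q) \<subseteq> ?S"
      using Poly_Mapping.keys_add[of p q] by auto
    then show ?thesis
      by (subst (1 2 3) L0[of ?S])
        (auto simp: lookup_add hscale_add_left sum.distrib simp flip: fps_const_add)
  qed
  have L0_0: "L0 0 = 0" by (simp add: L0_def)
  have L0_sum: "L0 (sum g A) = (\<Sum>x\<in>A. L0 (g x))" for g :: "'z \<Rightarrow> 'n xpoly" and A
    by (induction A rule: infinite_finite_induct) (simp_all add: L0_0 L0_add)
  have L0_single: "L0 (Poly_Mapping.single m c) = c *\<^sub>c F' m" for m c
    by (simp add: L0_def)
  have L0_scale: "L0 (Poly_Mapping.single 0 c * p) = c *\<^sub>c L0 p" for c p
    by (subst (1 2) pm_expand[of p])
      (simp add: sum_distrib_left mult_single L0_sum L0_single hmod.scale_sum_right)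
  let ?t = "\<lambda>r. \<Sum>i\<in>UNIV. Poly_Mapping.single (Poly_Mapping.single (i, i, r) 1) 1 :: 'n xpoly"
  have L0_trace: "L0 (?t r * q) = 0" for r q
  proof -
    have "L0 (?t r * Poly_Mapping.single m c) = 0" for m c
    proof -
      have "F' (Poly_Mapping.single (i, i, r) 1 + m) = F ((i, i, r) # lst m)" for i
        using F'[of "(i, i, r) # lst m"] by (simp add: lst)
      then have "L0 (?t r * Poly_Mapping.single m c) = c *\<^sub>c (\<Sum>i\<in>UNIV. F ((i, i, r) # lst m))"
        by (simp add: sum_distrib_right mult_single L0_sum L0_single hmod.scale_sum_right)
      then show ?thesis by (simp add: trace)
    qed
    then show ?thesis
      by (subst pm_expand[of q]) (simp only: sum_distrib_left L0_sum sum.neutral_const)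
  qed
  have kill: "L0 (fps_nth f k) = 0" if "f \<in> Hplus_ideal" for f k
  proof -
    \<comment> \<open>The quantifier over the factor q is what makes this set an ideal and not
      merely a submodule.\<close>
    let ?J = "{f. \<forall>k. \<forall>q. L0 (fps_nth f k * q) = 0}"
    have "two_sided_ideal ?J"
      unfolding two_sided_ideal_def
    proof (intro conjI ballI allI)
      show "0 \<in> ?J" by (simp add: L0_0)
      show "a + b \<in> ?J" if "a \<in> ?J" "b \<in> ?J" for a b
        using that by (simp add: distrib_right L0_add)
      have *: "a * r \<in> ?J" if "a \<in> ?J" for a r
        using that by (simp add: fps_mult_nth sum_distrib_right L0_sum mult.assoc)
      show "a * r \<in> ?J" "r * a \<in> ?J" if "a \<in> ?J" for a r
        using *[OF that, of r] by (simp_all only: mult.commute)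
    qed
    moreover have "closed ?J" by (rule closed_coefficientwise)
    moreover have "range (\<lambda>r. \<Sum>i\<in>UNIV. xvar i i r) \<subseteq> ?J"
    proof safe
      fix r k and q :: "'n xpoly"
      have "(\<Sum>i\<in>UNIV. xvar i i r) = fps_const (?t r)"
        by (simp add: xvar_def fps_const_sum)
      then have "fps_nth (\<Sum>i\<in>UNIV. xvar i i r) k = (if k = 0 then ?t r else 0)"
        by (simp only: fps_nth_fps_const)
      then show "L0 (fps_nth (\<Sum>i\<in>UNIV. xvar i i r) k * q) = 0"
        by (simp only: L0_trace mult_zero_left L0_0 split: if_split) simp
    qed
    ultimately have "f \<in> ?J"
      using that closed_ideal_minimal unfolding Hplus_ideal_def by blast
    then have "L0 (fps_nth f k * 1) = 0" by blast
    then show ?thesis by simp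
  qed
  define G where "G f = hsum (\<lambda>k. fps_X ^ k *\<^sub>h L0 (fps_nth f k)) UNIV" for f
  have summ: "hsummable (\<lambda>k. fps_X ^ k *\<^sub>h L0 (fps_nth f k)) UNIV" for f
  proof (rule hsummableI)
    fix K show "\<exists>A. finite A \<and> (\<forall>x\<in>UNIV - A. fps_X ^ x *\<^sub>h L0 (fps_nth f x) \<in> hpow K UNIV)"
      by (rule exI[of _ "{..<K}"]) (auto intro!: hpow_dvd le_imp_power_dvd)
  qed
  have G_add: "G (f + g) = G f + G g" for f g
    unfolding G_def using hsum_add[OF hc summ[of f] summ[of g]]
    by (simp add: L0_add hscale_add_right)
  have G_const: "G (fps_const (Poly_Mapping.single 0 c) * f) = c *\<^sub>c G f" for c f
    unfolding G_def using hsum_scale[OF hc summ[of f], of "fps_const c"]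
    by (simp add: L0_scale mult.commute[of _ "fps_const c"])
  have G_X: "G (fps_X * f) = fps_X *\<^sub>h G f" for f
  proof -
    have 1: "hsummable (\<lambda>k. fps_X ^ k *\<^sub>h L0 (fps_nth (fps_X * f) k)) (range Suc)"
      by (rule hsummable_subset[OF summ]) simp
    have "G (fps_X * f) = hsum (\<lambda>k. fps_X ^ k *\<^sub>h L0 (fps_nth (fps_X * f) k)) (range Suc)"
      unfolding G_def
    proof (rule hsum_neutral(1)[OF hc _ _ 1])
      fix x :: nat assume "x \<in> UNIV - range Suc"
      then have "x = 0" by (metis DiffD2 not0_implies_Suc rangeI)
      then show "fps_X ^ x *\<^sub>h L0 (fps_nth (fps_X * f) x) = 0" by (simp add: L0_0)
    qed simp
    also have "\<dots> = hsum (\<lambda>k. fps_X ^ Suc k *\<^sub>h L0 (fps_nth (fps_X * f) (Suc k))) UNIV"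
      by (rule hsum_reindex[OF hc _ 1]) simp
    also have "\<dots> = fps_X *\<^sub>h G f"
      unfolding G_def using hsum_scale[OF hc summ[of f], of "fps_X"] by simp
    finally show ?thesis .
  qed
  \<comment> \<open>\<open>G\<close> commutes with constants and with h. For a general scalar the
    constant term is split off n times, and separatedness of the target removes the remaining
    error.\<close>
  have "G (scalar_series c * f) - c *\<^sub>h G f \<in> hpow n UNIV" for c f n
  proof (induction n arbitrary: c)
    case (Suc n)
    let ?c = "fps_shift 1 c"
    have "(scalar_series c :: 'n xpoly fps) = fps_const (Poly_Mapping.single 0 (fps_nth c 0)) + fps_X * scalar_series ?c"
      using arg_cong[OF fps_const_shift[of c], of scalar_series]
      by (simp only: scalar_series_add scalar_series_mult scalar_series_X scalar_series_const)
    then have eq: "scalar_series c * f =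
        fps_const (Poly_Mapping.single 0 (fps_nth c 0)) * f + fps_X * (scalar_series ?c * f)"
      by (simp only: distrib_right mult.assoc)
    have "c *\<^sub>h G f = fps_nth c 0 *\<^sub>c G f + fps_X *\<^sub>h (?c *\<^sub>h G f)"
      using arg_cong[OF fps_const_shift[of c], of "\<lambda>z. z *\<^sub>h G f"]
      by (simp only: hscale_add_left hscale_hscale)
    then have "G (scalar_series c * f) - c *\<^sub>h G f = fps_X *\<^sub>h (G (scalar_series ?c * f) - ?c *\<^sub>h G f)"
      unfolding eq G_add G_const G_X by (simp add: hmod.scale_right_diff_distrib)
    moreover obtain y where "G (scalar_series ?c * f) - ?c *\<^sub>h G f = fps_X ^ n *\<^sub>h y"
      using Suc[of ?c] by (auto simp: in_hpow)
    ultimately have "G (scalar_series c * f) - c *\<^sub>h G f = fps_X ^ Suc n *\<^sub>h y" by simp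
    then show ?case by (simp only: in_hpowI)
  qed simp
  then have G_scale: "G (scalar_series c * f) = c *\<^sub>h G f" for c f
    by (rule hcs_eqI[OF hc])
  have G_cong: "G f = G g" if "abs_Hplus f = abs_Hplus g" for f g
  proof -
    have "f - g \<in> Hplus_ideal" using that by (simp add: abs_Hplus_eq_iff)
    then have "L0 (fps_nth (f - g) k) = 0" for k by (rule kill)
    then have "G (f - g) = 0" by (simp add: G_def hsum_0[OF hc])
    then show ?thesis using G_add[of "f - g" g] by simp
  qed
  define L where "L x = G (rep_Hplus x)" for x
  have L: "L (abs_Hplus f) = G f" for f
    unfolding L_def by (rule G_cong) (simp add: Quotient3_abs_rep[OF Quotient3_Hplus])
  have "hlinear L"
  proof (rule hlinearI)
    fix x y :: "'n Hplus" and c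
    obtain f g where fg: "x = abs_Hplus f" "y = abs_Hplus g" by (metis abs_Hplus_cases)
    show "L (x + y) = L x + L y" "L (c *\<^sub>h x) = c *\<^sub>h L x"
      unfolding fg abs_Hplus_add[symmetric] abs_Hplus_scale[symmetric] L G_add G_scale by simp_all
  qed
  moreover have "L (xmon l) = F l" for l
    unfolding abs_Hplus_lcount[symmetric] L unfolding G_def
    by (subst hsum_single[OF hc, of 0]) (auto simp: L0_0 L0_single F' hscale_one)
  ultimately show ?thesis by blast
qed

definition trace_free :: "('n::finite \<times> 'n \<times> nat \<Rightarrow> complex fps) \<Rightarrow> bool"
  where "trace_free d \<longleftrightarrow> (\<forall>r. (\<Sum>i\<in>UNIV. d (i, i, r)) = 0)"

text \<open>A vector field with constant coefficients: its values on the generators are scalars.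
  \<open>trace_free\<close> lets it descend to the quotient.\<close>

definition is_hder :: "('n::finite \<times> 'n \<times> nat \<Rightarrow> complex fps) \<Rightarrow> ('n Hplus \<Rightarrow> 'n Hplus) \<Rightarrow> bool"
  where "is_hder d D \<longleftrightarrow> hlinear D \<and> D 1 = 0 \<and> (\<forall>g u. D (xgen g * u) = xgen g * D u + d g *\<^sub>h u)"

lemma is_hder_exists:
  fixes d :: "'n::finite \<times> 'n \<times> nat \<Rightarrow> complex fps"
  assumes "trace_free d"
  shows "\<exists>D. is_hder d D"
proof -
  define F where "F = rec_list 0 (\<lambda>g l x. xgen g * x + d g *\<^sub>h xmon l)"
  have F: "F [] = 0" "F (g # l) = xgen g * F l + d g *\<^sub>h xmon l" for g l
    by (simp_all add: F_def)
  have "F l = F l'" if "mset l = mset l'" for l l'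
  proof (rule perm_invariant[OF _ _ that])
    show "F (x # y # l) = F (y # x # l)" for x y l
      by (simp add: F algebra_simps Hplus_mult_scale)
    show "F (x # l) = F (x # l')" if "mset l = mset l'" "F l = F l'" for x l l'
      using xmon_mset[OF that(1)] that(2) by (simp add: F)
  qed
  moreover have "(\<Sum>i\<in>UNIV. F ((i, i, r) # l)) = 0" for r l
  proof -
    have "(\<Sum>i\<in>UNIV. F ((i, i, r) # l)) = (\<Sum>i\<in>UNIV. xp i i r) * F l + (\<Sum>i\<in>UNIV. d (i, i, r)) *\<^sub>h xmon l"
      by (simp add: F sum.distrib sum_distrib_right hmod.scale_sum_left xgen_def)
    then show ?thesis
      using assms by (simp add: sum_xp_trace trace_free_def)
  qed
  ultimately obtain D where D: "hlinear D" "\<And>l. D (xmon l) = F l"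
    using Hplus_extend[OF hcs_Hplus, of F] by blast
  have "(\<lambda>u. D (xgen g * u)) = (\<lambda>u. xgen g * D u + d g *\<^sub>h u)" for g
  proof (rule hlinear_eqI[OF hcs_Hplus hgen_Hplus])
    show "hlinear (\<lambda>u. D (xgen g * u))" "hlinear (\<lambda>u. xgen g * D u + d g *\<^sub>h u)"
      using D(1) by (auto intro!: hlinear_intros hlinear_compose[OF D(1) hlinear_mult_Hplus]
          hlinear_compose[OF hlinear_mult_Hplus D(1)])
    show "D (xgen g * u) = xgen g * D u + d g *\<^sub>h u" if ul: "u \<in> range xmon" for u
    proof -
      obtain l where u: "u = xmon l" using ul by blast
      have "D (xmon (g # l)) = F (g # l)" by (rule D(2))
      then show ?thesis by (simp add: F D(2) u)
    qed
  qed
  moreover have "D 1 = 0" using D(2)[of "[]"] by (simp add: F)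
  ultimately show ?thesis
    using D(1) unfolding is_hder_def by meson
qed

definition hder :: "('n::finite \<times> 'n \<times> nat \<Rightarrow> complex fps) \<Rightarrow> 'n Hplus \<Rightarrow> 'n Hplus"
  where "hder d = (SOME D. is_hder d D)"

context
  fixes d :: "'n::finite \<times> 'n \<times> nat \<Rightarrow> complex fps"
  assumes d: "trace_free d"
begin

lemma is_hder_hder: "is_hder d (hder d)"
  unfolding hder_def using someI_ex[OF is_hder_exists[OF d]] .

lemma hlinear_hder: "hlinear (hder d)"
  and hder_1: "hder d 1 = 0"
  and hder_xgen: "hder d (xgen g * u) = xgen g * hder d u + d g *\<^sub>h u"
  using is_hder_hder unfolding is_hder_def by blast+

end

lemma Hplus_hlinear_eqI:
  fixes f g :: "'n::finite Hplus \<Rightarrow> 'd::hmodule"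
  assumes "hcs TYPE('d)" "hlinear f" "hlinear g" "\<And>l. f (xmon l) = g (xmon l)"
  shows "f u = g u"
proof -
  have "f = g"
    by (rule hlinear_eqI[OF assms(1) hgen_Hplus assms(2,3)]) (use assms(4) in blast)
  then show ?thesis by simp
qed

text \<open>Vector fields with constant coefficients commute. This makes negative modes commute with
  each other and the recursion for the braiding symmetric.\<close>

lemma hder_commute:
  assumes d: "trace_free d" "trace_free d'"
  shows "hder d (hder d' u) = hder d' (hder d u)"
proof (rule Hplus_hlinear_eqI[OF hcs_Hplus, of "\<lambda>u. hder d (hder d' u)" "\<lambda>u. hder d' (hder d u)"])
  note lin = hlinear_hder[OF d(1)] hlinear_hder[OF d(2)]
  show "hlinear (\<lambda>u. hder d (hder d' u))" "hlinear (\<lambda>u. hder d' (hder d u))"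
    using lin by (auto intro: hlinear_compose)
  show "hder d (hder d' (xmon l)) = hder d' (hder d (xmon l))" for l
    by (induction l) (simp_all add: hder_1 hder_xgen d lin hlinear_0 hlinear_add hlinear_scale algebra_simps)
qed

section \<open>The series \<open>S\<close>\<close>

lemma Rmat_entry:
  "vec_nth (vec_nth (Rmat \<tau> :: (complex poly fps, 'n::finite) mat2) p) q =
    (if p = q then 1 else 0) - (if q = prod.swap p then \<tau> else 0)"
proof -
  have "(\<Sum>k\<in>UNIV. (if p = k then \<tau> else 0) * (if fst k = snd q \<and> snd k = fst q then 1 else 0)) =
      (if q = prod.swap p then \<tau> else 0)"
    by (subst sum.mono_neutral_right[of UNIV "{p}"]) (auto simp: prod.swap_def prod_eq_iff)
  then show ?thesis
    by (simp add: Rmat_def matrix_matrix_mult_def mat_def Pmat_def)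
qed

text \<open>P squares to the identity, so products of R-matrices stay in the span of I and
  P.\<close>

lemma Rmat_mult_entry:
  "vec_nth (vec_nth (Rmat \<tau> ** Rmat \<tau>' :: (complex poly fps, 'n::finite) mat2) p) q =
    (if p = q then 1 + \<tau> * \<tau>' else 0) - (if q = prod.swap p then \<tau> + \<tau>' else 0)"
proof -
  have "(\<Sum>k\<in>UNIV. ((if p = k then 1 else 0) - (if k = prod.swap p then \<tau> else 0)) *
      ((if k = q then 1 else 0) - (if q = prod.swap k then \<tau>' else 0))) =
    (\<Sum>k\<in>UNIV. if k = p then ((if k = q then 1 else 0) - (if q = prod.swap k then \<tau>' else 0)) else 0) -
    (\<Sum>k\<in>UNIV. if k = prod.swap p then \<tau> * ((if k = q then 1 else 0) - (if q = prod.swap k then \<tau>' else 0)) else 0)"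
    by (subst sum_subtractf[symmetric], rule sum.cong) (auto simp: algebra_simps)
  also have "\<dots> = (if p = q then 1 + \<tau> * \<tau>' else 0) - (if q = prod.swap p then \<tau> + \<tau>' else 0)"
    by (simp only: sum.delta finite) (auto simp: algebra_simps)
  finally show ?thesis
    by (simp add: matrix_matrix_mult_def Rmat_entry)
qed

lemma GRR_entry:
  "vec_nth (vec_nth (GRR G :: (complex poly fps, 'n::finite) mat2) p) q =
    G * ((if p = q then 1 + fps_X * shifted_arg else 0)
      - (if q = prod.swap p then fps_X + shifted_arg else 0)) - (if p = q then 1 else 0)"
proof -
  have "vec_nth (vec_nth (mat G ** A) p) q = G * vec_nth (vec_nth A p) q"
    for A :: "(complex poly fps, 'n) mat2"
  proof -
    have "(\<Sum>k\<in>UNIV. (if p = k then G else 0) * vec_nth (vec_nth A k) q) =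
        (\<Sum>k\<in>UNIV. if k = p then G * vec_nth (vec_nth A k) q else 0)"
      by (rule sum.cong) auto
    then show ?thesis
      by (simp add: matrix_matrix_mult_def mat_def)
  qed
  then show ?thesis
    unfolding GRR_def by (simp add: Rmat_mult_entry mat_def flip: matrix_mul_assoc)
qed

text \<open>The partial trace of R(u) R(-u-hC) is this multiple of the identity: tracing I over one
  factor gives N, tracing P gives 1.\<close>

definition trace_coeff :: "'n::finite itself \<Rightarrow> complex poly fps"
  where "trace_coeff _ = of_nat CARD('n) * (1 + fps_X * shifted_arg) - (fps_X + shifted_arg)"

lemma tr1_GRR_entry:
  "(\<Sum>a\<in>UNIV. vec_nth (vec_nth (GRR G :: (complex poly fps, 'n::finite) mat2) (a, b)) (a, b')) =
    (if b = b' then G * trace_coeff TYPE('n) - of_nat CARD('n) else 0)"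
proof -
  have *: "(\<Sum>a\<in>UNIV. vec_nth (vec_nth (GRR G :: (complex poly fps, 'n::finite) mat2) (a, b)) (a, b')) =
      (\<Sum>a\<in>(UNIV::'n set). if b = b' then G * (1 + fps_X * shifted_arg) - 1 else 0)
      - (\<Sum>a\<in>UNIV. if a = b then if b = b' then G * (fps_X + shifted_arg) else 0 else 0)"
    by (subst sum_subtractf[symmetric], rule sum.cong) (auto simp: GRR_entry algebra_simps)
  show ?thesis
    unfolding * by (simp add: sum.delta trace_coeff_def algebra_simps)
qed

lemma tr2_GRR_entry:
  "(\<Sum>b\<in>UNIV. vec_nth (vec_nth (GRR G :: (complex poly fps, 'n::finite) mat2) (a, b)) (a', b)) =
    (if a = a' then G * trace_coeff TYPE('n) - of_nat CARD('n) else 0)"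
proof -
  have *: "(\<Sum>b\<in>UNIV. vec_nth (vec_nth (GRR G :: (complex poly fps, 'n::finite) mat2) (a, b)) (a', b)) =
      (\<Sum>b\<in>(UNIV::'n set). if a = a' then G * (1 + fps_X * shifted_arg) - 1 else 0)
      - (\<Sum>b\<in>UNIV. if b = a then if a = a' then G * (fps_X + shifted_arg) else 0 else 0)"
    by (subst sum_subtractf[symmetric], rule sum.cong) (auto simp: GRR_entry algebra_simps)
  show ?thesis
    unfolding * by (simp add: sum.delta trace_coeff_def algebra_simps)
qed

lemma trace_coeff_unit: "\<exists>u. trace_coeff TYPE('n::finite) * u = 1"
proof -
  have "fps_nth (trace_coeff TYPE('n)) 0 = of_nat CARD('n)"
    by (simp add: trace_coeff_def shifted_arg_def)
  moreover have "(of_nat CARD('n) :: complex poly) * [:inverse (of_nat CARD('n)):] = 1"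
    by (simp add: of_nat_poly one_pCons)
  ultimately show ?thesis
    using fps_right_inverse[of "trace_coeff TYPE('n)"] by metis
qed

text \<open>Both trace conditions say the same, \<open>G * trace_coeff = N\<close>. This has exactly
  one solution because the constant term N of \<open>trace_coeff\<close> is invertible.\<close>

lemma Gser_trace: "Gser TYPE('n::finite) * trace_coeff TYPE('n) = of_nat CARD('n)"
proof -
  have iff: "tr1 (GRR G :: (complex poly fps, 'n) mat2) = 0 \<and> tr2 (GRR G :: (complex poly fps, 'n) mat2) = 0
      \<longleftrightarrow> G * trace_coeff TYPE('n) = of_nat CARD('n)" for G
    by (auto simp: tr1_def tr2_def vec_eq_iff tr1_GRR_entry tr2_GRR_entry)
  obtain u where u: "trace_coeff TYPE('n) * u = 1"
    using trace_coeff_unit by blast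
  have "\<exists>!G. G * trace_coeff TYPE('n) = of_nat CARD('n)"
  proof (rule ex1I)
    show "(of_nat CARD('n) * u) * trace_coeff TYPE('n) = of_nat CARD('n)"
      using u by (simp add: mult.assoc mult.commute[of u])
    fix G assume "G * trace_coeff TYPE('n) = of_nat CARD('n)"
    then have "G * (trace_coeff TYPE('n) * u) = of_nat CARD('n) * u"
      by (simp flip: mult.assoc)
    then show "G = of_nat CARD('n) * u" by (simp add: u)
  qed
  from theI'[OF this] show ?thesis
    unfolding Gser_def iff .
qed

text \<open>At fixed C everything depends on h and u only through h/u, so the coefficient of u^(-s)
  is a single monomial in h, of degree s - 2 after the division by h^2.\<close>

lemma Sc_eq:
  fixes p q :: "'n::finite \<times> 'n"
  shows "Sc c p q (- int s) = (if 2 \<le> s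
    then fps_const (poly (fps_nth (vec_nth (vec_nth (GRR (Gser TYPE('n))) p) q) s) c) * fps_X ^ (s - 2)
    else 0)"
  by (rule fps_ext) (auto simp: Sc_def Sgen_def fps_X_power_nth)

lemma Sc_pos: "0 < d \<Longrightarrow> Sc c p q d = 0"
  by (rule fps_ext) (simp add: Sc_def Sgen_def)

lemma Sc_zero: "- 2 < d \<Longrightarrow> Sc c p q d = 0"
  using Sc_pos[of d c p q] Sc_eq[of c p q "nat (- d)"] by (cases "0 < d") auto

text \<open>The source of convergence for derivations and braiding: high poles in u carry high
  powers of h.\<close>

lemma Sc_dvd: "fps_X ^ (s - 2) dvd Sc c p q (- int s)"
  by (simp add: Sc_eq)

text \<open>Exchanging the tensor factors fixes I and P. This symmetry is what allows the kernel at
  z to be compared with the flipped kernel at -z.\<close>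

lemma Sc_swap: "Sc c (i, j) (i, j) d = Sc c (j, i) (j, i) d" for i j :: "'n::finite"
proof (cases "0 < d")
  case False
  then obtain s where s: "d = - int s"
    by (metis add.inverse_inverse linorder_not_less neg_0_le_iff_le nonneg_int_cases)
  have "vec_nth (vec_nth (GRR G :: (complex poly fps, 'n) mat2) (i, j)) (i, j) =
      vec_nth (vec_nth (GRR G) (j, i)) (j, i)" for G
    by (cases "i = j") (simp_all add: GRR_entry)
  then show ?thesis by (simp add: Sc_eq s)
qed (simp add: Sc_pos)

text \<open>In each kernel below, one index pair belongs to an operator and the other to the
  generator it contracts with. Both must respect the relation that the x_ii sum to 0, which is why
  both partial traces of S are used.\<close>

lemma Sc_tr1: "(\<Sum>a\<in>UNIV. Sc c (a, b) (a, b') d) = (0 :: complex fps)" for b :: "'n::finite"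
proof (cases "0 < d")
  case False
  then obtain s where s: "d = - int s"
    by (metis add.inverse_inverse linorder_not_less neg_0_le_iff_le nonneg_int_cases)
  have "(\<Sum>a\<in>UNIV. vec_nth (vec_nth (GRR (Gser TYPE('n)) :: (complex poly fps, 'n) mat2) (a, b)) (a, b')) = 0"
    by (simp add: tr1_GRR_entry Gser_trace)
  from arg_cong[OF this, of "\<lambda>f. poly (fps_nth f s) c"]
  have "(\<Sum>a\<in>UNIV. poly (fps_nth (vec_nth (vec_nth (GRR (Gser TYPE('n)) :: (complex poly fps, 'n) mat2) (a, b)) (a, b')) s) c) = 0"
    by (simp add: fps_sum_nth poly_sum)
  then show ?thesis
    by (cases "2 \<le> s") (simp_all add: s Sc_eq flip: sum_distrib_right fps_const_sum)
qed (simp add: Sc_pos)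

lemma Sc_tr2: "(\<Sum>b\<in>UNIV. Sc c (a, b) (a', b) d) = (0 :: complex fps)" for a :: "'n::finite"
proof (cases "0 < d")
  case False
  then obtain s where s: "d = - int s"
    by (metis add.inverse_inverse linorder_not_less neg_0_le_iff_le nonneg_int_cases)
  have "(\<Sum>b\<in>UNIV. vec_nth (vec_nth (GRR (Gser TYPE('n)) :: (complex poly fps, 'n) mat2) (a, b)) (a', b)) = 0"
    by (simp add: tr2_GRR_entry Gser_trace)
  from arg_cong[OF this, of "\<lambda>f. poly (fps_nth f s) c"]
  have "(\<Sum>b\<in>UNIV. poly (fps_nth (vec_nth (vec_nth (GRR (Gser TYPE('n)) :: (complex poly fps, 'n) mat2) (a, b)) (a', b)) s) c) = 0"
    by (simp add: fps_sum_nth poly_sum)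
  then show ?thesis
    by (cases "2 \<le> s") (simp_all add: s Sc_eq flip: sum_distrib_right fps_const_sum)
qed (simp add: Sc_pos)

text \<open>S has only poles, of order at least 2, and the expansion uses nonnegative powers of the
  second variable. So a contraction pairs a negative mode of the first operator with a nonnegative
  mode of the second.\<close>

lemma Sdiff_zero: "\<not> (e < 0 \<and> 0 \<le> f) \<Longrightarrow> Sdiff c p q e f = 0"
  by (cases "0 \<le> f") (auto simp: Sdiff_def diff_coeff_def Sc_zero)

section \<open>Binomial identities\<close>

lemma diff_coeff_neg: "f < 0 \<Longrightarrow> diff_coeff e f = 0"
  by (simp add: diff_coeff_def)

lemma diff_coeff_nat: "diff_coeff e (int k) = (- 1) ^ k * ((of_int e + of_nat k) gchoose k)"
  by (simp add: diff_coeff_def)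

lemma diff_coeff_negated: "diff_coeff e (int k) = (- of_int e - 1) gchoose k"
  by (simp add: diff_coeff_nat gbinomial_negated_upper[of "- of_int e - 1"] add.commute)

lemma diff_coeff_shift: "diff_coeff (n - int k) (int k) = (- 1) ^ k * (of_int n gchoose k)"
  by (simp add: diff_coeff_nat)

text \<open>Comparison of coefficients in (x - y)^n (x - y)^m = (x - y)^(n+m).\<close>

lemma diff_coeff_vandermonde:
  "(\<Sum>k\<le>t. diff_coeff (n - int k) (int k) * diff_coeff (m - int (t - k)) (int (t - k))) =
    diff_coeff (n + m - int t) (int t)"
proof -
  have "diff_coeff (n - int k) (int k) * diff_coeff (m - int (t - k)) (int (t - k)) =
      (- 1) ^ t * ((of_int n gchoose k) * (of_int m gchoose (t - k)))" if "k \<le> t" for k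
  proof -
    have "(- 1 :: complex) ^ t = (- 1) ^ k * (- 1) ^ (t - k)"
      using that by (simp flip: power_add)
    then show ?thesis
      by (simp only: diff_coeff_shift mult_ac)
  qed
  then have "(\<Sum>k\<le>t. diff_coeff (n - int k) (int k) * diff_coeff (m - int (t - k)) (int (t - k))) =
      (\<Sum>k\<le>t. (- 1) ^ t * ((of_int n gchoose k) * (of_int m gchoose (t - k))))"
    by (intro sum.cong) simp_all
  then show ?thesis
    by (simp only: diff_coeff_shift gbinomial_Vandermonde[symmetric] atMost_atLeast0 of_int_add
        sum_distrib_left)
qed

text \<open>In generating functions: (1 + y)^q (1 + y)^(-b-1) = (1 + y)^(-(b-q)-1).\<close>

lemma diff_coeff_binomial:
  "(\<Sum>j\<le>K. (of_int q gchoose j) * diff_coeff b (int (K - j))) = diff_coeff (b - q) (int K)"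
proof -
  have "- of_int (b - q) - 1 = (of_int q :: complex) + (- of_int b - 1)"
    by simp
  then show ?thesis
    by (simp only: diff_coeff_negated gbinomial_Vandermonde[symmetric] atMost_atLeast0)
qed

lemma gbinomial_of_nat_symmetric: "(of_nat (m + k) :: complex) gchoose k = of_nat (m + k) gchoose m"
  by (metis add_diff_cancel_right' binomial_gbinomial binomial_symmetric le_add2)

lemma gbinomial_of_nat_symmetric':
  "(of_nat m + of_nat k :: complex) gchoose k = (of_nat m + of_nat k) gchoose m"
  using gbinomial_of_nat_symmetric[of m k] by simp

text \<open>The coefficients of z0^(-1) delta((z1-z2)/z0) - z0^(-1) delta((z2-z1)/(-z0)) = z2^(-1)
  delta((z1-z0)/z2), with n = -a-1 the power of z1 - z2. The five cases are the signs of a and b,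
  with b compared to n when (z1-z2)^n is a polynomial.\<close>

lemma diff_coeff_delta:
  assumes n: "n = - a - 1"
  shows "diff_coeff b (n - b) - (- 1) powi n * diff_coeff (n - b) b = diff_coeff b a"
proof -
  have powi: "(- 1 :: complex) powi n * (- 1) ^ k = (- 1) powi (n + int k)" for n k
    by (simp add: power_int_add)
  have powi_cong: "(- 1 :: complex) powi m = (- 1) powi l" if ev: "even (m - l)" for m l
  proof -
    obtain j where "m - l = 2 * j"
      using ev by (elim evenE)
    then have "m = l + 2 * j" by simp
    then show ?thesis
      by (simp add: power_int_add power_int_mult)
  qed
  have neg: "(- of_nat k - 1 :: complex) gchoose m = (- 1) ^ m * (of_nat (k + m) gchoose m)" for k m
    using gbinomial_negated_upper[of "- of_nat k - 1 :: complex" m] by (simp add: algebra_simps)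
  have vanish: "(of_nat k :: complex) gchoose m = 0" if "k < m" for k m
    using that by (metis binomial_eq_0 binomial_gbinomial of_nat_0)
  consider (1) k l where "a = int k" "b = int l" | (2) k l where "a = int k" "b = - int l - 1"
    | (3) m l where "n = int m" "b = int l" "l \<le> m" | (4) m l where "n = int m" "b = int l" "m < l"
    | (5) m l where "n = int m" "b = - int l - 1"
  proof -
    have "a = int (nat a) \<or> n = int (nat n)" "b = int (nat b) \<or> b = - int (nat (- b - 1)) - 1"
      using n by linarith+
    then show ?thesis using that by (metis leI)
  qed
  then show ?thesis
  proof cases
    case 1
    have "diff_coeff (n - b) b = (- 1) ^ l * ((- of_nat k - 1) gchoose l)"
      using n by (simp add: 1 diff_coeff_nat)
    also have "\<dots> = of_nat (k + l) gchoose l"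
      by (simp add: neg flip: power_add)
    finally have "(- 1) powi n * diff_coeff (n - b) b = - ((- 1) ^ k * (of_nat (k + l) gchoose k))"
      using n powi_cong[of n "int k + 1"] by (simp add: 1 gbinomial_of_nat_symmetric'[of k l] power_int_add)
    moreover have "diff_coeff b (n - b) = 0"
      using n by (intro diff_coeff_neg) (simp add: 1)
    ultimately show ?thesis
      by (simp add: 1 diff_coeff_nat add.commute)
  next
    case 2
    have "diff_coeff (n - b) b = 0"
      by (intro diff_coeff_neg) (simp add: 2)
    moreover have "diff_coeff b (n - b) = of_nat l gchoose k"
    proof (cases "k \<le> l")
      case True
      then have "n - b = int (l - k)"
        using n by (simp add: 2 of_nat_diff)
      then have "diff_coeff b (n - b) = of_nat l gchoose (l - k)"
        by (simp only: diff_coeff_negated) (simp add: 2)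
      then show ?thesis
        using True by (metis binomial_gbinomial binomial_symmetric)
    next
      case False
      then have "n - b < 0" using n by (simp add: 2)
      with False show ?thesis by (simp add: diff_coeff_neg vanish)
    qed
    moreover have "diff_coeff b a = of_nat l gchoose k"
      by (simp add: 2 diff_coeff_negated)
    ultimately show ?thesis by simp
  next
    case 3
    then have nb: "n - b = int (m - l)" by simp
    have "diff_coeff b (n - b) = (- 1) ^ (m - l) * (of_nat m gchoose (m - l))"
    proof -
      have "of_int b + of_nat (m - l) = (of_nat m :: complex)"
        using 3 by (simp add: of_nat_diff)
      then show ?thesis by (simp only: nb diff_coeff_nat)
    qed
    moreover have "diff_coeff (n - b) b = (- 1) ^ l * (of_nat m gchoose l)"
      by (simp add: 3 diff_coeff_nat)
    moreover have "(- 1 :: complex) ^ (m - l) = (- 1) ^ m * (- 1) ^ l"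
      using 3(3) by (metis (no_types) le_add_diff_inverse2 power_add minus_one_mult_self mult.assoc mult.right_neutral)
    moreover have "(of_nat m :: complex) gchoose (m - l) = of_nat m gchoose l"
      using 3(3) by (metis binomial_gbinomial binomial_symmetric)
    moreover have "diff_coeff b a = 0"
      using n 3 by (intro diff_coeff_neg) simp
    ultimately show ?thesis by (simp add: 3)
  next
    case 4
    have "diff_coeff b (n - b) = 0"
      using 4 by (intro diff_coeff_neg) simp
    moreover have "diff_coeff (n - b) b = 0"
      using 4 by (simp add: diff_coeff_nat vanish)
    moreover have "diff_coeff b a = 0"
      using n 4 by (intro diff_coeff_neg) simp
    ultimately show ?thesis by simp
  next
    case 5
    then have nb: "n - b = int (m + l + 1)" by simp
    have "diff_coeff b (n - b) = 0"
      by (simp only: nb diff_coeff_negated) (simp add: 5 vanish)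
    moreover have "diff_coeff (n - b) b = 0"
      using 5 by (intro diff_coeff_neg) simp
    moreover have "diff_coeff b a = 0"
      using n 5 by (intro diff_coeff_neg) simp
    ultimately show ?thesis by simp
  qed
qed

lemma gbinomial_rev:
  "((x :: complex) gchoose (j + r)) * (of_nat (j + r) gchoose r) = (x gchoose r) * ((x - of_nat r) gchoose j)"
  using gbinomial_trinomial_revision[of r "j + r" x] by simp

lemma gbinomial_exchange:
  "((y :: complex) gchoose l) * ((y - of_nat l) gchoose r) = (y gchoose r) * ((y - of_nat r) gchoose l)"
  using gbinomial_rev[of y l r] gbinomial_rev[of y r l]
  unfolding add.commute[of r l] gbinomial_of_nat_symmetric[of l r] by metis

text \<open>The coefficient of z^k in the r-th divided derivative of z^(k+r).\<close>

definition mbin :: "int \<Rightarrow> nat \<Rightarrow> complex"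
  where "mbin k r = (of_int k + of_nat r) gchoose r"

lemma mbin_0 [simp]: "mbin k 0 = 1"
  by (simp add: mbin_def)

text \<open>A divided derivative never turns a nonnegative power into a negative one: z^(k+r) with 0
  <= k+r < r is annihilated. So differentiation does not disturb normal ordering.\<close>

lemma mbin_zero: "k < 0 \<Longrightarrow> 0 \<le> k + int r \<Longrightarrow> mbin k r = 0"
proof -
  assume "k < 0" "0 \<le> k + int r"
  then obtain m where "k + int r = int m" "m < r"
    by (metis add_less_same_cancel2 nonneg_int_cases of_nat_less_iff)
  moreover have "(of_nat m :: complex) gchoose r = 0" if "m < r"
    using that by (metis binomial_eq_0 binomial_gbinomial of_nat_0)
  moreover have "of_int k + of_nat r = (of_int (k + int r) :: complex)" by simp
  ultimately show ?thesis by (metis mbin_def of_int_of_nat_eq)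
qed

text \<open>The j-th divided derivative of the r-th one is binom(j+r, r) times the one of order
  j+r.\<close>

lemma mbin_comp:
  "((of_nat (j + r) :: complex) gchoose r) * mbin k (j + r) = ((of_int k + of_nat j) gchoose j) * mbin (k + int j) r"
  using gbinomial_rev[of "of_int k + of_nat (j + r)" j r] by (simp add: mbin_def algebra_simps)

text \<open>The coefficient of \<open>z\<^sup>-\<^sup>n u\<^sup>r v\<^sup>a\<close> in the entry \<open>(p, q)\<close> of \<open>-S(z + u - v)\<close>.\<close>

definition Kc :: "complex \<Rightarrow> 'n::finite \<times> 'n \<Rightarrow> 'n \<times> 'n \<Rightarrow> nat \<Rightarrow> nat \<Rightarrow> nat \<Rightarrow> complex fps"
  where "Kc c p q r a n = (if r + a \<le> n
    then - fps_const ((- of_nat (n - (r + a)) gchoose (r + a)) * of_nat ((r + a) choose r) * (- 1) ^ a)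
      * Sc c p q (- int (n - (r + a)))
    else 0)"

lemma Kc_0: "Kc c p q r a 0 = 0"
  by (simp add: Kc_def Sc_zero)

lemma Kc_dvd: "fps_X ^ (n - (r + a) - 2) dvd Kc c p q r a n"
  using dvd_mult[OF Sc_dvd[of "n - (r + a)" c p q]] by (auto simp: Kc_def)

lemma Kc_tr2: "(\<Sum>k\<in>UNIV. Kc c (i, k) (j, k) r a n) = 0"
  by (cases "r + a \<le> n") (simp_all add: Kc_def Sc_tr2 sum_negf flip: sum_distrib_left)

lemma Tshift_Kc_tr1: "(\<Sum>k\<in>UNIV. fps_nth (Tshift c (k, i) (k, j) a r) n) = 0"
  by (cases "a + r \<le> n")
    (simp_all add: Tshift_def Tc_def sum_subtractf Sc_tr1 right_diff_distrib flip: sum_distrib_left)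

text \<open>T(z) = S(z) - S(-z) on the level of kernels. The first part is minus the kernel with
  arguments (a, r); the second is, by the symmetry \<open>Sc_swap\<close>, the kernel with arguments
  (r, a) at -z, whence the sign (-1)^n.\<close>

lemma Tshift_Kc:
  "fps_nth (Tshift c (j, i) (j, i) a r) n = (- 1) ^ n * Kc c (i, j) (i, j) r a n - Kc c (j, i) (j, i) a r n"
proof (cases "r + a \<le> n")
  case True
  then obtain s where n: "n = s + (r + a)"
    by (metis add.commute le_Suc_ex)
  define X where "X = fps_const ((- of_nat s gchoose (r + a)) * of_nat ((r + a) choose r) :: complex)"
  define \<sigma> where "\<sigma> = Sc c (j, i) (j, i) (- int s)"
  have const: "fps_const ((- 1 :: complex) ^ m) = (- 1) ^ m" for m
    by (induction m) (simp_all flip: fps_const_mult fps_const_neg)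
  have choose: "(a + r) choose r = (a + r) choose a"
    using binomial_symmetric[of r "a + r"] by simp
  have ns: "n - (r + a) = s" "n - (a + r) = s" "r + a \<le> n" "a + r \<le> n"
    by (simp_all add: n)
  have T: "fps_nth (Tshift c (j, i) (j, i) a r) n = X * (- 1) ^ r * (\<sigma> - (- 1) ^ s * \<sigma>)"
    by (simp only: Tshift_def Abs_fps_inverse UNIV_I ns if_True fps_nth_Abs_fps Tc_def X_def \<sigma>_def
        choose const fps_const_mult[symmetric] add.commute[of r a])
  have K1: "Kc c (i, j) (i, j) r a n = - (X * (- 1) ^ a * \<sigma>)"
    by (simp only: Kc_def ns if_True X_def \<sigma>_def const fps_const_mult[symmetric] Sc_swap[of c i j]
        mult_minus_left)
  have K2: "Kc c (j, i) (j, i) a r n = - (X * (- 1) ^ r * \<sigma>)"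
    by (simp only: Kc_def ns if_True X_def \<sigma>_def const fps_const_mult[symmetric]
        mult_minus_left choose add.commute[of r a])
  have "(- 1 :: complex fps) ^ n * (- 1) ^ a = (- 1) ^ s * (- 1) ^ r * ((- 1) ^ a * (- 1) ^ a)"
    by (simp only: n power_add mult.assoc)
  also have "(- 1 :: complex fps) ^ a * (- 1) ^ a = 1"
    by (simp flip: power_add)
  finally have sign: "(- 1 :: complex fps) ^ n * (- 1) ^ a = (- 1) ^ s * (- 1) ^ r" by simp
  have "(- 1) ^ n * Kc c (i, j) (i, j) r a n = - (X * ((- 1) ^ n * (- 1) ^ a) * \<sigma>)"
    unfolding K1 by (simp only: mult_minus_right mult_ac)
  then show ?thesis
    unfolding T K2 sign by (simp add: right_diff_distrib mult_ac)
qed (simp add: Tshift_def Kc_def add.commute)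

lemma Tshift_nth_dvd: "fps_X ^ (n - (a + r) - 2) dvd fps_nth (Tshift c p q a r) n"
proof -
  have "fps_X ^ (n - (a + r) - 2) dvd Tc c p q (n - (a + r))"
    unfolding Tc_def by (intro dvd_diff dvd_mult Sc_dvd)
  then show ?thesis
    by (simp add: Tshift_def dvd_mult)
qed

text \<open>Divided derivatives of S(x - y) in both variables extract the u^r v^a term of S(x + u -
  y - v). Differentiating after or before the expansion of powers of x - y gives the two sides; the
  exponent of the pole in the kernel is -(k+l).\<close>

lemma mode_commutator:
  "fps_const (mbin k r * mbin l a) * Sdiff c p q (k + int r) (l + int a) =
    - (fps_const (diff_coeff k l) * Kc c p q r a (nat (- (k + l))))"
proof (cases "0 \<le> l")
  case False
  then have "mbin l a = 0 \<or> l + int a < 0"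
    using mbin_zero[of l a] by fastforce
  then show ?thesis
    using False by (auto simp: Sdiff_zero diff_coeff_neg)
next
  case l: True
  show ?thesis
  proof (cases "k + l + int (r + a) \<le> 0")
    case False
    then have "Sdiff c p q (k + int r) (l + int a) = 0"
      by (simp add: Sdiff_def Sc_zero)
    moreover have "Kc c p q r a (nat (- (k + l))) = 0"
      using False by (auto simp: Kc_def Sc_zero)
    ultimately show ?thesis by simp
  next
    case True
    define s where "s = nat (- (k + l + int (r + a)))"
    have k: "k = - int s - l - int (r + a)" using True by (simp add: s_def)
    obtain m where m: "l = int m" using l nonneg_int_cases by blast
    define x where "x = (- of_nat s :: complex)"
    have n: "nat (- (k + l)) = s + (r + a)" by (simp add: k)
    have e: "k + int r + (l + int a) = - int s" by (simp add: k)
    have "mbin k r = (x - of_nat (m + a)) gchoose r"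
    proof -
      have "of_int k + of_nat r = x - of_nat (m + a)"
        by (simp add: k m x_def)
      then show ?thesis by (simp only: mbin_def)
    qed
    moreover have "mbin l a = of_nat (m + a) gchoose a"
      by (simp add: mbin_def m)
    moreover have "diff_coeff (k + int r) (l + int a) = (- 1) ^ (m + a) * (x gchoose (m + a))"
      using diff_coeff_nat[of "k + int r" "m + a"] by (simp add: k m x_def algebra_simps)
    ultimately have 1: "mbin k r * mbin l a * diff_coeff (k + int r) (l + int a) =
        (- 1) ^ (m + a) * (((x gchoose (m + a)) * (of_nat (m + a) gchoose a)) * ((x - of_nat (m + a)) gchoose r))"
      by simp
    have "((x gchoose (m + a)) * (of_nat (m + a) gchoose a)) * ((x - of_nat (m + a)) gchoose r) =
        (x gchoose a) * (((x - of_nat a) gchoose m) * ((x - of_nat a - of_nat m) gchoose r))"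
      unfolding gbinomial_rev by (simp add: diff_diff_eq add.commute mult.assoc)
    also have "\<dots> = ((x gchoose a) * ((x - of_nat a) gchoose r)) * ((x - of_nat a - of_nat r) gchoose m)"
      by (simp add: gbinomial_exchange[of _ m r])
    also have "\<dots> = ((x gchoose (r + a)) * (of_nat (r + a) gchoose a)) * ((x - of_nat (r + a)) gchoose m)"
      unfolding gbinomial_rev by (simp add: diff_diff_eq add.commute mult.assoc)
    finally have 2: "((x gchoose (m + a)) * (of_nat (m + a) gchoose a)) * ((x - of_nat (m + a)) gchoose r) =
        ((x gchoose (r + a)) * (of_nat (r + a) gchoose a)) * ((x - of_nat (r + a)) gchoose m)" .
    have 3: "diff_coeff k l = (- 1) ^ m * ((x - of_nat (r + a)) gchoose m)"
    proof -
      have "of_int k + of_nat m = x - of_nat (r + a)"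
        by (simp add: k m x_def)
      then show ?thesis by (simp only: m diff_coeff_nat)
    qed
    have 4: "of_nat ((r + a) choose r) = (of_nat (r + a) gchoose a :: complex)"
      using gbinomial_of_nat_symmetric'[of r a] by (simp add: binomial_gbinomial)
    have "mbin k r * mbin l a * diff_coeff (k + int r) (l + int a) =
        diff_coeff k l * ((x gchoose (r + a)) * of_nat ((r + a) choose r) * (- 1) ^ a)"
      unfolding 1 2 3 4 by (simp add: power_add)
    then have "fps_const (mbin k r * mbin l a) * Sdiff c p q (k + int r) (l + int a) =
        fps_const (diff_coeff k l * ((x gchoose (r + a)) * of_nat ((r + a) choose r) * (- 1) ^ a)) * Sc c p q (- int s)"
      by (simp only: Sdiff_def e mult.assoc[symmetric] fps_const_mult)
    moreover have "Kc c p q r a (nat (- (k + l))) =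
        - fps_const ((x gchoose (r + a)) * of_nat ((r + a) choose r) * (- 1) ^ a) * Sc c p q (- int s)"
      unfolding n by (simp add: Kc_def x_def)
    ultimately show ?thesis
      by (simp only: mult_minus_left mult_minus_right minus_minus mult.assoc[symmetric] fps_const_mult)
  qed
qed

section \<open>Families of derivations\<close>

definition fps_summable :: "('i \<Rightarrow> complex fps) \<Rightarrow> bool"
  where "fps_summable d \<longleftrightarrow> (\<forall>K. finite {i. \<not> fps_X ^ K dvd d i})"

lemma hsummable_fps_scale: "fps_summable d \<Longrightarrow> hsummable (\<lambda>i. d i *\<^sub>h u) UNIV"
  unfolding fps_summable_def
proof (rule hsummableI)
  fix K assume "\<forall>K. finite {i. \<not> fps_X ^ K dvd d i}"
  then show "\<exists>F. finite F \<and> (\<forall>x\<in>UNIV - F. d x *\<^sub>h u \<in> hpow K UNIV)"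
    by (intro exI[of _ "{i. \<not> fps_X ^ K dvd d i}"]) (auto intro: hpow_dvd)
qed

text \<open>By the Leibniz rule, convergence on generators of the algebra gives convergence on
  monomials, which generate the module.\<close>

lemma hsummable_hder:
  assumes "\<And>p. trace_free (d p)" "\<And>g. fps_summable (\<lambda>p. d p g)"
  shows "hsummable (\<lambda>p. hder (d p) u) UNIV"
proof (rule hlinear_finite_exceptions[OF hgen_Hplus])
  show "hlinear (hder (d p))" for p
    by (rule hlinear_hder[OF assms(1)])
  have "hsummable (\<lambda>p. hder (d p) (xmon l)) UNIV" for l
  proof (induction l)
    case Nil
    then show ?case by (simp add: hder_1[OF assms(1)] hsummable_def)
  next
    case (Cons g l)
    then show ?case
      by (auto simp: hder_xgen[OF assms(1)] intro!: hsummable_add hsummable_fps_scale[OF assms(2)]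
          hsummable_hlinear[OF _ hlinear_mult_Hplus])
  qed
  then show "hsummable (\<lambda>p. hder (d p) u) UNIV" if "u \<in> range xmon" for u
    using that by blast
qed

lemma fps_summableI: "(\<And>n. fps_X ^ (n - m) dvd d n) \<Longrightarrow> fps_summable d"
  unfolding fps_summable_def
proof
  fix K assume *: "\<And>n. fps_X ^ (n - m) dvd d n"
  have "fps_X ^ K dvd d n" if "K + m \<le> n" for n
    using that by (intro dvd_trans[OF le_imp_power_dvd *[of n]]) simp
  then have "{n. \<not> fps_X ^ K dvd d n} \<subseteq> {..<K + m}"
    by (auto simp: not_less[symmetric])
  then show "finite {n. \<not> fps_X ^ K dvd d n}"
    by (rule finite_subset) simp
qed

lemma hder_scale:
  assumes "trace_free d"
  shows "hder (\<lambda>g. f * d g) u = f *\<^sub>h hder d u"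
proof (rule Hplus_hlinear_eqI[OF hcs_Hplus, of "hder (\<lambda>g. f * d g)" "\<lambda>u. f *\<^sub>h hder d u"])
  have d': "trace_free (\<lambda>g. f * d g)"
    using assms by (simp add: trace_free_def flip: sum_distrib_left)
  show "hlinear (hder (\<lambda>g. f * d g))" "hlinear (\<lambda>u. f *\<^sub>h hder d u)"
    using hlinear_hder[OF d'] hlinear_hder[OF assms] by (auto intro: hlinear_fun_scale)
  show "hder (\<lambda>g. f * d g) (xmon l) = f *\<^sub>h hder d (xmon l)" for l
    by (induction l) (simp_all add: hder_1 hder_xgen assms d' Hplus_mult_scale hscale_add_right)
qed

section \<open>Fields and normally ordered products\<close>

definition is_field :: "('w::hmodule \<Rightarrow> int \<Rightarrow> 'w) \<Rightarrow> bool"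
  where "is_field A \<longleftrightarrow> (\<forall>m. hlinear (\<lambda>w. A w m)) \<and> (\<forall>w. laurent_h (A w))"

text \<open>The condition of \<open>is_field\<close> with the mode number as first argument, because
  one factor of a normally ordered product is treated mode by mode.\<close>

definition is_modes :: "(int \<Rightarrow> 'w::hmodule \<Rightarrow> 'w) \<Rightarrow> bool"
  where "is_modes f \<longleftrightarrow> (\<forall>k. hlinear (f k)) \<and> (\<forall>w. laurent_h (\<lambda>k. f k w))"

text \<open>The part of \<open>:f(z) A(z):\<close> that comes from the mode \<open>f\<^sub>k\<close>: nonnegative modes act from the left.\<close>

definition nop :: "(int \<Rightarrow> 'w \<Rightarrow> 'w) \<Rightarrow> int \<Rightarrow> ('w \<Rightarrow> int \<Rightarrow> 'w) \<Rightarrow> 'w \<Rightarrow> int \<Rightarrow> 'w::hmodule"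
  where "nop f k A w m = (if 0 \<le> k then f k (A w (m - k)) else A (f k w) (m - k))"

definition nfield :: "(int \<Rightarrow> 'w \<Rightarrow> 'w) \<Rightarrow> ('w \<Rightarrow> int \<Rightarrow> 'w) \<Rightarrow> 'w \<Rightarrow> int \<Rightarrow> 'w::hmodule"
  where "nfield f A w m = hsum (\<lambda>k. nop f k A w m) UNIV"

text \<open>Modulo h^K the poles are bounded uniformly in the family, and each coefficient
  converges. This makes the sum a field again and lets it be exchanged with a normally ordered
  product.\<close>

definition unif_family :: "'x set \<Rightarrow> ('x \<Rightarrow> 'w::hmodule \<Rightarrow> int \<Rightarrow> 'w) \<Rightarrow> bool"
  where "unif_family Q B \<longleftrightarrow>
    (\<forall>x\<in>Q. \<forall>m. hlinear (\<lambda>w. B x w m)) \<and>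
    (\<forall>w K. \<exists>M. \<forall>m\<le>M. \<forall>x\<in>Q. B x w m \<in> hpow K UNIV) \<and>
    (\<forall>w m. hsummable (\<lambda>x. B x w m) Q)"

lemma is_field_lin: "is_field A \<Longrightarrow> hlinear (\<lambda>w. A w m)"
  and is_field_laurent: "is_field A \<Longrightarrow> laurent_h (A w)"
  by (auto simp: is_field_def)

lemma is_modes_lin: "is_modes f \<Longrightarrow> hlinear (f k)"
  and is_modes_laurent: "is_modes f \<Longrightarrow> laurent_h (\<lambda>k. f k w)"
  by (auto simp: is_modes_def)

lemma unif_family_lin: "unif_family Q B \<Longrightarrow> x \<in> Q \<Longrightarrow> hlinear (\<lambda>w. B x w m)"
  and unif_family_summable: "unif_family Q B \<Longrightarrow> hsummable (\<lambda>x. B x w m) Q"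
  unfolding unif_family_def by blast+

lemma unif_family_laurent:
  assumes "unif_family Q B"
  obtains M where "\<And>m x. m \<le> M \<Longrightarrow> x \<in> Q \<Longrightarrow> B x w m \<in> hpow K UNIV"
  using assms unfolding unif_family_def by blast

lemma laurent_h_obtain:
  assumes "laurent_h a"
  obtains M where "\<And>m. m \<le> M \<Longrightarrow> a m \<in> hpow K UNIV"
  using assms unfolding laurent_h_def by blast

lemma unif_family_single: "is_field A \<Longrightarrow> unif_family {()} (\<lambda>_. A)"
  by (auto simp: unif_family_def is_field_def laurent_h_def)

lemma hlinear_nop:
  assumes "is_modes f" "\<And>m. hlinear (\<lambda>w. A w m)"
  shows "hlinear (\<lambda>w. nop f k A w m)"
  using hlinear_compose[OF is_modes_lin[OF assms(1)] assms(2)]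
    hlinear_compose[OF assms(2) is_modes_lin[OF assms(1)]]
  by (cases "0 \<le> k") (simp_all add: nop_def)

lemma modes_exceptions:
  assumes "is_modes f"
  shows "finite {k. k < 0 \<and> f k w \<notin> hpow K UNIV}"
proof -
  obtain M where M: "\<And>k. k \<le> M \<Longrightarrow> f k w \<in> hpow K UNIV"
    using laurent_h_obtain[OF is_modes_laurent[OF assms, of w], of K] by blast
  have "{k. k < 0 \<and> f k w \<notin> hpow K UNIV} \<subseteq> {M..0}"
  proof
    fix k assume "k \<in> {k. k < 0 \<and> f k w \<notin> hpow K UNIV}"
    then have "k < 0" "\<not> k \<le> M" using M by blast+
    then show "k \<in> {M..0}" by simp
  qed
  then show ?thesis by (rule finite_subset) simp
qed

lemma nop_laurent:
  assumes f: "is_modes f" and B: "unif_family Q B"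
  shows "\<exists>M. \<forall>m\<le>M. \<forall>k. \<forall>x\<in>Q. nop f k (B x) w m \<in> hpow K UNIV"
proof -
  let ?E = "{k. k < 0 \<and> f k w \<notin> hpow K UNIV}"
  have fin: "finite ?E" by (rule modes_exceptions[OF f])
  obtain M0 where M0: "\<And>m x. m \<le> M0 \<Longrightarrow> x \<in> Q \<Longrightarrow> B x w m \<in> hpow K UNIV"
    using unif_family_laurent[OF B, of w K] by blast
  have "\<forall>k. \<exists>M. \<forall>m\<le>M. \<forall>x\<in>Q. B x (f k w) m \<in> hpow K UNIV"
    using B unfolding unif_family_def by blast
  then obtain N where N: "\<And>k m x. m \<le> N k \<Longrightarrow> x \<in> Q \<Longrightarrow> B x (f k w) m \<in> hpow K UNIV"
    by metis
  \<comment> \<open>Only finitely many negative modes move w outside h^K. Each of them contributes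
    its own pole bound, shifted by k; nonnegative modes are covered by \<open>M0\<close>.\<close>
  define M where "M = Min (insert M0 ((\<lambda>k. N k + k) ` ?E))"
  have M: "M \<le> M0" "\<And>k. k \<in> ?E \<Longrightarrow> M \<le> N k + k"
    using fin by (auto simp: M_def)
  have "nop f k (B x) w m \<in> hpow K UNIV" if mx: "m \<le> M" "x \<in> Q" for m k x
  proof (cases "0 \<le> k")
    case True
    then have "B x w (m - k) \<in> hpow K UNIV"
      using mx M(1) by (intro M0) auto
    then show ?thesis
      using True by (simp add: nop_def hpow_hlinear[OF is_modes_lin[OF f]])
  next
    case k: False
    show ?thesis
    proof (cases "k \<in> ?E")
      case True
      then have "m - k \<le> N k"
        using M(2)[OF True] mx by simp
      then show ?thesis
        using k N mx(2) by (simp add: nop_def)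
    next
      case False
      then have "f k w \<in> hpow K UNIV"
        using k by simp
      then show ?thesis
        using k hpow_hlinear[OF unif_family_lin[OF B mx(2)]] by (simp add: nop_def)
    qed
  qed
  then show ?thesis by blast
qed

context
  assumes hc: "hcs TYPE('w::hmodule)"
begin

lemma unif_family_nop:
  fixes f :: "int \<Rightarrow> 'w \<Rightarrow> 'w"
  assumes f: "is_modes f" and B: "unif_family Q B"
  shows "unif_family (UNIV \<times> Q) (\<lambda>(k, x). nop f k (B x))"
  unfolding unif_family_def
proof (intro conjI allI ballI)
  show "hlinear (\<lambda>w. (case p of (k, x) \<Rightarrow> nop f k (B x)) w m)" if pQ: "p \<in> UNIV \<times> Q" for p m
  proof -
    obtain k x where p: "p = (k, x)" "x \<in> Q" using pQ by auto
    show ?thesis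
      using hlinear_nop[OF f, of "B x" k m] unif_family_lin[OF B p(2)] by (simp add: p)
  qed
  show "\<exists>M. \<forall>m\<le>M. \<forall>p\<in>UNIV \<times> Q. (case p of (k, x) \<Rightarrow> nop f k (B x)) w m \<in> hpow K UNIV" for w K
    using nop_laurent[OF f B, of w K] by auto
  show "hsummable (\<lambda>p. (case p of (k, x) \<Rightarrow> nop f k (B x)) w m) (UNIV \<times> Q)" for w m
  proof (rule hsummable_SigmaI)
    fix K
    let ?E = "{k. k < 0 \<and> f k w \<notin> hpow K UNIV}"
    obtain M0 where M0: "\<And>m x. m \<le> M0 \<Longrightarrow> x \<in> Q \<Longrightarrow> B x w m \<in> hpow K UNIV"
      using unif_family_laurent[OF B, of w K] by blast
    \<comment> \<open>A nonnegative mode k beyond m - M0 meets the coefficient with index m - k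
      below M0, which is already small.\<close>
    let ?F = "?E \<union> {0..m - M0}"
    have "nop f k (B x) w m \<in> hpow K UNIV" if k: "k \<notin> ?F" "x \<in> Q" for k x
    proof (cases "0 \<le> k")
      case True
      then have "B x w (m - k) \<in> hpow K UNIV"
        using k by (intro M0) auto
      then show ?thesis
        using True by (simp add: nop_def hpow_hlinear[OF is_modes_lin[OF f]])
    next
      case False
      then have "f k w \<in> hpow K UNIV"
        using k by simp
      then show ?thesis
        using False hpow_hlinear[OF unif_family_lin[OF B k(2)]] by (simp add: nop_def)
    qed
    moreover have "finite ?F"
      using modes_exceptions[OF f] by simp
    ultimately show "\<exists>F. finite F \<and> (\<forall>k\<in>UNIV - F. \<forall>x\<in>Q. (case (k, x) of (k, x) \<Rightarrow> nop f k (B x)) w m \<in> hpow K UNIV)"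
      by (intro exI[of _ ?F]) auto
  next
    fix k :: int
    show "hsummable (\<lambda>x. (case (k, x) of (k, x) \<Rightarrow> nop f k (B x)) w m) Q"
      using hsummable_hlinear[OF unif_family_summable[OF B] is_modes_lin[OF f]]
        unif_family_summable[OF B]
      by (cases "0 \<le> k") (simp_all add: nop_def)
  qed
qed

lemma is_field_hsum:
  fixes B :: "'x \<Rightarrow> 'w \<Rightarrow> int \<Rightarrow> 'w"
  assumes B: "unif_family Q B"
  shows "is_field (\<lambda>w m. hsum (\<lambda>x. B x w m) Q)"
  unfolding is_field_def laurent_h_def
proof (intro conjI allI)
  show "hlinear (\<lambda>w. hsum (\<lambda>x. B x w m) Q)" for m
    by (rule hlinear_hsum[OF hc unif_family_lin[OF B] unif_family_summable[OF B]])
  fix w K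
  obtain M where M: "\<And>m x. m \<le> M \<Longrightarrow> x \<in> Q \<Longrightarrow> B x w m \<in> hpow K UNIV"
    using unif_family_laurent[OF B, of w K] by blast
  show "\<exists>M. \<forall>m\<le>M. hsum (\<lambda>x. B x w m) Q \<in> hpow K UNIV"
    using M by (intro exI[of _ M] allI impI hsum_in_hpow[OF hc unif_family_summable[OF B]])
qed

lemma nop_hsum:
  fixes f :: "int \<Rightarrow> 'w \<Rightarrow> 'w"
  assumes f: "is_modes f" and B: "unif_family Q B"
  shows "nop f k (\<lambda>w m. hsum (\<lambda>x. B x w m) Q) w m = hsum (\<lambda>x. nop f k (B x) w m) Q"
  using hsum_hlinear[OF hc hc unif_family_summable[OF B] is_modes_lin[OF f]]
  by (cases "0 \<le> k") (simp_all add: nop_def)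

lemma nfield_hsum:
  fixes f :: "int \<Rightarrow> 'w \<Rightarrow> 'w"
  assumes f: "is_modes f" and B: "unif_family Q B"
  shows "nfield f (\<lambda>w m. hsum (\<lambda>x. B x w m) Q) w m = hsum (\<lambda>(k, x). nop f k (B x) w m) (UNIV \<times> Q)"
  using hsum_Sigma[OF hc unif_family_summable[OF unif_family_nop[OF f B], of w m]]
  by (simp add: nfield_def nop_hsum[OF f B] case_prod_unfold)

lemma nop_summable:
  fixes f :: "int \<Rightarrow> 'w \<Rightarrow> 'w"
  assumes "is_modes f" "is_field A"
  shows "hsummable (\<lambda>k. nop f k A w m) UNIV"
  using hsummable_SigmaD(2)[OF hc unif_family_summable[OF unif_family_nop[OF assms(1) unif_family_single[OF assms(2)]], of w m]]
  by (simp add: hsum_finite[OF hc])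

lemma unif_family_nop_field:
  fixes f :: "int \<Rightarrow> 'w \<Rightarrow> 'w"
  assumes f: "is_modes f" and A: "is_field A"
  shows "unif_family UNIV (\<lambda>k. nop f k A)"
  unfolding unif_family_def
  using hlinear_nop[OF f is_field_lin[OF A]] nop_summable[OF f A]
    nop_laurent[OF f unif_family_single[OF A]] by simp

lemma is_field_nfield:
  fixes f :: "int \<Rightarrow> 'w \<Rightarrow> 'w"
  assumes "is_modes f" "is_field A"
  shows "is_field (nfield f A)"
  using is_field_hsum[OF unif_family_nop_field[OF assms]]
  by (simp add: nfield_def[abs_def])

text \<open>Only modes of equal sign have to commute: for different signs one mode acts to the left
  of A and the other to the right, so their order never arises.\<close>

lemma nfield_swap:
  fixes f g :: "int \<Rightarrow> 'w \<Rightarrow> 'w"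
  assumes f: "is_modes f" and g: "is_modes g" and A: "is_field A"
    and comm: "\<And>k l w. 0 \<le> k \<longleftrightarrow> 0 \<le> l \<Longrightarrow> f k (g l w) = g l (f k w)"
  shows "nfield f (nfield g A) w m = nfield g (nfield f A) w m"
proof -
  have eq: "nop f k (nop g l A) w m = nop g l (nop f k A) w m" for k l
    using comm[of k l] by (auto simp: nop_def algebra_simps)
  have 1: "nfield f (nfield g A) w m = hsum (\<lambda>(k, l). nop f k (nop g l A) w m) (UNIV \<times> UNIV)"
    using nfield_hsum[OF f unif_family_nop_field[OF g A]] by (simp add: nfield_def[abs_def])
  have 2: "nfield g (nfield f A) w m = hsum (\<lambda>(k, l). nop g k (nop f l A) w m) (UNIV \<times> UNIV)"
    using nfield_hsum[OF g unif_family_nop_field[OF f A]] by (simp add: nfield_def[abs_def])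
  have s: "hsummable (\<lambda>(k, l). nop g k (nop f l A) w m) (UNIV \<times> UNIV)"
    using unif_family_summable[OF unif_family_nop[OF g unif_family_nop_field[OF f A]], of w m]
    by (simp add: case_prod_unfold)
  have "hsum (\<lambda>(k, l). nop g k (nop f l A) w m) (prod.swap ` (UNIV \<times> UNIV)) =
      hsum (\<lambda>p. (case prod.swap p of (k, l) \<Rightarrow> nop g k (nop f l A) w m)) (UNIV \<times> UNIV)"
    using s by (intro hsum_reindex[OF hc]) simp_all
  also have "\<dots> = hsum (\<lambda>(k, l). nop f k (nop g l A) w m) (UNIV \<times> UNIV)"
    by (simp add: eq case_prod_unfold)
  finally show ?thesis
    using 1 2 by simp
qed

end

section \<open>Sums over matchings\<close>

definition matchings :: "(nat \<times> nat) set \<Rightarrow> (nat \<times> nat) set set"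
  where "matchings E = {i. i \<subseteq> E \<and> coords_distinct i}"

definition avoid :: "(nat \<times> nat) set \<Rightarrow> nat set \<Rightarrow> (nat \<times> nat) set"
  where "avoid E X = {e \<in> E. fst e \<notin> X \<and> snd e \<notin> X}"

lemma finite_matchings: "finite E \<Longrightarrow> finite (matchings E)"
  by (rule finite_subset[of _ "Pow E"]) (auto simp: matchings_def)

lemma coords_simps [simp]: "coords {} = {}" "coords (insert e i) = {fst e, snd e} \<union> coords i"
  by (auto simp: coords_def)

lemma coords_distinct_empty [simp]: "coords_distinct {}"
  by (simp add: coords_distinct_def)

lemma coords_eq: "coords i = (\<Union>x\<in>i. {fst x, snd x})"
  by (simp add: coords_def) blast

lemma coords_distinct_insert:
  assumes "e \<notin> i"
  shows "coords_distinct (insert e i) \<longleftrightarrow>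
    coords_distinct i \<and> fst e \<noteq> snd e \<and> {fst e, snd e} \<inter> coords i = {}"
proof
  assume "coords_distinct (insert e i)"
  then have 1: "\<forall>x\<in>insert e i. fst x \<noteq> snd x"
    and 2: "\<forall>x\<in>insert e i. \<forall>y\<in>insert e i. x \<noteq> y \<longrightarrow> {fst x, snd x} \<inter> {fst y, snd y} = {}"
    unfolding coords_distinct_def case_prod_unfold by - (elim conjE, assumption)+
  have "{fst e, snd e} \<inter> {fst x, snd x} = {}" if "x \<in> i" for x
  proof -
    have "e \<noteq> x" using assms that by blast
    then show ?thesis
      using 2[rule_format, OF insertI1 insertI2[OF that]] by simp
  qed
  then have "{fst e, snd e} \<inter> coords i = {}"
    by (simp only: coords_eq Int_UN_distrib UN_empty cong: SUP_cong_simp) simp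
  moreover have "coords_distinct i"
    unfolding coords_distinct_def case_prod_unfold
    using 1 2 by (meson insertI2)
  moreover have "fst e \<noteq> snd e" using 1 by blast
  ultimately show "coords_distinct i \<and> fst e \<noteq> snd e \<and> {fst e, snd e} \<inter> coords i = {}"
    by blast
next
  assume *: "coords_distinct i \<and> fst e \<noteq> snd e \<and> {fst e, snd e} \<inter> coords i = {}"
  then have 1: "\<forall>x\<in>i. fst x \<noteq> snd x"
    and 2: "\<forall>x\<in>i. \<forall>y\<in>i. x \<noteq> y \<longrightarrow> {fst x, snd x} \<inter> {fst y, snd y} = {}"
    unfolding coords_distinct_def case_prod_unfold by - (elim conjE, assumption)+
  have 3: "{fst e, snd e} \<inter> {fst x, snd x} = {}" if "x \<in> i" for x
  proof -
    have "{fst x, snd x} \<subseteq> coords i" using that unfolding coords_eq by (rule UN_upper)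
    then show ?thesis using * by blast
  qed
  show "coords_distinct (insert e i)"
    unfolding coords_distinct_def case_prod_unfold
  proof (intro conjI ballI impI)
    fix x assume "x \<in> insert e i" then show "fst x \<noteq> snd x"
      using 1 * by (elim insertE) simp_all
  next
    fix x y assume "x \<in> insert e i" "y \<in> insert e i" "x \<noteq> y"
    then show "{fst x, snd x} \<inter> {fst y, snd y} = {}"
      using 2 3 by (metis Int_commute insertE)
  qed
qed

lemma matchings_avoid_iff:
  "i \<in> matchings (avoid E X) \<longleftrightarrow> i \<in> matchings E \<and> coords i \<inter> X = {}"
proof -
  have 1: "i \<subseteq> avoid E X \<longleftrightarrow> i \<subseteq> E \<and> (\<forall>p\<in>i. fst p \<notin> X \<and> snd p \<notin> X)"
    unfolding avoid_def subset_iff mem_Collect_eq by blast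
  have 2: "coords i \<inter> X = {} \<longleftrightarrow> (\<forall>p\<in>i. fst p \<notin> X \<and> snd p \<notin> X)"
    unfolding coords_eq by blast
  show ?thesis
    unfolding matchings_def mem_Collect_eq 1 2 by (simp only: conj_ac)
qed

lemma coords_avoid: "i \<in> matchings (avoid E X) \<Longrightarrow> coords i \<inter> X = {}"
  by (simp add: matchings_avoid_iff)

text \<open>Recursion at a vertex x: a matching either leaves x free or has exactly one edge at x,
  and without that edge it is a matching that avoids both endpoints.\<close>

lemma sum_matchings:
  fixes G :: "(nat \<times> nat) set \<Rightarrow> 'a::comm_monoid_add"
  assumes fin: "finite E" and loop: "\<And>e. e \<in> E \<Longrightarrow> fst e \<noteq> snd e"
  shows "sum G (matchings E) = sum G (matchings (avoid E {x})) +
    (\<Sum>e | e \<in> E \<and> x \<in> {fst e, snd e}. \<Sum>i\<in>matchings (avoid E {fst e, snd e}). G (insert e i))"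
proof -
  let ?D = "{e \<in> E. x \<in> {fst e, snd e}}"
  let ?S = "Sigma ?D (\<lambda>e. matchings (avoid E {fst e, snd e}))"
  let ?h = "\<lambda>(e, i). insert e i"
  have nin: "e \<notin> i" if "i \<in> matchings (avoid E {fst e, snd e})" for e i
    using that by (auto simp: matchings_def avoid_def)
  have A: "{i \<in> matchings E. x \<notin> coords i} = matchings (avoid E {x})"
    by (rule set_eqI) (simp add: matchings_avoid_iff)
  have B: "{i \<in> matchings E. x \<in> coords i} = ?h ` ?S"
  proof (intro equalityI subsetI)
    fix i assume i: "i \<in> {i \<in> matchings E. x \<in> coords i}"
    then obtain e where e: "e \<in> i" "x \<in> {fst e, snd e}"
      by (auto simp: coords_def)
    define j where "j = i - {e}"
    have ij: "i = insert e j" "e \<notin> j" using e by (auto simp: j_def)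
    have cd: "coords_distinct j" "{fst e, snd e} \<inter> coords j = {}"
      using i coords_distinct_insert[OF ij(2)] by (auto simp: ij(1) matchings_def)
    have "j \<subseteq> E" using i ij(1) by (simp add: matchings_def)
    then have "j \<in> matchings (avoid E {fst e, snd e})"
      unfolding matchings_avoid_iff using cd by (simp add: matchings_def)
    moreover have "e \<in> ?D" using i e by (auto simp: matchings_def)
    ultimately show "i \<in> ?h ` ?S" using ij(1) by (intro image_eqI[of _ _ "(e, j)"] SigmaI) simp_all
  next
    fix i assume "i \<in> ?h ` ?S"
    then obtain e j where i: "i = insert e j" and e: "e \<in> ?D" and j: "j \<in> matchings (avoid E {fst e, snd e})"
      by auto
    have "coords_distinct i"
      unfolding i using j loop[of e] e coords_avoid[OF j]
      by (subst coords_distinct_insert[OF nin[OF j]]) (auto simp: matchings_def)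
    moreover have "i \<subseteq> E" using i e j by (auto simp: matchings_def avoid_def)
    ultimately show "i \<in> {i \<in> matchings E. x \<in> coords i}"
      using e by (auto simp: matchings_def i)
  qed
  have inj: "inj_on ?h ?S"
  proof (rule inj_onI)
    fix p q assume "p \<in> ?S" "q \<in> ?S" and eq: "?h p = ?h q"
    then obtain e i e' i' where p: "p = (e, i)" "q = (e', i')" and x: "x \<in> {fst e, snd e}"
      and i: "i \<in> matchings (avoid E {fst e, snd e})" and i': "i' \<in> matchings (avoid E {fst e', snd e'})"
      and x': "x \<in> {fst e', snd e'}"
      by (cases p, cases q) auto
    have "x \<notin> coords i'"
      using coords_avoid[OF i'] x' by auto
    then have "e \<notin> i'"
      using x unfolding coords_eq by blast
    then have "e = e'"
      using eq p by auto
    moreover from this have "i = i'"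
      using eq p nin[OF i] nin[OF i'] by (simp add: insert_ident)
    ultimately show "p = q" using p by simp
  qed
  have "sum G (matchings E) = sum G {i \<in> matchings E. x \<notin> coords i} + sum G {i \<in> matchings E. x \<in> coords i}"
    using finite_matchings[OF fin]
    by (subst sum.union_disjoint[symmetric]) (auto intro!: sum.cong)
  also have "sum G {i \<in> matchings E. x \<in> coords i} = (\<Sum>(e, i)\<in>?S. G (insert e i))"
    unfolding B by (subst sum.reindex[OF inj]) (simp add: case_prod_unfold)
  also have "\<dots> = (\<Sum>e\<in>?D. \<Sum>i\<in>matchings (avoid E {fst e, snd e}). G (insert e i))"
    using fin by (subst sum.Sigma) (auto intro!: finite_matchings simp: avoid_def)
  finally show ?thesis by (simp only: A)
qed

lemma card_coords:
  assumes "finite i" "coords_distinct i"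
  shows "finite (coords i) \<and> card (coords i) = 2 * card i"
  using assms
proof (induction i)
  case (insert e i)
  have "coords_distinct i" "fst e \<noteq> snd e" "{fst e, snd e} \<inter> coords i = {}"
    using insert.prems coords_distinct_insert[OF insert.hyps(2)] by auto
  then show ?case
    using insert by (simp add: card_insert_if)
qed simp

section \<open>Wick's theorem\<close>

text \<open>Instantiated by the operators x(u) on \<open>Hplus\<close> and by the diagonal matrix
  y(u) on W. Both matrix indices are kept so that one argument serves both cases.\<close>

locale heis =
  fixes X :: "'n::finite \<Rightarrow> 'n \<Rightarrow> int \<Rightarrow> 'w::hmodule \<Rightarrow> 'w"
    and S :: "'n \<times> 'n \<Rightarrow> 'n \<times> 'n \<Rightarrow> int \<Rightarrow> int \<Rightarrow> complex fps"
  assumes hc: "hcs TYPE('w)"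
    and X_lin: "hlinear (X i j e)"
    and X_laurent: "laurent_h (\<lambda>e. X i j e w)"
    and X_comm: "X i j e (X k l f w) - X k l f (X i j e w) = (S (k, i) (l, j) f e - S (i, k) (j, l) e f) *\<^sub>h w"
    and S_zero: "\<not> (e < 0 \<and> 0 \<le> f) \<Longrightarrow> S p q e f = 0"
    and X_trace: "(\<Sum>i\<in>UNIV. X i i e w) = 0"
begin

context
  fixes I J :: "nat \<Rightarrow> 'n" and e :: "nat \<Rightarrow> int"
begin

definition opA :: "nat \<Rightarrow> 'w \<Rightarrow> 'w"
  where "opA l = X (I l) (J l) (e l)"

definition scal :: "nat \<Rightarrow> nat \<Rightarrow> complex fps"
  where "scal p q = S (I p, I q) (J p, J q) (e p) (e q)"

primrec nord :: "nat list \<Rightarrow> 'w \<Rightarrow> 'w"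
  where "nord [] w = w"
  | "nord (l # L) w = (if 0 \<le> e l then opA l (nord L w) else nord L (opA l w))"

lemma opA_lin: "hlinear (opA l)"
  by (simp add: opA_def X_lin)

lemma nord_lin: "hlinear (nord L)"
proof (induction L)
  case (Cons l L)
  then show ?case
    using hlinear_compose[OF opA_lin Cons] hlinear_compose[OF Cons opA_lin]
    by (cases "0 \<le> e l") (simp_all add: fun_eq_iff)
qed (simp add: hlinear_ident fun_eq_iff hlinear_iff)

lemma opA_comm: "opA x (opA l w) = opA l (opA x w) + (scal l x - scal x l) *\<^sub>h w"
  using X_comm[of "I x" "J x" "e x" "I l" "J l" "e l" w] by (simp add: opA_def scal_def algebra_simps)

text \<open>Commutators are scalars, so moving one operator through the product deletes one factor
  at a time.\<close>

lemma opA_nord: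
  "distinct L \<Longrightarrow> opA x (nord L w) = nord L (opA x w) + (\<Sum>q\<in>set L. (scal q x - scal x q) *\<^sub>h nord (remove1 q L) w)"
proof (induction L arbitrary: w)
  case (Cons l L)
  let ?c = "\<lambda>q. scal q x - scal x q"
  have rem: "remove1 q (l # L) = l # remove1 q L" if "q \<in> set L" for q
    using Cons.prems that by auto
  have sum: "(\<Sum>q\<in>set (l # L). ?c q *\<^sub>h nord (remove1 q (l # L)) w) =
      ?c l *\<^sub>h nord L w + (\<Sum>q\<in>set L. ?c q *\<^sub>h nord (l # remove1 q L) w)"
    using Cons.prems rem by simp
  show ?case
  proof (cases "0 \<le> e l")
    case True
    have "opA x (nord (l # L) w) = opA l (opA x (nord L w)) + ?c l *\<^sub>h nord L w"
      using True opA_comm[of x l "nord L w"] by simp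
    also have "opA x (nord L w) = nord L (opA x w) + (\<Sum>q\<in>set L. ?c q *\<^sub>h nord (remove1 q L) w)"
      using Cons by simp
    finally show ?thesis
      unfolding sum using True
      by (simp add: hlinear_add[OF opA_lin] hlinear_sum[OF opA_lin] hlinear_scale[OF opA_lin] ac_simps)
  next
    case False
    have "opA x (nord (l # L) w) = nord L (opA x (opA l w)) + (\<Sum>q\<in>set L. ?c q *\<^sub>h nord (remove1 q L) (opA l w))"
      using False Cons by simp
    also have "opA x (opA l w) = opA l (opA x w) + ?c l *\<^sub>h w"
      by (rule opA_comm)
    finally show ?thesis
      unfolding sum using False
      by (simp add: hlinear_add[OF nord_lin] hlinear_scale[OF nord_lin] ac_simps)
  qed
qed simp

text \<open>A nonnegative mode is already on its side and its contractions \<open>scal x q\<close>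
  vanish by \<open>S_zero\<close>. A negative mode has to pass to the right, and of the two scalars
  in each commutator \<open>scal q x\<close> vanishes.\<close>

lemma nord_step:
  assumes "distinct L"
  shows "nord (x # L) w = opA x (nord L w) + (\<Sum>q\<in>set L. scal x q *\<^sub>h nord (remove1 q L) w)"
proof (cases "0 \<le> e x")
  case True
  then have "scal x q = 0" for q
    by (simp add: scal_def S_zero)
  then show ?thesis using True by simp
next
  case False
  then have "scal q x = 0" for q
    by (simp add: scal_def S_zero)
  then show ?thesis
    using False opA_nord[OF assms, of x w] by (simp add: sum_negf)
qed

definition edges :: "nat set \<Rightarrow> (nat \<times> nat) set"
  where "edges V = {(p, q). p \<in> V \<and> q \<in> V \<and> p < q}"

lemma finite_edges: "finite V \<Longrightarrow> finite (edges V)"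
  by (rule finite_subset[of _ "V \<times> V"]) (auto simp: edges_def)

definition wick :: "nat set \<Rightarrow> 'w \<Rightarrow> 'w"
  where "wick V w = (\<Sum>i\<in>matchings (edges V). (\<Prod>(p, q)\<in>i. scal p q) *\<^sub>h
      foldr opA (sorted_list_of_set (V - coords i)) w)"

text \<open>As the smallest vertex, x is the leftmost operator when it is free and the first
  component of its pair when it is matched. So the recursion for matchings takes the form of
  \<open>nord_step\<close>.\<close>

lemma wick_step:
  assumes V: "finite V" and x: "\<And>y. y \<in> V \<Longrightarrow> x < y"
  shows "wick (insert x V) w = opA x (wick V w) + (\<Sum>q\<in>V. scal x q *\<^sub>h wick (V - {q}) w)"
proof -
  let ?E = "edges (insert x V)"
  let ?G = "\<lambda>i. (\<Prod>(p, q)\<in>i. scal p q) *\<^sub>h foldr opA (sorted_list_of_set (insert x V - coords i)) w"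
  have xV: "x \<notin> V" using x by blast
  have av1: "avoid ?E {x} = edges V"
    using xV by (auto simp: avoid_def edges_def)
  have av2: "avoid ?E {x, q} = edges (V - {q})" for q
    using xV by (auto simp: avoid_def edges_def)
  have D: "{e \<in> ?E. x \<in> {fst e, snd e}} = Pair x ` V"
    using x by (auto simp: edges_def dest: order.asym)
  have co: "coords i \<subseteq> V" if "i \<in> matchings (edges V)" for i V
    using that by (auto simp: matchings_def edges_def coords_def)
  have fini: "finite i" if "i \<in> matchings (edges V)" "finite V" for i V
    using that finite_subset[OF _ finite_edges[OF that(2)]] by (auto simp: matchings_def)
  have loop: "fst e \<noteq> snd e" if "e \<in> ?E" for e
    using that by (auto simp: edges_def)
  have fin: "finite ?E" using V by (simp add: finite_edges)
  have "sum ?G (matchings ?E) = sum ?G (matchings (avoid ?E {x})) +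
      (\<Sum>e | e \<in> ?E \<and> x \<in> {fst e, snd e}. \<Sum>i\<in>matchings (avoid ?E {fst e, snd e}). ?G (insert e i))"
    by (rule sum_matchings[OF fin loop])
  then have "wick (insert x V) w = sum ?G (matchings (edges V)) +
      (\<Sum>e\<in>Pair x ` V. \<Sum>i\<in>matchings (avoid ?E {fst e, snd e}). ?G (insert e i))"
    by (simp only: wick_def av1 D)
  also have "sum ?G (matchings (edges V)) = opA x (wick V w)"
  proof -
    have "?G i = opA x ((\<Prod>(p, q)\<in>i. scal p q) *\<^sub>h foldr opA (sorted_list_of_set (V - coords i)) w)"
      if i: "i \<in> matchings (edges V)" for i
    proof -
      have "insert x V - coords i = insert x (V - coords i)"
        using co[OF i] xV by blast
      moreover have "sorted_list_of_set (insert x (V - coords i)) = x # sorted_list_of_set (V - coords i)"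
      proof -
        have "Min (insert x (V - coords i)) = x"
          using V x by (intro Min_eqI) (auto intro: less_imp_le)
        moreover have "insert x (V - coords i) - {x} = V - coords i"
          using xV by blast
        ultimately show ?thesis
          using V sorted_list_of_set_nonempty[of "insert x (V - coords i)"] by simp
      qed
      ultimately show ?thesis
        by (simp add: hlinear_scale[OF opA_lin])
    qed
    then show ?thesis
      by (simp add: wick_def hlinear_sum[OF opA_lin])
  qed
  also have "(\<Sum>e\<in>Pair x ` V. \<Sum>i\<in>matchings (avoid ?E {fst e, snd e}). ?G (insert e i)) =
      (\<Sum>q\<in>V. \<Sum>i\<in>matchings (edges (V - {q})). ?G (insert (x, q) i))"
    by (subst sum.reindex) (auto simp: inj_on_def av2)
  also have "\<dots> = (\<Sum>q\<in>V. scal x q *\<^sub>h wick (V - {q}) w)"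
  proof (rule sum.cong[OF refl])
    fix q assume q: "q \<in> V"
    have "?G (insert (x, q) i) = scal x q *\<^sub>h ((\<Prod>(p, q)\<in>i. scal p q) *\<^sub>h
        foldr opA (sorted_list_of_set (V - {q} - coords i)) w)"
      if i: "i \<in> matchings (edges (V - {q}))" for i
    proof -
      have "(x, q) \<notin> i"
        using co[OF i] by (force simp: coords_def)
      moreover have "insert x V - coords (insert (x, q) i) = V - {q} - coords i"
        using co[OF i] xV by auto
      ultimately show ?thesis
        using fini[OF i] V by simp
    qed
    then show "(\<Sum>i\<in>matchings (edges (V - {q})). ?G (insert (x, q) i)) = scal x q *\<^sub>h wick (V - {q}) w"
      by (simp add: wick_def hmod.scale_sum_right)
  qed
  finally show ?thesis .
qed

lemma wick_nord: "finite V \<Longrightarrow> wick V w = nord (sorted_list_of_set V) w"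
proof (induction "card V" arbitrary: V w rule: less_induct)
  case less
  show ?case
  proof (cases "V = {}")
    case True
    have "matchings (edges {}) = {{}}"
      by (auto simp: matchings_def edges_def)
    then show ?thesis by (simp add: True wick_def hscale_one)
  next
    case False
    define x U where "x = Min V" and "U = V - {x}"
    have xV: "x \<in> V" using False less.prems by (simp add: x_def)
    have V: "V = insert x U" "finite U" "x \<notin> U" using xV less.prems by (auto simp: U_def)
    have lt: "x < y" if "y \<in> U" for y
    proof -
      have "x \<le> y" "x \<noteq> y"
        using that less.prems by (simp_all add: x_def U_def)
      then show ?thesis by simp
    qed
    have cU: "card U < card V" and card: "card (U - {q}) < card V" for q
      by (rule psubset_card_mono[OF less.prems], use xV in \<open>auto simp: U_def\<close>)+
    have sl: "sorted_list_of_set V = x # sorted_list_of_set U"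
      using less.prems False by (simp add: sorted_list_of_set_nonempty x_def U_def)
    have "wick V w = opA x (wick U w) + (\<Sum>q\<in>U. scal x q *\<^sub>h wick (U - {q}) w)"
      unfolding V(1) using V(2) lt by (rule wick_step)
    also have "wick U w = nord (sorted_list_of_set U) w"
      using less.hyps[OF cU V(2)] .
    also have "(\<Sum>q\<in>U. scal x q *\<^sub>h wick (U - {q}) w) =
        (\<Sum>q\<in>U. scal x q *\<^sub>h nord (remove1 q (sorted_list_of_set U)) w)"
    proof (rule sum.cong[OF refl])
      fix q assume q: "q \<in> U"
      have "wick (U - {q}) w = nord (sorted_list_of_set (U - {q})) w"
        using less.hyps[OF card[of q]] V(2) by simp
      then show "scal x q *\<^sub>h wick (U - {q}) w = scal x q *\<^sub>h nord (remove1 q (sorted_list_of_set U)) w"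
        using V(2) by (simp add: sorted_list_of_set_remove)
    qed
    finally show ?thesis
      using nord_step[of "sorted_list_of_set U" x w] V(2) by (simp add: sl)
  qed
qed

text \<open>The bound n div 2 on the number of pairs omits no matching, since k disjoint pairs
  occupy 2k of the n positions.\<close>

lemma ordered_product_nord: "ordered_product S X n I J e w = nord [1..<Suc n] w"
proof -
  let ?G = "\<lambda>i. (\<Prod>(p, q)\<in>i. scal p q) *\<^sub>h foldr opA (sorted_list_of_set ({1..n} - coords i)) w"
  let ?M = "matchings (edges {1..n})"
  have pair: "pairings n k = {i \<in> ?M. card i = k}" for k
    by (auto simp: pairings_def matchings_def edges_def)
  have le: "card i \<in> {..n div 2}" if i: "i \<in> ?M" for i
  proof -
    have "finite i" "coords_distinct i"
      using i finite_subset[OF _ finite_edges[of "{1..n}"]] by (auto simp: matchings_def)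
    then have "2 * card i = card (coords i)" by (simp add: card_coords)
    also have "\<dots> \<le> card {1..n}"
      using i by (intro card_mono) (auto simp: matchings_def edges_def coords_def)
    finally show ?thesis by simp
  qed
  have "ordered_product S X n I J e w = (\<Sum>k\<le>n div 2. \<Sum>i\<in>{i \<in> ?M. card i = k}. ?G i)"
    by (simp add: ordered_product_def pair scal_def opA_def[abs_def])
  also have "\<dots> = sum ?G ?M"
    using le by (intro sum.group) (auto intro!: finite_matchings finite_edges)
  also have "\<dots> = wick {1..n} w" by (simp add: wick_def)
  also have "\<dots> = nord [1..<Suc n] w"
    by (simp add: wick_nord flip: atLeastLessThanSuc_atLeastAtMost del: upt_Suc)
  finally show ?thesis .
qed

end

end

lemma unif_family_reindex:
  fixes B :: "'x \<Rightarrow> 'w::hmodule \<Rightarrow> int \<Rightarrow> 'w"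
  assumes h: "bij_betw h P Q" and B: "unif_family P (\<lambda>x. B (h x))"
  shows "unif_family Q B"
  unfolding unif_family_def
proof (intro conjI allI ballI)
  have Q: "Q = h ` P" and inj: "inj_on h P" using h by (auto simp: bij_betw_def)
  show "hlinear (\<lambda>w. B y w m)" if y: "y \<in> Q" for y m
    using y unif_family_lin[OF B] unfolding Q by blast
  show "\<exists>M. \<forall>m\<le>M. \<forall>x\<in>Q. B x w m \<in> hpow K UNIV" for w K
  proof -
    obtain M where "\<And>m x. m \<le> M \<Longrightarrow> x \<in> P \<Longrightarrow> B (h x) w m \<in> hpow K UNIV"
      using unif_family_laurent[OF B, of w K] by blast
    then show ?thesis unfolding Q by blast
  qed
  show "hsummable (\<lambda>x. B x w m) Q" for w m
    using unif_family_summable[OF B, of w m] hsummable_reindex[OF inj, of "\<lambda>x. B x w m"] by (simp add: Q)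
qed

lemma xplus_xmon: "distinct L \<Longrightarrow> xplus (set L) I J a = xmon (map (\<lambda>l. (I l, J l, a l)) L)"
  by (induction L) (simp_all add: xplus_def xgen_def)

lemma xplus_xmon_upt: "xplus {1..n} I J a = xmon (map (\<lambda>l. (I l, J l, a l)) [1..<Suc n])"
  using xplus_xmon[of "[1..<Suc n]" I J a] by (simp add: atLeastLessThanSuc_atLeastAtMost del: upt_Suc)

lemma list_as_map:
  "l = map (\<lambda>i. (fst (l ! (i - 1)), fst (snd (l ! (i - 1))), snd (snd (l ! (i - 1))))) [1..<Suc (length l)]"
  by (rule nth_equalityI) (simp_all del: upt_Suc)

lemma xmon_xplus:
  "xmon l = xplus {1..length l} (\<lambda>i. fst (l ! (i - 1))) (\<lambda>i. fst (snd (l ! (i - 1)))) (\<lambda>i. snd (snd (l ! (i - 1))))"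
  unfolding xplus_xmon_upt using list_as_map[of l] by simp

section \<open>Vertex operators built from Heisenberg modes\<close>

context heis
begin

text \<open>The modes of the r-th divided derivative of X_ij(z), the field that belongs to the
  generator x_ij^(-r-1).\<close>

definition ymode :: "'n \<times> 'n \<times> nat \<Rightarrow> int \<Rightarrow> 'w \<Rightarrow> 'w"
  where "ymode g k w = mbin k (snd (snd g)) *\<^sub>c X (fst g) (fst (snd g)) (k + int (snd (snd g))) w"

lemma ymode_modes: "is_modes (ymode g)"
  unfolding is_modes_def laurent_h_def
proof (intro conjI allI)
  show "hlinear (ymode g k)" for k
    unfolding ymode_def[abs_def] by (rule hlinear_fun_scale[OF X_lin])
  show "\<exists>M. \<forall>k\<le>M. ymode g k w \<in> hpow K UNIV" for w K
  proof -
    obtain M where M: "\<And>e. e \<le> M \<Longrightarrow> X (fst g) (fst (snd g)) e w \<in> hpow K UNIV"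
      using laurent_h_obtain[OF X_laurent, of "fst g" "fst (snd g)" w K] by blast
    show ?thesis
      by (rule exI[of _ "M - int (snd (snd g))"]) (auto simp: ymode_def intro!: hpow_scale M)
  qed
qed

lemma ymode_lin: "hlinear (ymode g k)"
  using ymode_modes by (simp add: is_modes_def)

text \<open>Where the binomial factors do not vanish, differentiation preserves the sign of the mode
  number, and the scalars of two modes of equal sign are 0.\<close>

lemma ymode_comm:
  assumes "0 \<le> k \<longleftrightarrow> 0 \<le> l"
  shows "ymode g k (ymode g' l w) = ymode g' l (ymode g k w)"
proof (cases "mbin k (snd (snd g)) = 0 \<or> mbin l (snd (snd g')) = 0")
  case True
  then show ?thesis
    by (elim disjE) (simp_all add: ymode_def hlinear_0[OF X_lin])
next
  case False
  let ?e = "k + int (snd (snd g))" and ?f = "l + int (snd (snd g'))"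
  have "0 \<le> ?e \<longleftrightarrow> 0 \<le> k" "0 \<le> ?f \<longleftrightarrow> 0 \<le> l"
    using False mbin_zero[of k "snd (snd g)"] mbin_zero[of l "snd (snd g')"] by linarith+
  with assms have "S p q ?f ?e = 0" "S p q ?e ?f = 0" for p q
    by (simp_all add: S_zero not_less)
  then have "X (fst g) (fst (snd g)) ?e (X (fst g') (fst (snd g')) ?f w) =
      X (fst g') (fst (snd g')) ?f (X (fst g) (fst (snd g)) ?e w)"
    using X_comm[of "fst g" "fst (snd g)" ?e "fst g'" "fst (snd g')" ?f w] by simp
  then show ?thesis
    by (simp add: ymode_def hlinear_scale[OF X_lin] mult.commute)
qed

primrec Ylist :: "('n \<times> 'n \<times> nat) list \<Rightarrow> 'w \<Rightarrow> int \<Rightarrow> 'w"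
  where "Ylist [] = (\<lambda>w m. if m = 0 then w else 0)"
  | "Ylist (g # l) = nfield (ymode g) (Ylist l)"

lemma Ylist_field: "is_field (Ylist l)"
proof (induction l)
  case Nil
  have "\<exists>M. \<forall>m\<le>M. (if m = (0::int) then w else 0) \<in> hpow K UNIV" for w :: 'w and K
    by (rule exI[of _ "-1"]) simp
  then show ?case
    by (simp add: is_field_def laurent_h_def) (auto simp: hlinear_iff)
qed (simp add: is_field_nfield[OF hc ymode_modes])

lemma Ylist_swap: "Ylist (x # y # l) = Ylist (y # x # l)"
proof (rule ext, rule ext)
  fix w m
  have "nfield (ymode x) (nfield (ymode y) (Ylist l)) w m = nfield (ymode y) (nfield (ymode x) (Ylist l)) w m"
    by (rule nfield_swap[OF hc ymode_modes ymode_modes Ylist_field]) (rule ymode_comm)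
  then show "Ylist (x # y # l) w m = Ylist (y # x # l) w m" by (simp only: Ylist.simps)
qed

lemma Ylist_perm:
  assumes "mset l = mset l'"
  shows "Ylist l = Ylist l'"
proof (rule perm_invariant[where F = Ylist, OF Ylist_swap _ assms])
  show "Ylist (x # l) = Ylist (x # l')" if "Ylist l = Ylist l'" for x l l'
    by (simp only: Ylist.simps that)
qed

lemma Ylist_trace: "(\<Sum>i\<in>UNIV. Ylist ((i, i, r) # l) w m) = 0"
proof -
  have 0: "(\<Sum>i\<in>UNIV. ymode (i, i, r) k w) = 0" for k w
    by (simp add: ymode_def X_trace flip: hmod.scale_sum_right)
  have "(\<Sum>i\<in>UNIV. nop (ymode (i, i, r)) k (Ylist l) w m) = 0" for k
    using 0 hlinear_0[OF is_field_lin[OF Ylist_field]]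
    by (cases "0 \<le> k") (simp_all add: nop_def flip: hlinear_sum[OF is_field_lin[OF Ylist_field]])
  moreover have "(\<Sum>i\<in>UNIV. Ylist ((i, i, r) # l) w m) =
      hsum (\<lambda>k. \<Sum>i\<in>UNIV. nop (ymode (i, i, r)) k (Ylist l) w m) UNIV"
    by (simp add: nfield_def hsum_sum(1)[OF hc] nop_summable[OF hc ymode_modes Ylist_field])
  ultimately show ?thesis by (simp add: hsum_0[OF hc])
qed

definition Yh :: "'n Hplus \<Rightarrow> 'w \<Rightarrow> int \<Rightarrow> 'w"
  where "Yh u w m = (SOME L. hlinear L \<and> (\<forall>l. L (xmon l) = Ylist l w m)) u"

lemma Yh_some: "hlinear (\<lambda>u. Yh u w m) \<and> (\<forall>l. Yh (xmon l) w m = Ylist l w m)"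
proof -
  have "\<exists>L. hlinear L \<and> (\<forall>l. L (xmon l) = Ylist l w m)"
  proof (rule Hplus_extend[OF hc])
    show "Ylist l w m = Ylist l' w m" if "mset l = mset l'" for l l'
      using Ylist_perm[OF that] by simp
  qed (rule Ylist_trace)
  from someI_ex[OF this] show ?thesis
    unfolding Yh_def by simp
qed

lemma Yh_lin_left: "hlinear (\<lambda>u. Yh u w m)"
  and Yh_xmon: "Yh (xmon l) w m = Ylist l w m"
  using Yh_some by blast+

lemma Yh_1: "Yh 1 w m = (if m = 0 then w else 0)"
  using Yh_xmon[of "[]"] by simp

lemma Yh_lin_right: "hlinear (\<lambda>w. Yh u w m)"
proof (rule hlinearI)
  note lin = is_field_lin[OF Ylist_field]
  show "Yh u (x + y) m = Yh u x m + Yh u y m" for x y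
    by (rule Hplus_hlinear_eqI[OF hc, of "\<lambda>u. Yh u (x + y) m" "\<lambda>u. Yh u x m + Yh u y m"])
      (simp_all add: Yh_lin_left hlinear_fun_add Yh_xmon hlinear_add[OF lin])
  show "Yh u (c *\<^sub>h x) m = c *\<^sub>h Yh u x m" for c x
    by (rule Hplus_hlinear_eqI[OF hc, of "\<lambda>u. Yh u (c *\<^sub>h x) m" "\<lambda>u. c *\<^sub>h Yh u x m"])
      (simp_all add: Yh_lin_left hlinear_fun_scale Yh_xmon hlinear_scale[OF lin])
qed

lemma Yh_bilinear: "hbilinear (\<lambda>u w. Yh u w m)"
  by (simp add: hbilinear_def Yh_lin_left Yh_lin_right)

lemma Yh_laurent: "laurent_h (Yh u w)"
  unfolding laurent_h_def
proof
  fix K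
  show "\<exists>M. \<forall>m\<le>M. Yh u w m \<in> hpow K UNIV"
  proof (rule hgen_induct_hpow[OF hgen_Hplus, of _ K])
    show "hmod.subspace {u. \<exists>M. \<forall>m\<le>M. Yh u w m \<in> hpow K UNIV}"
    proof (rule hmod.subspaceI; clarify)
      show "\<exists>M. \<forall>m\<le>M. Yh 0 w m \<in> hpow K UNIV"
        by (simp add: hlinear_0[OF Yh_lin_left])
    next
      fix x y M M' assume "\<forall>m\<le>M. Yh x w m \<in> hpow K UNIV" "\<forall>m\<le>M'. Yh y w m \<in> hpow K UNIV"
      then show "\<exists>M. \<forall>m\<le>M. Yh (x + y) w m \<in> hpow K UNIV"
        by (intro exI[of _ "min M M'"]) (simp add: hlinear_add[OF Yh_lin_left] hpow_add)
    next
      fix c x M assume "\<forall>m\<le>M. Yh x w m \<in> hpow K UNIV"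
      then show "\<exists>M. \<forall>m\<le>M. Yh (c *\<^sub>h x) w m \<in> hpow K UNIV"
        by (intro exI[of _ M]) (simp add: hlinear_scale[OF Yh_lin_left] hpow_scale)
    qed
    show "\<exists>M. \<forall>m\<le>M. Yh u w m \<in> hpow K UNIV" if "u \<in> range xmon" for u
      using that is_field_laurent[OF Ylist_field] by (auto simp: Yh_xmon laurent_h_def)
    show "\<exists>M. \<forall>m\<le>M. Yh u w m \<in> hpow K UNIV" if "u \<in> hpow K UNIV" for u
      using hpow_hlinear[OF Yh_lin_left that] by simp
  qed
qed

lemma Yh_field: "is_field (Yh u)"
  by (simp add: is_field_def Yh_lin_right Yh_laurent)

lemma Yh_xgen: "Yh (xgen g * u) w m = hsum (\<lambda>k. nop (ymode g) k (Yh u) w m) UNIV"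
proof (rule Hplus_hlinear_eqI[OF hc, of "\<lambda>u. Yh (xgen g * u) w m" "\<lambda>u. hsum (\<lambda>k. nop (ymode g) k (Yh u) w m) UNIV"])
  show "hlinear (\<lambda>u. Yh (xgen g * u) w m)"
    using hlinear_compose[OF Yh_lin_left hlinear_mult_Hplus] .
  have "hlinear (\<lambda>u. nop (ymode g) k (Yh u) w m)" for k
    using hlinear_compose[OF ymode_lin Yh_lin_left] Yh_lin_left
    by (cases "0 \<le> k") (simp_all add: nop_def)
  then show "hlinear (\<lambda>u. hsum (\<lambda>k. nop (ymode g) k (Yh u) w m) UNIV)"
    by (intro hlinear_hsum[OF hc] nop_summable[OF hc ymode_modes Yh_field])
  fix l
  have "Yh (xmon l) = Ylist l"
    by (simp add: fun_eq_iff Yh_xmon)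
  then show "Yh (xgen g * xmon l) w m = hsum (\<lambda>k. nop (ymode g) k (Yh (xmon l)) w m) UNIV"
    using Yh_xmon[of "g # l" w m] by (simp add: nfield_def)
qed

text \<open>The contribution of the exponent vector e to the coefficient of z^m: taking u_l^(a l)
  out of (z + u_l)^(e l) leaves z^(e l - a l) and a binomial coefficient.\<close>

definition nterm :: "(nat \<Rightarrow> 'n) \<Rightarrow> (nat \<Rightarrow> 'n) \<Rightarrow> (nat \<Rightarrow> nat) \<Rightarrow> nat list \<Rightarrow> (nat \<Rightarrow> int) \<Rightarrow> 'w \<Rightarrow> int \<Rightarrow> 'w"
  where "nterm I J a L e w m = (if (\<Sum>l\<in>set L. e l - int (a l)) = m
    then (\<Prod>l\<in>set L. of_int (e l) gchoose a l) *\<^sub>c nord I J e L w else 0)"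

lemma nord_cong: "(\<And>l. l \<in> set L \<Longrightarrow> e l = e' l) \<Longrightarrow> nord I J e L w = nord I J e' L w"
  by (induction L arbitrary: w) (simp_all add: opA_def)

text \<open>Exponent k + a x of the variable corresponds to mode k of the divided derivative of
  order a x. The two numbers may differ in sign, but then the binomial factor is 0, so normal
  ordering by exponents and by modes agree.\<close>

lemma nterm_step:
  assumes x: "x \<notin> set L"
  shows "nterm I J a (x # L) (e(x := k + int (a x))) w m =
    nop (ymode (I x, J x, a x)) k (nterm I J a L e) w m"
proof -
  let ?e = "e(x := k + int (a x))"
  have nord: "nord I J ?e L = nord I J e L"
    using x by (intro ext nord_cong) auto
  have s: "(\<Sum>l\<in>set (x # L). ?e l - int (a l)) = k + (\<Sum>l\<in>set L. e l - int (a l))"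
    using x by (simp cong: sum.cong_simp) (auto intro!: sum.cong)
  have p: "(\<Prod>l\<in>set (x # L). of_int (?e l) gchoose a l) = mbin k (a x) * (\<Prod>l\<in>set L. of_int (e l) gchoose a l)"
  proof -
    have "(\<Prod>l\<in>set L. of_int (?e l) gchoose a l) = (\<Prod>l\<in>set L. of_int (e l) gchoose a l :: complex)"
      using x by (intro prod.cong) auto
    then show ?thesis using x by (simp add: mbin_def)
  qed
  have opA: "opA I J ?e x = X (I x) (J x) (k + int (a x))"
    by (simp add: opA_def fun_eq_iff)
  show ?thesis
  proof (cases "0 \<le> k")
    case True
    then show ?thesis
      unfolding nterm_def s p nord.simps nord opA
      by (simp add: nop_def nterm_def ymode_def hlinear_0[OF X_lin] hlinear_scale[OF X_lin] algebra_simps)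
  next
    case k: False
    show ?thesis
    proof (cases "0 \<le> k + int (a x)")
      case True
      then have "mbin k (a x) = 0" using k mbin_zero by simp
      then show ?thesis
        using k unfolding nterm_def s p
        by (simp add: nop_def nterm_def ymode_def hlinear_0[OF nord_lin])
    next
      case False
      then show ?thesis
        using k unfolding nterm_def s p nord.simps nord opA
        by (simp add: nop_def nterm_def ymode_def hlinear_scale[OF nord_lin] algebra_simps)
    qed
  qed
qed

text \<open>The uniform bound is proved together with the formula, because
  \<open>nfield_hsum\<close> needs it for the tail of the list.\<close>

lemma Ylist_nterm:
  assumes "distinct L"
  shows "unif_family (set L \<rightarrow>\<^sub>E UNIV) (nterm I J a L) \<and>
    (\<forall>w m. Ylist (map (\<lambda>l. (I l, J l, a l)) L) w m = hsum (\<lambda>e. nterm I J a L e w m) (set L \<rightarrow>\<^sub>E UNIV))"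
  using assms
proof (induction L)
  case Nil
  have "is_field (nterm I J a [] (\<lambda>_. undefined))"
    using Ylist_field[of "[]"] by (simp add: nterm_def[abs_def] hscale_one eq_commute cong: if_cong)
  then have "unif_family {\<lambda>_. undefined} (nterm I J a [])"
    by (auto simp: unif_family_def is_field_def laurent_h_def)
  then show ?case
    by (simp add: hsum_finite[OF hc]) (simp add: nterm_def hscale_one)
next
  case (Cons x L)
  let ?P = "UNIV \<times> (set L \<rightarrow>\<^sub>E UNIV)" and ?Q = "set (x # L) \<rightarrow>\<^sub>E (UNIV :: int set)"
  \<comment> \<open>Extends an exponent vector by position x; the shift by \<open>a x\<close> turns
    a mode number into an exponent.\<close>
  let ?h = "\<lambda>(k :: int, e). e(x := k + int (a x))"
  let ?g = "(I x, J x, a x)"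
  have x: "x \<notin> set L" using Cons by simp
  have bij: "bij_betw ?h ?P ?Q"
  proof (rule bij_betw_byWitness[where f' = "\<lambda>e. (e x - int (a x), e(x := undefined))"])
    show "\<forall>p\<in>?P. (\<lambda>e. (e x - int (a x), e(x := undefined))) (?h p) = p"
      using x by (auto simp: fun_eq_iff PiE_def extensional_def)
    show "\<forall>e\<in>?Q. ?h ((\<lambda>e. (e x - int (a x), e(x := undefined))) e) = e"
      by (auto simp: fun_eq_iff)
    show "?h ` ?P \<subseteq> ?Q"
      by (auto simp: PiE_def extensional_def)
    show "(\<lambda>e. (e x - int (a x), e(x := undefined))) ` ?Q \<subseteq> ?P"
      using x by (auto simp: PiE_def extensional_def)
  qed
  have eq: "nterm I J a (x # L) (?h p) = (case p of (k, e) \<Rightarrow> nop (ymode ?g) k (nterm I J a L e))" for p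
    using nterm_step[OF x] by (auto simp: fun_eq_iff split: prod.split)
  have IH: "unif_family (set L \<rightarrow>\<^sub>E UNIV) (nterm I J a L)"
    "Ylist (map (\<lambda>l. (I l, J l, a l)) L) = (\<lambda>w m. hsum (\<lambda>e. nterm I J a L e w m) (set L \<rightarrow>\<^sub>E UNIV))"
    using Cons by (auto simp: fun_eq_iff)
  have fam: "unif_family ?P (\<lambda>p. nterm I J a (x # L) (?h p))"
    unfolding eq by (rule unif_family_nop[OF hc ymode_modes IH(1)])
  have fam': "unif_family ?Q (nterm I J a (x # L))"
    by (rule unif_family_reindex[OF bij, OF fam])
  have "Ylist (map (\<lambda>l. (I l, J l, a l)) (x # L)) w m = hsum (\<lambda>e. nterm I J a (x # L) e w m) ?Q" for w m
  proof -
    have "Ylist (map (\<lambda>l. (I l, J l, a l)) (x # L)) w m =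
        hsum (\<lambda>(k, e). nop (ymode ?g) k (nterm I J a L e) w m) ?P"
      using nfield_hsum[OF hc ymode_modes IH(1)] by (simp add: IH(2))
    also have "\<dots> = hsum (\<lambda>p. nterm I J a (x # L) (?h p) w m) ?P"
      by (rule hsum_cong) (simp only: split_beta nterm_step[OF x])
    also have "\<dots> = hsum (\<lambda>e. nterm I J a (x # L) e w m) ?Q"
      using hsum_bij[OF hc bij, of "\<lambda>e. nterm I J a (x # L) e w m"] unif_family_summable[OF fam] by simp
    finally show ?thesis .
  qed
  then show ?case using fam' by blast
qed

lemma Yh_translate:
  "Yh (xplus {1..n} I J a) w m = translate n (\<lambda>e. ordered_product S X n I J e w) m a"
proof -
  let ?L = "[1..<Suc n]"
  have set: "set ?L = {1..n}" by (simp add: atLeastLessThanSuc_atLeastAtMost del: upt_Suc)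
  let ?A = "{e \<in> {1..n} \<rightarrow>\<^sub>E UNIV. (\<Sum>l=1..n. e l - int (a l)) = m}"
  have fam: "unif_family ({1..n} \<rightarrow>\<^sub>E UNIV) (nterm I J a ?L)"
    and Y: "Ylist (map (\<lambda>l. (I l, J l, a l)) ?L) w m = hsum (\<lambda>e. nterm I J a ?L e w m) ({1..n} \<rightarrow>\<^sub>E UNIV)"
    using Ylist_nterm[OF distinct_upt, of 1 "Suc n" I J a] unfolding set by blast+
  have "hsum (\<lambda>e. nterm I J a ?L e w m) ({1..n} \<rightarrow>\<^sub>E UNIV) = hsum (\<lambda>e. nterm I J a ?L e w m) ?A"
  proof (rule hsum_neutral(1)[OF hc _ _ hsummable_subset[OF unif_family_summable[OF fam]]])
    fix e assume "e \<in> ({1..n} \<rightarrow>\<^sub>E UNIV) - ?A"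
    then have "(\<Sum>l=1..n. e l - int (a l)) \<noteq> m" by blast
    then show "nterm I J a ?L e w m = 0" unfolding nterm_def set by simp
  qed blast+
  also have "\<dots> = translate n (\<lambda>e. ordered_product S X n I J e w) m a"
    unfolding translate_def
  proof (rule hsum_cong)
    fix e assume "e \<in> ?A"
    then have "(\<Sum>l=1..n. e l - int (a l)) = m" by blast
    then show "nterm I J a ?L e w m = (\<Prod>l=1..n. of_int (e l) gchoose a l) *\<^sub>c ordered_product S X n I J e w"
      unfolding nterm_def set ordered_product_nord by simp
  qed
  finally show ?thesis
    unfolding xplus_xmon_upt Yh_xmon Y .
qed

lemma Yh_unique:
  assumes "\<And>m. hbilinear (\<lambda>u w. Y u w m)"
    and "\<And>n I J a w m. Y (xplus {1..n} I J a) w m = translate n (\<lambda>e. ordered_product S X n I J e w) m a"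
  shows "Y = Yh"
proof (intro ext)
  fix u w m
  have "hlinear (\<lambda>u. Y u w m)"
    using assms(1)[of m] by (simp add: hbilinear_def)
  then show "Y u w m = Yh u w m"
    by (rule Hplus_hlinear_eqI[OF hc _ Yh_lin_left]) (simp only: xmon_xplus assms(2) Yh_translate)
qed

end

section \<open>The vertex operator map of \<open>H\<^sup>+\<^sub>N\<close>\<close>

text \<open>The characterisation of x^-(u) on products of generators is the Leibniz rule for a
  derivation with these values.\<close>

definition xminus_coeff :: "complex \<Rightarrow> 'n::finite \<Rightarrow> 'n \<Rightarrow> nat \<Rightarrow> 'n \<times> 'n \<times> nat \<Rightarrow> complex fps"
  where "xminus_coeff c i j r g = - Sdiff c (i, fst g) (j, fst (snd g)) (- int r) (int (snd (snd g)))"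

lemma trace_free_xminus: "trace_free (xminus_coeff c i j r)"
  by (simp add: trace_free_def xminus_coeff_def Sdiff_def Sc_tr2 sum_negf flip: sum_distrib_left)

lemma hder_xplus:
  assumes "trace_free d" "finite L"
  shows "hder d (xplus L I J a) = (\<Sum>j\<in>L. d (I j, J j, a j) *\<^sub>h xplus (L - {j}) I J a)"
  using assms(2)
proof (induction L)
  case empty
  then show ?case by (simp add: xplus_def hder_1 assms(1))
next
  case (insert x L)
  have 1: "xplus (insert x L) I J a = xgen (I x, J x, a x) * xplus L I J a"
    using insert by (simp add: xplus_def xgen_def)
  have 2: "xplus (insert x L - {j}) I J a = xgen (I x, J x, a x) * xplus (L - {j}) I J a" if "j \<in> L" for j
  proof -
    have "insert x L - {j} = insert x (L - {j})" using that insert by auto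
    then show ?thesis using insert by (simp add: xplus_def xgen_def)
  qed
  have "hder d (xplus (insert x L) I J a) = xgen (I x, J x, a x) * hder d (xplus L I J a) + d (I x, J x, a x) *\<^sub>h xplus L I J a"
    unfolding 1 by (rule hder_xgen[OF assms(1)])
  also have "\<dots> = (\<Sum>j\<in>insert x L. d (I j, J j, a j) *\<^sub>h xplus (insert x L - {j}) I J a)"
    using insert by (simp add: 2 sum_distrib_left Hplus_mult_scale)
  finally show ?case .
qed

lemma hder_zero:
  assumes "\<And>g. d g = 0"
  shows "hder d u = 0"
proof -
  have "trace_free d" by (simp add: trace_free_def assms)
  then have "hder (\<lambda>g. 0 * d g) u = 0 *\<^sub>h hder d u" by (rule hder_scale)
  moreover have "(\<lambda>g. 0 * d g) = d" by (rule ext) (simp only: assms mult_zero_left)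
  ultimately show ?thesis by simp
qed

lemma polar_h_hsummable: "hsummable a UNIV \<Longrightarrow> polar_h a"
  unfolding polar_h_def
proof
  fix K assume "hsummable a UNIV"
  then have "finite {r. a r \<notin> hpow K UNIV}"
    by (simp add: hsummable_def)
  then obtain M where "\<And>r. r \<in> {r. a r \<notin> hpow K UNIV} \<Longrightarrow> r < M"
    by (metis finite_nat_set_iff_bounded)
  then show "\<exists>M. \<forall>r\<ge>M. a r \<in> hpow K UNIV"
    by (intro exI[of _ M]) (auto simp: not_less[symmetric])
qed

lemma xminus_coeff_summable: "fps_summable (\<lambda>r. xminus_coeff c i j r g)"
proof (rule fps_summableI)
  fix r
  have "fps_X ^ (r - (snd (snd g) + 2)) dvd Sc c (i, fst g) (j, fst (snd g)) (- int (r - snd (snd g)))"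
    using Sc_dvd[of "r - snd (snd g)"] by simp
  moreover have "- int (r - snd (snd g)) = - int r + int (snd (snd g))" if "snd (snd g) \<le> r"
    using that by simp
  moreover have "Sc c (i, fst g) (j, fst (snd g)) (- int r + int (snd (snd g))) = 0" if "\<not> snd (snd g) \<le> r"
    using that by (intro Sc_zero) simp
  ultimately have "fps_X ^ (r - (snd (snd g) + 2)) dvd Sc c (i, fst g) (j, fst (snd g)) (- int r + int (snd (snd g)))"
    by (cases "snd (snd g) \<le> r") simp_all
  then show "fps_X ^ (r - (snd (snd g) + 2)) dvd xminus_coeff c i j r g"
    by (simp add: xminus_coeff_def Sdiff_def)
qed

lemma is_xminus_hder: "is_xminus c (\<lambda>(i :: 'n::finite) j r. hder (xminus_coeff c i j r))"
  unfolding is_xminus_def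
proof (intro conjI allI impI)
  show "hlinear (hder (xminus_coeff c i j r))" for i j :: 'n and r
    by (rule hlinear_hder[OF trace_free_xminus])
  show "polar_h (\<lambda>r. hder (xminus_coeff c i j r) v)" for i j :: 'n and v
    by (rule polar_h_hsummable[OF hsummable_hder[OF trace_free_xminus xminus_coeff_summable]])
  show "hder (xminus_coeff c i j 0) v = 0" for i j :: 'n and v
    by (rule hder_zero) (simp add: xminus_coeff_def Sdiff_zero)
  show "hder (xminus_coeff c i j r) 1 = 0" for i j :: 'n and r
    by (rule hder_1[OF trace_free_xminus])
  fix n :: nat and I J :: "nat \<Rightarrow> 'n" and a r
  show "hder (xminus_coeff c (I 0) (J 0) r) (xplus {1..n} I J a) =
    - (\<Sum>j=1..n. Sdiff c (I 0, I j) (J 0, J j) (- int r) (int (a j)) *\<^sub>h xplus ({1..n} - {j}) I J a)"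
    by (subst hder_xplus[OF trace_free_xminus]) (simp_all add: xminus_coeff_def sum_negf)
qed

lemma is_xminus_xplus:
  assumes "is_xminus c Xm" "1 \<le> n"
  shows "Xm (I 0) (J 0) r (xplus {1..n} I J a) =
    - (\<Sum>j=1..n. Sdiff c (I 0, I j) (J 0, J j) (- int r) (int (a j)) *\<^sub>h xplus ({1..n} - {j}) I J a)"
proof -
  have "\<forall>n\<ge>1. \<forall>I J a r. Xm (I 0) (J 0) r (xplus {1..n} I J a) =
      - (\<Sum>j=1..n. Sdiff c (I 0, I j) (J 0, J j) (- int r) (int (a j)) *\<^sub>h xplus ({1..n} - {j}) I J a)"
    using assms(1) unfolding is_xminus_def by (elim conjE) assumption
  then show ?thesis using assms(2) by blast
qed

lemma xminus_eq: "xminus c i j r = hder (xminus_coeff c i j r)" for i j :: "'n::finite"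
proof -
  have "Xm i j r u = hder (xminus_coeff c i j r) u" if Xm: "is_xminus c Xm" for Xm and i j :: 'n and r u
  proof (rule Hplus_hlinear_eqI[OF hcs_Hplus, of "Xm i j r" "hder (xminus_coeff c i j r)"])
    show "hlinear (Xm i j r)" using Xm by (simp add: is_xminus_def)
    show "hlinear (hder (xminus_coeff c i j r))" by (rule hlinear_hder[OF trace_free_xminus])
    fix l :: "('n \<times> 'n \<times> nat) list"
    show "Xm i j r (xmon l) = hder (xminus_coeff c i j r) (xmon l)"
    proof (cases "l = []")
      case True
      then show ?thesis using Xm by (simp add: is_xminus_def hder_1[OF trace_free_xminus])
    next
      case False
      \<comment> \<open>Index 0 is reserved for the operator, so the positions of the list start at
        1.\<close>
      define I J a where "I = (\<lambda>q. if q = 0 then i else fst (l ! (q - 1)))"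
        and "J = (\<lambda>q. if q = 0 then j else fst (snd (l ! (q - 1))))"
        and "a = (\<lambda>q. snd (snd (l ! (q - 1))))"
      have "xmon l = xplus {1..length l} I J a"
        unfolding xmon_xplus unfolding xplus_def by (rule prod.cong) (simp_all add: I_def J_def a_def)
      moreover have ij: "I 0 = i" "J 0 = j" by (simp_all add: I_def J_def)
      have len: "length l \<ge> 1" using False by (cases l) auto
      have "Xm i j r (xplus {1..length l} I J a) = hder (xminus_coeff c i j r) (xplus {1..length l} I J a)"
        using is_xminus_xplus[OF Xm len, of I J r a] is_xminus_xplus[OF is_xminus_hder len, of c I J r a]
        by (simp only: ij)
      ultimately show ?thesis by simp
    qed
  qed
  then have "is_xminus c Xm \<Longrightarrow> Xm = (\<lambda>i j r. hder (xminus_coeff c i j r))" for Xm :: "'n \<Rightarrow> 'n \<Rightarrow> nat \<Rightarrow> 'n Hplus \<Rightarrow> 'n Hplus"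
    by (simp add: fun_eq_iff)
  then have "xminus c = (\<lambda>i j r. hder (xminus_coeff c (i :: 'n) j r))"
    unfolding xminus_def using is_xminus_hder by (intro the_equality)
  then show ?thesis by simp
qed

text \<open>Nonnegative modes are multiplications and negative ones are derivations with scalar
  values. Each kind commutes with itself, and a mixed commutator is the value of the derivation on
  the generator.\<close>

lemma xop_heis: "heis (xop c) (Sdiff c :: 'n::finite \<times> 'n \<Rightarrow> _)"
proof
  show "hcs TYPE('n Hplus)" by (rule hcs_Hplus)
  have lin: "hlinear (xminus c i j r)" for i j :: 'n and r
    unfolding xminus_eq by (rule hlinear_hder[OF trace_free_xminus])
  show "hlinear (xop c i j e)" for i j :: 'n and e
    using lin hlinear_mult_Hplus by (cases "0 \<le> e") (simp_all add: xop_def[abs_def])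
  show "laurent_h (\<lambda>e. xop c i j e w)" for i j :: 'n and w
    unfolding laurent_h_def
  proof
    fix K
    obtain M where M: "\<And>r. r \<ge> M \<Longrightarrow> xminus c i j r w \<in> hpow K UNIV"
      using polar_h_hsummable[OF hsummable_hder[OF trace_free_xminus xminus_coeff_summable], of c i j w]
      unfolding xminus_eq polar_h_def by blast
    show "\<exists>M. \<forall>m\<le>M. xop c i j m w \<in> hpow K UNIV"
      by (rule exI[of _ "- int M - 1"]) (auto simp: xop_def intro!: M)
  qed
  show "\<not> (e < 0 \<and> 0 \<le> f) \<Longrightarrow> Sdiff c p q e f = 0" for p q :: "'n \<times> 'n" and e f
    by (rule Sdiff_zero)
  show "(\<Sum>i\<in>UNIV. xop c i i e w) = 0" for e and w :: "'n Hplus"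
  proof (cases "0 \<le> e")
    case True
    then show ?thesis
      by (simp add: xop_def sum_xp_trace flip: sum_distrib_right)
  next
    case False
    let ?D = "\<lambda>u :: 'n Hplus. \<Sum>i\<in>UNIV. hder (xminus_coeff c i i (nat (- e))) u"
    have "?D w = 0"
    proof (rule Hplus_hlinear_eqI[OF hcs_Hplus, of ?D "\<lambda>_. 0"])
      show "hlinear ?D" by (intro hlinear_fun_sum hlinear_hder[OF trace_free_xminus])
      \<comment> \<open>Here the trace runs over the indices of the operator itself, so the other
        partial trace of S applies than in \<open>trace_free_xminus\<close>.\<close>
      have c0: "(\<Sum>i\<in>UNIV. xminus_coeff c i i r g) = 0" for r and g :: "'n \<times> 'n \<times> nat"
        by (simp add: xminus_coeff_def Sdiff_def Sc_tr1 sum_negf flip: sum_distrib_left)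
      show "?D (xmon l) = 0" for l
        by (induction l) (simp_all add: hder_1[OF trace_free_xminus] hder_xgen[OF trace_free_xminus]
            sum.distrib c0 flip: sum_distrib_left hmod.scale_sum_left)
    qed (rule hlinear_zero)
    then show ?thesis using False by (simp add: xop_def xminus_eq)
  qed
  fix i j k l :: 'n and e f and w :: "'n Hplus"
  have der: "xminus c i j r (xp k l s * w) = xp k l s * xminus c i j r w - Sdiff c (i, k) (j, l) (- int r) (int s) *\<^sub>h w"
    for i j k l :: 'n and r s and w :: "'n Hplus"
    using hder_xgen[OF trace_free_xminus, of c i j r "(k, l, s)" w]
    by (simp add: xminus_eq xgen_def xminus_coeff_def)
  show "xop c i j e (xop c k l f w) - xop c k l f (xop c i j e w) =
      (Sdiff c (k, i) (l, j) f e - Sdiff c (i, k) (j, l) e f) *\<^sub>h w"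
  proof (cases "0 \<le> e"; cases "0 \<le> f")
    assume "0 \<le> e" "0 \<le> f"
    then show ?thesis by (simp add: xop_def Sdiff_zero mult.left_commute)
  next
    assume "0 \<le> e" "\<not> 0 \<le> f"
    then show ?thesis by (simp add: xop_def der Sdiff_zero)
  next
    assume "\<not> 0 \<le> e" "0 \<le> f"
    then show ?thesis by (simp add: xop_def der Sdiff_zero)
  next
    assume "\<not> 0 \<le> e" "\<not> 0 \<le> f"
    then show ?thesis
      by (simp add: xop_def xminus_eq hder_commute[OF trace_free_xminus trace_free_xminus] Sdiff_zero)
  qed
qed

interpretation Hp: heis "xop c" "Sdiff c :: 'n::finite \<times> 'n \<Rightarrow> _" for c
  by (rule xop_heis)

lemma Hplus_Y_eq: "Hplus_Y c = Hp.Yh c"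
  unfolding Hplus_Y_def
proof (rule the_equality)
  show "(\<forall>m. hbilinear (\<lambda>a b. Hp.Yh c a b m)) \<and> (\<forall>a b. laurent_h (Hp.Yh c a b)) \<and>
    (\<forall>n I J a b m. Hp.Yh c (xplus {1..n} I J a) b m =
      translate n (\<lambda>e. ordered_product (Sdiff c) (xop c) n I J e b) m a)"
    by (intro conjI allI Hp.Yh_bilinear Hp.Yh_laurent Hp.Yh_translate)
qed (auto intro!: Hp.Yh_unique)

section \<open>The braiding of \<open>H\<^sup>+\<^sub>N\<close>\<close>

lemma hder_sum_zero:
  fixes d :: "'i \<Rightarrow> 'n::finite \<times> 'n \<times> nat \<Rightarrow> complex fps"
  assumes d: "\<And>i. trace_free (d i)" and 0: "\<And>g. (\<Sum>i\<in>A. d i g) = 0"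
  shows "(\<Sum>i\<in>A. hder (d i) u) = 0"
proof (rule Hplus_hlinear_eqI[OF hcs_Hplus, of "\<lambda>u. \<Sum>i\<in>A. hder (d i) u" "\<lambda>_. 0"])
  show "hlinear (\<lambda>u. \<Sum>i\<in>A. hder (d i) u)"
    by (intro hlinear_fun_sum hlinear_hder[OF d])
  show "(\<Sum>i\<in>A. hder (d i) (xmon l)) = 0" for l
  proof (induction l)
    case (Cons g l)
    have "(\<Sum>i\<in>A. hder (d i) (xmon (g # l))) = xgen g * (\<Sum>i\<in>A. hder (d i) (xmon l)) + (\<Sum>i\<in>A. d i g) *\<^sub>h xmon l"
      by (simp add: hder_xgen[OF d] sum.distrib sum_distrib_left hmod.scale_sum_left)
    then show ?case by (simp add: Cons 0)
  qed (simp add: hder_1[OF d])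
qed (rule hlinear_zero)

text \<open>Contraction at z^(-p) of a generator g of the second factor with a generator k of the
  first one. The index k stands first because T is evaluated at z + u - v with u from the first
  factor.\<close>

definition tcoeff :: "complex \<Rightarrow> 'n::finite \<times> 'n \<times> nat \<Rightarrow> nat \<Rightarrow> 'n \<times> 'n \<times> nat \<Rightarrow> complex fps"
  where "tcoeff c g p k =
    fps_nth (Tshift c (fst k, fst g) (fst (snd k), fst (snd g)) (snd (snd k)) (snd (snd g))) p"

lemma trace_free_tcoeff: "trace_free (tcoeff c g p)"
  by (simp add: trace_free_def tcoeff_def Tshift_Kc_tr1)

lemma tcoeff_trace: "(\<Sum>i\<in>UNIV. tcoeff c (i, i, b) p k) = 0"
  by (cases "snd (snd k) + b \<le> p")
    (simp_all add: tcoeff_def Tshift_def Tc_def sum_subtractf Sc_tr2 right_diff_distrib flip: sum_distrib_left)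

lemma tcoeff_summable: "fps_summable (\<lambda>p. tcoeff c g p k)"
  using Tshift_nth_dvd[of _ "snd (snd k)" "snd (snd g)"]
  by (intro fps_summableI[of "snd (snd k) + snd (snd g) + 2"]) (simp add: tcoeff_def diff_diff_add)

abbreviation tder :: "complex \<Rightarrow> 'n::finite \<times> 'n \<times> nat \<Rightarrow> nat \<Rightarrow> 'n Hplus \<Rightarrow> 'n Hplus"
  where "tder c g p \<equiv> hder (tcoeff c g p)"

lemma hlinear_tder: "hlinear (tder c g p)"
  by (rule hlinear_hder[OF trace_free_tcoeff])

definition mul2 :: "'n::finite \<times> 'n \<times> nat \<Rightarrow> ('a::hmodule, 'n Hplus) ctensor \<Rightarrow> ('a, 'n Hplus) ctensor"
  where "mul2 g = tensor_map (\<lambda>a. a) (\<lambda>b. xgen g * b)"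

lemma hlinear_mul2: "hlinear (mul2 g)"
  unfolding mul2_def by (rule hlinear_tensor_map[OF hlinear_ident hlinear_mult_Hplus])

lemma mul2_tensor: "mul2 g (a \<otimes>\<^sub>h b) = a \<otimes>\<^sub>h (xgen g * b)"
  unfolding mul2_def by (rule tensor_map_tensor[OF hlinear_ident hlinear_mult_Hplus])

lemma mul2_commute: "mul2 g (mul2 g' t) = mul2 g' (mul2 g t)"
  unfolding mul2_def
  by (simp add: tensor_map_comp hlinear_ident hlinear_mult_Hplus mult.left_commute)

lemma mul2_trace: "(\<Sum>i\<in>UNIV. mul2 (i, i, r) t) = 0" for t :: "('a::hmodule, 'n::finite Hplus) ctensor"
proof -
  have "(\<lambda>t. \<Sum>i\<in>UNIV. mul2 (i, i, r) t) = (\<lambda>t :: ('a, 'n Hplus) ctensor. 0)"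
  proof (rule hlinear_ctensor_eqI[OF hcs_ctensor hgen_UNIV hgen_UNIV])
    show "hlinear (\<lambda>t. \<Sum>i\<in>UNIV. mul2 (i, i, r) t)"
      by (intro hlinear_fun_sum hlinear_mul2)
    fix a :: 'a and b :: "'n Hplus"
    have "(\<Sum>i\<in>UNIV. mul2 (i, i, r) (a \<otimes>\<^sub>h b)) = a \<otimes>\<^sub>h ((\<Sum>i\<in>UNIV. xp i i r) * b)"
      by (simp add: mul2_tensor xgen_def sum_distrib_right hlinear_sum[OF hlinear_tensor_right])
    then show "(\<Sum>i\<in>UNIV. mul2 (i, i, r) (a \<otimes>\<^sub>h b)) = 0"
      by (simp add: sum_xp_trace hlinear_0[OF hlinear_tensor_right])
  qed (rule hlinear_zero)
  then show ?thesis by (rule fun_cong)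
qed

text \<open>The sum over cross pairings, built one generator of the second factor at a time: it
  stays in its place or is contracted with the first factor through a derivation.\<close>

primrec Slist :: "complex \<Rightarrow> ('n::finite \<times> 'n \<times> nat) list \<Rightarrow> 'n Hplus \<Rightarrow> nat \<Rightarrow> ('n Hplus, 'n Hplus) ctensor"
  where "Slist c [] = (\<lambda>v r. if r = 0 then v \<otimes>\<^sub>h 1 else 0)"
  | "Slist c (g # l) = (\<lambda>v r. mul2 g (Slist c l v r) + (\<Sum>p\<le>r. Slist c l (tder c g p v) (r - p)))"

lemma Slist_lin: "hlinear (\<lambda>v. Slist c l v r)"
proof (induction l arbitrary: r)
  case Nil
  then show ?case by (cases "r = 0") (simp_all add: hlinear_tensor_left hlinear_zero)
next
  case (Cons g l)
  then show ?case
    by (simp, intro hlinear_fun_add hlinear_compose[OF hlinear_mul2] hlinear_fun_sum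
        hlinear_compose[OF Cons hlinear_tder]) (rule Cons)
qed

lemma sum_triangle_swap:
  "(\<Sum>p\<le>(r::nat). \<Sum>q\<le>r - p. h p q) = (\<Sum>q\<le>r. \<Sum>p\<le>r - q. h p q)"
proof -
  have "(\<Sum>(p, q)\<in>Sigma {..r} (\<lambda>p. {..r - p}). h p q) = (\<Sum>(q, p)\<in>Sigma {..r} (\<lambda>q. {..r - q}). h p q)"
    by (rule sum.reindex_bij_witness[of _ prod.swap prod.swap]) auto
  then show ?thesis by (simp add: sum.Sigma)
qed

text \<open>The double contractions agree because the derivations commute and the sum over p + q <=
  r is symmetric.\<close>

lemma Slist_swap: "Slist c (x # y # l) = Slist c (y # x # l)"
proof (rule ext, rule ext)
  fix v r
  have expand: "Slist c (x # y # l) v r =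
      mul2 x (mul2 y (Slist c l v r)) + (\<Sum>p\<le>r. mul2 x (Slist c l (tder c y p v) (r - p)))
      + ((\<Sum>p\<le>r. mul2 y (Slist c l (tder c x p v) (r - p)))
      + (\<Sum>p\<le>r. \<Sum>q\<le>r - p. Slist c l (tder c y q (tder c x p v)) (r - p - q)))" for x y
    by (simp add: hlinear_add[OF hlinear_mul2] hlinear_sum[OF hlinear_mul2] sum.distrib)
  have "(\<Sum>p\<le>r. \<Sum>q\<le>r - p. Slist c l (tder c y q (tder c x p v)) (r - p - q)) =
      (\<Sum>p\<le>r. \<Sum>q\<le>r - p. Slist c l (tder c x q (tder c y p v)) (r - p - q))"
    by (subst sum_triangle_swap)
      (simp add: hder_commute[OF trace_free_tcoeff trace_free_tcoeff, of c y] add.commute)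
  then show "Slist c (x # y # l) v r = Slist c (y # x # l) v r"
    unfolding expand by (simp only: mul2_commute[of x y] add.assoc add.left_commute)
qed

lemma Slist_perm:
  assumes "mset l = mset l'"
  shows "Slist c l = Slist c l'"
proof (rule perm_invariant[where F = "Slist c", OF Slist_swap _ assms])
  show "Slist c (x # l) = Slist c (x # l')" if "Slist c l = Slist c l'" for x l l'
    by (simp only: Slist.simps that)
qed

lemma Slist_trace: "(\<Sum>i\<in>UNIV. Slist c ((i, i, b) # l) v r) = 0"
proof -
  have "(\<Sum>i\<in>UNIV. Slist c ((i, i, b) # l) v r) =
      (\<Sum>i\<in>UNIV. mul2 (i, i, b) (Slist c l v r)) + (\<Sum>p\<le>r. Slist c l (\<Sum>i\<in>UNIV. tder c (i, i, b) p v) (r - p))"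
    by (simp add: sum.distrib hlinear_sum[OF Slist_lin]) (rule sum.swap)
  then show ?thesis
    by (simp add: mul2_trace hder_sum_zero[OF trace_free_tcoeff tcoeff_trace] hlinear_0[OF Slist_lin])
qed

lemma hsummable_convolution:
  fixes f :: "nat \<times> nat \<Rightarrow> 'a::hmodule"
  assumes "hsummable f (UNIV \<times> UNIV)"
  shows "hsummable (\<lambda>r. \<Sum>p\<le>r. f (p, r - p)) UNIV"
  unfolding hsummable_def
proof
  fix K
  let ?F = "{x \<in> UNIV \<times> UNIV. f x \<notin> hpow K UNIV}"
  have "{r \<in> UNIV. (\<Sum>p\<le>r. f (p, r - p)) \<notin> hpow K UNIV} \<subseteq> (\<lambda>x. fst x + snd x) ` ?F"
  proof
    fix r assume "r \<in> {r \<in> UNIV. (\<Sum>p\<le>r. f (p, r - p)) \<notin> hpow K UNIV}"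
    then obtain p where "p \<le> r" "f (p, r - p) \<notin> hpow K UNIV"
      using hpow_sum[of "{..r}" "\<lambda>p. f (p, r - p)" K] by auto
    then show "r \<in> (\<lambda>x. fst x + snd x) ` ?F"
      by (intro image_eqI[of _ _ "(p, r - p)"]) auto
  qed
  then show "finite {r \<in> UNIV. (\<Sum>p\<le>r. f (p, r - p)) \<notin> hpow K UNIV}"
    by (rule finite_subset) (use assms in \<open>simp add: hsummable_def\<close>)
qed

lemma hsummable_lin_Sigma:
  assumes f: "\<And>i y. hlinear (\<lambda>v. f v y)" and g: "hsummable g UNIV" and s: "\<And>v. hsummable (f v) B"
  shows "hsummable (\<lambda>(x, y). f (g x) y) (UNIV \<times> B)"
proof (rule hsummable_SigmaI)
  fix K
  have "finite {x. g x \<notin> hpow K UNIV}" using g by (simp add: hsummable_def)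
  moreover have "\<forall>x\<in>UNIV - {x. g x \<notin> hpow K UNIV}. \<forall>y\<in>B. (case (x, y) of (x, y) \<Rightarrow> f (g x) y) \<in> hpow K UNIV"
    using hpow_hlinear[OF f] by auto
  ultimately show "\<exists>F. finite F \<and> (\<forall>x\<in>UNIV - F. \<forall>y\<in>B. (case (x, y) of (x, y) \<Rightarrow> f (g x) y) \<in> hpow K UNIV)"
    by blast
qed (simp add: s)

lemma tder_summable: "hsummable (\<lambda>p. tder c g p v) UNIV"
  by (rule hsummable_hder[OF trace_free_tcoeff tcoeff_summable])

lemma Slist_summable: "hsummable (Slist c l v) UNIV"
proof (induction l arbitrary: v)
  case Nil
  have "{r. r = (0::nat) \<and> P r} \<subseteq> {0}" for P by auto
  then show ?case
    by (intro hsummableI exI[of _ "{0}"]) simp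
next
  case (Cons g l)
  have "hsummable (\<lambda>(p, q). Slist c l (tder c g p v) q) (UNIV \<times> UNIV)"
    by (rule hsummable_lin_Sigma[OF Slist_lin tder_summable Cons])
  from hsummable_convolution[OF this]
  show ?case
    by (simp, intro hsummable_add hsummable_hlinear[OF Cons hlinear_mul2]) simp
qed

definition Sh :: "complex \<Rightarrow> 'n::finite Hplus \<Rightarrow> 'n Hplus \<Rightarrow> nat \<Rightarrow> ('n Hplus, 'n Hplus) ctensor"
  where "Sh c v u r = (SOME L. hlinear L \<and> (\<forall>l. L (xmon l) = Slist c l v r)) u"

lemma Sh_some: "hlinear (\<lambda>u. Sh c v u r) \<and> (\<forall>l. Sh c v (xmon l) r = Slist c l v r)"
proof -
  have "\<exists>L. hlinear L \<and> (\<forall>l. L (xmon l) = Slist c l v r)"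
  proof (rule Hplus_extend[OF hcs_ctensor])
    show "Slist c l v r = Slist c l' v r" if "mset l = mset l'" for l l' :: "('a \<times> 'a \<times> nat) list"
      using Slist_perm[OF that] by simp
  qed (rule Slist_trace)
  from someI_ex[OF this] show ?thesis
    unfolding Sh_def by simp
qed

lemma Sh_lin_right: "hlinear (\<lambda>u. Sh c v u r)"
  and Sh_xmon: "Sh c v (xmon l) r = Slist c l v r"
  using Sh_some by blast+

lemma Sh_lin_left: "hlinear (\<lambda>v. Sh c v u r)"
proof (rule hlinearI)
  show "Sh c (x + y) u r = Sh c x u r + Sh c y u r" for x y
    by (rule Hplus_hlinear_eqI[OF hcs_ctensor, of "\<lambda>u. Sh c (x + y) u r" "\<lambda>u. Sh c x u r + Sh c y u r"])
      (simp_all add: Sh_lin_right hlinear_fun_add Sh_xmon hlinear_add[OF Slist_lin])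
  show "Sh c (f *\<^sub>h x) u r = f *\<^sub>h Sh c x u r" for f x
    by (rule Hplus_hlinear_eqI[OF hcs_ctensor, of "\<lambda>u. Sh c (f *\<^sub>h x) u r" "\<lambda>u. f *\<^sub>h Sh c x u r"])
      (simp_all add: Sh_lin_right hlinear_fun_scale Sh_xmon hlinear_scale[OF Slist_lin])
qed

lemma Sh_bilinear: "hbilinear (\<lambda>v u. Sh c v u r)"
  by (simp add: hbilinear_def Sh_lin_left Sh_lin_right)

lemma Sh_xgen: "Sh c v (xgen g * u) r = mul2 g (Sh c v u r) + (\<Sum>p\<le>r. Sh c (tder c g p v) u (r - p))"
proof (rule Hplus_hlinear_eqI[OF hcs_ctensor, of "\<lambda>u. Sh c v (xgen g * u) r"
      "\<lambda>u. mul2 g (Sh c v u r) + (\<Sum>p\<le>r. Sh c (tder c g p v) u (r - p))"])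
  show "hlinear (\<lambda>u. Sh c v (xgen g * u) r)"
    by (rule hlinear_compose[OF Sh_lin_right hlinear_mult_Hplus])
  show "hlinear (\<lambda>u. mul2 g (Sh c v u r) + (\<Sum>p\<le>r. Sh c (tder c g p v) u (r - p)))"
    by (intro hlinear_fun_add hlinear_compose[OF hlinear_mul2] hlinear_fun_sum Sh_lin_right)
  show "Sh c v (xgen g * xmon l) r = mul2 g (Sh c v (xmon l) r) + (\<Sum>p\<le>r. Sh c (tder c g p v) (xmon l) (r - p))" for l
    using Sh_xmon[of c v "g # l" r] by (simp add: Sh_xmon)
qed

definition Sop :: "complex \<Rightarrow> ('n::finite Hplus, 'n Hplus) ctensor \<Rightarrow> nat \<Rightarrow> ('n Hplus, 'n Hplus) ctensor"
  where "Sop c t r = induced (\<lambda>v u. Sh c v u r) t"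

lemma Sop_lin: "hlinear (\<lambda>t. Sop c t r)"
  unfolding Sop_def by (rule hlinear_induced[OF hcs_ctensor Sh_bilinear])

lemma Sop_tensor: "Sop c (v \<otimes>\<^sub>h u) r = Sh c v u r"
  unfolding Sop_def by (rule induced_tensor[OF hcs_ctensor Sh_bilinear])

lemma Sop_summable: "hsummable (Sop c t) UNIV" for t :: "('n::finite Hplus, 'n Hplus) ctensor"
proof (rule hlinear_finite_exceptions[OF hgen_tensor[OF hgen_UNIV hgen_Hplus] Sop_lin])
  fix x :: "('n Hplus, 'n Hplus) ctensor" assume "x \<in> {v \<otimes>\<^sub>h u |v u. v \<in> UNIV \<and> u \<in> range xmon}"
  then obtain v l where x: "x = v \<otimes>\<^sub>h xmon l" by blast
  show "hsummable (\<lambda>r. Sop c x r) UNIV"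
    unfolding x Sop_tensor Sh_xmon by (rule Slist_summable)
qed

text \<open>The braiding changes the first factor only by constant vector fields, which commute with
  d, and the second factor only by multiplications.\<close>

lemma Sop_der:
  assumes d: "trace_free d"
  shows "Sop c (tensor_map (hder d) (\<lambda>b. b) t) r = tensor_map (hder d) (\<lambda>b. b) (Sop c t r)"
proof -
  let ?D = "tensor_map (hder d) (\<lambda>b. b)"
  note D = hlinear_tensor_map[OF hlinear_hder[OF d] hlinear_ident]
  have mul: "?D (mul2 g t) = mul2 g (?D t)" for g and t :: "('a Hplus, 'a Hplus) ctensor"
    unfolding mul2_def by (simp add: tensor_map_comp hlinear_ident hlinear_mult_Hplus hlinear_hder[OF d])
  have "Slist c l (hder d v) r = ?D (Slist c l v r)" for l v r
  proof (induction l arbitrary: v r)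
    case Nil
    then show ?case by (simp add: tensor_map_tensor[OF hlinear_hder[OF d] hlinear_ident] hlinear_0[OF D])
  next
    case (Cons g l)
    have "tder c g p (hder d v) = hder d (tder c g p v)" for p
      by (rule hder_commute[OF trace_free_tcoeff d])
    then show ?case
      by (simp add: Cons hlinear_add[OF D] hlinear_sum[OF D] mul)
  qed
  then have "(\<lambda>t. Sop c (?D t) r) = (\<lambda>t. ?D (Sop c t r))"
    by (intro hlinear_ctensor_eqI[OF hcs_ctensor hgen_UNIV hgen_Hplus])
      (auto simp: tensor_map_tensor[OF hlinear_hder[OF d] hlinear_ident] Sop_tensor Sh_xmon
        intro: hlinear_compose[OF Sop_lin D] hlinear_compose[OF D Sop_lin])
  then show ?thesis by (rule fun_cong)
qed

text \<open>The vertex recursion of Wick's theorem on the bipartite graph with parts A and B. The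
  product of series in 1/z becomes the convolution over p.\<close>

lemma Sh_xplus:
  assumes "finite B" "finite A" "A \<inter> B = {}"
  shows "Sh c (xplus A I J a) (xplus B I J a) r =
    (\<Sum>i\<in>matchings (A \<times> B). fps_nth (\<Prod>(p, q)\<in>i. Tshift c (I p, I q) (J p, J q) (a p) (a q)) r *\<^sub>h
      (xplus (A - coords i) I J a \<otimes>\<^sub>h xplus (B - coords i) I J a))"
  using assms
proof (induction B arbitrary: A r rule: finite_induct)
  case empty
  have "matchings (A \<times> {}) = {{}}" by (auto simp: matchings_def)
  moreover have "Sh c v 1 r = (if r = 0 then v \<otimes>\<^sub>h 1 else 0)" for v :: "'a Hplus"
    using Sh_xmon[of c v "[]" r] by simp
  ultimately show ?case by (simp add: xplus_def hscale_one)
next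
  case (insert b B)
  let ?T = "\<lambda>(p, q). Tshift c (I p, I q) (J p, J q) (a p) (a q)"
  let ?g = "(I b, J b, a b)"
  let ?x = "\<lambda>L. xplus L I J a"
  let ?E = "A \<times> insert b B"
  let ?G = "\<lambda>i. fps_nth (prod ?T i) r *\<^sub>h (?x (A - coords i) \<otimes>\<^sub>h ?x (insert b B - coords i))"
  have bA: "b \<notin> A" and AB: "A \<inter> B = {}" using insert.prems by auto
  have ins: "?x (insert b L) = xgen ?g * ?x L" if "finite L" "b \<notin> L" for L
    using that by (simp add: xplus_def xgen_def)
  have co: "coords i \<subseteq> A' \<union> B'" and fi: "finite A' \<Longrightarrow> finite B' \<Longrightarrow> finite i" if "i \<in> matchings (A' \<times> B')" for i A' B'
    using that finite_subset[of i "A' \<times> B'"] unfolding matchings_def coords_eq by fastforce+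
  have av1: "avoid ?E {b} = A \<times> B" using insert.hyps bA by (auto simp: avoid_def)
  have av2: "avoid ?E {fst e, snd e} = (A - {fst e}) \<times> B" if "e \<in> (\<lambda>k. (k, b)) ` A" for e
    using insert.hyps bA AB that by (auto simp: avoid_def)
  have D: "{e \<in> ?E. b \<in> {fst e, snd e}} = (\<lambda>k. (k, b)) ` A"
    using bA by auto
  have fin: "finite ?E" using insert by simp
  have loop: "fst e \<noteq> snd e" if "e \<in> ?E" for e
    using that bA AB by auto
  have "sum ?G (matchings ?E) = sum ?G (matchings (A \<times> B)) +
      (\<Sum>e\<in>(\<lambda>k. (k, b)) ` A. \<Sum>i\<in>matchings (avoid ?E {fst e, snd e}). ?G (insert e i))"
    using sum_matchings[where G = ?G, OF fin loop, of b] by (simp only: av1 D)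
  also have "(\<Sum>e\<in>(\<lambda>k. (k, b)) ` A. \<Sum>i\<in>matchings (avoid ?E {fst e, snd e}). ?G (insert e i)) =
      (\<Sum>e\<in>(\<lambda>k. (k, b)) ` A. \<Sum>i\<in>matchings ((A - {fst e}) \<times> B). ?G (insert e i))"
    by (rule sum.cong[OF refl]) (simp only: av2)
  also have "\<dots> = (\<Sum>k\<in>A. \<Sum>i\<in>matchings ((A - {k}) \<times> B). ?G (insert (k, b) i))"
    by (subst sum.reindex) (simp_all add: inj_on_def)
  also have "sum ?G (matchings (A \<times> B)) = mul2 ?g (Sh c (?x A) (?x B) r)"
  proof -
    have "?G i = mul2 ?g (fps_nth (prod ?T i) r *\<^sub>h (?x (A - coords i) \<otimes>\<^sub>h ?x (B - coords i)))"
      if i: "i \<in> matchings (A \<times> B)" for i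
    proof -
      have "b \<notin> coords i" using co[OF i] bA insert.hyps by blast
      then have "insert b B - coords i = insert b (B - coords i)" by blast
      then show ?thesis
        using insert.hyps by (simp add: hlinear_scale[OF hlinear_mul2] mul2_tensor ins)
    qed
    then show ?thesis
      using insert.IH[OF insert.prems(1) AB] by (simp add: hlinear_sum[OF hlinear_mul2])
  qed
  also have "(\<Sum>k\<in>A. \<Sum>i\<in>matchings ((A - {k}) \<times> B). ?G (insert (k, b) i)) =
      (\<Sum>p\<le>r. Sh c (tder c ?g p (?x A)) (?x B) (r - p))"
  proof -
    have "(\<Sum>i\<in>matchings ((A - {k}) \<times> B). ?G (insert (k, b) i)) =
        (\<Sum>p\<le>r. tcoeff c ?g p (I k, J k, a k) *\<^sub>h Sh c (?x (A - {k})) (?x B) (r - p))" if k: "k \<in> A" for k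
    proof -
      have "?G (insert (k, b) i) = (\<Sum>p\<le>r. tcoeff c ?g p (I k, J k, a k) *\<^sub>h
          (fps_nth (prod ?T i) (r - p) *\<^sub>h (?x (A - {k} - coords i) \<otimes>\<^sub>h ?x (B - coords i))))"
        if i: "i \<in> matchings ((A - {k}) \<times> B)" for i
      proof -
        have nb: "b \<notin> coords i" and nk: "k \<notin> coords i"
          using co[OF i] bA insert.hyps AB k by blast+
        have ni: "(k, b) \<notin> i" using nb unfolding coords_eq by force
        have 1: "A - coords (insert (k, b) i) = A - {k} - coords i" using bA by auto
        have 2: "insert b B - coords (insert (k, b) i) = B - coords i"
          using insert.hyps AB k by auto
        have "prod ?T (insert (k, b) i) = ?T (k, b) * prod ?T i"
          using fi[OF i] insert ni by simp
        then show ?thesis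
          unfolding 1 2 by (simp add: fps_mult_nth hmod.scale_sum_left tcoeff_def atMost_atLeast0)
      qed
      moreover have "Sh c (?x (A - {k})) (?x B) (r - p) = (\<Sum>i\<in>matchings ((A - {k}) \<times> B).
          fps_nth (prod ?T i) (r - p) *\<^sub>h (?x (A - {k} - coords i) \<otimes>\<^sub>h ?x (B - coords i)))" for p
        using insert.prems AB by (intro insert.IH) auto
      ultimately show ?thesis
        by (simp add: hmod.scale_sum_right) (rule sum.swap)
    qed
    moreover have "tder c ?g p (?x A) = (\<Sum>k\<in>A. tcoeff c ?g p (I k, J k, a k) *\<^sub>h ?x (A - {k}))" for p
      by (rule hder_xplus[OF trace_free_tcoeff insert.prems(1)])
    ultimately show ?thesis
      by (simp add: hlinear_sum[OF Sh_lin_left] hlinear_scale[OF Sh_lin_left]) (rule sum.swap)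
  qed
  finally show ?case
    using insert.hyps by (simp add: ins Sh_xgen case_prod_unfold)
qed

lemma inj_on_matching:
  assumes "coords_distinct i"
  shows "inj_on fst i" "inj_on snd i"
  using assms unfolding coords_distinct_def inj_on_def by (blast, blast)

lemma Sop_xplus:
  fixes I J :: "nat \<Rightarrow> 'n::finite"
  shows "Sop c (xplus {1..n} I J a \<otimes>\<^sub>h xplus {n+1..n+m} I J a) r =
      (\<Sum>k\<le>min m n. \<Sum>i\<in>cross_pairings n m k.
        fps_nth (\<Prod>(p, q)\<in>i. Tshift c (I p, I q) (J p, J q) (a p) (a q)) r *\<^sub>h
          (xplus ({1..n} - coords i) I J a \<otimes>\<^sub>h xplus ({n+1..n+m} - coords i) I J a))"
proof -
  let ?M = "matchings ({1..n} \<times> {n+1..n+m})"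
  let ?G = "\<lambda>i. fps_nth (\<Prod>(p, q)\<in>i. Tshift c (I p, I q) (J p, J q) (a p) (a q)) r *\<^sub>h
          (xplus ({1..n} - coords i) I J a \<otimes>\<^sub>h xplus ({n+1..n+m} - coords i) I J a)"
  have cp: "cross_pairings n m k = {i \<in> ?M. card i = k}" for k
    by (auto simp: cross_pairings_def matchings_def)
  have le: "card i \<in> {..min m n}" if i: "i \<in> ?M" for i
  proof -
    have cd: "coords_distinct i" and sub: "i \<subseteq> {1..n} \<times> {n+1..n+m}"
      using i by (auto simp: matchings_def)
    have "card i = card (fst ` i)" "card i = card (snd ` i)"
      using inj_on_matching[OF cd] by (simp_all add: card_image)
    moreover have "card (fst ` i) \<le> card {1..n}" "card (snd ` i) \<le> card {n+1..n+m}"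
      using sub by (intro card_mono; fastforce)+
    ultimately show ?thesis by simp
  qed
  have "(\<Sum>k\<le>min m n. \<Sum>i\<in>cross_pairings n m k. ?G i) = sum ?G ?M"
    unfolding cp using le by (intro sum.group) (auto intro!: finite_matchings)
  moreover have "Sh c (xplus {1..n} I J a) (xplus {n+1..n+m} I J a) r = sum ?G ?M"
    by (rule Sh_xplus) auto
  ultimately show ?thesis by (simp only: Sop_tensor)
qed

text \<open>The formula for the braiding indexes both factors by common I, J, a; these are read off
  from the concatenated list.\<close>

lemma xmon_xplus2:
  fixes l l' :: "('n::finite \<times> 'n \<times> nat) list"
  obtains I J :: "nat \<Rightarrow> 'n" and a where
    "xmon l = xplus {1..length l} I J a"
    "xmon l' = xplus {length l + 1..length l + length l'} I J a"
proof
  let ?L = "l @ l'"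
  let ?I = "\<lambda>i. fst (?L ! (i - 1))" and ?J = "\<lambda>i. fst (snd (?L ! (i - 1)))" and ?a = "\<lambda>i. snd (snd (?L ! (i - 1)))"
  have "l = map (\<lambda>i. (?I i, ?J i, ?a i)) [1..<Suc (length l)]"
    by (rule nth_equalityI) (simp_all add: nth_append del: upt_Suc)
  then show "xmon l = xplus {1..length l} ?I ?J ?a"
    unfolding xplus_xmon_upt by simp
  let ?R = "[Suc (length l)..<Suc (length l + length l')]"
  have R: "set ?R = {length l + 1..length l + length l'}" by (auto simp del: upt_Suc)
  have "l' = map (\<lambda>i. (?I i, ?J i, ?a i)) ?R"
    by (rule nth_equalityI) (simp_all add: nth_append del: upt_Suc)
  then have "xmon l' = xplus (set ?R) ?I ?J ?a"
    using xplus_xmon[OF distinct_upt, of "Suc (length l)" "Suc (length l + length l')" ?I ?J ?a] by simp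
  then show "xmon l' = xplus {length l + 1..length l + length l'} ?I ?J ?a"
    by (simp only: R)
qed

text \<open>Uniqueness holds because pure tensors of monomials generate the completed tensor
  square.\<close>

lemma Hplus_S_eq: "Hplus_S c = (Sop c :: ('n::finite Hplus, 'n Hplus) ctensor \<Rightarrow> _)"
  unfolding Hplus_S_def
proof (rule the_equality, intro conjI allI)
  show "hlinear (\<lambda>t. Sop c t r)" for r by (rule Sop_lin)
  show "polar_h (Sop c t)" for t by (rule polar_h_hsummable[OF Sop_summable])
next
  fix S :: "('n Hplus, 'n Hplus) ctensor \<Rightarrow> nat \<Rightarrow> ('n Hplus, 'n Hplus) ctensor"
  assume S: "(\<forall>r. hlinear (\<lambda>t. S t r)) \<and>
    (\<forall>t. polar_h (S t)) \<and>
    (\<forall>n m I J a r. S (xplus {1..n} I J a \<otimes>\<^sub>h xplus {n+1..n+m} I J a) r =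
      (\<Sum>k\<le>min m n. \<Sum>i\<in>cross_pairings n m k.
        fps_nth (\<Prod>(p, q)\<in>i. Tshift c (I p, I q) (J p, J q) (a p) (a q)) r *\<^sub>h
          (xplus ({1..n} - coords i) I J a \<otimes>\<^sub>h xplus ({n+1..n+m} - coords i) I J a)))"
  show "S = Sop c"
  proof (rule ext, rule ext)
    fix t r
    have "(\<lambda>t. S t r) = (\<lambda>t. Sop c t r)"
    proof (rule hlinear_ctensor_eqI[OF hcs_ctensor hgen_Hplus hgen_Hplus _ Sop_lin])
      show "hlinear (\<lambda>t. S t r)" using S by blast
      fix x y :: "'n Hplus" assume "x \<in> range xmon" "y \<in> range xmon"
      then obtain l l' where xy: "x = xmon l" "y = xmon l'" by blast
      obtain I J a where I: "xmon l = xplus {1..length l} I J a"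
        "xmon l' = xplus {length l + 1..length l + length l'} I J a"
        by (rule xmon_xplus2)
      show "S (x \<otimes>\<^sub>h y) r = Sop c (x \<otimes>\<^sub>h y) r"
        unfolding xy I Sop_xplus using S by (elim conjE allE) 
    qed
    then show "S t r = Sop c t r" by (rule fun_cong)
  qed
qed (rule Sop_xplus)

section \<open>The subalgebra \<open>\<V>\<^sub>H(c)\<close>\<close>

definition diag_list :: "('n \<times> 'n \<times> nat) list \<Rightarrow> bool"
  where "diag_list l \<longleftrightarrow> (\<forall>g\<in>set l. fst g = fst (snd g))"

lemma diag_list_simps [simp]: "diag_list []" "diag_list (g # l) \<longleftrightarrow> fst g = fst (snd g) \<and> diag_list l"
  by (auto simp: diag_list_def)

text \<open>A projection onto the diagonal subalgebra that kills every monomial with an off-diagonal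
  generator. It respects the trace relation because a monomial keeps or loses its diagonality when
  multiplied by any x_ii alike.\<close>

definition pvh :: "'n::finite Hplus \<Rightarrow> 'n Hplus"
  where "pvh = (SOME L. hlinear L \<and> (\<forall>l. L (xmon l) = (if diag_list l then xmon l else 0)))"

lemma pvh_some: "hlinear (pvh :: 'n::finite Hplus \<Rightarrow> 'n Hplus) \<and>
    (\<forall>l :: ('n \<times> 'n \<times> nat) list. pvh (xmon l) = (if diag_list l then xmon l else 0))"
proof -
  have "\<exists>L. hlinear L \<and> (\<forall>l. L (xmon l) = (if diag_list l then xmon l else 0 :: 'n Hplus))"
  proof (rule Hplus_extend[OF hcs_Hplus])
    fix l l' :: "('n \<times> 'n \<times> nat) list" assume "mset l = mset l'"
    then show "(if diag_list l then xmon l else 0) = (if diag_list l' then xmon l' else 0)"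
      using xmon_mset[of l l'] mset_eq_setD[of l l'] by (simp add: diag_list_def)
  next
    fix r and l :: "('n \<times> 'n \<times> nat) list"
    have "(\<Sum>i\<in>UNIV. xmon ((i, i, r) # l)) = (\<Sum>i\<in>UNIV. xp i i r) * xmon l"
      by (simp add: xgen_def sum_distrib_right)
    then show "(\<Sum>i\<in>UNIV. if diag_list ((i, i, r) # l) then xmon ((i, i, r) # l) else 0) = 0"
      by (cases "diag_list l") (simp_all add: sum_xp_trace del: xmon_simps)
  qed
  from someI_ex[OF this] show ?thesis unfolding pvh_def .
qed

lemma pvh_lin: "hlinear pvh"
  and pvh_xmon: "pvh (xmon l) = (if diag_list l then xmon l else 0)"
  using pvh_some by blast+

lemma pvh_1: "pvh 1 = 1"
  using pvh_xmon[of "[]"] by simp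

lemma pvh_xgen: "pvh (xgen (i, i, r) * u) = xgen (i, i, r) * pvh u"
proof (rule Hplus_hlinear_eqI[OF hcs_Hplus, of "\<lambda>u. pvh (xgen (i, i, r) * u)" "\<lambda>u. xgen (i, i, r) * pvh u"])
  show "pvh (xgen (i, i, r) * xmon l) = xgen (i, i, r) * pvh (xmon l)" for l
    using pvh_xmon[of "(i, i, r) # l"] by (simp add: pvh_xmon)
qed (intro hlinear_compose[OF pvh_lin hlinear_mult_Hplus] hlinear_compose[OF hlinear_mult_Hplus pvh_lin])+

lemma pvh_pvh: "pvh (pvh u) = pvh u"
  by (rule Hplus_hlinear_eqI[OF hcs_Hplus, of "\<lambda>u. pvh (pvh u)" pvh])
    (simp_all add: pvh_lin hlinear_compose[OF pvh_lin pvh_lin] pvh_xmon hlinear_0[OF pvh_lin])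

text \<open>Whether f preserves the image of \<open>pvh\<close> can be tested on diagonal
  monomials.\<close>

lemma pvh_induct:
  assumes f: "hlinear f" and step: "\<And>l. diag_list l \<Longrightarrow> pvh (f (xmon l)) = f (xmon l)"
  shows "pvh (f (pvh u)) = f (pvh u)"
proof (rule Hplus_hlinear_eqI[OF hcs_Hplus, of "\<lambda>u. pvh (f (pvh u))" "\<lambda>u. f (pvh u)"])
  show "hlinear (\<lambda>u. f (pvh u))" "hlinear (\<lambda>u. pvh (f (pvh u)))"
    using hlinear_compose[OF f pvh_lin] hlinear_compose[OF pvh_lin hlinear_compose[OF f pvh_lin]] by auto
  show "pvh (f (pvh (xmon l))) = f (pvh (xmon l))" for l
    using step[of l] by (cases "diag_list l") (simp_all add: pvh_xmon hlinear_0[OF f] hlinear_0[OF pvh_lin])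
qed

lemma pvh_xmon_mult: "diag_list l \<Longrightarrow> pvh (xmon l * u) = xmon l * pvh u"
proof (induction l)
  case (Cons g l)
  then obtain i r where "g = (i, i, r)" by (cases g) auto
  with Cons show ?case by (simp add: mult.assoc pvh_xgen)
qed simp

lemma pvh_mult: "pvh (pvh u * pvh v) = pvh u * pvh v"
proof (rule pvh_induct[of "\<lambda>u. u * pvh v"])
  show "hlinear (\<lambda>u. u * pvh v)"
    using hlinear_mult_Hplus[of "pvh v"] by (simp add: mult.commute)
  show "pvh (xmon l * pvh v) = xmon l * pvh v" if "diag_list l" for l
    by (simp add: pvh_xmon_mult[OF that] pvh_pvh)
qed

lemma pvh_hder:
  assumes d: "trace_free d"
  shows "pvh (hder d (pvh u)) = hder d (pvh u)"
proof (rule pvh_induct[OF hlinear_hder[OF d]])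
  show "pvh (hder d (xmon l)) = hder d (xmon l)" if "diag_list l" for l
    using that
  proof (induction l)
    case Nil
    then show ?case by (simp add: hder_1[OF d] hlinear_0[OF pvh_lin])
  next
    case (Cons g l)
    then obtain i r where "g = (i, i, r)" by (cases g) auto
    with Cons show ?case
      by (simp add: hder_xgen[OF d] hlinear_add[OF pvh_lin] hlinear_scale[OF pvh_lin] pvh_xgen pvh_xmon)
  qed
qed

text \<open>Witnesses for divisibility by h^k exist in the whole algebra; applying the projection
  moves them into the fixed set. The limit of a sequence of fixed elements is fixed by
  continuity.\<close>

lemma topologically_free_fixed: "topologically_free {a. pvh a = a}"
  unfolding topologically_free_def
proof (intro conjI)
  let ?A = "{a. pvh a = (a :: 'a Hplus)}"
  show sub: "hmod.subspace ?A"
    by (rule hmod.subspaceI) (simp_all add: hlinear_0[OF pvh_lin] hlinear_add[OF pvh_lin] hlinear_scale[OF pvh_lin])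
  show "torsion_free ?A"
    using topologically_free_Hplus unfolding topologically_free_def torsion_free_def by blast
  have "x = 0" if x: "\<And>k. x \<in> hpow k ?A" for x
  proof (rule hcs_eqI[OF hcs_Hplus])
    show "x - 0 \<in> hpow k UNIV" for k using hpow_UNIV_I[OF x] by simp
  qed
  moreover have "0 \<in> hpow k ?A" for k
    by (rule hmod.subspace_0[OF hpow_subspace[OF sub]])
  ultimately have "x \<in> (\<Inter>k. hpow k ?A) \<longleftrightarrow> x \<in> {0}" for x
    by (cases "x = 0") (simp_all, blast)
  then show "hseparated ?A"
    unfolding hseparated_def by blast
  show "hcomplete ?A"
    unfolding hcomplete_def
  proof (intro allI impI, elim conjE)
    fix s :: "nat \<Rightarrow> 'a Hplus"
    assume s: "\<forall>n. s n \<in> ?A" and cauchy: "\<forall>k. \<exists>M. \<forall>m\<ge>M. \<forall>n\<ge>M. s m - s n \<in> hpow k ?A"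
    have *: "(\<forall>n. s n \<in> UNIV) \<and> (\<forall>k. \<exists>M. \<forall>m\<ge>M. \<forall>n\<ge>M. s m - s n \<in> hpow k UNIV)"
    proof (intro conjI allI)
      fix k
      obtain M where "\<And>m n. m \<ge> M \<Longrightarrow> n \<ge> M \<Longrightarrow> s m - s n \<in> hpow k ?A"
        using cauchy by blast
      then show "\<exists>M. \<forall>m\<ge>M. \<forall>n\<ge>M. s m - s n \<in> hpow k UNIV"
        using hpow_UNIV_I by (intro exI[of _ M]) blast
    qed simp
    obtain l where l: "\<And>k. \<exists>M. \<forall>n\<ge>M. s n - l \<in> hpow k UNIV"
      using hcs_Hplus[unfolded hcs_def hcomplete_def, THEN conjunct2, rule_format, OF *] by blast
    have pl: "pvh l = l"
    proof (rule hcs_eqI[OF hcs_Hplus])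
      fix k
      obtain n where n: "s n - l \<in> hpow k UNIV" using l[of k] by blast
      have "pvh l - l = (s n - l) - pvh (s n - l)"
        using s by (simp add: hlinear_diff[OF pvh_lin])
      then show "pvh l - l \<in> hpow k UNIV"
        by (simp only: hpow_diff[OF n hpow_hlinear[OF pvh_lin n]])
    qed
    have "\<exists>M. \<forall>n\<ge>M. s n - l \<in> hpow k ?A" for k
    proof -
      obtain M where M: "\<And>n. n \<ge> M \<Longrightarrow> s n - l \<in> hpow k UNIV" using l[of k] by blast
      have "s n - l \<in> hpow k ?A" if n: "n \<ge> M" for n
      proof -
        obtain y where "s n - l = fps_X ^ k *\<^sub>h y" using M[OF n] by (auto simp: in_hpow)
        then have "pvh (s n - l) = fps_X ^ k *\<^sub>h pvh y" by (simp add: hlinear_scale[OF pvh_lin])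
        then have "s n - l = fps_X ^ k *\<^sub>h pvh y" using s pl by (simp add: hlinear_diff[OF pvh_lin])
        then show ?thesis unfolding in_hpow using pvh_pvh by blast
      qed
      then show ?thesis by blast
    qed
    then show "\<exists>l\<in>?A. \<forall>k. \<exists>M. \<forall>n\<ge>M. s n - l \<in> hpow k ?A" using pl by blast
  qed
qed

text \<open>The fixed set of \<open>pvh\<close> is one of the admissible subalgebras. It lies in
  every other one, since these contain the diagonal monomials and, by
  \<open>hlinear_in_closed\<close>, the limits of their expansions.\<close>

lemma VH_carrier_eq: "VH_carrier = {a. pvh a = a}"
proof (intro equalityI subsetI)
  fix a :: "'a Hplus" assume "a \<in> VH_carrier"
  moreover have "pvh (x * y) = x * y" if "pvh x = x" "pvh y = y" for x y :: "'a Hplus"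
    using pvh_mult[of x y] that by simp
  moreover have "pvh (xp i i r) = xp i i r" for i :: 'a and r
    using pvh_xgen[of i r 1] by (simp add: pvh_1 xgen_def)
  ultimately show "a \<in> {a. pvh a = a}"
    using topologically_free_fixed pvh_1 unfolding VH_carrier_def by blast
next
  fix a :: "'a Hplus" assume a: "a \<in> {a. pvh a = a}"
  show "a \<in> VH_carrier"
    unfolding VH_carrier_def
  proof (rule InterI, clarify)
    fix A :: "'a Hplus set"
    assume A: "topologically_free A" "1 \<in> A" "\<forall>a\<in>A. \<forall>b\<in>A. a * b \<in> A" "\<forall>i r. xp i i r \<in> A"
    have "pvh a \<in> A"
    proof (rule hlinear_in_closed[OF hcs_Hplus hgen_Hplus pvh_lin])
      show "hmod.subspace A" "hcomplete A" using A(1) by (auto simp: topologically_free_def)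
      fix x :: "'a Hplus" assume "x \<in> range xmon"
      then obtain l where x: "x = xmon l" by blast
      have "xmon l \<in> A" if "diag_list l" for l
        using that
      proof (induction l)
        case (Cons g l)
        then show ?case using A(3,4) by (simp add: xgen_def)
      qed (simp add: A(2))
      then show "pvh x \<in> A"
        using hmod.subspace_0[of A] A(1) by (simp add: x pvh_xmon topologically_free_def)
    qed
    then show "a \<in> A" using a by simp
  qed
qed

text \<open>A linear retraction of the inclusion \<open>Rep_VH\<close>; facts about
  \<open>Hplus\<close> are transported along this pair.\<close>

definition vproj :: "'n::finite Hplus \<Rightarrow> 'n VH"
  where "vproj a = Abs_VH (pvh a)"

lemma Rep_vproj: "Rep_VH (vproj a) = pvh a"
  unfolding vproj_def by (rule Abs_VH_inverse) (simp add: VH_carrier_eq pvh_pvh)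

lemma pvh_Rep: "pvh (Rep_VH v) = Rep_VH v"
  using Rep_VH[of v] by (simp add: VH_carrier_eq)

lemma vproj_Rep: "vproj (Rep_VH v) = v"
  by (simp add: vproj_def pvh_Rep Rep_VH_inverse)

lemma Rep_lin: "hlinear Rep_VH"
  by (simp add: hlinear_iff plus_VH.rep_eq hscale_VH.rep_eq)

lemma vproj_lin: "hlinear vproj"
proof (rule hlinearI)
  show "vproj (x + y) = vproj x + vproj y" for x y :: "'a Hplus"
    by (rule Rep_VH_inject[THEN iffD1]) (simp add: Rep_vproj plus_VH.rep_eq hlinear_add[OF pvh_lin])
  show "vproj (c *\<^sub>h x) = c *\<^sub>h vproj x" for c and x :: "'a Hplus"
    by (rule Rep_VH_inject[THEN iffD1]) (simp add: Rep_vproj hscale_VH.rep_eq hlinear_scale[OF pvh_lin])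
qed

lemma hcs_expansion:
  fixes y :: "nat \<Rightarrow> 'a::hmodule"
  assumes "hcs TYPE('a)"
  shows "\<exists>l. \<forall>n. l - (\<Sum>k<n. fps_X ^ k *\<^sub>h y k) \<in> hpow n UNIV"
proof (rule hcs_limit[OF assms])
  fix k m :: nat assume "k \<le> m"
  then have "(\<Sum>j<m. fps_X ^ j *\<^sub>h y j) - (\<Sum>j<k. fps_X ^ j *\<^sub>h y j) = (\<Sum>j\<in>{k..<m}. fps_X ^ j *\<^sub>h y j)"
    by (simp add: lessThan_atLeast0 sum_diff_nat_ivl)
  then show "(\<Sum>j<m. fps_X ^ j *\<^sub>h y j) - (\<Sum>j<k. fps_X ^ j *\<^sub>h y j) \<in> hpow k UNIV"
    by (auto intro!: hpow_sum hpow_dvd le_imp_power_dvd)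
qed

lemma hcs_VH: "hcs TYPE('n::finite VH)"
  unfolding hcs_def
proof
  have "x = 0" if x: "\<And>n. x \<in> hpow n UNIV" for x :: "'n VH"
  proof -
    have "Rep_VH x = 0"
    proof (rule hcs_eqI[OF hcs_Hplus])
      show "Rep_VH x - 0 \<in> hpow k UNIV" for k
        using hpow_hlinear[OF Rep_lin x] by simp
    qed
    then show ?thesis using vproj_Rep[of x] by (simp add: hlinear_0[OF vproj_lin])
  qed
  then show "hseparated (UNIV :: 'n VH set)"
    by (auto simp: hseparated_def)
  show "hcomplete (UNIV :: 'n VH set)"
  proof (rule hcompleteI)
    fix y :: "nat \<Rightarrow> 'n VH"
    obtain l where l: "\<And>n. l - (\<Sum>k<n. fps_X ^ k *\<^sub>h Rep_VH (y k)) \<in> hpow n UNIV"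
      using hcs_expansion[OF hcs_Hplus, of "\<lambda>k. Rep_VH (y k)"] by blast
    have "vproj l - (\<Sum>k<n. fps_X ^ k *\<^sub>h y k) \<in> hpow n UNIV" for n
      using hpow_hlinear[OF vproj_lin l[of n]]
      by (simp add: hlinear_diff[OF vproj_lin] hlinear_sum[OF vproj_lin] hlinear_scale[OF vproj_lin] vproj_Rep)
    then show "\<exists>l. \<forall>n. l - (\<Sum>k<n. fps_X ^ k *\<^sub>h y k) \<in> hpow n UNIV" by blast
  qed
qed

definition gm :: "'n::finite \<Rightarrow> nat \<Rightarrow> 'n VH \<Rightarrow> 'n VH"
  where "gm i r v = vproj (xgen (i, i, r) * Rep_VH v)"

definition vvac :: "'n::finite VH"
  where "vvac = Abs_VH 1"

lemma Rep_vvac: "Rep_VH (vvac :: 'n::finite VH) = 1" and vproj_1: "vproj 1 = (vvac :: 'n VH)"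
proof -
  show "vproj 1 = (vvac :: 'n VH)" by (simp add: vvac_def vproj_def pvh_1)
  then show "Rep_VH (vvac :: 'n VH) = 1" using Rep_vproj[of "1 :: 'n Hplus"] by (simp add: pvh_1)
qed

lemma Rep_gm: "Rep_VH (gm i r v) = xgen (i, i, r) * Rep_VH v"
  by (simp add: gm_def Rep_vproj pvh_xgen pvh_Rep)

lemma vproj_xgen: "vproj (xgen (i, i, r) * a) = gm i r (vproj a)"
  by (rule Rep_VH_inject[THEN iffD1]) (simp add: Rep_gm Rep_vproj pvh_xgen)

lemma gm_lin: "hlinear (gm i r)"
  unfolding gm_def[abs_def]
  by (rule hlinear_compose[OF vproj_lin hlinear_compose[OF hlinear_mult_Hplus Rep_lin]])

definition vmon :: "('n::finite \<times> nat) list \<Rightarrow> 'n VH"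
  where "vmon l = foldr (\<lambda>(i, r). gm i r) l vvac"

lemma vmon_simps [simp]: "vmon [] = vvac" "vmon ((i, r) # l) = gm i r (vmon l)"
  by (simp_all add: vmon_def)

lemma vproj_xmon: "vproj (xmon l) = (if diag_list l then vmon (map (\<lambda>g. (fst g, snd (snd g))) l) else 0)"
proof (cases "diag_list l")
  case True
  then show ?thesis
  proof (induction l)
    case (Cons g l)
    then obtain i r where "g = (i, i, r)" by (cases g) auto
    with Cons show ?case by (simp add: vproj_xgen)
  qed (simp add: vproj_1)
next
  case False
  then show ?thesis
    using vproj_Rep[of "vproj (xmon l)"] by (simp add: Rep_vproj pvh_xmon hlinear_0[OF vproj_lin])
qed

lemma hgen_image:
  assumes B: "hgen B" and f: "hlinear f" and surj: "\<And>y. \<exists>x. f x = y"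
  shows "hgen (f ` B)"
  unfolding hgen_def
proof
  fix y
  obtain x where y: "y = f x" using surj[of y] by blast
  obtain b a' where b: "b \<in> hmod.span B" "x = b + fps_X *\<^sub>h a'" using B unfolding hgen_def by blast
  have "hmod.span B \<subseteq> {x. f x \<in> hmod.span (f ` B)}"
  proof (rule hmod.span_minimal)
    show "hmod.subspace {x. f x \<in> hmod.span (f ` B)}"
      by (rule hmod.subspaceI) (simp_all add: hlinear_0[OF f] hlinear_add[OF f] hlinear_scale[OF f]
          hmod.span_zero hmod.span_add hmod.span_scale)
  qed (auto intro: hmod.span_base)
  then have "f b \<in> hmod.span (f ` B)" using b(1) by blast
  then show "\<exists>b\<in>hmod.span (f ` B). \<exists>a'. y = b + fps_X *\<^sub>h a'"
    using b(2) by (intro bexI[of _ "f b"] exI[of _ "f a'"]) (simp_all add: y hlinear_add[OF f] hlinear_scale[OF f])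
qed

lemma hgen_VH: "hgen (range vmon)"
proof -
  have 1: "hgen (vproj ` range xmon)"
    using vproj_Rep by (intro hgen_image[OF hgen_Hplus vproj_lin]) blast
  have "vproj ` range xmon \<subseteq> hmod.span (range vmon)"
    by (auto simp: vproj_xmon hmod.span_zero hmod.span_base[OF rangeI])
  then have "hmod.span (vproj ` range xmon) \<subseteq> hmod.span (range vmon)"
    by (rule hmod.span_minimal[OF _ hmod.subspace_span])
  then show ?thesis using 1 unfolding hgen_def by blast
qed

definition vder :: "('n::finite \<times> 'n \<times> nat \<Rightarrow> complex fps) \<Rightarrow> 'n VH \<Rightarrow> 'n VH"
  where "vder d v = vproj (hder d (Rep_VH v))"

context
  fixes d :: "'n::finite \<times> 'n \<times> nat \<Rightarrow> complex fps"
  assumes d: "trace_free d"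
begin

lemma Rep_vder: "Rep_VH (vder d v) = hder d (Rep_VH v)"
  using pvh_hder[OF d, of "Rep_VH v"] by (simp add: vder_def Rep_vproj pvh_Rep)

lemma vder_lin: "hlinear (vder d)"
  unfolding vder_def[abs_def]
  by (rule hlinear_compose[OF vproj_lin hlinear_compose[OF hlinear_hder[OF d] Rep_lin]])

lemma vder_vvac: "vder d vvac = 0"
  by (simp add: vder_def Rep_vvac hder_1[OF d] hlinear_0[OF vproj_lin])

lemma vder_gm: "vder d (gm j a u) = gm j a (vder d u) + d (j, j, a) *\<^sub>h u"
  by (rule Rep_VH_inject[THEN iffD1])
    (simp add: Rep_vder Rep_gm hder_xgen[OF d] plus_VH.rep_eq hscale_VH.rep_eq)

end

lemma vder_summable:
  assumes "\<And>p. trace_free (d p)" "\<And>g. fps_summable (\<lambda>p. d p g)"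
  shows "hsummable (\<lambda>p. vder (d p) u) UNIV"
  unfolding vder_def by (rule hsummable_hlinear[OF hsummable_hder[OF assms] vproj_lin])

section \<open>The derivations attached to a generator of the subalgebra\<close>

definition kcoeff :: "complex \<Rightarrow> 'n::finite \<Rightarrow> nat \<Rightarrow> nat \<Rightarrow> 'n \<times> 'n \<times> nat \<Rightarrow> complex fps"
  where "kcoeff c i r p g = Kc c (i, fst g) (i, fst (snd g)) r (snd (snd g)) p"

lemma trace_free_kcoeff: "trace_free (kcoeff c i r p)"
  by (simp add: trace_free_def kcoeff_def Kc_tr2)

lemma kcoeff_summable: "fps_summable (\<lambda>p. kcoeff c i r p g)"
  using Kc_dvd[of _ r "snd (snd g)"]
  by (intro fps_summableI[of "r + snd (snd g) + 2"]) (simp add: kcoeff_def diff_diff_add)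

text \<open>For positive p this is the action of mode -p of the r-th divided derivative of x_ii(z),
  see \<open>mode_derivation\<close>.\<close>

definition dpos :: "complex \<Rightarrow> 'n::finite \<Rightarrow> nat \<Rightarrow> nat \<Rightarrow> 'n VH \<Rightarrow> 'n VH"
  where "dpos c i r p = vder (kcoeff c i r p)"

definition dtw :: "complex \<Rightarrow> 'n::finite \<Rightarrow> nat \<Rightarrow> nat \<Rightarrow> 'n VH \<Rightarrow> 'n VH"
  where "dtw c i r p = vder (tcoeff c (i, i, r) p)"

text \<open>Defined as a difference, so that the relation with the twist holds by construction.
  \<open>dneg_gm\<close> then shows that it is the derivation whose kernel has its two arguments
  exchanged.\<close>

definition dneg :: "complex \<Rightarrow> 'n::finite \<Rightarrow> nat \<Rightarrow> nat \<Rightarrow> 'n VH \<Rightarrow> 'n VH"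
  where "dneg c i r p v = (- 1) ^ p *\<^sub>h dpos c i r p v - dtw c i r p v"

text \<open>At l = 0 the expansion coefficient in \<open>mode_commutator\<close> is 1, so the kernel
  is the commutator of mode k with a generator. If k + r is nonnegative, both sides vanish together
  with the binomial factor.\<close>

lemma mode_derivation:
  assumes "k < 0"
  shows "Hp.ymode c (i, i, r) k w = hder (kcoeff c i r (nat (- k))) w"
proof -
  have dc: "diff_coeff k 0 = 1" by (simp add: diff_coeff_def)
  have mb: "mbin 0 a = 1" for a by (simp add: mbin_def binomial_gbinomial[symmetric])
  have kc: "kcoeff c i r (nat (- k)) g = fps_const (mbin k r) * (- Sdiff c (i, fst g) (i, fst (snd g)) (k + int r) (int (snd (snd g))))" for g
    using mode_commutator[of k r 0 "snd (snd g)" c "(i, fst g)" "(i, fst (snd g))"]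
    by (simp add: kcoeff_def dc mb)
  show ?thesis
  proof (cases "0 \<le> k + int r")
    case True
    then have "mbin k r = 0" using assms mbin_zero by simp
    then show ?thesis by (simp add: Hp.ymode_def hder_zero kc)
  next
    case False
    then have "kcoeff c i r (nat (- k)) = (\<lambda>g. fps_const (mbin k r) * xminus_coeff c i i (nat (- (k + int r))) g)"
      by (simp add: fun_eq_iff kc xminus_coeff_def add.commute)
    then show ?thesis
      using False by (simp add: Hp.ymode_def xop_def xminus_eq hder_scale[OF trace_free_xminus])
  qed
qed

definition vmode :: "complex \<Rightarrow> 'n::finite \<Rightarrow> nat \<Rightarrow> int \<Rightarrow> 'n VH \<Rightarrow> 'n VH"
  where "vmode c i r k v = (if 0 \<le> k then mbin k r *\<^sub>c gm i (nat k + r) v else dpos c i r (nat (- k)) v)"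

lemma Rep_vmode: "Rep_VH (vmode c i r k v) = Hp.ymode c (i, i, r) k (Rep_VH v)"
proof (cases "0 \<le> k")
  case True
  then show ?thesis
    by (simp add: vmode_def hscale_VH.rep_eq Rep_gm Hp.ymode_def xop_def xgen_def nat_add_distrib)
next
  case False
  then show ?thesis
    by (simp add: vmode_def dpos_def Rep_vder[OF trace_free_kcoeff] mode_derivation)
qed

lemma vproj_mode: "pvh w = w \<Longrightarrow> pvh (Hp.ymode c (i, i, r) k w) = Hp.ymode c (i, i, r) k w"
  using Rep_vmode[of c i r k "vproj w"] pvh_Rep[of "vmode c i r k (vproj w)"] by (simp add: Rep_vproj)

text \<open>Diagonal modes preserve the subalgebra, and a convergent sum of elements fixed by the
  continuous map \<open>pvh\<close> is fixed.\<close>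

lemma Ylist_pvh: "diag_list l \<Longrightarrow> pvh w = w \<Longrightarrow> pvh (Hp.Ylist c l w m) = Hp.Ylist c l w m"
proof (induction l arbitrary: w m)
  case Nil
  then show ?case by (simp add: hlinear_0[OF pvh_lin])
next
  case (Cons g l)
  then obtain i r where g: "g = (i, i, r)" by (cases g) auto
  have "pvh (nop (Hp.ymode c g) k (Hp.Ylist c l) w m) = nop (Hp.ymode c g) k (Hp.Ylist c l) w m" for k
    using Cons vproj_mode[of _ c i r k] by (simp add: nop_def g)
  moreover have "hsummable (\<lambda>k. nop (Hp.ymode c g) k (Hp.Ylist c l) w m) UNIV"
    by (rule nop_summable[OF hcs_Hplus Hp.ymode_modes Hp.Ylist_field])
  from hsum_hlinear[OF hcs_Hplus hcs_Hplus this pvh_lin]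
  have "pvh (Hp.Ylist c (g # l) w m) = hsum (\<lambda>k. pvh (nop (Hp.ymode c g) k (Hp.Ylist c l) w m)) UNIV"
    by (simp add: nfield_def)
  ultimately show ?case
    by (simp add: nfield_def)
qed

definition YV :: "complex \<Rightarrow> 'n::finite VH \<Rightarrow> 'n VH \<Rightarrow> int \<Rightarrow> 'n VH"
  where "YV c u v m = Abs_VH (Hplus_Y c (Rep_VH u) (Rep_VH v) m)"

lemma Rep_YV: "Rep_VH (YV c u v m) = Hp.Yh c (Rep_VH u) (Rep_VH v) m"
proof -
  have "pvh (Hp.Yh c (pvh (Rep_VH u)) (Rep_VH v) m) = Hp.Yh c (pvh (Rep_VH u)) (Rep_VH v) m"
    by (rule pvh_induct[of "\<lambda>u. Hp.Yh c u (Rep_VH v) m"])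
      (simp_all add: Hp.Yh_lin_left Hp.Yh_xmon Ylist_pvh pvh_Rep)
  then show ?thesis
    unfolding YV_def Hplus_Y_eq by (intro Abs_VH_inverse) (simp add: VH_carrier_eq pvh_Rep)
qed

lemma YV_eq: "YV c u v m = vproj (Hp.Yh c (Rep_VH u) (Rep_VH v) m)"
  using vproj_Rep[of "YV c u v m"] by (simp add: Rep_YV)

lemma YV_lin_left: "hlinear (\<lambda>u. YV c u v m)"
  unfolding YV_eq by (rule hlinear_compose[OF vproj_lin hlinear_compose[OF Hp.Yh_lin_left Rep_lin]])

lemma YV_lin_right: "hlinear (\<lambda>v. YV c u v m)"
  unfolding YV_eq by (rule hlinear_compose[OF vproj_lin hlinear_compose[OF Hp.Yh_lin_right Rep_lin]])

lemma YV_field: "is_field (YV c u)"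
proof -
  have "\<exists>M. \<forall>m\<le>M. YV c u v m \<in> hpow K UNIV" for v K
  proof -
    obtain M where "\<And>m. m \<le> M \<Longrightarrow> Hp.Yh c (Rep_VH u) (Rep_VH v) m \<in> hpow K UNIV"
      using laurent_h_obtain[OF Hp.Yh_laurent, of c "Rep_VH u" "Rep_VH v" K] by blast
    then show ?thesis unfolding YV_eq using hpow_hlinear[OF vproj_lin] by blast
  qed
  then show ?thesis by (simp add: is_field_def laurent_h_def YV_lin_right)
qed

lemma YV_vvac: "YV c vvac v m = (if m = 0 then v else 0)"
  by (simp add: YV_eq Rep_vvac Hp.Yh_1 vproj_Rep hlinear_0[OF vproj_lin])

lemma YV_gm: "YV c (gm i r u) v m = nfield (vmode c i r) (YV c u) v m"
proof -
  have eq: "vproj (nop (Hp.ymode c (i, i, r)) k (Hp.Yh c (Rep_VH u)) (Rep_VH v) m) = nop (vmode c i r) k (YV c u) v m" for k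
    by (rule Rep_VH_inject[THEN iffD1])
      (simp add: Rep_vproj nop_def pvh_Rep flip: Rep_YV Rep_vmode)
  have "YV c (gm i r u) v m = hsum (\<lambda>k. vproj (nop (Hp.ymode c (i, i, r)) k (Hp.Yh c (Rep_VH u)) (Rep_VH v) m)) UNIV"
    unfolding YV_eq Rep_gm Hp.Yh_xgen
    by (rule hsum_hlinear[OF hcs_VH hcs_Hplus nop_summable[OF hcs_Hplus Hp.ymode_modes Hp.Yh_field] vproj_lin])
  then show ?thesis by (simp only: nfield_def eq)
qed

section \<open>The braiding restricted to the subalgebra\<close>

definition tmR :: "('n::finite VH, 'n VH) ctensor \<Rightarrow> ('n Hplus, 'n Hplus) ctensor"
  where "tmR = tensor_map Rep_VH Rep_VH"

definition tmP :: "('n::finite Hplus, 'n Hplus) ctensor \<Rightarrow> ('n VH, 'n VH) ctensor"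
  where "tmP = tensor_map vproj vproj"

lemma tmR_lin: "hlinear tmR" and tmP_lin: "hlinear tmP"
  and tmR_tensor: "tmR (a \<otimes>\<^sub>h b) = Rep_VH a \<otimes>\<^sub>h Rep_VH b"
  and tmP_tensor: "tmP (a' \<otimes>\<^sub>h b') = vproj a' \<otimes>\<^sub>h vproj b'"
  by (simp_all add: tmR_def tmP_def hlinear_tensor_map tensor_map_tensor Rep_lin vproj_lin)

text \<open>The retraction on the factors makes the map between completed tensor squares injective,
  which gives the definite description in \<open>VH\<close> at most one solution.\<close>

lemma tmP_tmR: "tmP (tmR t) = t"
  by (simp add: tmR_def tmP_def tensor_map_comp Rep_lin vproj_lin vproj_Rep tensor_map_id)

lemma tmR_tmP_mul2: "tmR (tmP (mul2 (i, i, r) t)) = mul2 (i, i, r) (tmR (tmP t))"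
  unfolding tmR_def tmP_def mul2_def
  by (simp add: tensor_map_comp Rep_lin vproj_lin hlinear_ident hlinear_mult_Hplus hlinear_compose[OF Rep_lin vproj_lin] pvh_lin
      hlinear_compose[OF vproj_lin hlinear_mult_Hplus] Rep_vproj pvh_xgen)

text \<open>The two parts of the braiding recursion, multiplication by a diagonal generator and the
  twists, both preserve the image of the smaller tensor square.\<close>

lemma tmR_tmP_Sh: "tmR (tmP (Sh c (Rep_VH v) (Rep_VH (vmon l)) r)) = Sh c (Rep_VH v) (Rep_VH (vmon l)) r"
proof (induction l arbitrary: v r)
  case Nil
  show ?case
    using Sh_xmon[of c "Rep_VH v" "[]" r]
    by (simp add: Rep_vvac tmP_tensor tmR_tensor Rep_vproj pvh_Rep pvh_1 hlinear_0[OF tmR_lin] hlinear_0[OF tmP_lin])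
next
  case (Cons g l)
  obtain i s where g: "g = (i, s)" by (cases g)
  have "Sh c (tder c (i, i, s) p (Rep_VH v)) (Rep_VH (vmon l)) q = Sh c (Rep_VH (dtw c i s p v)) (Rep_VH (vmon l)) q" for p q
    by (simp add: dtw_def Rep_vder[OF trace_free_tcoeff])
  then show ?case
    by (simp add: g Rep_gm Sh_xgen hlinear_add[OF tmR_lin] hlinear_add[OF tmP_lin] hlinear_sum[OF tmR_lin]
        hlinear_sum[OF tmP_lin] tmR_tmP_mul2 Cons)
qed

lemma tmR_tmP_Sop: "tmR (tmP (Sop c (tmR t) r)) = Sop c (tmR t) r"
proof -
  have "(\<lambda>t. tmR (tmP (Sop c (tmR t) r))) = (\<lambda>t. Sop c (tmR t) r)"
  proof (rule hlinear_ctensor_eqI[OF hcs_ctensor hgen_UNIV hgen_VH])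
    show lin: "hlinear (\<lambda>t. Sop c (tmR t) r)" by (rule hlinear_compose[OF Sop_lin tmR_lin])
    show "hlinear (\<lambda>t. tmR (tmP (Sop c (tmR t) r)))"
      by (rule hlinear_compose[OF tmR_lin hlinear_compose[OF tmP_lin lin]])
    show "tmR (tmP (Sop c (tmR (a \<otimes>\<^sub>h b)) r)) = Sop c (tmR (a \<otimes>\<^sub>h b)) r" if "b \<in> range vmon" for a b
      using that by (auto simp: tmR_tensor Sop_tensor tmR_tmP_Sh)
  qed
  then show ?thesis by (rule fun_cong)
qed

definition SV :: "complex \<Rightarrow> ('n::finite VH, 'n VH) ctensor \<Rightarrow> nat \<Rightarrow> ('n VH, 'n VH) ctensor"
  where "SV c t r = tmP (Sop c (tmR t) r)"

lemma VH_eq: "VH c = \<lparr>qva_vacuum = (vvac :: 'n::finite VH), qva_Y = YV c, qva_S = SV c\<rparr>"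
proof -
  have "(THE t'. tmR t' = Sop c (tmR t) r) = SV c t r" for t :: "('n VH, 'n VH) ctensor" and r
  proof (rule the_equality)
    show "tmR (SV c t r) = Sop c (tmR t) r" by (simp add: SV_def tmR_tmP_Sop)
    show "t' = SV c t r" if "tmR t' = Sop c (tmR t) r" for t'
      using that tmP_tmR[of t'] by (simp add: SV_def)
  qed
  then show ?thesis
    by (simp add: VH_def vvac_def YV_def[abs_def] Hplus_S_eq flip: tmR_def)
qed

lemma SV_lin: "hlinear (\<lambda>t. SV c t r)"
  unfolding SV_def by (rule hlinear_compose[OF tmP_lin hlinear_compose[OF Sop_lin tmR_lin]])

lemma SV_summable: "hsummable (SV c t) UNIV"
  using hsummable_hlinear[OF Sop_summable tmP_lin] by (simp add: SV_def[abs_def])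

lemma SV_vvac: "SV c (v \<otimes>\<^sub>h vvac) r = (if r = 0 then v \<otimes>\<^sub>h vvac else 0)"
  using Sh_xmon[of c "Rep_VH v" "[]" r]
  by (simp add: SV_def tmR_tensor Sop_tensor Rep_vvac tmP_tensor vproj_Rep vproj_1 hlinear_0[OF tmP_lin])

definition vmul2 :: "'n::finite \<Rightarrow> nat \<Rightarrow> ('n VH, 'n VH) ctensor \<Rightarrow> ('n VH, 'n VH) ctensor"
  where "vmul2 i r = tensor_map (\<lambda>a. a) (gm i r)"

lemma SV_gm: "SV c (v \<otimes>\<^sub>h gm i s u) r = vmul2 i s (SV c (v \<otimes>\<^sub>h u) r) + (\<Sum>p\<le>r. SV c (dtw c i s p v \<otimes>\<^sub>h u) (r - p))"
proof -
  have mul: "tmP (mul2 (i, i, s) t) = vmul2 i s (tmP t)" for t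
    unfolding tmP_def mul2_def vmul2_def
    by (simp add: tensor_map_comp vproj_lin hlinear_ident hlinear_mult_Hplus gm_lin vproj_xgen)
  show ?thesis
    by (simp add: SV_def tmR_tensor Sop_tensor Rep_gm Sh_xgen dtw_def Rep_vder[OF trace_free_tcoeff]
        hlinear_add[OF tmP_lin] hlinear_sum[OF tmP_lin] mul)
qed

lemma SV_vder:
  assumes d: "trace_free d"
  shows "SV c (vder d v \<otimes>\<^sub>h u) r = tensor_map (vder d) (\<lambda>b. b) (SV c (v \<otimes>\<^sub>h u) r)"
proof -
  let ?D = "tensor_map (hder d) (\<lambda>b. b)"
  have "tmR (vder d v \<otimes>\<^sub>h u) = ?D (tmR (v \<otimes>\<^sub>h u))"
    by (simp add: tmR_tensor Rep_vder[OF d] tensor_map_tensor[OF hlinear_hder[OF d] hlinear_ident])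
  then have "SV c (vder d v \<otimes>\<^sub>h u) r = tmP (?D (Sop c (tmR (v \<otimes>\<^sub>h u)) r))"
    by (simp add: SV_def Sop_der[OF d])
  also have "Sop c (tmR (v \<otimes>\<^sub>h u)) r = tmR (SV c (v \<otimes>\<^sub>h u) r)"
    by (simp add: SV_def tmR_tmP_Sop)
  also have "tmP (?D (tmR t)) = tensor_map (vder d) (\<lambda>b. b) t" for t
    unfolding tmP_def tmR_def
    by (simp add: tensor_map_comp vproj_lin Rep_lin hlinear_ident hlinear_hder[OF d]
        hlinear_compose[OF hlinear_hder[OF d] Rep_lin] vproj_Rep vder_def[abs_def])
  finally show ?thesis .
qed

lemma dpos_lin: "hlinear (dpos c i r p)" and dtw_lin: "hlinear (dtw c i r p)"
  by (simp_all add: dpos_def dtw_def vder_lin trace_free_kcoeff trace_free_tcoeff)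

lemma dneg_lin: "hlinear (dneg c i r p)"
  unfolding dneg_def[abs_def] by (intro hlinear_fun_diff hlinear_fun_scale dpos_lin dtw_lin)

lemma dpos_gm: "dpos c i r p (gm j a u) = gm j a (dpos c i r p u) + Kc c (i, j) (i, j) r a p *\<^sub>h u"
  by (simp add: dpos_def vder_gm[OF trace_free_kcoeff] kcoeff_def)

text \<open>By \<open>Tshift_Kc\<close> the kernel of \<open>dpos\<close> cancels against the first
  part of the twist, and only the flipped kernel remains.\<close>

lemma dneg_gm: "dneg c i r p (gm j a u) = gm j a (dneg c i r p u) + Kc c (j, i) (j, i) a r p *\<^sub>h u"
proof -
  have "dtw c i r p (gm j a u) = gm j a (dtw c i r p u) +
      ((- 1) ^ p * Kc c (i, j) (i, j) r a p - Kc c (j, i) (j, i) a r p) *\<^sub>h u"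
    by (simp add: dtw_def vder_gm[OF trace_free_tcoeff] tcoeff_def Tshift_Kc)
  then show ?thesis
    by (simp add: dneg_def dpos_gm hlinear_diff[OF gm_lin] hlinear_scale[OF gm_lin] hscale_add_right
        hmod.scale_left_diff_distrib)
qed

lemma dpos_vvac: "dpos c i r p vvac = 0" and dneg_vvac: "dneg c i r p vvac = 0"
  by (simp_all add: dneg_def dpos_def dtw_def vder_vvac trace_free_kcoeff trace_free_tcoeff)

lemma dpos_summable: "hsummable (\<lambda>p. dpos c i r p v) UNIV"
  unfolding dpos_def by (rule vder_summable[OF trace_free_kcoeff kcoeff_summable])

lemma dtw_summable: "hsummable (\<lambda>p. dtw c i r p v) UNIV"
  unfolding dtw_def by (rule vder_summable[OF trace_free_tcoeff tcoeff_summable])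

lemma dneg_summable: "hsummable (\<lambda>p. dneg c i r p v) UNIV"
proof -
  have "hsummable (\<lambda>p. (- 1) ^ p *\<^sub>h dpos c i r p v) UNIV"
    by (rule hsummable_weaken[OF dpos_summable]) (rule hpow_scale)
  moreover have "hsummable (\<lambda>p. - dtw c i r p v) UNIV"
    by (rule hsummable_weaken[OF dtw_summable]) (rule hpow_uminus)
  ultimately show ?thesis
    using hsummable_add by (fastforce simp: dneg_def)
qed

lemma dpos_0: "dpos c i r 0 v = 0"
  using vproj_Rep[of "dpos c i r 0 v"]
  by (simp add: dpos_def vder_def hder_zero kcoeff_def Kc_0 hlinear_0[OF vproj_lin])

lemma tensor_map_dneg:
  "tensor_map (dneg c i r p) (\<lambda>b. b) t =
    (- 1) ^ p *\<^sub>h tensor_map (dpos c i r p) (\<lambda>b. b) t - tensor_map (dtw c i r p) (\<lambda>b. b) t"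
proof -
  have "tensor_map (dneg c i r p) (\<lambda>b. b) =
      (\<lambda>t. (- 1) ^ p *\<^sub>h tensor_map (dpos c i r p) (\<lambda>b. b) t - tensor_map (dtw c i r p) (\<lambda>b. b) t)"
    by (rule hlinear_ctensor_eqI[OF hcs_ctensor hgen_UNIV hgen_UNIV])
      (auto simp: tensor_map_tensor dneg_lin dpos_lin dtw_lin hlinear_ident dneg_def
        hlinear_diff[OF hlinear_tensor_left] hlinear_scale[OF hlinear_tensor_left]
        intro!: hlinear_tensor_map hlinear_fun_diff hlinear_fun_scale dneg_lin dpos_lin dtw_lin)
  then show ?thesis by (rule fun_cong)
qed

lemma SV_dneg: "SV c (dneg c i s p v \<otimes>\<^sub>h u) r = tensor_map (dneg c i s p) (\<lambda>b. b) (SV c (v \<otimes>\<^sub>h u) r)"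
proof -
  have "SV c (dneg c i s p v \<otimes>\<^sub>h u) r =
      (- 1) ^ p *\<^sub>h SV c (dpos c i s p v \<otimes>\<^sub>h u) r - SV c (dtw c i s p v \<otimes>\<^sub>h u) r"
    by (simp add: dneg_def hlinear_diff[OF hlinear_tensor_left] hlinear_scale[OF hlinear_tensor_left]
        hlinear_diff[OF SV_lin] hlinear_scale[OF SV_lin])
  then show ?thesis
    by (simp add: tensor_map_dneg dpos_def dtw_def SV_vder trace_free_kcoeff trace_free_tcoeff)
qed

section \<open>The Jacobi identity\<close>

context
  assumes hc: "hcs TYPE('a::hmodule)"
begin

lemma hsum_pair:
  fixes f :: "'i \<times> 'j \<Rightarrow> 'a"
  assumes "hsummable f UNIV"
  shows "hsum f UNIV = hsum (\<lambda>x. hsum (\<lambda>y. f (x, y)) UNIV) UNIV"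
  using hsum_Sigma[OF hc, of f UNIV "\<lambda>_. UNIV"] assms by simp

lemma hsum_pair_swap:
  fixes f :: "'i \<Rightarrow> 'j \<Rightarrow> 'a"
  assumes "hsummable (\<lambda>(x, y). f x y) UNIV"
  shows "hsum (\<lambda>x. hsum (\<lambda>y. f x y) UNIV) UNIV = hsum (\<lambda>y. hsum (\<lambda>x. f x y) UNIV) UNIV"
  using hsum_swap[OF hc, of f UNIV UNIV] assms by simp

lemma hsummable_pairD:
  fixes f :: "'i \<times> 'j \<Rightarrow> 'a"
  assumes "hsummable f UNIV"
  shows "hsummable (\<lambda>y. f (x, y)) UNIV" "hsummable (\<lambda>x. hsum (\<lambda>y. f (x, y)) UNIV) UNIV"
  using hsummable_SigmaD[OF hc, of f UNIV "\<lambda>_. UNIV"] assms by simp_all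

text \<open>Regrouping by t = k + j trades two infinite indices for one and a finite inner sum of
  coefficients, which is where Vandermonde-type identities enter.\<close>

lemma hsum_convolve:
  fixes X :: "'x \<Rightarrow> nat \<Rightarrow> 'a" and \<alpha> :: "nat \<Rightarrow> 'x \<Rightarrow> nat \<Rightarrow> complex"
  assumes X: "hsummable (\<lambda>(x, t). X x t) UNIV"
  shows "hsummable (\<lambda>(k, x, j). \<alpha> k x j *\<^sub>c X x (k + j)) UNIV"
    and "hsum (\<lambda>(k, x, j). \<alpha> k x j *\<^sub>c X x (k + j)) UNIV =
      hsum (\<lambda>(x, t). (\<Sum>j\<le>t. \<alpha> (t - j) x j) *\<^sub>c X x t) UNIV"
proof -
  let ?h = "\<lambda>((x :: 'x, t :: nat), j :: nat). (t - j, x, j)"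
  let ?A = "Sigma (UNIV :: ('x \<times> nat) set) (\<lambda>p. {..snd p})"
  let ?g = "\<lambda>(k, x, j). \<alpha> k x j *\<^sub>c X x (k + j)"
  let ?f = "\<lambda>((x, t), j). \<alpha> (t - j) x j *\<^sub>c X x t"
  have bij: "bij_betw ?h ?A UNIV"
    by (rule bij_betw_byWitness[where f' = "\<lambda>(k, x :: 'x, j). ((x, k + j), j)"]) auto
  have gh: "?g (?h p) = ?f p" if "p \<in> ?A" for p
    using that by (cases p) (auto split: prod.split)
  have f: "hsummable ?f ?A"
  proof (rule hsummable_SigmaI)
    fix K
    let ?F = "{p. (case p of (x, t) \<Rightarrow> X x t) \<notin> hpow K UNIV}"
    have "finite ?F" using X by (simp add: hsummable_def)
    then show "\<exists>F. finite F \<and> (\<forall>p\<in>UNIV - F. \<forall>j\<in>{..snd p}. ?f (p, j) \<in> hpow K UNIV)"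
      by (intro exI[of _ ?F]) (auto intro: hpow_scale)
  qed simp
  then have gA: "hsummable (\<lambda>p. ?g (?h p)) ?A"
    by (rule hsummable_weaken) (simp only: gh)
  then show s: "hsummable ?g UNIV"
    using hsummable_reindex[of ?h ?A ?g] bij by (simp only: bij_betw_def)
  have "hsum ?g UNIV = hsum (\<lambda>p. ?g (?h p)) ?A"
    by (rule hsum_bij[OF hc bij gA])
  also have "\<dots> = hsum ?f ?A"
    by (rule hsum_cong) (rule gh)
  also have "\<dots> = hsum (\<lambda>p. hsum (\<lambda>j. ?f (p, j)) {..snd p}) UNIV"
    by (rule hsum_Sigma[OF hc f])
  also have "\<dots> = hsum (\<lambda>(x, t). (\<Sum>j\<le>t. \<alpha> (t - j) x j) *\<^sub>c X x t) UNIV"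
    by (rule hsum_cong) (auto simp: hsum_finite[OF hc] fps_const_sum hmod.scale_sum_left split: prod.split)
  finally show "hsum ?g UNIV = hsum (\<lambda>(x, t). (\<Sum>j\<le>t. \<alpha> (t - j) x j) *\<^sub>c X x t) UNIV" .
qed

lemma nfield_hsum_swap:
  fixes f :: "int \<Rightarrow> 'a \<Rightarrow> 'a"
  assumes f: "is_modes f" and B: "unif_family UNIV B"
  shows "nfield f (\<lambda>w m. hsum (\<lambda>x. B x w m) UNIV) w m = hsum (\<lambda>x. nfield f (B x) w m) UNIV"
proof -
  have "hsummable (\<lambda>(k, x). nop f k (B x) w m) UNIV"
    using unif_family_summable[OF unif_family_nop[OF hc f B], of w m] by (simp add: case_prod_unfold)
  from hsum_pair_swap[OF this] show ?thesis
    by (simp only: nfield_def nop_hsum[OF hc f B])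
qed

end

lemma hsummable_pairI:
  fixes f :: "'i \<times> 'j \<Rightarrow> 'a::hmodule"
  assumes "\<And>K. \<exists>F. finite F \<and> (\<forall>x. x \<notin> F \<longrightarrow> (\<forall>y. f (x, y) \<in> hpow K UNIV))"
    and "\<And>x. hsummable (\<lambda>y. f (x, y)) UNIV"
  shows "hsummable f UNIV"
  using hsummable_SigmaI[of UNIV "\<lambda>_. UNIV" f] assms by (simp add: Ball_def)

text \<open>A null family fed into a linear f: modulo h^K only finitely many rows count, because f
  respects the filtration.\<close>

lemma hsummable_pair_lin:
  assumes f: "\<And>x y. hlinear (\<lambda>v. f v x y)" and g: "hsummable g UNIV"
    and s: "\<And>v x. hsummable (f v x) UNIV"
  shows "hsummable (\<lambda>(x, y). f (g x) x y) UNIV"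
proof (rule hsummable_pairI)
  fix K
  have "finite {x. g x \<notin> hpow K UNIV}" using g by (simp add: hsummable_def)
  moreover have "\<forall>x. x \<notin> {x. g x \<notin> hpow K UNIV} \<longrightarrow> (\<forall>y. (case (x, y) of (x, y) \<Rightarrow> f (g x) x y) \<in> hpow K UNIV)"
    using hpow_hlinear[OF f] by auto
  ultimately show "\<exists>F. finite F \<and> (\<forall>x. x \<notin> F \<longrightarrow> (\<forall>y. (case (x, y) of (x, y) \<Rightarrow> f (g x) x y) \<in> hpow K UNIV))"
    by (intro exI[of _ "{x. g x \<notin> hpow K UNIV}"] conjI)
qed (simp add: s)

lemma laurent_summable: "laurent_h g \<Longrightarrow> hsummable (\<lambda>k. g (d - int k)) UNIV"
proof (rule hsummableI)
  fix K assume g: "laurent_h g"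
  obtain M where M: "\<And>m. m \<le> M \<Longrightarrow> g m \<in> hpow K UNIV"
    using laurent_h_obtain[OF g, of K] by blast
  show "\<exists>F. finite F \<and> (\<forall>k\<in>UNIV - F. g (d - int k) \<in> hpow K UNIV)"
    by (rule exI[of _ "{..nat (d - M)}"]) (auto intro!: M)
qed

lemma nop_shift:
  assumes "is_modes f"
  shows "nop f k (\<lambda>w m. c *\<^sub>h A w (m + s)) w m = c *\<^sub>h nop f k A w (m + s)"
  by (simp add: nop_def hlinear_scale[OF is_modes_lin[OF assms]] algebra_simps)

lemma nfield_shift:
  fixes f :: "int \<Rightarrow> 'w::hmodule \<Rightarrow> 'w"
  assumes hc: "hcs TYPE('w)" and f: "is_modes f" and A: "is_field A"
  shows "nfield f (\<lambda>w m. c *\<^sub>h A w (m + s)) w m = c *\<^sub>h nfield f A w (m + s)"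
  unfolding nfield_def nop_shift[OF f] by (rule hsum_scale[OF hc nop_summable[OF hc f A]])

lemma nfield_add:
  fixes f :: "int \<Rightarrow> 'w::hmodule \<Rightarrow> 'w"
  assumes hc: "hcs TYPE('w)" and f: "is_modes f" and A: "is_field A" and B: "is_field B"
  shows "nfield f (\<lambda>w m. A w m + B w m) w m = nfield f A w m + nfield f B w m"
proof -
  have "nop f k (\<lambda>w m. A w m + B w m) w m = nop f k A w m + nop f k B w m" for k
    by (simp add: nop_def hlinear_add[OF is_modes_lin[OF f]])
  then show ?thesis
    by (simp add: nfield_def hsum_add[OF hc] nop_summable[OF hc f] A B)
qed

text \<open>Uniformity comes from the null sequence g: modulo h^K only finitely many p contribute,
  and each of these is a single Laurent series.\<close>

lemma unif_family_null:
  fixes A :: "'x::hmodule \<Rightarrow> nat \<Rightarrow> 'w::hmodule \<Rightarrow> int \<Rightarrow> 'w" and g :: "'w \<Rightarrow> nat \<Rightarrow> 'x"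
  assumes lin: "\<And>p w m. hlinear (\<lambda>x. A x p w m)" and wlin: "\<And>p m. hlinear (\<lambda>w. A (g w p) p w m)"
    and lau: "\<And>x p w. laurent_h (A x p w)" and g: "\<And>w. hsummable (g w) UNIV"
  shows "unif_family UNIV (\<lambda>p w. A (g w p) p w)"
  unfolding unif_family_def
proof (intro conjI ballI allI)
  show "hlinear (\<lambda>w. A (g w p) p w m)" for p m by (rule wlin)
  show "\<exists>M. \<forall>m\<le>M. \<forall>p\<in>UNIV. A (g w p) p w m \<in> hpow K UNIV" for w K
  proof -
    let ?F = "{p. g w p \<notin> hpow K UNIV}"
    have fin: "finite ?F" using g[of w] by (simp add: hsummable_def)
    have "\<forall>p. \<exists>M. \<forall>m\<le>M. A (g w p) p w m \<in> hpow K UNIV"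
      using lau unfolding laurent_h_def by blast
    then obtain N where N: "\<And>p m. m \<le> N p \<Longrightarrow> A (g w p) p w m \<in> hpow K UNIV" by metis
    \<comment> \<open>The element 0 keeps the minimum meaningful when no p is exceptional.\<close>
    define M where "M = Min (insert 0 (N ` ?F))"
    have "A (g w p) p w m \<in> hpow K UNIV" if "m \<le> M" for p m
    proof (cases "p \<in> ?F")
      case True
      then have "M \<le> N p" using fin by (simp add: M_def)
      then show ?thesis using that by (intro N) simp
    next
      case False
      then show ?thesis using hpow_hlinear[OF lin] by simp
    qed
    then show ?thesis by blast
  qed
  show "hsummable (\<lambda>p. A (g w p) p w m) UNIV" for w m
    by (rule hsummable_weaken[OF g]) (rule hpow_hlinear[OF lin])
qed

text \<open>The data on which the Jacobi identity depends, stripped of polynomial algebras and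
  matrices. Multiplying u by a generator leaves \<open>der\<close> on v, multiplying v leaves
  \<open>der'\<close> on u, and \<open>tw\<close> is the contraction made by the braiding. The
  commutators on W and the derivations on V share the kernel \<open>kap\<close>; this is the link
  between module and algebra.\<close>

locale vertex_setup =
  fixes vac :: "'v::hmodule" and gm :: "'i \<Rightarrow> nat \<Rightarrow> 'v \<Rightarrow> 'v"
    and der der' tw :: "'i \<Rightarrow> nat \<Rightarrow> nat \<Rightarrow> 'v \<Rightarrow> 'v"
    and kap :: "'i \<Rightarrow> nat \<Rightarrow> 'i \<Rightarrow> nat \<Rightarrow> nat \<Rightarrow> complex fps"
    and Y :: "'v \<Rightarrow> 'v \<Rightarrow> int \<Rightarrow> 'v" and S :: "('v, 'v) ctensor \<Rightarrow> nat \<Rightarrow> ('v, 'v) ctensor"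
    and YW :: "'v \<Rightarrow> 'w::hmodule \<Rightarrow> int \<Rightarrow> 'w" and ym :: "'i \<Rightarrow> nat \<Rightarrow> int \<Rightarrow> 'w \<Rightarrow> 'w"
  assumes hcV: "hcs TYPE('v)" and hcW: "hcs TYPE('w)"
    and gen: "hgen (range (\<lambda>l. foldr (\<lambda>(i, r). gm i r) l vac))"
    and gm_lin: "hlinear (gm i r)"
    and der_lin: "hlinear (der i r p)" and der'_lin: "hlinear (der' i r p)"
    and der_vac: "der i r p vac = 0" and der'_vac: "der' i r p vac = 0"
    and der_gm: "der i r p (gm j a u) = gm j a (der i r p u) + kap i r j a p *\<^sub>h u"
    and der'_gm: "der' i r p (gm j a u) = gm j a (der' i r p u) + kap j a i r p *\<^sub>h u"
    and der_sum: "hsummable (\<lambda>p. der i r p v) UNIV" and der'_sum: "hsummable (\<lambda>p. der' i r p v) UNIV"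
    and der_0: "der i r 0 v = 0" and kap_0: "kap i r j a 0 = 0"
    and tw: "tw i r p v = (- 1) ^ p *\<^sub>h der i r p v - der' i r p v"
    and Y_lin_left: "hlinear (\<lambda>u. Y u v m)" and Y_field: "is_field (Y u)"
    and Y_vac: "Y vac v m = (if m = 0 then v else 0)"
    and Y_gm: "Y (gm i r u) v m = nfield
      (\<lambda>k v. if 0 \<le> k then mbin k r *\<^sub>c gm i (nat k + r) v else der i r (nat (- k)) v) (Y u) v m"
    and YW_lin_left: "hlinear (\<lambda>u. YW u w m)" and YW_field: "is_field (YW u)"
    and YW_vac: "YW vac w m = (if m = 0 then w else 0)"
    and YW_gm: "YW (gm i r u) w m = nfield (ym i r) (YW u) w m"
    and ym_modes: "is_modes (ym i r)"
    and ym_comm: "ym i r k (ym j a l w) - ym j a l (ym i r k w) =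
      (fps_const (diff_coeff k l) * kap i r j a (nat (- (k + l)))
        - fps_const (diff_coeff l k) * kap j a i r (nat (- (k + l)))) *\<^sub>h w"
    and ym_shift: "mbin (int n) r *\<^sub>c ym i (n + r) k w = (of_int (k + int n) gchoose n) *\<^sub>c ym i r (k + int n) w"
    and S_lin: "hlinear (\<lambda>t. S t r)" and S_sum: "hsummable (S t) UNIV"
    and S_vac: "S (v \<otimes>\<^sub>h vac) n = (if n = 0 then v \<otimes>\<^sub>h vac else 0)"
    and S_gm: "S (v \<otimes>\<^sub>h gm i r u) n = tensor_map (\<lambda>a. a) (gm i r) (S (v \<otimes>\<^sub>h u) n)
      + (\<Sum>p\<le>n. S (tw i r p v \<otimes>\<^sub>h u) (n - p))"
    and S_der': "S (der' i r p v \<otimes>\<^sub>h u) n = tensor_map (der' i r p) (\<lambda>b. b) (S (v \<otimes>\<^sub>h u) n)"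
begin

abbreviation vmon :: "('i \<times> nat) list \<Rightarrow> 'v"
  where "vmon l \<equiv> foldr (\<lambda>(i, r). gm i r) l vac"

lemma YW_lin: "hlinear (\<lambda>w. YW u w m)" and YW_laurent: "laurent_h (YW u w)"
  using YW_field by (auto simp: is_field_def)

lemma ym_lin: "hlinear (ym i r k)"
  by (rule is_modes_lin[OF ym_modes])

lemma induct_gen:
  assumes "hlinear f" "hlinear g" "hcs TYPE('d::hmodule)" "\<And>l. f (vmon l) = (g (vmon l) :: 'd)"
  shows "f u = g u"
proof -
  have "f = g"
    by (rule hlinear_eqI[OF assms(3) gen assms(1,2)]) (use assms(4) in blast)
  then show ?thesis by simp
qed

lemma shift_field: "is_field (\<lambda>w d. \<alpha> *\<^sub>h YW v w (d + s))"
proof -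
  have "\<exists>M. \<forall>d\<le>M. \<alpha> *\<^sub>h YW v w (d + s) \<in> hpow K UNIV" for w K
  proof -
    obtain M where M: "\<And>m. m \<le> M \<Longrightarrow> YW v w m \<in> hpow K UNIV"
      using laurent_h_obtain[OF YW_laurent, of v w K] by blast
    show ?thesis by (rule exI[of _ "M - s"]) (auto intro!: hpow_scale M)
  qed
  then show ?thesis
    by (simp add: is_field_def laurent_h_def hlinear_fun_scale YW_lin)
qed

section \<open>Commutators of modes with vertex operators\<close>

definition dsum :: "(nat \<Rightarrow> 'v \<Rightarrow> 'v) \<Rightarrow> (nat \<Rightarrow> complex) \<Rightarrow> int \<Rightarrow> 'v \<Rightarrow> 'w \<Rightarrow> int \<Rightarrow> 'w"
  where "dsum D c k v w d = hsum (\<lambda>p. c p *\<^sub>c YW (D p v) w (d + (int p + k))) UNIV"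

context
  fixes D :: "nat \<Rightarrow> 'v \<Rightarrow> 'v" and c :: "nat \<Rightarrow> complex" and k :: int and \<kappa> :: "'i \<Rightarrow> nat \<Rightarrow> nat \<Rightarrow> complex fps"
  assumes D_lin: "\<And>p. hlinear (D p)" and D_sum: "\<And>v. hsummable (\<lambda>p. D p v) UNIV"
    and D_gm: "\<And>p j a u. D p (gm j a u) = gm j a (D p u) + \<kappa> j a p *\<^sub>h u" and D_vac: "\<And>p. D p vac = 0"
begin

lemma dsum_family: "unif_family UNIV (\<lambda>p w d. c p *\<^sub>c YW (D p v) w (d + (int p + k)))"
  by (rule unif_family_null[where A = "\<lambda>v p w d. c p *\<^sub>c YW v w (d + (int p + k))" and g = "\<lambda>w p. D p v"])
    (rule hlinear_fun_scale[OF YW_lin_left] hlinear_fun_scale[OF YW_lin] is_field_laurent[OF shift_field] D_sum)+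

lemma dsum_field: "is_field (dsum D c k v)"
  using is_field_hsum[OF hcW dsum_family] by (simp add: dsum_def[abs_def])

lemma dsum_lin: "hlinear (\<lambda>v. dsum D c k v w d)"
  unfolding dsum_def
  by (rule hlinear_hsum[OF hcW _ unif_family_summable[OF dsum_family]])
    (rule hlinear_fun_scale[OF hlinear_compose[OF YW_lin_left D_lin]])

lemma dsum_vac: "dsum D c k vac w d = 0"
  by (simp add: dsum_def D_vac hlinear_0[OF YW_lin_left] hsum_0[OF hcW])

text \<open>Convergence of the kernel is recovered from that of the derivations: the scalar part of
  \<open>D p (gm j a u)\<close> is a difference of two convergent families.\<close>

lemma kappa_summable: "hsummable (\<lambda>p. (fps_const (c p) * \<kappa> j a p) *\<^sub>h YW u w (d + (int p + k))) UNIV"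
proof -
  have "hsummable (\<lambda>p. D p (gm j a u) + - gm j a (D p u)) UNIV"
    by (intro hsummable_add D_sum hsummable_weaken[OF hsummable_hlinear[OF D_sum[of u] gm_lin[of j a]] hpow_uminus])
  then have 1: "hsummable (\<lambda>p. \<kappa> j a p *\<^sub>h u) UNIV" by (simp add: D_gm)
  have "(fps_const (c p) * \<kappa> j a p) *\<^sub>h YW u w (d + (int p + k)) \<in> hpow K UNIV"
    if "\<kappa> j a p *\<^sub>h u \<in> hpow K UNIV" for p K
    using hpow_scale[OF hpow_hlinear[OF YW_lin_left that], of "fps_const (c p)" w "d + (int p + k)"]
    by (simp add: hlinear_scale[OF YW_lin_left])
  then show ?thesis by (rule hsummable_weaken[OF 1])
qed

lemma dsum_gm: "dsum D c k (gm j a u) w d = nfield (ym j a) (dsum D c k u) w d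
    + hsum (\<lambda>p. (fps_const (c p) * \<kappa> j a p) *\<^sub>h YW u w (d + (int p + k))) UNIV"
proof -
  let ?B = "\<lambda>p w d. c p *\<^sub>c YW (D p u) w (d + (int p + k))"
  have eq: "c p *\<^sub>c YW (D p (gm j a u)) w (d + (int p + k)) = nfield (ym j a) (?B p) w d
      + (fps_const (c p) * \<kappa> j a p) *\<^sub>h YW u w (d + (int p + k))" for p
    by (simp add: D_gm hlinear_add[OF YW_lin_left] hlinear_scale[OF YW_lin_left] hscale_add_right
        YW_gm nfield_shift[OF hcW ym_modes YW_field])
  have s: "hsummable (\<lambda>p. nfield (ym j a) (?B p) w d) UNIV"
  proof -
    have "hsummable (\<lambda>(k, x). nop (ym j a) k (?B x) w d) UNIV"
      using unif_family_summable[OF unif_family_nop[OF hcW ym_modes[of j a] dsum_family[of u]], of w d]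
      by (simp add: case_prod_unfold)
    then have "hsummable (\<lambda>(x, k). nop (ym j a) k (?B x) w d) UNIV"
      using hsummable_swap[OF hcW, of "\<lambda>k x. nop (ym j a) k (?B x) w d" UNIV UNIV] by simp
    from hsummable_pairD(2)[OF hcW this] show ?thesis by (simp add: nfield_def)
  qed
  have "dsum D c k (gm j a u) w d = hsum (\<lambda>p. nfield (ym j a) (?B p) w d) UNIV
    + hsum (\<lambda>p. (fps_const (c p) * \<kappa> j a p) *\<^sub>h YW u w (d + (int p + k))) UNIV"
    unfolding dsum_def eq by (rule hsum_add[OF hcW s kappa_summable])
  then show ?thesis
    by (simp only: nfield_hsum_swap[OF hcW ym_modes dsum_family] dsum_def[abs_def])
qed

end

lemmas dsum_der = dsum_field[OF der_lin der_sum der_gm der_vac] dsum_lin[OF der_lin der_sum der_gm der_vac]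
  dsum_vac[OF der_lin der_sum der_gm der_vac] dsum_gm[OF der_lin der_sum der_gm der_vac]
  kappa_summable[OF der_lin der_sum der_gm der_vac]
lemmas dsum_der' = dsum_field[OF der'_lin der'_sum der'_gm der'_vac] dsum_lin[OF der'_lin der'_sum der'_gm der'_vac]
  dsum_vac[OF der'_lin der'_sum der'_gm der'_vac] dsum_gm[OF der'_lin der'_sum der'_gm der'_vac]
  kappa_summable[OF der'_lin der'_sum der'_gm der'_vac]

lemma commutator_field: "is_field (\<lambda>w d. ym i r k (YW u w d) - YW u (ym i r k w) d)"
proof -
  have "\<exists>M. \<forall>m\<le>M. ym i r k (YW u w m) - YW u (ym i r k w) m \<in> hpow K UNIV" for w K
  proof -
    obtain M M' where "\<And>m. m \<le> M \<Longrightarrow> YW u w m \<in> hpow K UNIV" "\<And>m. m \<le> M' \<Longrightarrow> YW u (ym i r k w) m \<in> hpow K UNIV"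
      using laurent_h_obtain[OF YW_laurent, of u w K] laurent_h_obtain[OF YW_laurent, of u "ym i r k w" K] by metis
    then show ?thesis
      by (intro exI[of _ "min M M'"]) (auto intro!: hpow_diff hpow_hlinear[OF ym_lin])
  qed
  then show ?thesis
    by (simp add: is_field_def laurent_h_def hlinear_fun_diff hlinear_compose[OF ym_lin YW_lin]
        hlinear_compose[OF YW_lin ym_lin])
qed

text \<open>A mode passing a normally ordered product leaves the normally ordered product with its
  commutator, plus one scalar for every mode l of the new generator. The substitution l = -p-k
  arranges these scalars by p.\<close>

lemma commutator_gm:
  defines "\<beta> \<equiv> \<lambda>i r k j a l. fps_const (diff_coeff k l) * kap i r j a (nat (- (k + l)))
        - fps_const (diff_coeff l k) * kap j a i r (nat (- (k + l)))"
  shows "ym i r k (YW (gm j a u) w d) - YW (gm j a u) (ym i r k w) d =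
    nfield (ym j a) (\<lambda>w d. ym i r k (YW u w d) - YW u (ym i r k w) d) w d
    + (hsum (\<lambda>p. (fps_const (diff_coeff k (- int p - k)) * kap i r j a p) *\<^sub>h YW u w (d + (int p + k))) UNIV
     - hsum (\<lambda>p. (fps_const (diff_coeff (- int p - k) k) * kap j a i r p) *\<^sub>h YW u w (d + (int p + k))) UNIV)"
proof -
  let ?f = "ym j a" and ?g = "ym i r k" and ?A = "YW u"
  let ?C = "\<lambda>w d. ?g (?A w d) - ?A (?g w) d"
  have comm: "?g (?f l w) = ?f l (?g w) + \<beta> i r k j a l *\<^sub>h w" for l w
    using ym_comm[of i r k j a l w] by (simp add: \<beta>_def algebra_simps)
  have pt: "?g (nop ?f l ?A w d) - nop ?f l ?A (?g w) d = nop ?f l ?C w d + \<beta> i r k j a l *\<^sub>h ?A w (d - l)" for l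
  proof (cases "0 \<le> l")
    case True
    then show ?thesis
      by (simp add: nop_def comm hlinear_diff[OF ym_lin])
  next
    case False
    have "?A (?g (?f l w)) (d - l) = ?A (?f l (?g w)) (d - l) + \<beta> i r k j a l *\<^sub>h ?A w (d - l)"
      by (simp add: comm hlinear_add[OF YW_lin] hlinear_scale[OF YW_lin])
    then show ?thesis
      using False by (simp add: nop_def)
  qed
  have s1: "hsummable (\<lambda>l. ?g (nop ?f l ?A w d)) UNIV"
    by (rule hsummable_hlinear[OF nop_summable[OF hcW ym_modes YW_field] ym_lin])
  have s2: "hsummable (\<lambda>l. nop ?f l ?A (?g w) d) UNIV"
    by (rule nop_summable[OF hcW ym_modes YW_field])
  have s3: "hsummable (\<lambda>l. nop ?f l ?C w d) UNIV"
    by (rule nop_summable[OF hcW ym_modes commutator_field])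
  have neg: "hsummable f UNIV \<Longrightarrow> hsummable (\<lambda>l. - f l) UNIV" for f :: "int \<Rightarrow> 'w"
    by (erule hsummable_weaken) (rule hpow_uminus)
  have "hsummable (\<lambda>l. ?g (nop ?f l ?A w d) + - nop ?f l ?A (?g w) d + - nop ?f l ?C w d) UNIV"
    by (intro hsummable_add neg s1 s2 s3)
  moreover have "?g (nop ?f l ?A w d) + - nop ?f l ?A (?g w) d + - nop ?f l ?C w d = \<beta> i r k j a l *\<^sub>h ?A w (d - l)" for l
    using pt[of l] by (simp add: algebra_simps)
  ultimately have s4: "hsummable (\<lambda>l. \<beta> i r k j a l *\<^sub>h ?A w (d - l)) UNIV" by simp
  have "?g (YW (gm j a u) w d) - YW (gm j a u) (?g w) d =
      hsum (\<lambda>l. ?g (nop ?f l ?A w d)) UNIV - hsum (\<lambda>l. nop ?f l ?A (?g w) d) UNIV"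
    by (simp add: YW_gm nfield_def hsum_hlinear[OF hcW hcW nop_summable[OF hcW ym_modes YW_field] ym_lin])
  also have "\<dots> = hsum (\<lambda>l. ?g (nop ?f l ?A w d) + - nop ?f l ?A (?g w) d) UNIV"
    by (simp only: hsum_add[OF hcW s1 neg[OF s2]] hsum_uminus[OF hcW s2] diff_conv_add_uminus)
  also have "\<dots> = hsum (\<lambda>l. nop ?f l ?C w d + \<beta> i r k j a l *\<^sub>h ?A w (d - l)) UNIV"
    by (simp add: pt)
  also have "\<dots> = nfield ?f ?C w d + hsum (\<lambda>l. \<beta> i r k j a l *\<^sub>h ?A w (d - l)) UNIV"
    by (simp add: hsum_add[OF hcW s3 s4] nfield_def)
  also have "hsum (\<lambda>l. \<beta> i r k j a l *\<^sub>h ?A w (d - l)) UNIV =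
      hsum (\<lambda>l. \<beta> i r k j a l *\<^sub>h ?A w (d - l)) (range (\<lambda>p. - int p - k))"
  proof (rule hsum_neutral(1)[OF hcW])
    \<comment> \<open>Here k + l is positive, so \<open>nat\<close> truncates -(k+l) to 0, where the
      kernel vanishes.\<close>
    fix l assume "l \<in> UNIV - range (\<lambda>p. - int p - k)"
    then have "l \<noteq> - int (nat (- (k + l))) - k" by blast
    then have "nat (- (k + l)) = 0" by (cases "k + l \<le> 0") auto
    then show "\<beta> i r k j a l *\<^sub>h ?A w (d - l) = 0" by (simp add: \<beta>_def kap_0)
  qed (auto intro: hsummable_subset[OF s4])
  also have "\<dots> = hsum (\<lambda>p. \<beta> i r k j a (- int p - k) *\<^sub>h ?A w (d - (- int p - k))) UNIV"
    by (rule hsum_reindex[OF hcW _ hsummable_subset[OF s4]]) (auto simp: inj_on_def)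
  also have "\<dots> = hsum (\<lambda>p. (fps_const (diff_coeff k (- int p - k)) * kap i r j a p) *\<^sub>h ?A w (d + (int p + k))
      + - ((fps_const (diff_coeff (- int p - k) k) * kap j a i r p) *\<^sub>h ?A w (d + (int p + k)))) UNIV"
  proof (rule hsum_cong)
    fix p
    have "d - (- int p - k) = d + (int p + k)" by simp
    then show "\<beta> i r k j a (- int p - k) *\<^sub>h ?A w (d - (- int p - k)) =
        (fps_const (diff_coeff k (- int p - k)) * kap i r j a p) *\<^sub>h ?A w (d + (int p + k))
      + - ((fps_const (diff_coeff (- int p - k) k) * kap j a i r p) *\<^sub>h ?A w (d + (int p + k)))"
      by (simp only:) (simp add: \<beta>_def hmod.scale_left_diff_distrib)
  qed
  also have "\<dots> = hsum (\<lambda>p. (fps_const (diff_coeff k (- int p - k)) * kap i r j a p) *\<^sub>h ?A w (d + (int p + k))) UNIV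
     - hsum (\<lambda>p. (fps_const (diff_coeff (- int p - k) k) * kap j a i r p) *\<^sub>h ?A w (d + (int p + k))) UNIV"
    using hsum_add[OF hcW dsum_der(5) hsummable_weaken[OF dsum_der'(5) hpow_uminus]] hsum_uminus[OF hcW dsum_der'(5)]
    by simp
  finally show ?thesis .
qed

text \<open>Both sides obey the same recursion when v is multiplied by a generator:
  \<open>commutator_gm\<close> on the left, the Leibniz rules of \<open>der\<close> and
  \<open>der'\<close> on the right.\<close>

lemma commutator:
  "ym i r k (YW v w d) - YW v (ym i r k w) d =
    dsum (der i r) (\<lambda>p. diff_coeff k (- int p - k)) k v w d
    - dsum (der' i r) (\<lambda>p. diff_coeff (- int p - k) k) k v w d"
proof (rule induct_gen[of "\<lambda>v. ym i r k (YW v w d) - YW v (ym i r k w) d" _ v])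
  let ?P = "dsum (der i r) (\<lambda>p. diff_coeff k (- int p - k)) k"
  let ?Q = "dsum (der' i r) (\<lambda>p. diff_coeff (- int p - k) k) k"
  show "hlinear (\<lambda>v. ym i r k (YW v w d) - YW v (ym i r k w) d)"
    by (intro hlinear_fun_diff hlinear_compose[OF ym_lin YW_lin_left] YW_lin_left)
  show "hlinear (\<lambda>v. ?P v w d - ?Q v w d)"
    by (intro hlinear_fun_diff dsum_der(2) dsum_der'(2))
  show "ym i r k (YW (vmon l) w d) - YW (vmon l) (ym i r k w) d = ?P (vmon l) w d - ?Q (vmon l) w d" for l
  proof (induction l arbitrary: w d)
    case Nil
    then show ?case by (simp add: YW_vac dsum_der(3) dsum_der'(3) hlinear_0[OF ym_lin])
  next
    case (Cons x l)
    obtain j a where x: "x = (j, a)" by (cases x)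
    have neg: "is_field (\<lambda>w d. - ?Q (vmon l) w d)"
      using dsum_der'(1)[of i r "\<lambda>p. diff_coeff (- int p - k) k" k "vmon l"]
      unfolding is_field_def laurent_h_def by (fast intro: hlinear_fun_uminus hpow_uminus)
    have eq: "(\<lambda>w d. ym i r k (YW (vmon l) w d) - YW (vmon l) (ym i r k w) d) = (\<lambda>w d. ?P (vmon l) w d + - ?Q (vmon l) w d)"
      by (simp add: Cons)
    have Qn: "nfield (ym j a) (\<lambda>w d. - ?Q (vmon l) w d) w d = - nfield (ym j a) (?Q (vmon l)) w d"
      using nfield_shift[OF hcW ym_modes dsum_der'(1), where c = "-1" and s = 0] by simp
    have "nfield (ym j a) (\<lambda>w d. ym i r k (YW (vmon l) w d) - YW (vmon l) (ym i r k w) d) w d =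
        nfield (ym j a) (?P (vmon l)) w d - nfield (ym j a) (?Q (vmon l)) w d"
      unfolding eq nfield_add[OF hcW ym_modes dsum_der(1) neg] Qn by simp
    then show ?case
      by (simp add: x commutator_gm dsum_der(4) dsum_der'(4))
  qed
qed (rule hcW)

text \<open>For a negative mode only the \<open>der\<close> sum survives, for a nonnegative one only
  the \<open>der'\<close> sum, as expansions contain no negative power of the second variable. In
  the nonnegative case the remaining term p = j = 0 is removed by \<open>der_0\<close>.\<close>

lemma commutator_neg:
  assumes "j < 0"
  shows "ym i r j (YW v w d) = YW v (ym i r j w) d
    + hsum (\<lambda>p. diff_coeff j (- int p - j) *\<^sub>c YW (der i r p v) w (d + (int p + j))) UNIV"
  using commutator[of i r j v w d] diff_coeff_neg[OF assms]
  by (simp add: dsum_def hsum_0[OF hcW] algebra_simps)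

lemma commutator_nonneg:
  assumes "0 \<le> j"
  shows "YW v (ym i r j w) d = ym i r j (YW v w d)
    + hsum (\<lambda>p. diff_coeff (- int p - j) j *\<^sub>c YW (der' i r p v) w (d + (int p + j))) UNIV"
proof -
  have "diff_coeff j (- int p - j) *\<^sub>c YW (der i r p v) w (d + (int p + j)) = 0" for p
    using assms by (cases "p = 0 \<and> j = 0") (auto simp: diff_coeff_neg der_0 hlinear_0[OF YW_lin_left])
  then show ?thesis
    using commutator[of i r j v w d] by (simp add: dsum_def hsum_0[OF hcW] algebra_simps)
qed

end

section \<open>The first term of the Jacobi identity\<close>

context vertex_setup
begin

abbreviation "J1 \<equiv> jacobi1 YW"

lemma J1_def: "J1 u v w a b d =
    hsum (\<lambda>k. diff_coeff (- a - 1 - int k) (int k) *\<^sub>c YW u (YW v w (d - int k)) (b + a + 1 + int k)) UNIV"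
proof -
  have idx: "b - (- a - 1 - int k) = b + a + 1 + int k" for k by simp
  show ?thesis unfolding jacobi1_def Let_def idx ..
qed

lemma YW_YW_lin: "hlinear (\<lambda>w. YW u (YW v w \<delta>) \<beta>)" and YW_YW_lin_left: "hlinear (\<lambda>u. YW u (YW v w \<delta>) \<beta>)"
  and YW_YW_lin_mid: "hlinear (\<lambda>v. YW u (YW v w \<delta>) \<beta>)"
  by (rule hlinear_compose[OF YW_lin YW_lin] YW_lin_left hlinear_compose[OF YW_lin YW_lin_left])+

lemma J1_family_left: "unif_family UNIV
    (\<lambda>k w b. diff_coeff (- a - 1 - int k) (int k) *\<^sub>c YW u (YW v w (d - int k)) (b + (a + 1 + int k)))"
  by (rule unif_family_null[where A = "\<lambda>x k w b. diff_coeff (- a - 1 - int k) (int k) *\<^sub>c YW u x (b + (a + 1 + int k))"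
        and g = "\<lambda>w k. YW v w (d - int k)"])
    (rule hlinear_fun_scale[OF YW_lin] hlinear_fun_scale[OF YW_YW_lin] is_field_laurent[OF shift_field]
      laurent_summable[OF YW_laurent])+

lemma J1_summable: "hsummable
    (\<lambda>k. diff_coeff (- a - 1 - int k) (int k) *\<^sub>c YW u (YW v w (d - int k)) (b + a + 1 + int k)) UNIV"
  using unif_family_summable[OF J1_family_left[where a = a and u = u and v = v and d = d], where w = w and m = b] by (simp add: add.assoc)

lemma J1_lin_left: "hlinear (\<lambda>u. J1 u v w a b d)"
  and J1_lin_right: "hlinear (\<lambda>v. J1 u v w a b d)"
  and J1_lin: "hlinear (\<lambda>w. J1 u v w a b d)"
  unfolding J1_def
  by (rule hlinear_hsum[OF hcW _ J1_summable] hlinear_fun_scale[OF YW_YW_lin_left]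
      hlinear_fun_scale[OF YW_YW_lin_mid] hlinear_fun_scale[OF YW_YW_lin])+

lemma J1_family_right: "unif_family UNIV
    (\<lambda>k w d. diff_coeff (- a - 1 - int k) (int k) *\<^sub>c YW u (YW v w (d - int k)) (b + a + 1 + int k))"
  unfolding unif_family_def
proof (intro conjI allI ballI J1_summable hlinear_fun_scale[OF YW_YW_lin])
  fix w K
  obtain M where M: "\<And>m. m \<le> M \<Longrightarrow> YW v w m \<in> hpow K UNIV"
    using laurent_h_obtain[OF YW_laurent, of v w K] by blast
  then show "\<exists>M. \<forall>m\<le>M. \<forall>k\<in>UNIV. diff_coeff (- a - 1 - int k) (int k) *\<^sub>c
      YW u (YW v w (m - int k)) (b + a + 1 + int k) \<in> hpow K UNIV"
    by (intro exI[of _ M] allI impI ballI hpow_scale hpow_hlinear[OF YW_lin] M) simp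
qed

lemma J1_field_right: "is_field (\<lambda>w d. J1 u v w a b d)"
  unfolding J1_def by (rule is_field_hsum[OF hcW J1_family_right])

lemma YW_gm_nop: "YW (gm i r u) w m = hsum (\<lambda>j. nop (ym i r) j (YW u) w m) UNIV"
  by (simp add: YW_gm nfield_def)

lemma nop_YW_summable: "hsummable (\<lambda>j. nop (ym i r) j (YW u) w m) UNIV"
  by (rule nop_summable[OF hcW ym_modes YW_field])

text \<open>The correction terms in both recursions are indexed by the pairs \<open>(p, q)\<close> with \<open>j = - p - q\<close> resp. \<open>j = q\<close>.\<close>

lemma corr_left_summable: "hsummable (\<lambda>(p, q). diff_coeff (- int p - int q) (int q) *\<^sub>c
    YW u (YW (der i r p v) w (\<delta> - int q)) (\<beta> + int p + int q)) UNIV"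
  by (rule hsummable_pair_lin[where f = "\<lambda>v p q. diff_coeff (- int p - int q) (int q) *\<^sub>c
        YW u (YW v w (\<delta> - int q)) (\<beta> + int p + int q)", OF _ der_sum])
    (rule hlinear_fun_scale[OF YW_YW_lin_mid]
      hsummable_weaken[OF laurent_summable[OF YW_laurent] hpow_scale[OF hpow_hlinear[OF YW_lin]]] | assumption)+

text \<open>To be normally ordered around the whole product, the negative modes of the generator
  have to pass Y(v) on their way to w; each passage leaves \<open>der\<close> on v.\<close>

lemma YW_gm_YW: "YW (gm i r u) (YW v w \<delta>) \<beta> =
    nfield (ym i r) (\<lambda>w \<beta>. YW u (YW v w \<delta>) \<beta>) w \<beta> +
    hsum (\<lambda>(p, q). diff_coeff (- int p - int q) (int q) *\<^sub>c
      YW u (YW (der i r p v) w (\<delta> - int q)) (\<beta> + int p + int q)) UNIV"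
proof -
  let ?f = "ym i r" and ?Z = "\<lambda>w \<beta>. YW u (YW v w \<delta>) \<beta>"
  let ?e = "\<lambda>(j, p). diff_coeff j (- int p - j) *\<^sub>c YW u (YW (der i r p v) w (\<delta> + (int p + j))) (\<beta> - j)"
  \<comment> \<open>The expansion coefficient vanishes unless q = -p-j is nonnegative, so the sum
    over all (j, p) lives on the image of this map.\<close>
  let ?h = "\<lambda>(p, q). (- int p - int q, p)"
  let ?g = "\<lambda>(p, q). diff_coeff (- int p - int q) (int q) *\<^sub>c
      YW u (YW (der i r p v) w (\<delta> - int q)) (\<beta> + int p + int q)"
  have Z: "is_field ?Z"
    using YW_laurent by (simp add: is_field_def YW_YW_lin)
  have inj: "inj ?h" by (auto simp: inj_on_def)
  have gh: "?e (?h x) = ?g x" for x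
  proof (cases x)
    case (Pair p q)
    have "- int p - (- int p - int q) = int q" "\<delta> + (int p + (- int p - int q)) = \<delta> - int q"
      "\<beta> - (- int p - int q) = \<beta> + int p + int q" by simp_all
    then show ?thesis by (simp only: Pair prod.case)
  qed
  have sg: "hsummable ?g UNIV" by (rule corr_left_summable)
  then have sr: "hsummable ?e (range ?h)"
    using hsummable_reindex[OF inj, of ?e] by (simp only: gh)
  have z: "?e x = 0" if "x \<in> UNIV - range ?h" for x
  proof -
    obtain j p where x: "x = (j, p)" by (cases x)
    have "- int p - j < 0"
    proof (rule ccontr)
      assume "\<not> - int p - j < 0"
      then have "x = ?h (p, nat (- int p - j))" by (simp add: x)
      then show False using that by blast
    qed
    then show ?thesis by (simp add: x diff_coeff_neg)
  qed
  have se: "hsummable ?e UNIV" and he: "hsum ?e UNIV = hsum ?e (range ?h)"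
    using hsum_neutral[OF hcW, of "range ?h" UNIV ?e] z sr by simp_all
  have e0: "?e (j, p) = 0" if "0 \<le> j" for j p
    using that by (cases "p = 0 \<and> j = 0")
      (auto simp: diff_coeff_neg der_0 hlinear_0[OF YW_YW_lin_mid] hlinear_0[OF YW_lin_left] hlinear_0[OF YW_lin])
  have pt: "nop ?f j (YW u) (YW v w \<delta>) \<beta> = nop ?f j ?Z w \<beta> + hsum (\<lambda>p. ?e (j, p)) UNIV" for j
  proof (cases "0 \<le> j")
    case True
    then have "hsum (\<lambda>p. ?e (j, p)) UNIV = 0" using e0 by (simp only: hsum_0[OF hcW])
    then show ?thesis using True by (simp only: nop_def if_True add_0_right)
  next
    case False
    then have j: "j < 0" by simp
    have s: "hsummable (\<lambda>p. diff_coeff j (- int p - j) *\<^sub>c YW (der i r p v) w (\<delta> + (int p + j))) UNIV"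
      by (rule hsummable_weaken[OF der_sum]) (intro hpow_scale hpow_hlinear[OF YW_lin_left])
    show ?thesis
      using False by (simp add: nop_def commutator_neg[OF j] hlinear_add[OF YW_lin]
          hsum_hlinear[OF hcW hcW s YW_lin] hlinear_scale[OF YW_lin])
  qed
  have "YW (gm i r u) (YW v w \<delta>) \<beta> = hsum (\<lambda>j. nop ?f j ?Z w \<beta> + hsum (\<lambda>p. ?e (j, p)) UNIV) UNIV"
    unfolding YW_gm_nop pt ..
  also have "\<dots> = nfield ?f ?Z w \<beta> + hsum (\<lambda>j. hsum (\<lambda>p. ?e (j, p)) UNIV) UNIV"
    unfolding nfield_def by (rule hsum_add[OF hcW nop_summable[OF hcW ym_modes Z] hsummable_pairD(2)[OF hcW se]])
  also have "hsum (\<lambda>j. hsum (\<lambda>p. ?e (j, p)) UNIV) UNIV = hsum ?e UNIV"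
    by (rule hsum_pair[OF hcW se, symmetric])
  also have "\<dots> = hsum ?g UNIV"
    unfolding he hsum_reindex[OF hcW inj sr] gh ..
  finally show ?thesis .
qed

lemma corr_right_summable: "hsummable (\<lambda>(p, q). diff_coeff (- int p - int q) (int q) *\<^sub>c
    YW (der' i r p u) (YW v w (\<delta> - int q)) (\<beta> + int p + int q)) UNIV"
  by (rule hsummable_pair_lin[where f = "\<lambda>u p q. diff_coeff (- int p - int q) (int q) *\<^sub>c
        YW u (YW v w (\<delta> - int q)) (\<beta> + int p + int q)", OF _ der'_sum])
    (rule hlinear_fun_scale[OF YW_YW_lin_left]
      hsummable_weaken[OF laurent_summable[OF YW_laurent] hpow_scale[OF hpow_hlinear[OF YW_lin]]] | assumption)+

text \<open>Now it is the nonnegative modes of the inner field that must move left past Y(u), which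
  leaves \<open>der'\<close> on u.\<close>

lemma YW_YW_gm: "YW u (YW (gm i r v) w \<delta>) \<beta> =
    nfield (ym i r) (\<lambda>w \<delta>. YW u (YW v w \<delta>) \<beta>) w \<delta> +
    hsum (\<lambda>(p, q). diff_coeff (- int p - int q) (int q) *\<^sub>c
      YW (der' i r p u) (YW v w (\<delta> - int q)) (\<beta> + int p + int q)) UNIV"
proof -
  let ?f = "ym i r" and ?Z = "\<lambda>w \<delta>. YW u (YW v w \<delta>) \<beta>"
  let ?e = "\<lambda>(q, p). diff_coeff (- int p - int q) (int q) *\<^sub>c
      YW (der' i r p u) (YW v w (\<delta> - int q)) (\<beta> + int p + int q)"
  have Z: "is_field ?Z"
    unfolding is_field_def laurent_h_def
  proof (intro conjI allI YW_YW_lin)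
    fix w K
    obtain M where M: "\<And>m. m \<le> M \<Longrightarrow> YW v w m \<in> hpow K UNIV"
      using laurent_h_obtain[OF YW_laurent, of v w K] by blast
    then show "\<exists>M. \<forall>m\<le>M. YW u (YW v w m) \<beta> \<in> hpow K UNIV"
      by (intro exI[of _ M] allI impI hpow_hlinear[OF YW_lin] M)
  qed
  have s: "hsummable (\<lambda>(p, q). ?e (q, p)) UNIV"
    using corr_right_summable[of i r u v w \<delta> \<beta>] by simp
  have se: "hsummable ?e UNIV"
    using hsummable_swap[OF hcW, of "\<lambda>p q. ?e (q, p)" UNIV UNIV] s by (simp add: case_prod_unfold)
  let ?E = "\<lambda>j. if 0 \<le> j then hsum (\<lambda>p. ?e (nat j, p)) UNIV else 0"
  have pt: "YW u (nop ?f j (YW v) w \<delta>) \<beta> = nop ?f j ?Z w \<delta> + ?E j" for j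
  proof (cases "0 \<le> j")
    case True
    have idx: "\<delta> - int (nat j) = \<delta> - j" "- int p - int (nat j) = - int p - j" "int (nat j) = j"
      "\<beta> + int p + int (nat j) = \<beta> + (int p + j)" for p using True by simp_all
    show ?thesis
      using True by (simp add: nop_def commutator_nonneg[OF True] idx add.assoc del: int_nat_eq)
  next
    case False
    then show ?thesis by (simp add: nop_def)
  qed
  have inj: "inj int" by (simp add: inj_on_def)
  have sq: "hsummable (\<lambda>q. hsum (\<lambda>p. ?e (q, p)) UNIV) UNIV"
    by (rule hsummable_pairD(2)[OF hcW se])
  have sr: "hsummable ?E (range int)"
    using hsummable_reindex[OF inj, of ?E] sq by simp
  have z: "?E j = 0" if "j \<in> UNIV - range int" for j
  proof -
    have "\<not> 0 \<le> j" using that by (metis DiffD2 nonneg_int_cases rangeI)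
    then show ?thesis by simp
  qed
  have sE: "hsummable ?E UNIV" and hE: "hsum ?E UNIV = hsum ?E (range int)"
    using hsum_neutral[OF hcW, of "range int" UNIV ?E] z sr by simp_all
  have "YW u (YW (gm i r v) w \<delta>) \<beta> = hsum (\<lambda>j. nop ?f j ?Z w \<delta> + ?E j) UNIV"
    unfolding YW_gm_nop hsum_hlinear[OF hcW hcW nop_YW_summable YW_lin] pt ..
  also have "\<dots> = nfield ?f ?Z w \<delta> + hsum ?E UNIV"
    unfolding nfield_def by (rule hsum_add[OF hcW nop_summable[OF hcW ym_modes Z] sE])
  also have "hsum ?E UNIV = hsum (\<lambda>q. hsum (\<lambda>p. ?e (q, p)) UNIV) UNIV"
    unfolding hE hsum_reindex[OF hcW inj sr] by simp
  also have "\<dots> = hsum (\<lambda>p. hsum (\<lambda>q. ?e (q, p)) UNIV) UNIV"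
    by (rule hsum_pair_swap[OF hcW]) (use se in \<open>simp add: case_prod_unfold\<close>)
  also have "\<dots> = hsum (\<lambda>(p, q). ?e (q, p)) UNIV"
    using hsum_pair[OF hcW s] by simp
  finally show ?thesis by simp
qed

text \<open>Each correction carries an expanded power -p of a difference. Vandermonde's identity
  absorbs it into the power -a-1 from the delta function, so the correction is again a first term,
  with a replaced by a + p.\<close>

lemma corr_convolve:
  fixes E :: "nat \<Rightarrow> int \<Rightarrow> int \<Rightarrow> 'w"
  assumes s: "hsummable (\<lambda>(p, t). E p (b + a + 1 + int p + int t) (d - int t)) UNIV"
  shows "hsummable (\<lambda>k. diff_coeff (- a - 1 - int k) (int k) *\<^sub>c
      hsum (\<lambda>(p, q). diff_coeff (- int p - int q) (int q) *\<^sub>c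
        E p (b + a + 1 + int k + int p + int q) (d - int k - int q)) UNIV) UNIV" (is "hsummable ?L UNIV")
    and "hsum (\<lambda>k. diff_coeff (- a - 1 - int k) (int k) *\<^sub>c
      hsum (\<lambda>(p, q). diff_coeff (- int p - int q) (int q) *\<^sub>c
        E p (b + a + 1 + int k + int p + int q) (d - int k - int q)) UNIV) UNIV =
      hsum (\<lambda>p. hsum (\<lambda>t. diff_coeff (- (a + int p) - 1 - int t) (int t) *\<^sub>c
        E p (b + (a + int p) + 1 + int t) (d - int t)) UNIV) UNIV"
proof -
  let ?X = "\<lambda>p t. E p (b + a + 1 + int p + int t) (d - int t)"
  let ?\<alpha> = "\<lambda>k p q. diff_coeff (- a - 1 - int k) (int k) * diff_coeff (- int p - int q) (int q)"
  note conv = hsum_convolve[OF hcW s, of ?\<alpha>]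
  have idx: "b + a + 1 + int k + int p + int q = b + a + 1 + int p + int (k + q)"
    "d - int k - int q = d - int (k + q)" for k p q by simp_all
  have inner: "hsummable (\<lambda>(p, q). diff_coeff (- int p - int q) (int q) *\<^sub>c ?X p (k + q)) UNIV" for k
  proof (rule hsummable_weaken)
    let ?h = "\<lambda>(p, q). (p, k + q)"
    have "inj ?h" by (auto simp: inj_on_def)
    then show "hsummable (\<lambda>x. (case ?h x of (p, t) \<Rightarrow> ?X p t)) UNIV"
      using hsummable_reindex[of ?h UNIV "\<lambda>(p, t). ?X p t"] hsummable_subset[OF s] by blast
  qed (auto intro: hpow_scale)
  have L: "?L k = hsum (\<lambda>(p, q). ?\<alpha> k p q *\<^sub>c ?X p (k + q)) UNIV" for k
  proof -
    have "?L k = hsum (\<lambda>x. diff_coeff (- a - 1 - int k) (int k) *\<^sub>c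
        (case x of (p, q) \<Rightarrow> diff_coeff (- int p - int q) (int q) *\<^sub>c ?X p (k + q))) UNIV"
      unfolding idx by (rule hsum_scale[OF hcW inner, symmetric])
    also have "\<dots> = hsum (\<lambda>(p, q). ?\<alpha> k p q *\<^sub>c ?X p (k + q)) UNIV"
      by (rule hsum_cong) (auto simp: hscale_hscale)
    finally show ?thesis .
  qed
  show "hsummable ?L UNIV"
    unfolding L using hsummable_pairD(2)[OF hcW conv(1)] by simp
  have "hsum ?L UNIV = hsum (\<lambda>(k, x, j). ?\<alpha> k x j *\<^sub>c ?X x (k + j)) UNIV"
    unfolding L using hsum_pair[OF hcW conv(1)] by simp
  also have "\<dots> = hsum (\<lambda>(p, t). (\<Sum>j\<le>t. ?\<alpha> (t - j) p j) *\<^sub>c ?X p t) UNIV"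
    by (rule conv(2))
  also have "(\<lambda>(p, t). (\<Sum>j\<le>t. ?\<alpha> (t - j) p j) *\<^sub>c ?X p t) =
      (\<lambda>(p, t). diff_coeff (- (a + int p) - 1 - int t) (int t) *\<^sub>c ?X p t)"
  proof (rule ext, clarify)
    fix p t
    have "(\<Sum>j\<le>t. ?\<alpha> (t - j) p j) =
        (\<Sum>j\<le>t. diff_coeff (- int p - int j) (int j) * diff_coeff (- a - 1 - int (t - j)) (int (t - j)))"
      by (rule sum.cong) simp_all
    also have "\<dots> = diff_coeff (- int p + (- a - 1) - int t) (int t)"
      by (rule diff_coeff_vandermonde)
    finally show "(\<Sum>j\<le>t. ?\<alpha> (t - j) p j) *\<^sub>c ?X p t = diff_coeff (- (a + int p) - 1 - int t) (int t) *\<^sub>c ?X p t"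
      by (simp add: algebra_simps)
  qed
  also have "hsum \<dots> UNIV = hsum (\<lambda>p. hsum (\<lambda>t. diff_coeff (- (a + int p) - 1 - int t) (int t) *\<^sub>c ?X p t) UNIV) UNIV"
  proof (rule hsum_pair[OF hcW, of "\<lambda>(p, t). diff_coeff (- (a + int p) - 1 - int t) (int t) *\<^sub>c ?X p t", simplified prod.case])
    show "hsummable (\<lambda>(p, t). diff_coeff (- (a + int p) - 1 - int t) (int t) *\<^sub>c ?X p t) UNIV"
      by (rule hsummable_weaken[OF s]) (auto intro: hpow_scale)
  qed
  also have "\<dots> = hsum (\<lambda>p. hsum (\<lambda>t. diff_coeff (- (a + int p) - 1 - int t) (int t) *\<^sub>c
        E p (b + (a + int p) + 1 + int t) (d - int t)) UNIV) UNIV"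
    by (simp add: algebra_simps)
  finally show "hsum ?L UNIV = hsum (\<lambda>p. hsum (\<lambda>t. diff_coeff (- (a + int p) - 1 - int t) (int t) *\<^sub>c
        E p (b + (a + int p) + 1 + int t) (d - int t)) UNIV) UNIV" .
qed

lemma J1_gm: "J1 (gm i r u) v w a b d =
    nfield (ym i r) (\<lambda>w b. J1 u v w a b d) w b + hsum (\<lambda>p. J1 u (der i r p v) w (a + int p) b d) UNIV"
proof -
  let ?c = "\<lambda>k. fps_const (diff_coeff (- a - 1 - int k) (int k))"
  let ?B = "\<lambda>k w b. ?c k *\<^sub>h YW u (YW v w (d - int k)) (b + (a + 1 + int k))"
  let ?E = "\<lambda>p \<beta> \<delta>. YW u (YW (der i r p v) w \<delta>) \<beta>"
  let ?L = "\<lambda>k. ?c k *\<^sub>h hsum (\<lambda>(p, q). diff_coeff (- int p - int q) (int q) *\<^sub>c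
      ?E p (b + a + 1 + int k + int p + int q) (d - int k - int q)) UNIV"
  have F: "is_field (\<lambda>w \<beta>. YW u (YW v w \<delta>) \<beta>)" for \<delta>
    using YW_laurent by (simp add: is_field_def YW_YW_lin)
  have s: "hsummable (\<lambda>(p, t). ?E p (b + a + 1 + int p + int t) (d - int t)) UNIV"
    by (rule hsummable_pair_lin[where f = "\<lambda>v p t. YW u (YW v w (d - int t)) (b + a + 1 + int p + int t)", OF _ der_sum])
      (rule YW_YW_lin_mid hsummable_weaken[OF laurent_summable[OF YW_laurent] hpow_hlinear[OF YW_lin]] | assumption)+
  note conv = corr_convolve[where E = ?E, OF s]
  have step: "?c k *\<^sub>h YW (gm i r u) (YW v w (d - int k)) (b + a + 1 + int k) =
      nfield (ym i r) (?B k) w b + ?L k" for k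
    by (simp add: YW_gm_YW hscale_add_right nfield_shift[OF hcW ym_modes F] add.assoc)
  have neg: "hsummable (\<lambda>k. - ?L k) UNIV"
    by (rule hsummable_weaken[OF conv(1) hpow_uminus])
  have s1: "hsummable (\<lambda>k. nfield (ym i r) (?B k) w b) UNIV"
    using hsummable_add[OF J1_summable[of a "gm i r u" v w d b, unfolded step] neg] by simp
  have "J1 (gm i r u) v w a b d = hsum (\<lambda>k. nfield (ym i r) (?B k) w b) UNIV + hsum ?L UNIV"
    unfolding J1_def step by (rule hsum_add[OF hcW s1 conv(1)])
  also have "hsum (\<lambda>k. nfield (ym i r) (?B k) w b) UNIV = nfield (ym i r) (\<lambda>w b. J1 u v w a b d) w b"
    using nfield_hsum_swap[OF hcW ym_modes J1_family_left] by (simp add: J1_def add.assoc)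
  finally show ?thesis
    unfolding conv(2) J1_def .
qed

text \<open>Serves the second term of the identity, where u is the inner argument.\<close>

lemma J1_gm_right: "J1 u (gm i r v) w a b d =
    nfield (ym i r) (\<lambda>w d. J1 u v w a b d) w d + hsum (\<lambda>p. J1 (der' i r p u) v w (a + int p) b d) UNIV"
proof -
  let ?c = "\<lambda>k. fps_const (diff_coeff (- a - 1 - int k) (int k))"
  let ?B = "\<lambda>k w d. ?c k *\<^sub>h YW u (YW v w (d - int k)) (b + a + 1 + int k)"
  let ?E = "\<lambda>p \<beta> \<delta>. YW (der' i r p u) (YW v w \<delta>) \<beta>"
  let ?L = "\<lambda>k. ?c k *\<^sub>h hsum (\<lambda>(p, q). diff_coeff (- int p - int q) (int q) *\<^sub>c
      ?E p (b + a + 1 + int k + int p + int q) (d - int k - int q)) UNIV"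
  have F: "is_field (\<lambda>w \<delta>. YW u (YW v w \<delta>) \<beta>)" for \<beta>
    unfolding is_field_def laurent_h_def
  proof (intro conjI allI YW_YW_lin)
    fix w K
    obtain M where M: "\<And>m. m \<le> M \<Longrightarrow> YW v w m \<in> hpow K UNIV"
      using laurent_h_obtain[OF YW_laurent, of v w K] by blast
    then show "\<exists>M. \<forall>m\<le>M. YW u (YW v w m) \<beta> \<in> hpow K UNIV"
      by (intro exI[of _ M] allI impI hpow_hlinear[OF YW_lin] M)
  qed
  have s: "hsummable (\<lambda>(p, t). ?E p (b + a + 1 + int p + int t) (d - int t)) UNIV"
    by (rule hsummable_pair_lin[where f = "\<lambda>u p t. YW u (YW v w (d - int t)) (b + a + 1 + int p + int t)", OF _ der'_sum])
      (rule YW_YW_lin_left hsummable_weaken[OF laurent_summable[OF YW_laurent] hpow_hlinear[OF YW_lin]] | assumption)+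
  note conv = corr_convolve[where E = ?E, OF s]
  have step: "?c k *\<^sub>h YW u (YW (gm i r v) w (d - int k)) (b + a + 1 + int k) =
      nfield (ym i r) (?B k) w d + ?L k" for k
    using nfield_shift[OF hcW ym_modes F, where c = "?c k" and s = "- int k" and w = w and m = d] by (simp add: YW_YW_gm hscale_add_right add.assoc)
  have neg: "hsummable (\<lambda>k. - ?L k) UNIV"
    by (rule hsummable_weaken[OF conv(1) hpow_uminus])
  have s1: "hsummable (\<lambda>k. nfield (ym i r) (?B k) w d) UNIV"
    using hsummable_add[OF J1_summable[of a u "gm i r v" w d b, unfolded step] neg] by simp
  have "J1 u (gm i r v) w a b d = hsum (\<lambda>k. nfield (ym i r) (?B k) w d) UNIV + hsum ?L UNIV"
    unfolding J1_def step by (rule hsum_add[OF hcW s1 conv(1)])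
  also have "hsum (\<lambda>k. nfield (ym i r) (?B k) w d) UNIV = nfield (ym i r) (\<lambda>w d. J1 u v w a b d) w d"
    using nfield_hsum_swap[OF hcW ym_modes J1_family_right] by (simp add: J1_def)
  finally show ?thesis
    unfolding conv(2) J1_def .
qed

end

section \<open>The second term of the Jacobi identity\<close>

context vertex_setup
begin

text \<open>The first term for the opposite order of the factors, extended to tensors; z1 and z2
  change places, hence the exchanged exponents d and b.\<close>

definition Kop :: "('v, 'v) ctensor \<Rightarrow> int \<Rightarrow> 'w \<Rightarrow> int \<Rightarrow> int \<Rightarrow> 'w"
  where "Kop t a w d b = induced (\<lambda>v u. J1 v u w a d b) t"

lemma hbilinear_J1: "hbilinear (\<lambda>v u. J1 v u w a d b)"
  using J1_lin_left J1_lin_right by (simp add: hbilinear_def)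

lemma Kop_lin: "hlinear (\<lambda>t. Kop t a w d b)"
  unfolding Kop_def by (rule hlinear_induced[OF hcW hbilinear_J1])

lemma Kop_tensor: "Kop (v \<otimes>\<^sub>h u) a w d b = J1 v u w a d b"
  unfolding Kop_def by (rule induced_tensor[OF hcW hbilinear_J1])

lemma hgen_pure: "hgen {v \<otimes>\<^sub>h u | v u. v \<in> (UNIV :: 'v set) \<and> u \<in> (UNIV :: 'v set)}"
  by (rule hgen_tensor[OF hgen_UNIV hgen_UNIV])

lemma Kop_field: "is_field (\<lambda>w b. Kop t a w d b)"
  unfolding is_field_def laurent_h_def
proof (intro conjI allI)
  show "hlinear (\<lambda>w. Kop t a w d b)" for b
  proof (rule hlinearI)
    have "(\<lambda>t. Kop t a (x + y) d b) = (\<lambda>t. Kop t a x d b + Kop t a y d b)" for x y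
      by (rule hlinear_ctensor_eqI[OF hcW hgen_UNIV hgen_UNIV])
        (simp_all add: Kop_lin hlinear_fun_add Kop_tensor hlinear_add[OF J1_lin])
    then show "Kop t a (x + y) d b = Kop t a x d b + Kop t a y d b" for x y
      by (rule fun_cong)
    have "(\<lambda>t. Kop t a (c *\<^sub>h x) d b) = (\<lambda>t. c *\<^sub>h Kop t a x d b)" for c x
      by (rule hlinear_ctensor_eqI[OF hcW hgen_UNIV hgen_UNIV])
        (simp_all add: Kop_lin hlinear_fun_scale Kop_tensor hlinear_scale[OF J1_lin])
    then show "Kop t a (c *\<^sub>h x) d b = c *\<^sub>h Kop t a x d b" for c x
      by (rule fun_cong)
  qed
  fix w K
  show "\<exists>M. \<forall>m\<le>M. Kop t a w d m \<in> hpow K UNIV"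
  proof (rule hgen_induct_hpow[OF hgen_pure])
    show "hmod.subspace {t. \<exists>M. \<forall>m\<le>M. Kop t a w d m \<in> hpow K UNIV}"
      unfolding hmod.subspace_def
    proof (intro conjI allI impI ballI)
      show "0 \<in> {t. \<exists>M. \<forall>m\<le>M. Kop t a w d m \<in> hpow K UNIV}"
        by (simp add: hlinear_0[OF Kop_lin])
    next
      fix x y assume "x \<in> {t. \<exists>M. \<forall>m\<le>M. Kop t a w d m \<in> hpow K UNIV}"
        "y \<in> {t. \<exists>M. \<forall>m\<le>M. Kop t a w d m \<in> hpow K UNIV}"
      then obtain M N where "\<forall>m\<le>M. Kop x a w d m \<in> hpow K UNIV" "\<forall>m\<le>N. Kop y a w d m \<in> hpow K UNIV"
        by blast
      then have "\<forall>m\<le>min M N. Kop (x + y) a w d m \<in> hpow K UNIV"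
        by (simp add: hlinear_add[OF Kop_lin] hpow_add)
      then show "x + y \<in> {t. \<exists>M. \<forall>m\<le>M. Kop t a w d m \<in> hpow K UNIV}" by blast
    next
      fix c x assume "x \<in> {t. \<exists>M. \<forall>m\<le>M. Kop t a w d m \<in> hpow K UNIV}"
      then obtain M where "\<forall>m\<le>M. Kop x a w d m \<in> hpow K UNIV" by blast
      then have "\<forall>m\<le>M. Kop (c *\<^sub>h x) a w d m \<in> hpow K UNIV"
        by (simp add: hlinear_scale[OF Kop_lin] hpow_scale)
      then show "c *\<^sub>h x \<in> {t. \<exists>M. \<forall>m\<le>M. Kop t a w d m \<in> hpow K UNIV}" by blast
    qed
  next
    fix x assume "x \<in> {v \<otimes>\<^sub>h u | v u. v \<in> (UNIV :: 'v set) \<and> u \<in> (UNIV :: 'v set)}"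
    then obtain v u where x: "x = v \<otimes>\<^sub>h u" by blast
    show "\<exists>M. \<forall>m\<le>M. Kop x a w d m \<in> hpow K UNIV"
      using is_field_laurent[OF J1_field_right] unfolding x Kop_tensor laurent_h_def by blast
  next
    fix x :: "('v, 'v) ctensor" assume "x \<in> hpow K UNIV"
    then show "\<exists>M. \<forall>m\<le>M. Kop x a w d m \<in> hpow K UNIV"
      using hpow_hlinear[OF Kop_lin] by blast
  qed
qed

lemma tensor_map_lin: "hlinear (tensor_map (der' i r p) (\<lambda>b :: 'v. b))" "hlinear (tensor_map (\<lambda>a :: 'v. a) (gm i r))"
  by (intro hlinear_tensor_map der'_lin gm_lin hlinear_ident)+

lemma tensor_der'_summable: "hsummable (\<lambda>p. tensor_map (der' i r p) (\<lambda>b :: 'v. b) t) UNIV"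
proof (rule hlinear_finite_exceptions[OF hgen_pure tensor_map_lin(1)])
  fix x assume "x \<in> {v \<otimes>\<^sub>h u | v u. v \<in> (UNIV :: 'v set) \<and> u \<in> (UNIV :: 'v set)}"
  then obtain v u where x: "x = v \<otimes>\<^sub>h u" by blast
  show "hsummable (\<lambda>p. tensor_map (der' i r p) (\<lambda>b. b) x) UNIV"
    unfolding x tensor_map_tensor[OF der'_lin hlinear_ident]
    by (rule hsummable_hlinear[OF der'_sum hlinear_tensor_left])
qed

lemma Kop_der'_summable: "hsummable (\<lambda>p. Kop (tensor_map (der' i r p) (\<lambda>b. b) t) (a + int p) w d b) UNIV"
  by (rule hsummable_weaken[OF tensor_der'_summable]) (rule hpow_hlinear[OF Kop_lin])

lemma Kop_gm: "Kop (tensor_map (\<lambda>a. a) (gm i r) t) a w d b = nfield (ym i r) (\<lambda>w b. Kop t a w d b) w b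
    + hsum (\<lambda>p. Kop (tensor_map (der' i r p) (\<lambda>b. b) t) (a + int p) w d b) UNIV"
proof -
  let ?f = "\<lambda>t. Kop (tensor_map (\<lambda>a. a) (gm i r) t) a w d b"
  let ?g = "\<lambda>t. nfield (ym i r) (\<lambda>w b. Kop t a w d b) w b
    + hsum (\<lambda>p. Kop (tensor_map (der' i r p) (\<lambda>b. b) t) (a + int p) w d b) UNIV"
  have nop_lin: "hlinear (\<lambda>t. nop (ym i r) k (\<lambda>w b. Kop t a w d b) w b)" for k
    using hlinear_compose[OF ym_lin Kop_lin] Kop_lin by (cases "0 \<le> k") (simp_all add: nop_def)
  have "?f = ?g"
  proof (rule hlinear_ctensor_eqI[OF hcW hgen_UNIV hgen_UNIV])
    show "hlinear ?f" by (rule hlinear_compose[OF Kop_lin tensor_map_lin(2)])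
    show "hlinear ?g"
      unfolding nfield_def
      by (intro hlinear_fun_add hlinear_hsum[OF hcW] nop_lin nop_summable[OF hcW ym_modes Kop_field]
          hlinear_compose[OF Kop_lin tensor_map_lin(1)] Kop_der'_summable)
  qed (simp add: tensor_map_tensor gm_lin der'_lin hlinear_ident Kop_tensor J1_gm_right)
  then show ?thesis by (rule fun_cong)
qed

abbreviation "qv \<equiv> \<lparr>qva_vacuum = vac, qva_Y = Y, qva_S = S\<rparr>"
abbreviation "J2 \<equiv> jacobi2 qv YW"
abbreviation "J3 \<equiv> jacobi3 qv YW"

lemma sign_powi: "(- 1) ^ r * (- 1 :: complex) powi (n - int r) = (- 1) powi n"
proof -
  have "(- 1) ^ r * (- 1 :: complex) powi (n - int r) = (- 1) powi (int r + (n - int r))"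
    by (subst power_int_add) simp_all
  then show ?thesis by simp
qed

lemma hbilinear_YW_YW: "hbilinear (\<lambda>v u. YW v (YW u w \<beta>) \<delta>)"
  using YW_YW_lin_left YW_YW_lin_mid by (simp add: hbilinear_def)

text \<open>The pole z0^(-r) of the braiding raises a to a + r. Its sign (-1)^r from S(-z0) and the
  sign (-1)^(-a-1-r) from the delta function combine to one that does not depend on r.\<close>

lemma J2_Kop: "J2 u v w a b d =
    (- 1) powi (- a - 1) *\<^sub>c hsum (\<lambda>r. Kop (S (v \<otimes>\<^sub>h u) r) (a + int r) w d b) UNIV"
proof -
  let ?B = "\<lambda>r k. induced (\<lambda>v' u'. YW v' (YW u' w (b - int k)) (d + (a + int r) + 1 + int k))"
  let ?c = "\<lambda>r k. diff_coeff (- (a + int r) - 1 - int k) (int k)"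
  let ?F = "\<lambda>t r k. ?c r k *\<^sub>c ?B r k t"
  let ?t = "S (v \<otimes>\<^sub>h u)"
  have Blin: "hlinear (?B r k)" for r k by (rule hlinear_induced[OF hcW hbilinear_YW_YW])
  have Flin: "hlinear (\<lambda>t. ?F t r k)" for r k by (rule hlinear_fun_scale[OF Blin])
  have Ften: "?F (v' \<otimes>\<^sub>h u') r k = ?c r k *\<^sub>c YW v' (YW u' w (b - int k)) (d + (a + int r) + 1 + int k)" for v' u' r k
    by (simp add: induced_tensor[OF hcW hbilinear_YW_YW])
  have Fsum: "hsummable (?F t r) UNIV" for t r
  proof (rule hlinear_finite_exceptions[OF hgen_pure Flin])
    fix x assume "x \<in> {v \<otimes>\<^sub>h u | v u. v \<in> (UNIV :: 'v set) \<and> u \<in> (UNIV :: 'v set)}"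
    then obtain v u where x: "x = v \<otimes>\<^sub>h u" by blast
    show "hsummable (\<lambda>k. ?F x r k) UNIV"
      unfolding x Ften by (rule J1_summable)
  qed
  have K: "hsum (?F t r) UNIV = Kop t (a + int r) w d b" for t r
  proof -
    have "(\<lambda>t. hsum (?F t r) UNIV) = (\<lambda>t. Kop t (a + int r) w d b)"
      by (rule hlinear_ctensor_eqI[OF hcW hgen_UNIV hgen_UNIV hlinear_hsum[OF hcW Flin Fsum] Kop_lin])
        (simp only: Ften Kop_tensor J1_def)
    then show ?thesis by (rule fun_cong)
  qed
  have s: "hsummable (\<lambda>(r, k). ?F (?t r) r k) UNIV"
    by (rule hsummable_pair_lin[OF Flin S_sum Fsum])
  have "J2 u v w a b d = hsum (\<lambda>(r, k). (- 1) powi (- a - 1) *\<^sub>c ?F (?t r) r k) UNIV"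
    unfolding jacobi2_def Let_def
  proof (rule hsum_cong, clarify)
    fix r k :: nat
    have idx: "- a - 1 - int r - int k = - (a + int r) - 1 - int k"
      "d - (- (a + int r) - 1 - int k) = d + (a + int r) + 1 + int k" by simp_all
    show "((- 1) ^ r * (- 1) powi (- a - 1 - int r) * diff_coeff (- a - 1 - int r - int k) (int k)) *\<^sub>c
        induced (\<lambda>v' u'. YW v' (YW u' w (b - int k)) (d - (- a - 1 - int r - int k))) (qva_S qv (v \<otimes>\<^sub>h u) r) =
      (- 1) powi (- a - 1) *\<^sub>c ?F (?t r) r k"
      unfolding sign_powi idx by (simp add: hscale_hscale)
  qed
  also have "\<dots> = (- 1) powi (- a - 1) *\<^sub>c hsum (\<lambda>(r, k). ?F (?t r) r k) UNIV"
    using hsum_scale[OF hcW s, of "fps_const ((- 1) powi (- a - 1))"] by (simp add: case_prod_unfold)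
  also have "hsum (\<lambda>(r, k). ?F (?t r) r k) UNIV = hsum (\<lambda>r. Kop (?t r) (a + int r) w d b) UNIV"
    using hsum_pair[OF hcW s] by (simp only: prod.case K)
  finally show ?thesis .
qed

lemma J2_family: "unif_family UNIV (\<lambda>r w b. Kop (S t r) (a + int r) w d b)"
  by (rule unif_family_null[where A = "\<lambda>t r w b. Kop t (a + int r) w d b" and g = "\<lambda>w. S t"])
    (rule Kop_lin is_field_lin[OF Kop_field] is_field_laurent[OF Kop_field] S_sum)+

lemma S_tensor_lin: "hlinear (\<lambda>v. S (v \<otimes>\<^sub>h u) r)" "hlinear (\<lambda>u. S (v \<otimes>\<^sub>h u) r)"
  by (rule hlinear_compose[OF S_lin hlinear_tensor_left] hlinear_compose[OF S_lin hlinear_tensor_right])+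

lemma J2_lin_left: "hlinear (\<lambda>u. J2 u v w a b d)" and J2_lin_right: "hlinear (\<lambda>v. J2 u v w a b d)"
  unfolding J2_Kop
  by (rule hlinear_fun_scale hlinear_hsum[OF hcW] unif_family_summable[OF J2_family]
      hlinear_compose[OF Kop_lin S_tensor_lin(1)] hlinear_compose[OF Kop_lin S_tensor_lin(2)])+

lemma is_field_scale:
  assumes "is_field A"
  shows "is_field (\<lambda>w m. c *\<^sub>h A w m)"
  unfolding is_field_def laurent_h_def
proof (intro conjI allI)
  show "hlinear (\<lambda>w. c *\<^sub>h A w m)" for m by (rule hlinear_fun_scale[OF is_field_lin[OF assms]])
  fix w K
  obtain M where "\<And>m. m \<le> M \<Longrightarrow> A w m \<in> hpow K UNIV"
    using laurent_h_obtain[OF is_field_laurent[OF assms], of w K] by blast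
  then show "\<exists>M. \<forall>m\<le>M. c *\<^sub>h A w m \<in> hpow K UNIV"
    by (intro exI[of _ M] allI impI hpow_scale)
qed

lemma J2_field: "is_field (\<lambda>w b. J2 u v w a b d)"
  unfolding J2_Kop by (rule is_field_scale[OF is_field_hsum[OF hcW J2_family]])

lemma J2_shift_sum:
  assumes D: "hsummable D UNIV"
  shows "hsummable (\<lambda>(p, r). Kop (S (D p \<otimes>\<^sub>h u) r) (a + int p + int r) w d b) UNIV"
  by (rule hsummable_pair_lin[where f = "\<lambda>v p r. Kop (S (v \<otimes>\<^sub>h u) r) (a + int p + int r) w d b", OF _ D])
    (rule hlinear_compose[OF Kop_lin S_tensor_lin(1)] unif_family_summable[OF J2_family])+

lemma tw_sum: "hsummable (\<lambda>p. tw i r p v) UNIV"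
proof -
  have "hsummable (\<lambda>p. (- 1) ^ p *\<^sub>h der i r p v + - der' i r p v) UNIV"
    by (intro hsummable_add hsummable_weaken[OF der_sum hpow_scale] hsummable_weaken[OF der'_sum hpow_uminus])
  then show ?thesis by (simp add: tw)
qed

text \<open>The recursion for the opposite order leaves \<open>der'\<close> on v, and the braiding
  leaves \<open>tw\<close> on v. Their sum is (-1)^p \<open>der\<close>, and the sign is absorbed
  when a becomes a + p. So the second term obeys the recursion of the first.\<close>

lemma J2_gm: "J2 (gm i s u) v w a b d =
    nfield (ym i s) (\<lambda>w b. J2 u v w a b d) w b + hsum (\<lambda>p. J2 u (der i s p v) w (a + int p) b d) UNIV"
proof -
  let ?e = "\<lambda>a :: int. (- 1 :: complex) powi (- a - 1)"
  let ?N = "\<lambda>r. nfield (ym i s) (\<lambda>w b. Kop (S (v \<otimes>\<^sub>h u) r) (a + int r) w d b) w b"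
  let ?P = "\<lambda>p r. Kop (S (der' i s p v \<otimes>\<^sub>h u) r) (a + int p + int r) w d b"
  let ?Q = "\<lambda>p r. Kop (S (tw i s p v \<otimes>\<^sub>h u) r) (a + int p + int r) w d b"
  let ?D = "\<lambda>p r. Kop (S (der i s p v \<otimes>\<^sub>h u) r) (a + int p + int r) w d b"
  have sP: "hsummable (\<lambda>(p, r). ?P p r) UNIV" by (rule J2_shift_sum[OF der'_sum])
  have sQ: "hsummable (\<lambda>(p, r). ?Q p r) UNIV" by (rule J2_shift_sum[OF tw_sum])
  have sP': "hsummable (\<lambda>(r, p). ?P p r) UNIV"
    using hsummable_swap[OF hcW, of ?P UNIV UNIV] sP by simp
  have sPr: "hsummable (\<lambda>r. hsum (\<lambda>p. ?P p r) UNIV) UNIV"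
    using hsummable_pairD(2)[OF hcW sP'] by simp
  \<comment> \<open>Replacing r by p + r turns the convolution in \<open>S_gm\<close> into an
    unrestricted double sum.\<close>
  let ?h = "\<lambda>(r :: nat, p :: nat). (p, r - p)" and ?A = "Sigma UNIV (\<lambda>r :: nat. {..r})"
  have bij: "bij_betw ?h ?A UNIV"
    by (rule bij_betw_byWitness[where f' = "\<lambda>(p, r). (p + r, p)"]) auto
  have img: "?h ` ?A = UNIV" and inj: "inj_on ?h ?A" using bij by (auto simp: bij_betw_def)
  have sQA: "hsummable (\<lambda>x. case ?h x of (p, r) \<Rightarrow> ?Q p r) ?A"
    using hsummable_reindex[OF inj, of "\<lambda>(p, r). ?Q p r"] sQ by (simp only: img)
  have Qeq: "(case ?h (r, p) of (p, r) \<Rightarrow> ?Q p r) = Kop (S (tw i s p v \<otimes>\<^sub>h u) (r - p)) (a + int r) w d b"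
    if "p \<in> {..r}" for r p using that by (simp add: of_nat_diff)
  have Qs: "hsum (\<lambda>p. case ?h (r, p) of (p, r) \<Rightarrow> ?Q p r) {..r} =
      (\<Sum>p\<le>r. Kop (S (tw i s p v \<otimes>\<^sub>h u) (r - p)) (a + int r) w d b)" for r
    unfolding hsum_finite[OF hcW finite_atMost] by (rule sum.cong[OF refl Qeq])
  have sQr: "hsummable (\<lambda>r. \<Sum>p\<le>r. Kop (S (tw i s p v \<otimes>\<^sub>h u) (r - p)) (a + int r) w d b) UNIV"
    using hsummable_SigmaD(2)[OF hcW sQA] unfolding Qs .
  have hQ: "hsum (\<lambda>r. \<Sum>p\<le>r. Kop (S (tw i s p v \<otimes>\<^sub>h u) (r - p)) (a + int r) w d b) UNIV = hsum (\<lambda>(p, r). ?Q p r) UNIV"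
    unfolding hsum_bij[OF hcW bij sQA] hsum_Sigma[OF hcW sQA] Qs ..
  have step: "Kop (S (v \<otimes>\<^sub>h gm i s u) r) (a + int r) w d b =
      ?N r + hsum (\<lambda>p. ?P p r) UNIV + (\<Sum>p\<le>r. Kop (S (tw i s p v \<otimes>\<^sub>h u) (r - p)) (a + int r) w d b)" for r
  proof -
    have idx: "a + int r + int p = a + int p + int r" for p by simp
    show ?thesis
      by (simp add: S_gm hlinear_add[OF Kop_lin] Kop_gm hlinear_sum[OF Kop_lin] S_der'[symmetric] idx)
  qed
  have N: "nfield (ym i s) (\<lambda>w b. J2 u v w a b d) w b = ?e a *\<^sub>c hsum ?N UNIV" and sN: "hsummable ?N UNIV"
  proof -
    note fam = J2_family[of "v \<otimes>\<^sub>h u" a d]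
    have "hsummable (\<lambda>(k, x). nop (ym i s) k (\<lambda>w b. Kop (S (v \<otimes>\<^sub>h u) x) (a + int x) w d b) w b) UNIV"
      using unif_family_summable[OF unif_family_nop[OF hcW ym_modes[of i s] fam], of w b]
      by (simp add: case_prod_unfold)
    then have "hsummable (\<lambda>(x, k). nop (ym i s) k (\<lambda>w b. Kop (S (v \<otimes>\<^sub>h u) x) (a + int x) w d b) w b) UNIV"
      using hsummable_swap[OF hcW, of "\<lambda>k x. nop (ym i s) k (\<lambda>w b. Kop (S (v \<otimes>\<^sub>h u) x) (a + int x) w d b) w b" UNIV UNIV] by simp
    from hsummable_pairD(2)[OF hcW this] show "hsummable ?N UNIV" by (simp add: nfield_def)
    show "nfield (ym i s) (\<lambda>w b. J2 u v w a b d) w b = ?e a *\<^sub>c hsum ?N UNIV"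
      unfolding J2_Kop
      using nfield_shift[OF hcW ym_modes[of i s] is_field_hsum[OF hcW fam], where s = 0]
        nfield_hsum_swap[OF hcW ym_modes[of i s] fam] by simp
  qed
  have PQ: "?P p r + ?Q p r = (- 1) ^ p *\<^sub>h ?D p r" for p r
  proof -
    have "(- 1 :: complex fps) ^ p *\<^sub>h der i s p v = der' i s p v + tw i s p v" by (simp add: tw)
    then show ?thesis
      by (simp flip: hlinear_add[OF Kop_lin] hlinear_add[OF S_tensor_lin(1)] hlinear_scale[OF Kop_lin] hlinear_scale[OF S_tensor_lin(1)])
  qed
  have sD: "hsummable (\<lambda>(p, r). ?D p r) UNIV" by (rule J2_shift_sum[OF der_sum])
  have Dp: "?e a *\<^sub>c hsum (\<lambda>r. (- 1) ^ p *\<^sub>h ?D p r) UNIV = J2 u (der i s p v) w (a + int p) b d" for p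
  proof -
    have sd: "hsummable (?D p) UNIV" using hsummable_pairD(1)[OF hcW sD, of p] by simp
    \<comment> \<open>(-1)^p is its own inverse, so the exponent -a-1 may be lowered by p at the
      cost of this factor.\<close>
    have "?e a * (- 1) ^ p = ?e (a + int p)"
    proof -
      have "?e a * (- 1) ^ p = (- 1) powi (- a - 1 - int p) * ((- 1) ^ p * (- 1) ^ p)"
        unfolding sign_powi[of p "- a - 1", symmetric] by (simp only: mult_ac)
      also have "- a - 1 - int p = - (a + int p) - 1" by simp
      finally show ?thesis by (simp flip: power_mult_distrib)
    qed
    then have e: "fps_const (?e a) * (- 1) ^ p = fps_const (?e (a + int p))"
      by (metis fps_const_1_eq_1 fps_const_mult fps_const_neg fps_const_power)
    show ?thesis
      unfolding J2_Kop hsum_scale[OF hcW sd] hscale_hscale e ..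
  qed
  have sD': "hsummable (\<lambda>(p, r). (- 1) ^ p *\<^sub>h ?D p r) UNIV"
    by (rule hsummable_weaken[OF sD]) (auto intro: hpow_scale)
  have sD'': "hsummable (\<lambda>p. hsum (\<lambda>r. (- 1) ^ p *\<^sub>h ?D p r) UNIV) UNIV"
    using hsummable_pairD(2)[OF hcW sD'] by simp
  have "J2 (gm i s u) v w a b d = ?e a *\<^sub>c (hsum ?N UNIV + hsum (\<lambda>r. hsum (\<lambda>p. ?P p r) UNIV) UNIV + hsum (\<lambda>(p, r). ?Q p r) UNIV)"
    unfolding J2_Kop step hsum_add[OF hcW hsummable_add[OF sN sPr] sQr] hsum_add[OF hcW sN sPr] hQ ..
  also have "hsum (\<lambda>r. hsum (\<lambda>p. ?P p r) UNIV) UNIV = hsum (\<lambda>(p, r). ?P p r) UNIV"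
    using hsum_pair_swap[OF hcW sP] hsum_pair[OF hcW sP] by simp
  also have "hsum ?N UNIV + hsum (\<lambda>(p, r). ?P p r) UNIV + hsum (\<lambda>(p, r). ?Q p r) UNIV =
      hsum ?N UNIV + hsum (\<lambda>x. (case x of (p, r) \<Rightarrow> ?P p r) + (case x of (p, r) \<Rightarrow> ?Q p r)) UNIV"
    by (subst hsum_add[OF hcW sP sQ]) (rule add.assoc)
  also have "(\<lambda>x. (case x of (p, r) \<Rightarrow> ?P p r) + (case x of (p, r) \<Rightarrow> ?Q p r)) = (\<lambda>(p, r). (- 1) ^ p *\<^sub>h ?D p r)"
    by (rule ext) (simp add: PQ case_prod_unfold)
  also have "hsum (\<lambda>(p, r). (- 1) ^ p *\<^sub>h ?D p r) UNIV = hsum (\<lambda>p. hsum (\<lambda>r. (- 1) ^ p *\<^sub>h ?D p r) UNIV) UNIV"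
    using hsum_pair[OF hcW sD'] by simp
  also have "?e a *\<^sub>c (hsum ?N UNIV + \<dots>) = nfield (ym i s) (\<lambda>w b. J2 u v w a b d) w b
      + hsum (\<lambda>p. ?e a *\<^sub>c hsum (\<lambda>r. (- 1) ^ p *\<^sub>h ?D p r) UNIV) UNIV"
    unfolding hscale_add_right N hsum_scale[OF hcW sD''] ..
  finally show ?thesis
    unfolding Dp .
qed

section \<open>The third term of the Jacobi identity\<close>

lemma Y_gm_modes: "Y (gm i r u) v m =
    hsum (\<lambda>j. mbin (int j) r *\<^sub>c gm i (j + r) (Y u v (m - int j))) UNIV + hsum (\<lambda>p. Y u (der i r p v) (m + int p)) UNIV"
proof -
  let ?vm = "\<lambda>k v. if 0 \<le> k then mbin k r *\<^sub>c gm i (nat k + r) v else der i r (nat (- k)) v"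
  let ?g = "\<lambda>j. mbin (int j) r *\<^sub>c gm i (j + r) (Y u v (m - int j))" and ?d = "\<lambda>p. Y u (der i r p v) (m + int p)"
  let ?G = "\<lambda>k. if 0 \<le> k then ?g (nat k) else 0" and ?D = "\<lambda>k. if k \<le> 0 then ?d (nat (- k)) else 0"
  have Ylin: "hlinear (\<lambda>v. Y u v m)" for m by (rule is_field_lin[OF Y_field])
  have pt: "nop ?vm k (Y u) v m = ?G k + ?D k" for k
    by (cases "0 \<le> k"; cases "k = 0") (simp_all add: nop_def der_0 hlinear_0[OF Ylin])
  have sg: "hsummable ?g UNIV"
    by (rule hsummable_weaken[OF laurent_summable[OF is_field_laurent[OF Y_field]]])
      (rule hpow_scale[OF hpow_hlinear[OF gm_lin]])
  have sd: "hsummable ?d UNIV"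
    by (rule hsummable_weaken[OF der_sum]) (rule hpow_hlinear[OF Ylin])
  have injg: "inj int" and injd: "inj (\<lambda>p. - int p)" by (simp_all add: inj_on_def)
  have zg: "?G k = 0" if "k \<in> UNIV - range int" for k
  proof -
    have "\<not> 0 \<le> k" using that by (metis DiffD2 nonneg_int_cases rangeI)
    then show ?thesis by simp
  qed
  have zd: "?D k = 0" if "k \<in> UNIV - range (\<lambda>p. - int p)" for k
  proof -
    have "\<not> k \<le> 0"
    proof
      assume "k \<le> 0"
      then have "k = - int (nat (- k))" by simp
      then show False using that by blast
    qed
    then show ?thesis by simp
  qed
  have srg: "hsummable ?G (range int)" using hsummable_reindex[OF injg, of ?G] sg by simp
  have srd: "hsummable ?D (range (\<lambda>p. - int p))" using hsummable_reindex[OF injd, of ?D] sd by simp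
  have G: "hsummable ?G UNIV" "hsum ?G UNIV = hsum ?g UNIV"
    using hsum_neutral[OF hcV, of "range int" UNIV ?G] zg srg hsum_reindex[OF hcV injg srg] by simp_all
  have D: "hsummable ?D UNIV" "hsum ?D UNIV = hsum ?d UNIV"
    using hsum_neutral[OF hcV, of "range (\<lambda>p. - int p)" UNIV ?D] zd srd hsum_reindex[OF hcV injd srd] by simp_all
  have "Y (gm i r u) v m = hsum (\<lambda>k. ?G k + ?D k) UNIV"
    unfolding Y_gm nfield_def pt ..
  then show ?thesis by (simp only: hsum_add[OF hcV G(1) D(1)] G(2) D(2))
qed

text \<open>Up to a binomial factor, the generator of index j + r has as field the j-th divided
  derivative of the field of index r, so its modes are shifted by j. The two normal orderings differ
  only for 0 <= q < j, where the binomial coefficient of q over j vanishes.\<close>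

lemma YW_gm_shift: "mbin (int j) r *\<^sub>c YW (gm i (j + r) v) w m =
    hsum (\<lambda>q. (of_int q gchoose j) *\<^sub>c nop (ym i r) q (YW v) w (m + int j)) UNIV"
proof -
  let ?h = "\<lambda>q. q + int j" and ?F = "\<lambda>q. (of_int q gchoose j) *\<^sub>c nop (ym i r) q (YW v) w (m + int j)"
  have bij: "bij_betw ?h UNIV UNIV"
    by (rule bij_betw_byWitness[where f' = "\<lambda>q. q - int j"]) auto
  have sF: "hsummable ?F UNIV"
    by (rule hsummable_weaken[OF nop_YW_summable]) (rule hpow_scale)
  have inj: "inj ?h" and img: "range ?h = UNIV" using bij by (auto simp: bij_betw_def)
  have sFh: "hsummable (\<lambda>q. ?F (?h q)) UNIV"
    using hsummable_reindex[OF inj, of ?F] sF by (simp only: img)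
  have pt: "mbin (int j) r *\<^sub>c nop (ym i (j + r)) q (YW v) w m = ?F (?h q)" for q
  proof (cases "0 \<le> q \<or> q + int j < 0")
    case True
    have idx: "m + int j - (q + int j) = m - q" by simp
    have "mbin (int j) r *\<^sub>c YW v (ym i (j + r) q w) (m - q) = (of_int (q + int j) gchoose j) *\<^sub>c YW v (ym i r (q + int j) w) (m - q)"
      using arg_cong[OF ym_shift[of j r i q w], of "\<lambda>w. YW v w (m - q)"] by (simp add: hlinear_scale[OF YW_lin])
    then show ?thesis
      using True ym_shift[of j r i q "YW v w (m - q)"] by (auto simp: nop_def idx)
  next
    case False
    have "(of_int (q + int j) gchoose j :: complex) = 0"
    proof -
      obtain n where n: "q + int j = int n" using False by (metis nonneg_int_cases not_le linorder_le_cases)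
      then have "n < j" using False by simp
      then show ?thesis unfolding n by (simp add: binomial_eq_0 flip: binomial_gbinomial)
    qed
    moreover have "mbin (int j) r *\<^sub>c YW v (ym i (j + r) q w) (m - q) = (of_int (q + int j) gchoose j) *\<^sub>c YW v (ym i r (q + int j) w) (m - q)"
      using arg_cong[OF ym_shift[of j r i q w], of "\<lambda>w. YW v w (m - q)"] by (simp add: hlinear_scale[OF YW_lin])
    ultimately show ?thesis using False by (simp add: nop_def)
  qed
  have "mbin (int j) r *\<^sub>c YW (gm i (j + r) v) w m = hsum (\<lambda>q. ?F (?h q)) UNIV"
    unfolding YW_gm_nop pt[symmetric] by (rule hsum_scale[OF hcW nop_YW_summable, symmetric])
  also have "\<dots> = hsum ?F UNIV"
    by (rule hsum_bij[OF hcW bij sFh, symmetric])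
  finally show ?thesis .
qed

end

context vertex_setup
begin

lemma Y_lin: "hlinear (\<lambda>v. Y u v m)" and Y_laurent: "laurent_h (Y u v)"
  by (rule is_field_lin[OF Y_field] is_field_laurent[OF Y_field])+

lemma J3_def: "J3 u v w a b d =
    hsum (\<lambda>k. diff_coeff b (int k) *\<^sub>c YW (Y u v (a - int k)) w (d + b + int k + 1)) UNIV"
proof -
  have idx: "b + int k - int k = b" "d + (b + int k) + 1 = d + b + int k + 1" for k by simp_all
  show ?thesis unfolding jacobi3_def Let_def idx by simp
qed

lemma J3_family: "unif_family UNIV
    (\<lambda>k w b. diff_coeff b (int k) *\<^sub>c YW (Y u v (a - int k)) w (d + b + int k + 1))"
proof (rule unif_family_null[where A = "\<lambda>x k w b. diff_coeff b (int k) *\<^sub>c YW x w (d + b + int k + 1)"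
      and g = "\<lambda>w k. Y u v (a - int k)"])
  show "laurent_h (\<lambda>b. diff_coeff b (int p) *\<^sub>c YW x w (d + b + int p + 1))" for x p w
    unfolding laurent_h_def
  proof
    fix K
    obtain M where M: "\<And>m. m \<le> M \<Longrightarrow> YW x w m \<in> hpow K UNIV"
      using laurent_h_obtain[OF YW_laurent, of x w K] by blast
    show "\<exists>N. \<forall>m\<le>N. diff_coeff m (int p) *\<^sub>c YW x w (d + m + int p + 1) \<in> hpow K UNIV"
      by (intro exI[of _ "M - d - int p - 1"] allI impI hpow_scale M) simp
  qed
qed (rule hlinear_fun_scale[OF YW_lin_left] hlinear_fun_scale[OF YW_lin] laurent_summable[OF Y_laurent])+

lemma J3_summable: "hsummable (\<lambda>k. diff_coeff b (int k) *\<^sub>c YW (Y u v (a - int k)) w (d + b + int k + 1)) UNIV"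
  by (rule unif_family_summable[OF J3_family])

lemma J3_field: "is_field (\<lambda>w b. J3 u v w a b d)"
  unfolding J3_def by (rule is_field_hsum[OF hcW J3_family])

lemma J3_lin_left: "hlinear (\<lambda>u. J3 u v w a b d)" and J3_lin_right: "hlinear (\<lambda>v. J3 u v w a b d)"
  unfolding J3_def
  by (rule hlinear_hsum[OF hcW _ J3_summable] hlinear_fun_scale hlinear_compose[OF YW_lin_left Y_lin_left]
      hlinear_compose[OF YW_lin_left Y_lin])+

text \<open>The nonnegative modes of the generator, rewritten by \<open>YW_gm_shift\<close> and
  summed over k + j = t, give the normally ordered product: \<open>diff_coeff_binomial\<close>
  changes the exponent b into b - q. The negative modes give the \<open>der\<close> terms.\<close>

lemma J3_gm: "J3 (gm i r u) v w a b d =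
    nfield (ym i r) (\<lambda>w b. J3 u v w a b d) w b + hsum (\<lambda>p. J3 u (der i r p v) w (a + int p) b d) UNIV"
proof -
  let ?f = "ym i r"
  let ?G = "\<lambda>k. hsum (\<lambda>j. mbin (int j) r *\<^sub>c YW (gm i (j + r) (Y u v (a - int k - int j))) w (d + b + int k + 1)) UNIV"
  let ?D = "\<lambda>k. hsum (\<lambda>p. YW (Y u (der i r p v) (a - int k + int p)) w (d + b + int k + 1)) UNIV"
  let ?c = "\<lambda>k. fps_const (diff_coeff b (int k))"
  have s1: "hsummable (\<lambda>j. mbin (int j) r *\<^sub>c gm i (j + r) (Y u v (m - int j))) UNIV" for m
    by (rule hsummable_weaken[OF laurent_summable[OF Y_laurent]]) (rule hpow_scale[OF hpow_hlinear[OF gm_lin]])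
  have s2: "hsummable (\<lambda>p. Y u (der i r p v) (m + int p)) UNIV" for m
    by (rule hsummable_weaken[OF der_sum]) (rule hpow_hlinear[OF Y_lin])
  have step: "YW (Y (gm i r u) v (a - int k)) w (d + b + int k + 1) = ?G k + ?D k" for k
    unfolding Y_gm_modes
    by (simp add: hlinear_add[OF YW_lin_left] hsum_hlinear[OF hcW hcV s1 YW_lin_left]
        hsum_hlinear[OF hcW hcV s2 YW_lin_left] hlinear_scale[OF YW_lin_left])
  let ?DD = "\<lambda>p k. ?c k *\<^sub>h YW (Y u (der i r p v) (a + int p - int k)) w (d + b + int k + 1)"
  have sDD: "hsummable (\<lambda>(p, k). ?DD p k) UNIV"
    by (rule hsummable_pair_lin[where f = "\<lambda>v p k. ?c k *\<^sub>h YW (Y u v (a + int p - int k)) w (d + b + int k + 1)", OF _ der_sum])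
      (rule hlinear_fun_scale[OF hlinear_compose[OF YW_lin_left Y_lin]] J3_summable)+
  have cD: "?c k *\<^sub>h ?D k = hsum (\<lambda>p. ?DD p k) UNIV" for k
  proof -
    have idx: "a + int p - int k = a - int k + int p" for p by simp
    show ?thesis
      unfolding idx by (rule hsum_scale[OF hcW, symmetric]) (rule hsummable_hlinear[OF s2 YW_lin_left])
  qed
  have sD: "hsummable (\<lambda>k. ?c k *\<^sub>h ?D k) UNIV"
  proof -
    have "hsummable (\<lambda>(k, p). ?DD p k) UNIV"
      using hsummable_swap[OF hcW, of ?DD UNIV UNIV] sDD by simp
    from hsummable_pairD(2)[OF hcW this] show ?thesis by (simp add: cD)
  qed
  have hD: "hsum (\<lambda>k. ?c k *\<^sub>h ?D k) UNIV = hsum (\<lambda>p. J3 u (der i r p v) w (a + int p) b d) UNIV"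
    unfolding cD J3_def by (rule hsum_pair_swap[OF hcW sDD, symmetric])
  let ?X = "\<lambda>q t. nop ?f q (YW (Y u v (a - int t))) w (d + b + int t + 1)"
  let ?\<alpha> = "\<lambda>k q j. diff_coeff b (int k) * (of_int q gchoose j)"
  have nop_lin: "hlinear (\<lambda>x. nop ?f q (YW x) w m)" for q m
    using hlinear_compose[OF ym_lin YW_lin_left] YW_lin_left by (cases "0 \<le> q") (simp_all add: nop_def)
  have sX': "hsummable (\<lambda>(t, q). ?X q t) UNIV"
    by (rule hsummable_pair_lin[where f = "\<lambda>x t q. nop ?f q (YW x) w (d + b + int t + 1)", OF nop_lin laurent_summable[OF Y_laurent]])
      (rule nop_YW_summable)
  then have sX: "hsummable (\<lambda>(q, t). ?X q t) UNIV"
    using hsummable_swap[OF hcW, of ?X UNIV UNIV] by simp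
  note conv = hsum_convolve[OF hcW sX, of ?\<alpha>]
  have cG: "?c k *\<^sub>h ?G k = hsum (\<lambda>(q, j). ?\<alpha> k q j *\<^sub>c ?X q (k + j)) UNIV" for k
  proof -
    have idx: "a - int (k + j) = a - int k - int j" "d + b + int (k + j) + 1 = d + b + int k + 1 + int j" for j by simp_all
    have s: "hsummable (\<lambda>(q, j). (of_int q gchoose j) *\<^sub>c ?X q (k + j)) UNIV"
    proof (rule hsummable_weaken)
      let ?h = "\<lambda>(q :: int, j). (q, k + j)"
      have "inj ?h" by (auto simp: inj_on_def)
      then show "hsummable (\<lambda>x. case ?h x of (q, t) \<Rightarrow> ?X q t) UNIV"
        using hsummable_reindex[of ?h UNIV "\<lambda>(q, t). ?X q t"] hsummable_subset[OF sX] by blast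
    qed (auto intro: hpow_scale)
    have "?G k = hsum (\<lambda>j. hsum (\<lambda>q. (of_int q gchoose j) *\<^sub>c ?X q (k + j)) UNIV) UNIV"
      unfolding YW_gm_shift idx ..
    also have "\<dots> = hsum (\<lambda>(q, j). (of_int q gchoose j) *\<^sub>c ?X q (k + j)) UNIV"
      using hsum_pair_swap[OF hcW s] hsum_pair[OF hcW s] by simp
    finally have "?c k *\<^sub>h ?G k = hsum (\<lambda>x. ?c k *\<^sub>h (case x of (q, j) \<Rightarrow> (of_int q gchoose j) *\<^sub>c ?X q (k + j))) UNIV"
      by (simp only: hsum_scale[OF hcW s])
    also have "\<dots> = hsum (\<lambda>(q, j). ?\<alpha> k q j *\<^sub>c ?X q (k + j)) UNIV"
      by (rule hsum_cong) (auto simp: hscale_hscale)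
    finally show ?thesis .
  qed
  have sG: "hsummable (\<lambda>k. ?c k *\<^sub>h ?G k) UNIV"
    unfolding cG using hsummable_pairD(2)[OF hcW conv(1)] by simp
  have nop_B: "nop ?f q (\<lambda>w b. diff_coeff b (int t) *\<^sub>c YW x w (d + b + int t + 1)) w b =
      diff_coeff (b - q) (int t) *\<^sub>c nop ?f q (YW x) w (d + b + int t + 1)" for q t x
    by (simp add: nop_def hlinear_scale[OF ym_lin] algebra_simps)
  have hG: "hsum (\<lambda>k. ?c k *\<^sub>h ?G k) UNIV = nfield ?f (\<lambda>w b. J3 u v w a b d) w b"
  proof -
    have "hsum (\<lambda>k. ?c k *\<^sub>h ?G k) UNIV = hsum (\<lambda>(k, q, j). ?\<alpha> k q j *\<^sub>c ?X q (k + j)) UNIV"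
      unfolding cG using hsum_pair[OF hcW conv(1)] by simp
    also have "\<dots> = hsum (\<lambda>(q, t). (\<Sum>j\<le>t. ?\<alpha> (t - j) q j) *\<^sub>c ?X q t) UNIV"
      by (rule conv(2))
    also have "(\<lambda>(q, t). (\<Sum>j\<le>t. ?\<alpha> (t - j) q j) *\<^sub>c ?X q t) = (\<lambda>(q, t). diff_coeff (b - q) (int t) *\<^sub>c ?X q t)"
      unfolding diff_coeff_binomial[symmetric] by (simp only: mult.commute)
    also have "hsum \<dots> UNIV = hsum (\<lambda>q. hsum (\<lambda>t. diff_coeff (b - q) (int t) *\<^sub>c ?X q t) UNIV) UNIV"
    proof -
      have s: "hsummable (\<lambda>(q, t). diff_coeff (b - q) (int t) *\<^sub>c ?X q t) UNIV"
        by (rule hsummable_weaken[OF sX]) (auto intro: hpow_scale)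
      show ?thesis using hsum_pair[OF hcW s] by simp
    qed
    also have "\<dots> = nfield ?f (\<lambda>w b. J3 u v w a b d) w b"
      unfolding nfield_def J3_def nop_hsum[OF hcW ym_modes J3_family] nop_B ..
    finally show ?thesis .
  qed
  have "J3 (gm i r u) v w a b d = hsum (\<lambda>k. ?c k *\<^sub>h ?G k + ?c k *\<^sub>h ?D k) UNIV"
    unfolding J3_def step hscale_add_right ..
  also have "\<dots> = hsum (\<lambda>k. ?c k *\<^sub>h ?G k) UNIV + hsum (\<lambda>k. ?c k *\<^sub>h ?D k) UNIV"
    by (rule hsum_add[OF hcW sG sD])
  finally show ?thesis unfolding hG hD .
qed

section \<open>The vacuum case and the induction over u\<close>

lemma hsum_single_nat:
  fixes f :: "nat \<Rightarrow> 'w"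
  assumes "\<And>k. int k \<noteq> n \<Longrightarrow> f k = 0"
  shows "hsum f UNIV = (if 0 \<le> n then f (nat n) else 0)"
proof (cases "0 \<le> n")
  case True
  then show ?thesis using hsum_single[OF hcW, of "nat n" UNIV f] assms by (metis UNIV_I nat_int)
next
  case False
  then have "f k = 0" for k by (intro assms) simp
  then have "f = (\<lambda>_. 0)" by blast
  then show ?thesis using False by (simp add: hsum_0[OF hcW])
qed

lemma J1_vac: "J1 vac v w a b d = diff_coeff b (- a - 1 - b) *\<^sub>c YW v w (d + b + a + 1)"
proof -
  have "J1 vac v w a b d = (if 0 \<le> - a - 1 - b then
      diff_coeff (- a - 1 - int (nat (- a - 1 - b))) (int (nat (- a - 1 - b))) *\<^sub>c
        YW vac (YW v w (d - int (nat (- a - 1 - b)))) (b + a + 1 + int (nat (- a - 1 - b))) else 0)"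
    unfolding J1_def by (rule hsum_single_nat) (auto simp: YW_vac)
  then show ?thesis
    by (auto simp: YW_vac diff_coeff_neg algebra_simps)
qed

lemma J1_vac_right: "J1 v vac w a b d = diff_coeff (- a - 1 - d) d *\<^sub>c YW v w (b + a + 1 + d)"
proof -
  have "J1 v vac w a b d = (if 0 \<le> d then
      diff_coeff (- a - 1 - int (nat d)) (int (nat d)) *\<^sub>c
        YW v (YW vac w (d - int (nat d))) (b + a + 1 + int (nat d)) else 0)"
    unfolding J1_def by (rule hsum_single_nat) (auto simp: YW_vac hlinear_0[OF YW_lin])
  then show ?thesis
    by (auto simp: YW_vac diff_coeff_neg)
qed

lemma J2_vac: "J2 vac v w a b d = ((- 1) powi (- a - 1) * diff_coeff (- a - 1 - b) b) *\<^sub>c YW v w (d + b + a + 1)"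
proof -
  have "hsum (\<lambda>r. Kop (S (v \<otimes>\<^sub>h vac) r) (a + int r) w d b) UNIV = Kop (S (v \<otimes>\<^sub>h vac) 0) (a + int 0) w d b"
    by (rule hsum_single[OF hcW]) (simp_all add: S_vac hlinear_0[OF Kop_lin])
  also have "\<dots> = diff_coeff (- a - 1 - b) b *\<^sub>c YW v w (d + b + a + 1)"
    by (simp add: S_vac Kop_tensor J1_vac_right algebra_simps)
  finally show ?thesis by (simp add: J2_Kop hscale_hscale)
qed

lemma J3_vac: "J3 vac v w a b d = diff_coeff b a *\<^sub>c YW v w (d + b + a + 1)"
proof -
  have "J3 vac v w a b d = (if 0 \<le> a then
      diff_coeff b (int (nat a)) *\<^sub>c YW (Y vac v (a - int (nat a))) w (d + b + int (nat a) + 1) else 0)"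
    unfolding J3_def by (rule hsum_single_nat) (auto simp: Y_vac hlinear_0[OF YW_lin_left])
  then show ?thesis
    by (auto simp: Y_vac diff_coeff_neg)
qed

text \<open>The induction over u generalises v and a, because the recursions replace them by
  \<open>der\<close> images of v and by a + p. The three recursions have the same shape, so equality
  is inherited from the vacuum case, which is \<open>diff_coeff_delta\<close>.\<close>

lemma jacobi_add: "J1 u v w a b d = J3 u v w a b d + J2 u v w a b d"
proof (rule induct_gen[of "\<lambda>u. J1 u v w a b d" "\<lambda>u. J3 u v w a b d + J2 u v w a b d" u])
  show "J1 (vmon l) v w a b d = J3 (vmon l) v w a b d + J2 (vmon l) v w a b d" for l
  proof (induction l arbitrary: v w a b d)
    case Nil
    have "diff_coeff b (- a - 1 - b) = diff_coeff b a + (- 1) powi (- a - 1) * diff_coeff (- a - 1 - b) b"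
      using diff_coeff_delta[OF refl, of b a] by (simp add: algebra_simps)
    then have "fps_const (diff_coeff b (- a - 1 - b)) =
        fps_const (diff_coeff b a) + fps_const ((- 1) powi (- a - 1) * diff_coeff (- a - 1 - b) b)"
      by (metis fps_const_add)
    then show ?case
      by (simp only: foldr.simps id_apply J1_vac J2_vac J3_vac hscale_add_left)
  next
    case (Cons x l)
    obtain i r where x: "x = (i, r)" by (cases x)
    have s: "hsummable (\<lambda>p. F (der i r p v) p) UNIV" if "\<And>p. hlinear (\<lambda>v. F v p)" for F :: "'v \<Rightarrow> nat \<Rightarrow> 'w"
      by (rule hsummable_weaken[OF der_sum]) (rule hpow_hlinear[OF that])
    have eq: "(\<lambda>w b. J1 (vmon l) v w a b d) = (\<lambda>w b. J3 (vmon l) v w a b d + J2 (vmon l) v w a b d)"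
      by (simp only: Cons.IH)
    have "J1 (vmon (x # l)) v w a b d = nfield (ym i r) (\<lambda>w b. J1 (vmon l) v w a b d) w b
        + hsum (\<lambda>p. J1 (vmon l) (der i r p v) w (a + int p) b d) UNIV"
      by (simp add: x J1_gm)
    also have "nfield (ym i r) (\<lambda>w b. J1 (vmon l) v w a b d) w b =
        nfield (ym i r) (\<lambda>w b. J3 (vmon l) v w a b d) w b + nfield (ym i r) (\<lambda>w b. J2 (vmon l) v w a b d) w b"
      unfolding eq by (rule nfield_add[OF hcW ym_modes J3_field J2_field])
    also have "hsum (\<lambda>p. J1 (vmon l) (der i r p v) w (a + int p) b d) UNIV =
        hsum (\<lambda>p. J3 (vmon l) (der i r p v) w (a + int p) b d) UNIV
        + hsum (\<lambda>p. J2 (vmon l) (der i r p v) w (a + int p) b d) UNIV"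
      unfolding Cons.IH
      by (rule hsum_add[OF hcW s[of "\<lambda>v p. J3 (vmon l) v w (a + int p) b d"] s[of "\<lambda>v p. J2 (vmon l) v w (a + int p) b d"]])
        (rule J3_lin_right J2_lin_right)+
    finally show ?case
      by (simp add: x J2_gm J3_gm)
  qed
qed (intro hlinear_fun_add J1_lin_left J2_lin_left J3_lin_left hcW)+

theorem jacobi: "jacobi1 YW u v w a b d - jacobi2 qv YW u v w a b d = jacobi3 qv YW u v w a b d"
  by (simp add: jacobi_add)

end

section \<open>Restricted modules\<close>

lemma abs_HC_hom: "abs_HC (f + g) = abs_HC f + abs_HC g" "abs_HC (f - g) = abs_HC f - abs_HC g"
  "abs_HC (f * g) = abs_HC f * abs_HC g" "abs_HC (scalar_series c * f) = c *\<^sub>h abs_HC f"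
  "abs_HC 0 = 0" "abs_HC 1 = 1"
  by (simp_all add: plus_HC.abs_eq minus_HC.abs_eq times_HC.abs_eq hscale_HC.abs_eq
      zero_HC.abs_eq one_HC.abs_eq)

lemma abs_HC_sum: "abs_HC (sum f A) = (\<Sum>x\<in>A. abs_HC (f x))"
  by (induction A rule: infinite_finite_induct) (simp_all add: abs_HC_hom)

lemma abs_HC_X: "abs_HC (fps_X * f) = fps_X *\<^sub>h abs_HC f"
  using abs_HC_hom(4)[of fps_X f] by (simp add: scalar_series_X)

lemma abs_HC_step: "abs_HC f = abs_HC (fps_const (fps_nth f 0)) + fps_X *\<^sub>h abs_HC (fps_shift 1 f)"
  using arg_cong[OF fps_const_shift[of f], of abs_HC] by (simp only: abs_HC_hom(1) abs_HC_X)

lemma abs_HC_relation: "f \<in> HC_relations \<Longrightarrow> abs_HC f = 0"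
  using subsetD[OF closed_ideal_base, of f HC_relations] HC.abs_eq_iff[of f 0]
  by (simp only: abs_HC_hom(5) diff_zero)

lemma HC_gen_abs: "HC_gen g = abs_HC (fps_const (gen g))"
  by (simp add: HC_gen.abs_eq)

lemma abs_HC_const_mult: "abs_HC (fps_const (x * y)) = abs_HC (fps_const x) * abs_HC (fps_const y)"
  by (simp flip: abs_HC_hom(3))

lemma abs_HC_const_scale: "abs_HC (fps_const (Poly_Mapping.single 0 a * x)) = a *\<^sub>c abs_HC (fps_const x)"
  by (simp flip: abs_HC_hom(4) add: scalar_series_const)

lemma abs_HC_gen_power: "abs_HC (fps_const (gen g ^ l)) = HC_gen g ^ l"
proof (induction l)
  case 0
  then show ?case by (simp add: abs_HC_hom)
next
  case (Suc l)
  then show ?case by (simp only: power_Suc abs_HC_const_mult HC_gen_abs)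
qed

definition wmon :: "'n::finite HCgen list \<Rightarrow> 'n HC"
  where "wmon gs = prod_list (map HC_gen gs)"

lemma abs_HC_word: "abs_HC (fps_const (Poly_Mapping.single (Word gs) 1)) = wmon gs"
proof (induction gs)
  case Nil
  have "Poly_Mapping.single (Word []) 1 = (1 :: 'a free_alg)"
    unfolding zero_word_def[symmetric] by simp
  then show ?case by (simp add: wmon_def abs_HC_hom)
next
  case (Cons g gs)
  have "Poly_Mapping.single (Word (g # gs)) 1 = gen g * (Poly_Mapping.single (Word gs) 1 :: 'a free_alg)"
    by (simp add: gen_def mult_single plus_word_def)
  then show ?case
    using Cons by (simp only: abs_HC_const_mult HC_gen_abs[symmetric]) (simp add: wmon_def)
qed

lemma hgen_HC: "hgen (range wmon :: 'n::finite HC set)"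
  unfolding hgen_def
proof
  fix x :: "'n HC"
  obtain f where f: "x = abs_HC f" using HC.abs_induct[of "\<lambda>x. \<exists>f. x = abs_HC f" x] by blast
  let ?p = "fps_nth f 0"
  have p: "?p = (\<Sum>m\<in>Poly_Mapping.keys ?p. Poly_Mapping.single 0 (Poly_Mapping.lookup ?p m) * Poly_Mapping.single m 1)"
    by (subst pm_expand[of ?p]) (simp add: mult_single)
  have "abs_HC (fps_const ?p) = (\<Sum>m\<in>Poly_Mapping.keys ?p. Poly_Mapping.lookup ?p m *\<^sub>c abs_HC (fps_const (Poly_Mapping.single m 1)))"
    by (subst p) (simp only: fps_const_sum abs_HC_sum abs_HC_const_scale)
  also have "\<dots> \<in> hmod.span (range wmon)"
  proof (intro hmod.span_sum hmod.span_scale hmod.span_base)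
    fix m :: "'n HCgen word"
    show "abs_HC (fps_const (Poly_Mapping.single m 1)) \<in> range wmon"
      by (cases m) (simp add: abs_HC_word)
  qed
  finally show "\<exists>b\<in>hmod.span (range wmon). \<exists>a'. x = b + fps_X *\<^sub>h a'"
    unfolding f using abs_HC_step[of f] by blast
qed

context
  fixes c :: complex and act :: "'n::finite HC \<Rightarrow> 'w::hmodule \<Rightarrow> 'w"
  assumes HCm: "HC_module act" and lev: "HC_level act c" and restr: "HC_restricted act"
begin

lemma hcW: "hcs TYPE('w)"
  using restr by (simp add: HC_restricted_def topologically_free_def hcs_def)

lemma act_lin_left: "hlinear (\<lambda>a. act a w)" and act_lin: "hlinear (act a)"
  and act_1: "act 1 w = w" and act_mult: "act (a * b) w = act a (act b w)"
  using HCm by (auto simp: HC_module_def hbilinear_def)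

text \<open>Linearity over the scalars determines the action of a whole series: splitting off the
  constant term n times gives agreement modulo h^n.\<close>

lemma act_series_hpow:
  assumes "\<And>k. act (abs_HC (fps_const (fps_nth f k))) w = fps_nth F k *\<^sub>c w"
  shows "act (abs_HC f) w - F *\<^sub>h w \<in> hpow n UNIV"
  using assms
proof (induction n arbitrary: f F)
  case (Suc n)
  have "act (abs_HC f) w = fps_nth F 0 *\<^sub>c w + fps_X *\<^sub>h act (abs_HC (fps_shift 1 f)) w"
    by (subst abs_HC_step) (simp only: hlinear_add[OF act_lin_left] hlinear_scale[OF act_lin_left] Suc.prems)
  moreover have "F *\<^sub>h w = fps_nth F 0 *\<^sub>c w + fps_X *\<^sub>h (fps_shift 1 F *\<^sub>h w)"
    by (subst fps_const_shift[of F]) (simp only: hscale_add_left hscale_hscale)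
  ultimately have eq: "act (abs_HC f) w - F *\<^sub>h w = fps_X *\<^sub>h (act (abs_HC (fps_shift 1 f)) w - fps_shift 1 F *\<^sub>h w)"
    by (simp only: hmod.scale_right_diff_distrib) (simp only: add_diff_add diff_self add_0_left)
  have "act (abs_HC (fps_shift 1 f)) w - fps_shift 1 F *\<^sub>h w \<in> hpow n UNIV"
    by (rule Suc.IH) (simp add: Suc.prems)
  then show ?case
    unfolding eq in_hpow by (auto simp: hscale_hscale intro!: bexI)
qed simp

lemma act_series:
  assumes "\<And>k. act (abs_HC (fps_const (fps_nth f k))) w = fps_nth F k *\<^sub>c w"
  shows "act (abs_HC f) w = F *\<^sub>h w"
  by (rule hcs_eqI[OF hcW act_series_hpow[OF assms]])

lemma act_C_power: "act (HC_gen Gen_C ^ l) w = (c ^ l) *\<^sub>c w"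
  using lev
  by (induction l) (simp_all add: act_1 act_mult HC_level_def hlinear_scale[OF act_lin] hscale_one hscale_hscale mult.commute)

text \<open>C acts as c, so the polynomial coefficients of s_ij are evaluated at c and become those
  of \<open>Sdiff\<close>.\<close>

lemma act_sC: "act (abs_HC (sC i j e f)) w = Sdiff c (i, j) (i, j) e f *\<^sub>h w"
proof -
  let ?p = "\<lambda>k. fps_nth (Sgen (i, j) (i, j) (e + f)) k"
  let ?A = "Abs_fps (\<lambda>k. \<Sum>l\<le>degree (?p k). Poly_Mapping.single 0 (coeff (?p k) l) * gen Gen_C ^ l)"
  have "act (abs_HC ?A) w = Sc c (i, j) (i, j) (e + f) *\<^sub>h w"
  proof (rule act_series)
    fix k
    have "act (abs_HC (fps_const (fps_nth ?A k))) w = (\<Sum>l\<le>degree (?p k). coeff (?p k) l *\<^sub>c (c ^ l) *\<^sub>c w)"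
      by (simp only: fps_nth_Abs_fps fps_const_sum abs_HC_sum abs_HC_const_scale abs_HC_gen_power
          hlinear_sum[OF act_lin_left] hlinear_scale[OF act_lin_left] act_C_power)
    also have "\<dots> = fps_const (poly (?p k) c) *\<^sub>h w"
      by (simp add: poly_altdef fps_const_sum hmod.scale_sum_left hscale_hscale)
    finally show "act (abs_HC (fps_const (fps_nth ?A k))) w = fps_nth (Sc c (i, j) (i, j) (e + f)) k *\<^sub>c w"
      by (simp add: Sc_def)
  qed
  then show ?thesis
    by (simp only: sC_def Sdiff_def Let_def abs_HC_hom(4) hlinear_scale[OF act_lin_left] hscale_hscale)
qed

lemma yop_comm: "yop act i e (yop act j f w) - yop act j f (yop act i e w) =
    (Sdiff c (i, j) (i, j) f e - Sdiff c (i, j) (i, j) e f) *\<^sub>h w"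
proof -
  let ?r = "- e - 1" and ?s = "- f - 1"
  have "fps_const (gen (Gen_y i ?r) * gen (Gen_y j ?s) - gen (Gen_y j ?s) * gen (Gen_y i ?r))
       + sC i j (- ?r - 1) (- ?s - 1) - sC i j (- ?s - 1) (- ?r - 1) \<in> HC_relations"
    unfolding HC_relations_def by blast
  from abs_HC_relation[OF this]
  have "HC_gen (Gen_y i ?r) * HC_gen (Gen_y j ?s) - HC_gen (Gen_y j ?s) * HC_gen (Gen_y i ?r)
      + abs_HC (sC i j e f) - abs_HC (sC i j f e) = 0"
    by (simp add: abs_HC_hom HC_gen_abs flip: fps_const_sub fps_const_mult)
  then have "act (HC_gen (Gen_y i ?r) * HC_gen (Gen_y j ?s) - HC_gen (Gen_y j ?s) * HC_gen (Gen_y i ?r)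
      + abs_HC (sC i j e f) - abs_HC (sC i j f e)) w = 0"
    by (simp add: hlinear_0[OF act_lin_left])
  then show ?thesis
    by (simp add: hlinear_add[OF act_lin_left] hlinear_diff[OF act_lin_left] act_mult act_sC yop_def
        hmod.scale_left_diff_distrib algebra_simps)
qed

lemma yop_trace: "(\<Sum>i\<in>UNIV. yop act i e w) = 0"
proof -
  have "fps_const (\<Sum>i\<in>UNIV. gen (Gen_y i (- e - 1))) \<in> (HC_relations :: 'n free_alg fps set)"
    unfolding HC_relations_def by blast
  from abs_HC_relation[OF this] have "(\<Sum>i\<in>UNIV. HC_gen (Gen_y i (- e - 1))) = (0 :: 'n HC)"
    by (simp add: fps_const_sum abs_HC_sum HC_gen_abs)
  then show ?thesis
    by (simp add: yop_def hlinear_0[OF act_lin_left] flip: hlinear_sum[OF act_lin_left])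
qed

text \<open>A diagonal matrix of operators fits \<open>heis\<close>: its off-diagonal entries
  vanish, and so do the scalars of \<open>Sdiff_diag\<close>. The symmetry \<open>Sc_swap\<close>
  reconciles the order of the indices in the relation for the y^i with that in
  \<open>X_comm\<close>.\<close>

lemma ymat_heis: "heis (ymat act) (Sdiff_diag c)"
proof
  show "hcs TYPE('w)" by (rule hcW)
  show "hlinear (ymat act i j e)" for i j e
    unfolding ymat_def[abs_def] yop_def using act_lin by (cases "i = j") auto
  show "laurent_h (\<lambda>e. ymat act i j e w)" for i j w
    using restr by (cases "i = j") (auto simp: ymat_def HC_restricted_def laurent_h_def)
  show "ymat act i j e (ymat act k l f w) - ymat act k l f (ymat act i j e w) =
      (Sdiff_diag c (k, i) (l, j) f e - Sdiff_diag c (i, k) (j, l) e f) *\<^sub>h w" for i j e k l f w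
  proof (cases "i = j \<and> k = l")
    case True
    then show ?thesis
      using yop_comm[of i e k f w] Sc_swap[of c i k] by (simp add: ymat_def Sdiff_diag_def Sdiff_def)
  next
    case False
    then show ?thesis
      by (auto simp: ymat_def Sdiff_diag_def yop_def hlinear_0[OF act_lin])
  qed
  show "\<not> (e < 0 \<and> 0 \<le> f) \<Longrightarrow> Sdiff_diag c p q e f = 0" for e f and p q :: "'n \<times> 'n"
    by (simp add: Sdiff_diag_def Sdiff_zero)
  show "(\<Sum>i\<in>UNIV. ymat act i i e w) = 0" for e w
    by (simp add: ymat_def yop_trace)
qed

interpretation W: heis "ymat act" "Sdiff_diag c"
  by (rule ymat_heis)

definition YWm :: "'n VH \<Rightarrow> 'w \<Rightarrow> int \<Rightarrow> 'w"
  where "YWm v w m = W.Yh (Rep_VH v) w m"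

lemma YWm_lin_left: "hlinear (\<lambda>v. YWm v w m)"
  unfolding YWm_def by (rule hlinear_compose[OF W.Yh_lin_left Rep_lin])

lemma YWm_field: "is_field (YWm v)"
  using W.Yh_field[of "Rep_VH v"] by (simp add: YWm_def[abs_def])

lemma YWm_vvac: "YWm vvac w m = (if m = 0 then w else 0)"
  by (simp add: YWm_def Rep_vvac W.Yh_1)

lemma YWm_gm: "YWm (gm i r u) w m = nfield (W.ymode (i, i, r)) (YWm u) w m"
  by (simp add: YWm_def[abs_def] Rep_gm W.Yh_xgen nfield_def)

text \<open>By \<open>mode_commutator\<close> the modes on W commute through the very kernel that
  defines the derivations of the subalgebra.\<close>

lemma ymode_comm: "W.ymode (i, i, r) k (W.ymode (j, j, a) l w) - W.ymode (j, j, a) l (W.ymode (i, i, r) k w) =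
  (fps_const (diff_coeff k l) * Kc c (i, j) (i, j) r a (nat (- (k + l)))
        - fps_const (diff_coeff l k) * Kc c (j, i) (j, i) a r (nat (- (k + l)))) *\<^sub>h w"
proof -
  let ?X = "\<lambda>i e. ymat act i i e"
  have "W.ymode (i, i, r) k (W.ymode (j, j, a) l w) - W.ymode (j, j, a) l (W.ymode (i, i, r) k w) =
      fps_const (mbin k r * mbin l a) *\<^sub>h (?X i (k + int r) (?X j (l + int a) w) - ?X j (l + int a) (?X i (k + int r) w))"
    by (simp add: W.ymode_def hlinear_scale[OF W.X_lin] hmod.scale_right_diff_distrib mult.commute)
  also have "\<dots> = (fps_const (mbin l a * mbin k r) * Sdiff c (j, i) (j, i) (l + int a) (k + int r)
      - fps_const (mbin k r * mbin l a) * Sdiff c (i, j) (i, j) (k + int r) (l + int a)) *\<^sub>h w"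
    by (simp add: W.X_comm Sdiff_diag_def right_diff_distrib mult.commute)
  finally show ?thesis
    unfolding mode_commutator by (simp add: add.commute)
qed

lemma ymode_shift: "mbin (int n) r *\<^sub>c W.ymode (i, i, n + r) k w =
    (of_int (k + int n) gchoose n) *\<^sub>c W.ymode (i, i, r) (k + int n) w"
proof -
  have "fps_const (mbin (int n) r) * fps_const (mbin k (n + r)) =
      fps_const ((of_int (k + int n) gchoose n) * mbin (k + int n) r)"
    using mbin_comp[of n r k] by (simp add: mbin_def[of "int n"])
  then show ?thesis
    by (simp add: W.ymode_def add.assoc)
qed

lemma vertex: "vertex_setup vvac gm (dpos c) (dneg c) (dtw c) (\<lambda>i r j a. Kc c (i, j) (i, j) r a)
    (YV c) (SV c) YWm (\<lambda>i r. W.ymode (i, i, r))"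
proof
  show "hgen (range (\<lambda>l. foldr (\<lambda>(i, r). gm i r) l (vvac :: 'n VH)))"
    using hgen_VH by (simp add: vmon_def[abs_def])
  show "SV c (v \<otimes>\<^sub>h gm i r u) n = tensor_map (\<lambda>a. a) (gm i r) (SV c (v \<otimes>\<^sub>h u) n)
      + (\<Sum>p\<le>n. SV c (dtw c i r p v \<otimes>\<^sub>h u) (n - p))" for v u :: "'n VH" and i r n
    using SV_gm by (simp add: vmul2_def)
  show "YV c (gm i r u) v m = nfield
      (\<lambda>k v. if 0 \<le> k then mbin k r *\<^sub>c gm i (nat k + r) v else dpos c i r (nat (- k)) v) (YV c u) v m"
    for i r and u v :: "'n VH" and m
    unfolding YV_gm vmode_def[abs_def] ..
  show "dtw c i r p v = (- 1) ^ p *\<^sub>h dpos c i r p v - dneg c i r p v" for i r p and v :: "'n VH"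
    by (simp add: dneg_def)
qed (rule hcs_VH hcW gm_lin dpos_lin dneg_lin dpos_vvac dneg_vvac dpos_gm dneg_gm dpos_summable dneg_summable
    dpos_0 Kc_0 YV_lin_left YV_field YV_vvac YWm_lin_left YWm_field YWm_vvac YWm_gm W.ymode_modes
    ymode_comm ymode_shift SV_lin SV_summable SV_vvac SV_dneg)+

lemma YWm_module: "qva_module (VH c) YWm"
  unfolding qva_module_def VH_eq
proof (intro conjI allI)
  show "topologically_free (UNIV :: 'w set)" using restr by (simp add: HC_restricted_def)
  show "hbilinear (\<lambda>v w. YWm v w m)" for m
    using YWm_lin_left is_field_lin[OF YWm_field] by (simp add: hbilinear_def)
  show "laurent_h (YWm v w)" for v w by (rule is_field_laurent[OF YWm_field])
  show "YWm (qva_vacuum \<lparr>qva_vacuum = vvac, qva_Y = YV c, qva_S = SV c\<rparr>) w m = (if m = 0 then w else 0)" for w m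
    by (simp add: YWm_vvac)
  show "jacobi1 YWm u v w a b d - jacobi2 \<lparr>qva_vacuum = vvac, qva_Y = YV c, qva_S = SV c\<rparr> YWm u v w a b d =
      jacobi3 \<lparr>qva_vacuum = vvac, qva_Y = YV c, qva_S = SV c\<rparr> YWm u v w a b d" for u v w a b d
    by (rule vertex_setup.jacobi[OF vertex])
qed

text \<open>Off-diagonal entries of the matrix y(u) are 0, so the vertex map on \<open>Hplus\<close>
  factors through \<open>pvh\<close>. This matches the two sides of \<open>given_by_y\<close> at
  entries that the diagonal part discards.\<close>

lemma Ylist_offdiag: "\<not> diag_list l \<Longrightarrow> W.Ylist l w m = 0"
proof (induction l arbitrary: w m)
  case (Cons g l)
  have zero: "nfield f (\<lambda>_ _. 0) w m = 0" if "is_modes f" for f :: "int \<Rightarrow> 'w \<Rightarrow> 'w" and w m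
  proof -
    have "nop f k (\<lambda>_ _. 0) w m = 0" for k
      using hlinear_0[OF is_modes_lin[OF that]] by (simp add: nop_def)
    then show ?thesis by (simp add: nfield_def hsum_0[OF hcW])
  qed
  show ?case
  proof (cases "diag_list l")
    case True
    then have "fst g \<noteq> fst (snd g)" using Cons.prems by simp
    then have "W.ymode g k w = 0" for k w
      by (simp add: W.ymode_def ymat_def)
    then show ?thesis
      by (simp add: nfield_def nop_def hlinear_0[OF is_field_lin[OF W.Ylist_field]] hsum_0[OF hcW] cong: if_cong)
  next
    case False
    then have "W.Ylist l = (\<lambda>_ _. 0)" using Cons.IH by blast
    then show ?thesis by (simp add: zero W.ymode_modes)
  qed
qed simp

lemma Yh_pvh: "W.Yh (pvh u) w m = W.Yh u w m"
proof (rule Hplus_hlinear_eqI[OF hcW, of "\<lambda>u. W.Yh (pvh u) w m" "\<lambda>u. W.Yh u w m"])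
  show "W.Yh (pvh (xmon l)) w m = W.Yh (xmon l) w m" for l
    by (simp add: pvh_xmon W.Yh_xmon Ylist_offdiag hlinear_0[OF W.Yh_lin_left])
qed (rule W.Yh_lin_left hlinear_compose[OF W.Yh_lin_left pvh_lin])+

lemma Abs_xplus_diag: "Abs_VH (xplus_diag n I J a) = vproj (xplus {1..n} I J a)" for I :: "nat \<Rightarrow> 'n"
proof -
  have "diag_list (map (\<lambda>l. (I l, J l, a l)) [1..<Suc n]) \<longleftrightarrow> (\<forall>l\<in>{1..n}. I l = J l)"
    by (simp only: diag_list_def set_map set_upt ball_simps fst_conv snd_conv atLeastLessThanSuc_atLeastAtMost)
  then show ?thesis
    by (simp only: vproj_def xplus_xmon_upt pvh_xmon xplus_diag_def)
qed

lemma YWm_given: "given_by_y c act YWm"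
  unfolding given_by_y_def
proof (intro allI)
  fix n I J a w m
  show "YWm (Abs_VH (xplus_diag n I J a)) w m = translate n (\<lambda>e. y_bracket c act n I J e w) m a"
    unfolding Abs_xplus_diag YWm_def Rep_vproj Yh_pvh W.Yh_translate y_bracket_def ..
qed

text \<open>Diagonal monomials generate the subalgebra and are entries of diag x^+_[n], where the
  formula prescribes the value.\<close>

lemma given_unique:
  assumes "qva_module (VH c) YW" "given_by_y c act YW"
  shows "YW = YWm"
proof (intro ext)
  fix v w m
  have "(\<lambda>v. YW v w m) = (\<lambda>v. YWm v w m)"
  proof (rule hlinear_eqI[OF hcW hgen_VH])
    show "hlinear (\<lambda>v. YW v w m)"
      using assms(1) by (simp add: qva_module_def hbilinear_def)
    show "hlinear (\<lambda>v. YWm v w m)" by (rule YWm_lin_left)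
    fix x :: "'n VH" assume "x \<in> range vmon"
    then obtain l where l: "x = vmon l" by blast
    let ?l = "map (\<lambda>(i, r). (i, i, r)) l"
    have "diag_list ?l" "map (\<lambda>g. (fst g, snd (snd g))) ?l = l"
      by (auto simp: diag_list_def case_prod_unfold comp_def)
    then have "x = vproj (xmon ?l)" by (simp add: l vproj_xmon)
    then have "\<exists>n I J a. x = Abs_VH (xplus_diag n I J a)"
      unfolding xmon_xplus[of ?l] Abs_xplus_diag[symmetric] by blast
    then show "YW x w m = YWm x w m"
      using assms(2) YWm_given by (auto simp: given_by_y_def)
  qed
  then show "YW v w m = YWm v w m" by (rule fun_cong)
qed

lemma YWm_generator: "YWm (gm i 0 vvac) w e = yop act i e w"
proof -
  have "YWm (gm i 0 vvac) w e = hsum (\<lambda>k. nop (W.ymode (i, i, 0)) k (YWm vvac) w e) UNIV"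
    by (simp add: YWm_gm nfield_def)
  also have "\<dots> = nop (W.ymode (i, i, 0)) e (YWm vvac) w e"
    by (rule hsum_single[OF hcW]) (auto simp: nop_def YWm_vvac hlinear_0[OF W.ymode_lin])
  also have "\<dots> = yop act i e w"
    by (simp add: nop_def YWm_vvac W.ymode_def ymat_def hscale_one)
  finally show ?thesis .
qed

text \<open>Words in the generators span H(C) only topologically. Their limits stay in U because a
  submodule is complete for its own filtration, as \<open>hlinear_in_closed\<close>
  requires.\<close>

lemma YWm_irreducible:
  assumes "HC_irreducible act"
  shows "qva_irreducible YWm"
  unfolding qva_irreducible_def
proof (intro allI impI)
  fix U assume U: "qva_submodule YWm U"
  then have sub: "hmod.subspace U" and comp: "hcomplete U"
    by (auto simp: qva_submodule_def topologically_free_def)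
  have gen: "act (HC_gen g) w \<in> U" if "w \<in> U" for g w
  proof (cases g)
    case Gen_C
    then show ?thesis using lev hmod.subspace_scale[OF sub \<open>w \<in> U\<close>] by (simp add: HC_level_def)
  next
    case (Gen_y i r)
    have "act (HC_gen g) w = YWm (gm i 0 vvac) w (- r - 1)"
      by (simp add: YWm_generator yop_def Gen_y)
    then show ?thesis using U \<open>w \<in> U\<close> by (simp add: qva_submodule_def)
  qed
  have word: "act (wmon gs) w \<in> U" if "w \<in> U" for gs w
    using that by (induction gs) (simp_all add: wmon_def act_1 act_mult gen)
  have "act a w \<in> U" if "w \<in> U" for a w
    by (rule hlinear_in_closed[OF hcW hgen_HC act_lin_left sub comp]) (use word[OF that] in auto)
  then have "HC_submodule act U"
    using U by (simp add: HC_submodule_def qva_submodule_def)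
  then show "U = {0} \<or> U = UNIV"
    using assms by (simp add: HC_irreducible_def)
qed

end

theorem theorem3p7:
  fixes c :: complex
    and act :: "'n::finite HC \<Rightarrow> 'w::hmodule \<Rightarrow> 'w"
  assumes "CARD('n) \<ge> 2"
    and "HC_module act"
    and "HC_level act c"
    and "HC_restricted act"
  shows "(\<exists>!YW. qva_module (VH c :: 'n VH qva) YW \<and> given_by_y c act YW) \<and>
    (HC_irreducible act \<longrightarrow>
      (\<exists>!YW. qva_module (VH c :: 'n VH qva) YW \<and> qva_irreducible YW \<and> given_by_y c act YW))"
proof -
  note facts = YWm_module[OF assms(2-4)] YWm_given[OF assms(2-4)]
  note unique = given_unique[OF assms(2-4)]
  show ?thesis
    using facts unique YWm_irreducible[OF assms(2-4)] by (intro conjI impI ex1I) blast+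
qed

end
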